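(* Let $J$ be an $m\times m$ signature matrix, let $n\in\mathbb N_0$, and let $(A_j)_{j=0}^n$ be a $J$-Potapov sequence. If $n\ge1$ put $V_n^\Box:=Q_{n-1,J}^+S_{n-1}^*J_{[n-1]}y_n$ and $W_n^\Box:=z_nJ_{[n-1]}S_{n-1}^*P_{n-1,J}^+$, and let $\pi_{n,J},\rho_{n,J},\sigma_{n,J},\tau_{n,J}$ be the matrix polynomials $\pi_{n,J}(w)=A_0+we_{n-1,m}(w)(y_n+S_{n-1}V_n^\Box)$, $\rho_{n,J}(w)=I_m+we_{n-1,m}(w)V_n^\Box$, $\sigma_{n,J}(w)=(W_n^\Box S_{n-1}+z_n)w\varepsilon_{n-1,m}(w)+A_0$, $\tau_{n,J}(w)=W_n^\Box w\varepsilon_{n-1,m}(w)+I_m$ (and $\pi_{0,J}=\sigma_{0,J}=A_0$, $\rho_{0,J}=\tau_{0,J}=I_m$ if $n=0$). For $S\in\mathcal S_{m\times m}(\mathbb D)$ and each $w\in\mathbb D$ at which $wJ\tilde\sigma_{n,J}^{[n]}(w)\sqrt{L_{n+1,J}}^+S(w)\sqrt{R_{n+1,J}}+\rho_{n,J}(w)$ is nonsingular, let $$f_S(w):=\big(wJ\tilde\tau_{n,J}^{[n]}(w)\sqrt{L_{n+1,J}}^+S(w)\sqrt{R_{n+1,J}}+\pi_{n,J}(w)\big)\big(wJ\tilde\sigma_{n,J}^{[n]}(w)\sqrt{L_{n+1,J}}^+S(w)\sqrt{R_{n+1,J}}+\rho_{n,J}(w)\big)^{-1}.$$ Then for each $S\in\mathcal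 S_{m\times m}(\mathbb D)$ this defines a matrix-valued function $f_S$ meromorphic in $\mathbb D$, and $$\mathbb H_{f_S}=\{w\in\mathbb D:\det(wJ\tilde\sigma_{n,J}^{[n]}(w)\sqrt{L_{n+1,J}}^+S(w)\sqrt{R_{n+1,J}}+\rho_{n,J}(w))\neq0\}=\{w\in\mathbb D:\det(w\sqrt{L_{n+1,J}}S(w)\sqrt{R_{n+1,J}}^+\tilde\pi_{n,J}^{[n]}(w)J+\tau_{n,J}(w))\neq0\}.$$ Moreover, for every $w\in\mathbb H_{f_S}$, $$f_S(w)=\big(w\sqrt{L_{n+1,J}}S(w)\sqrt{R_{n+1,J}}^+\tilde\pi_{n,J}^{[n]}(w)J+\tau_{n,J}(w)\big)^{-1}\big(w\sqrt{L_{n+1,J}}S(w)\sqrt{R_{n+1,J}}^+\tilde\rho_{n,J}^{[n]}(w)J+\sigma_{n,J}(w)\big),$$ and $\mathcal P_{J,0}[\mathbb D,(A_j)_{j=0}^n]=\{f_S:S\in\mathcal S_{m\times m}(\mathbb D)\}$.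
   Context: $m\in\mathbb N$, $\mathbb D=\{z\in\mathbb C:|z|<1\}$. An $m\times m$ signature matrix is $J\in\mathbb C^{m\times m}$ with $J^*=J$, $J^2=I_m$. A matrix $A$ is $J$-contractive if $J-A^*JA$ is nonnegative Hermitian. For $f$ meromorphic in $\mathbb D$, $\mathbb H_f$ is the set of points of $\mathbb D$ where $f$ is holomorphic. $\mathcal P_{J,0}(\mathbb D)$ is the set of $\mathbb C^{m\times m}$-valued $f$ meromorphic in $\mathbb D$ with $0\in\mathbb H_f$ and $f(w)$ $J$-contractive for all $w\in\mathbb H_f$. $\mathcal S_{m\times m}(\mathbb D)$ is the set of holomorphic $S:\mathbb D\to\mathbb C^{m\times m}$ with $\|S(w)\|\le1$ for all $w$. For $A_0,\dots,A_n\in\mathbb C^{m\times m}$, $\mathcal P_{J,0}[\mathbb D,(A_j)_{j=0}^n]$ is the set of $f\in\mathcal P_{J,0}(\mathbb D)$ with $f^{(j)}(0)/j!=A_j$ for $j=0,\dots,n$. For $k\in\mathbb N_0$, $S_k$ is the $(k+1)m\times(k+1)m$ block lower triangular Toeplitz matrix whose $(i,l)$ block ($0\le i,l\le k$) is $A_{i-l}$ if $i\ge l$ and $0$ otherwise; $J_{[k]}:=\mathrm{diag}(J,\dots,J)$ ($k+1$ blocks). $(A_j)_{j=0}^n$ is a $J$-Potapov sequence if $J_{[n]}-S_n^*J_{[n]}S_n$ is nonnegative Hermitian. $P_{k,J}:=J_{[k]}-S_kJ_{[k]}S_k^*$, $Q_{k,J}:=J_{[k]}-S_k^*J_{[k]}S_k$;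 for $k\ge1$, $y_k:=(A_1^*,\dots,A_k^* )^*$ (block column), $z_k:=(A_k,A_{k-1},\dots,A_1)$ (block row). $X^+$ is the Moore–Penrose inverse, $\sqrt X$ the nonnegative square root of $X\ge0$, $\sqrt X^+:=(\sqrt X)^+$. $L_{1,J}:=J-A_0JA_0^*$, $R_{1,J}:=J-A_0^*JA_0$; for $n\ge1$, $L_{n+1,J}:=J-A_0JA_0^*-z_nQ_{n-1,J}^+z_n^*$, $R_{n+1,J}:=J-A_0^*JA_0-y_n^*P_{n-1,J}^+y_n$ (nonnegative Hermitian for $J$-Potapov sequences). $e_{k,m}(w):=(I_m,wI_m,\dots,w^kI_m)$, $\varepsilon_{k,m}(w):=$ the block column $(w^kI_m;w^{k-1}I_m;\dots;I_m)$. For a matrix polynomial $b(w)=\sum_{k=0}^nw^kB_k$ of formal degree $n$, $\tilde b^{[n]}(w):=\sum_{k=0}^nw^{n-k}B_k^*$. *)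

theory Defs
  imports "HOL-Analysis.Analysis" "Jordan_Normal_Form.Schur_Decomposition"
begin

abbreviation unit_disc :: "complex set" where
  "unit_disc \<equiv> ball 0 1"

definition psd :: "nat \<Rightarrow> complex mat \<Rightarrow> bool" where
  "psd n M \<longleftrightarrow> M \<in> carrier_mat n n \<and> mat_adjoint M = M \<and>
     (\<forall>v \<in> carrier_vec n. 0 \<le> Re (\<Sum>i<n. cnj (vec_index v i) * vec_index (M *\<^sub>v v) i))"

definition sig_mat :: "nat \<Rightarrow> complex mat \<Rightarrow> bool" where
  "sig_mat m J \<longleftrightarrow> J \<in> carrier_mat m m \<and> mat_adjoint J = J \<and> J * J = 1\<^sub>m m"

definition J_contractive :: "nat \<Rightarrow> complex mat \<Rightarrow> complex mat \<Rightarrow> bool" where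
  "J_contractive m J X \<longleftrightarrow> psd m (J - mat_adjoint X * J * X)"

definition mp_inv :: "complex mat \<Rightarrow> complex mat" where
  "mp_inv A = (THE X. X \<in> carrier_mat (dim_col A) (dim_row A) \<and> A * X * A = A \<and> X * A * X = X
      \<and> mat_adjoint (A * X) = A * X \<and> mat_adjoint (X * A) = X * A)"

definition msqrt :: "complex mat \<Rightarrow> complex mat" where
  "msqrt A = (THE B. psd (dim_row A) B \<and> B * B = A)"

definition minv :: "complex mat \<Rightarrow> complex mat" where
  "minv A = (THE B. B \<in> carrier_mat (dim_row A) (dim_row A) \<and>
      A * B = 1\<^sub>m (dim_row A) \<and> B * A = 1\<^sub>m (dim_row A))"

definition S_blk :: "nat \<Rightarrow> (nat \<Rightarrow> complex mat) \<Rightarrow> nat \<Rightarrow> complex mat" where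
  "S_blk m A k = mat ((k+1)*m) ((k+1)*m) (\<lambda>(r,c).
      if c div m \<le> r div m then A (r div m - c div m) $$ (r mod m, c mod m) else 0)"

definition J_blk :: "nat \<Rightarrow> complex mat \<Rightarrow> nat \<Rightarrow> complex mat" where
  "J_blk m J k = mat ((k+1)*m) ((k+1)*m) (\<lambda>(r,c).
      if r div m = c div m then J $$ (r mod m, c mod m) else 0)"

definition P_mat :: "nat \<Rightarrow> complex mat \<Rightarrow> (nat \<Rightarrow> complex mat) \<Rightarrow> nat \<Rightarrow> complex mat" where
  "P_mat m J A k = J_blk m J k - S_blk m A k * J_blk m J k * mat_adjoint (S_blk m A k)"

definition Q_mat :: "nat \<Rightarrow> complex mat \<Rightarrow> (nat \<Rightarrow> complex mat) \<Rightarrow> nat \<Rightarrow> complex mat" where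
  "Q_mat m J A k = J_blk m J k - mat_adjoint (S_blk m A k) * J_blk m J k * S_blk m A k"

definition y_col :: "nat \<Rightarrow> (nat \<Rightarrow> complex mat) \<Rightarrow> nat \<Rightarrow> complex mat" where
  "y_col m A k = mat (k*m) m (\<lambda>(r,c). A (r div m + 1) $$ (r mod m, c))"

definition z_row :: "nat \<Rightarrow> (nat \<Rightarrow> complex mat) \<Rightarrow> nat \<Rightarrow> complex mat" where
  "z_row m A k = mat m (k*m) (\<lambda>(r,c). A (k - c div m) $$ (r, c mod m))"

definition J_Potapov :: "nat \<Rightarrow> complex mat \<Rightarrow> (nat \<Rightarrow> complex mat) \<Rightarrow> nat \<Rightarrow> bool" where
  "J_Potapov m J A n \<longleftrightarrow> psd ((n+1)*m) (Q_mat m J A n)"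

definition L_next :: "nat \<Rightarrow> complex mat \<Rightarrow> (nat \<Rightarrow> complex mat) \<Rightarrow> nat \<Rightarrow> complex mat" where
  "L_next m J A n = (if n = 0 then J - A 0 * J * mat_adjoint (A 0)
     else J - A 0 * J * mat_adjoint (A 0)
            - z_row m A n * mp_inv (Q_mat m J A (n-1)) * mat_adjoint (z_row m A n))"

definition R_next :: "nat \<Rightarrow> complex mat \<Rightarrow> (nat \<Rightarrow> complex mat) \<Rightarrow> nat \<Rightarrow> complex mat" where
  "R_next m J A n = (if n = 0 then J - mat_adjoint (A 0) * J * A 0
     else J - mat_adjoint (A 0) * J * A 0
            - mat_adjoint (y_col m A n) * mp_inv (P_mat m J A (n-1)) * y_col m A n)"

definition e_row :: "nat \<Rightarrow> nat \<Rightarrow> complex \<Rightarrow> complex mat" where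
  "e_row m k w = mat m ((k+1)*m) (\<lambda>(r,c). if r = c mod m then w ^ (c div m) else 0)"

definition eps_col :: "nat \<Rightarrow> nat \<Rightarrow> complex \<Rightarrow> complex mat" where
  "eps_col m k w = mat ((k+1)*m) m (\<lambda>(r,c). if r mod m = c then w ^ (k - r div m) else 0)"

definition V_box :: "nat \<Rightarrow> complex mat \<Rightarrow> (nat \<Rightarrow> complex mat) \<Rightarrow> nat \<Rightarrow> complex mat" where
  "V_box m J A n = mp_inv (Q_mat m J A (n-1)) * mat_adjoint (S_blk m A (n-1)) * J_blk m J (n-1) * y_col m A n"

definition W_box :: "nat \<Rightarrow> complex mat \<Rightarrow> (nat \<Rightarrow> complex mat) \<Rightarrow> nat \<Rightarrow> complex mat" where
  "W_box m J A n = z_row m A n * J_blk m J (n-1) * mat_adjoint (S_blk m A (n-1)) * mp_inv (P_mat m J A (n-1))"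

definition pi_poly :: "nat \<Rightarrow> complex mat \<Rightarrow> (nat \<Rightarrow> complex mat) \<Rightarrow> nat \<Rightarrow> complex \<Rightarrow> complex mat" where
  "pi_poly m J A n w = (if n = 0 then A 0 else
     A 0 + (w \<cdot>\<^sub>m e_row m (n-1) w) * (y_col m A n + S_blk m A (n-1) * V_box m J A n))"

definition rho_poly :: "nat \<Rightarrow> complex mat \<Rightarrow> (nat \<Rightarrow> complex mat) \<Rightarrow> nat \<Rightarrow> complex \<Rightarrow> complex mat" where
  "rho_poly m J A n w = (if n = 0 then 1\<^sub>m m else
     1\<^sub>m m + (w \<cdot>\<^sub>m e_row m (n-1) w) * V_box m J A n)"

definition sigma_poly :: "nat \<Rightarrow> complex mat \<Rightarrow> (nat \<Rightarrow> complex mat) \<Rightarrow> nat \<Rightarrow> complex \<Rightarrow> complex mat" where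
  "sigma_poly m J A n w = (if n = 0 then A 0 else
     (W_box m J A n * S_blk m A (n-1) + z_row m A n) * (w \<cdot>\<^sub>m eps_col m (n-1) w) + A 0)"

definition tau_poly :: "nat \<Rightarrow> complex mat \<Rightarrow> (nat \<Rightarrow> complex mat) \<Rightarrow> nat \<Rightarrow> complex \<Rightarrow> complex mat" where
  "tau_poly m J A n w = (if n = 0 then 1\<^sub>m m else
     W_box m J A n * (w \<cdot>\<^sub>m eps_col m (n-1) w) + 1\<^sub>m m)"

text \<open>Reciprocal polynomial of formal degree n: if b(w) = sum_k w^k B_k then
  tilde b(w) = sum_k w^(n-k) B_k^*; the coefficients B_k are the Taylor coefficients at 0.\<close>
definition mat_tilde :: "nat \<Rightarrow> nat \<Rightarrow> (complex \<Rightarrow> complex mat) \<Rightarrow> complex \<Rightarrow> complex mat" where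
  "mat_tilde m n b w = mat m m (\<lambda>(i,j).
     \<Sum>k\<le>n. w ^ (n-k) * cnj ((deriv ^^ k) (\<lambda>z. b z $$ (j,i)) 0 / of_nat (fact k)))"

definition mat_analytic_at :: "nat \<Rightarrow> (complex \<Rightarrow> complex mat) \<Rightarrow> complex \<Rightarrow> bool" where
  "mat_analytic_at m F w \<longleftrightarrow> (\<forall>i<m. \<forall>j<m. (\<lambda>z. F z $$ (i,j)) analytic_on {w})"

definition mat_removable_at :: "nat \<Rightarrow> (complex \<Rightarrow> complex mat) \<Rightarrow> complex \<Rightarrow> bool" where
  "mat_removable_at m F p \<longleftrightarrow> (\<forall>i<m. \<forall>j<m. \<exists>r>0. \<exists>g. g holomorphic_on ball p r \<and>
      (\<forall>z\<in>ball p r - {p}. F z $$ (i,j) = g z))"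

definition mat_H :: "complex set \<Rightarrow> nat \<Rightarrow> (complex \<Rightarrow> complex mat) \<Rightarrow> complex set" where
  "mat_H D m F = {w \<in> D. mat_analytic_at m F w}"

text \<open>F is an m x m matrix-valued meromorphic function in the open set D:
  every point of D has a punctured neighbourhood in which all entries are holomorphic with at
  most a pole at the centre; removable singularities are removed (F is holomorphic at each
  point where all entries have removable singularities); values at poles are irrelevant.\<close>
definition mat_meromorphic_on :: "complex set \<Rightarrow> nat \<Rightarrow> (complex \<Rightarrow> complex mat) \<Rightarrow> bool" where
  "mat_meromorphic_on D m F \<longleftrightarrow> open D \<and>
     (\<forall>w \<in> mat_H D m F. F w \<in> carrier_mat m m) \<and>
     (\<forall>p\<in>D. (\<exists>r>0. ball p r \<subseteq> D \<and> (\<forall>i<m. \<forall>j<m. \<exists>k::nat. \<exists>g. g holomorphic_on ball p r \<and>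
                 (\<forall>z\<in>ball p r - {p}. F z $$ (i,j) = g z / (z - p) ^ k))) \<and>
            (mat_removable_at m F p \<longrightarrow> mat_analytic_at m F p))"

definition mero_eq :: "complex set \<Rightarrow> nat \<Rightarrow> (complex \<Rightarrow> complex mat) \<Rightarrow> (complex \<Rightarrow> complex mat) \<Rightarrow> bool" where
  "mero_eq D m F G \<longleftrightarrow> mat_H D m F = mat_H D m G \<and> (\<forall>w \<in> mat_H D m F. F w = G w)"

definition schur_class :: "nat \<Rightarrow> (complex \<Rightarrow> complex mat) \<Rightarrow> bool" where
  "schur_class m S \<longleftrightarrow> (\<forall>w\<in>unit_disc. S w \<in> carrier_mat m m) \<and>
     (\<forall>i<m. \<forall>j<m. (\<lambda>z. S z $$ (i,j)) holomorphic_on unit_disc) \<and>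
     (\<forall>w\<in>unit_disc. \<forall>v\<in>carrier_vec m.
        (\<Sum>i<m. (cmod (vec_index (S w *\<^sub>v v) i))\<^sup>2) \<le> (\<Sum>i<m. (cmod (vec_index v i))\<^sup>2))"

definition P_J0 :: "nat \<Rightarrow> complex mat \<Rightarrow> (complex \<Rightarrow> complex mat) \<Rightarrow> bool" where
  "P_J0 m J f \<longleftrightarrow> mat_meromorphic_on unit_disc m f \<and> 0 \<in> mat_H unit_disc m f \<and>
     (\<forall>w \<in> mat_H unit_disc m f. J_contractive m J (f w))"

definition P_J0_interp :: "nat \<Rightarrow> complex mat \<Rightarrow> (nat \<Rightarrow> complex mat) \<Rightarrow> nat \<Rightarrow> (complex \<Rightarrow> complex mat) \<Rightarrow> bool" where
  "P_J0_interp m J A n f \<longleftrightarrow> P_J0 m J f \<and>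
     (\<forall>j\<le>n. mat m m (\<lambda>(a,b). (deriv ^^ j) (\<lambda>z. f z $$ (a,b)) 0 / of_nat (fact j)) = A j)"

definition den1 :: "nat \<Rightarrow> complex mat \<Rightarrow> (nat \<Rightarrow> complex mat) \<Rightarrow> nat \<Rightarrow> (complex \<Rightarrow> complex mat) \<Rightarrow> complex \<Rightarrow> complex mat" where
  "den1 m J A n S w = w \<cdot>\<^sub>m (J * mat_tilde m n (sigma_poly m J A n) w * mp_inv (msqrt (L_next m J A n))
      * S w * msqrt (R_next m J A n)) + rho_poly m J A n w"

definition num1 :: "nat \<Rightarrow> complex mat \<Rightarrow> (nat \<Rightarrow> complex mat) \<Rightarrow> nat \<Rightarrow> (complex \<Rightarrow> complex mat) \<Rightarrow> complex \<Rightarrow> complex mat" where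
  "num1 m J A n S w = w \<cdot>\<^sub>m (J * mat_tilde m n (tau_poly m J A n) w * mp_inv (msqrt (L_next m J A n))
      * S w * msqrt (R_next m J A n)) + pi_poly m J A n w"

definition den2 :: "nat \<Rightarrow> complex mat \<Rightarrow> (nat \<Rightarrow> complex mat) \<Rightarrow> nat \<Rightarrow> (complex \<Rightarrow> complex mat) \<Rightarrow> complex \<Rightarrow> complex mat" where
  "den2 m J A n S w = w \<cdot>\<^sub>m (msqrt (L_next m J A n) * S w * mp_inv (msqrt (R_next m J A n))
      * mat_tilde m n (pi_poly m J A n) w * J) + tau_poly m J A n w"

definition num2 :: "nat \<Rightarrow> complex mat \<Rightarrow> (nat \<Rightarrow> complex mat) \<Rightarrow> nat \<Rightarrow> (complex \<Rightarrow> complex mat) \<Rightarrow> complex \<Rightarrow> complex mat" where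
  "num2 m J A n S w = w \<cdot>\<^sub>m (msqrt (L_next m J A n) * S w * mp_inv (msqrt (R_next m J A n))
      * mat_tilde m n (rho_poly m J A n) w * J) + sigma_poly m J A n w"

text \<open>f_S, defined where den1 is nonsingular (value at other points is irrelevant; set to 0).\<close>
definition f_S :: "nat \<Rightarrow> complex mat \<Rightarrow> (nat \<Rightarrow> complex mat) \<Rightarrow> nat \<Rightarrow> (complex \<Rightarrow> complex mat) \<Rightarrow> complex \<Rightarrow> complex mat" where
  "f_S m J A n S w = (if Determinant.det (den1 m J A n S w) \<noteq> 0
      then num1 m J A n S w * minv (den1 m J A n S w) else 0\<^sub>m m m)"

end

(* Everything rests on one identity for the block Toeplitz form Q = J - S^* J S. If Q x is the
   vector built from J w^(n-i) h - S^* J w^(n-i) g and e = J (g - (S x)_n), then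
     <J h, h> - <J g, g> = (1 - |w|^2) <Q x, x> + |w|^2 <R x_0, x_0> - <L e, e>,
   rho~ J h - pi~ J g = R x_0 and tau g - sigma h = L e.
   For h and g the denominator and the numerator of f_S applied to a vector, such an x is explicit,
   with x_0 = w^n v and e = w^(n+1) s. Hence f_S is J-contractive, its two representations agree,
   and denominator and numerator have no common kernel, so that every zero of the determinant is
   a pole; tau f_S - sigma = O(w^(n+1)) yields the interpolation conditions.
   Conversely, the Potapov-Ginzburg transform turns an interpolant f into a contractive holomorphic
   X on the disc. Its Toeplitz sections are contractive; testing them on w^(N-k) h and letting N grow
   gives the fundamental matrix inequality of f. That inequality forces the linear system Q x = ...
   to be solvable, and the identity leaves |pL beta v| <= |w| |pR alpha v| for
   alpha = rho~ J d - pi~ J c and beta = tau c - sigma d, where f = c d^-1. The contraction that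
   takes pR alpha v to pL beta v, divided by w, is the Schur parameter; it extends holomorphically
   because it is bounded off a discrete set. *)
theory Submission
  imports Defs "HOL-Complex_Analysis.Complex_Analysis"
begin

section \<open>Block Toeplitz forms in abstract inner product spaces\<close>

text \<open>The obstacle is degeneracy: Q, P, R and L may all be singular, so no system can be
  solved by inverting them. The arguments therefore use images Q x only: vectors with equal images
  give equal values of the form, and a right-hand side orthogonal to the kernel is attained. The
  Moore-Penrose inverse has two roles beyond solving. In V and W it places the columns orthogonally
  to the kernel, and this orthogonality excludes a common kernel vector of rho and pi inside the
  disc. In front of S it keeps the parameter vector in the range of L, where L is injective. The
  work is halved by a symmetry. Replacing every A_k by its adjoint and reversing the order of the
  blocks turns S into S^*, hence Q into P, and exchanges V with the adjoint of W and R with L. To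
  have both sides available, Q >= 0 must imply P >= 0; this is a first use of the Potapov-Ginzburg
  transform, on the large block matrix, long before it is applied to functions. The price of
  singular R is paid at the end: a Schur parameter is prescribed only on a subspace, and has to be
  continued holomorphically to the whole space.\<close>

locale cip_space = vector_space sc for sc :: "complex \<Rightarrow> 'v::ab_group_add \<Rightarrow> 'v" +
  fixes ip :: "'v \<Rightarrow> 'v \<Rightarrow> complex"
  assumes ip_add_left: "ip (u + v) x = ip u x + ip v x"
    and ip_scale_left: "ip (sc c u) x = c * ip u x"
    and ip_cnj: "cnj (ip u v) = ip v u"
    and ip_nonneg: "0 \<le> Re (ip u u)"
    and ip_definite: "ip u u = 0 \<Longrightarrow> u = 0"
begin

lemma ip_add_right: "ip x (u + v) = ip x u + ip x v"
  by (metis ip_add_left ip_cnj complex_cnj_add)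

lemma ip_scale_right: "ip x (sc c u) = cnj c * ip x u"
  by (metis ip_scale_left ip_cnj complex_cnj_mult)

lemma ip_zero_left [simp]: "ip 0 x = 0"
  using ip_add_left[of 0 0 x] by simp

lemma ip_zero_right [simp]: "ip x 0 = 0"
  using ip_add_right[of x 0 0] by simp

lemma ip_minus_left: "ip (- u) x = - ip u x"
  using ip_add_left[of u "-u" x] by (simp add: eq_neg_iff_add_eq_0 add.commute)

lemma ip_minus_right: "ip x (- u) = - ip x u"
  using ip_add_right[of x u "-u"] by (simp add: eq_neg_iff_add_eq_0 add.commute)

lemma ip_diff_left: "ip (u - v) x = ip u x - ip v x"
  using ip_add_left[of u "-v" x] by (simp add: ip_minus_left)

lemma ip_diff_right: "ip x (u - v) = ip x u - ip x v"
  using ip_add_right[of x u "-v"] by (simp add: ip_minus_right)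

lemma ip_sum_left: "ip (\<Sum>i\<in>I. f i) x = (\<Sum>i\<in>I. ip (f i) x)"
  by (induction I rule: infinite_finite_induct) (auto simp: ip_add_left)

lemma ip_sum_right: "ip x (\<Sum>i\<in>I. f i) = (\<Sum>i\<in>I. ip x (f i))"
  by (induction I rule: infinite_finite_induct) (auto simp: ip_add_right)

lemma ip_ext: "(\<And>x. ip u x = ip v x) \<Longrightarrow> u = v"
  using ip_definite[of "u - v"] by (auto simp: ip_diff_left)

lemma ip_self_Re: "ip u u = of_real (Re (ip u u))"
  using ip_cnj[of u u] by (simp add: complex_eq_iff)

definition lin :: "('v \<Rightarrow> 'v) \<Rightarrow> bool" where
  "lin f \<longleftrightarrow> (\<forall>u v. f (u + v) = f u + f v) \<and> (\<forall>c u. f (sc c u) = sc c (f u))"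

lemma lin_add: "lin f \<Longrightarrow> f (u + v) = f u + f v"
  and lin_scale: "lin f \<Longrightarrow> f (sc c u) = sc c (f u)"
  by (auto simp: lin_def)

lemma lin_zero: "lin f \<Longrightarrow> f 0 = 0"
  using lin_scale[of f 0 0] by simp

lemma lin_minus: "lin f \<Longrightarrow> f (- u) = - f u"
  using lin_scale[of f "-1" u] by simp

lemma lin_diff: "lin f \<Longrightarrow> f (u - v) = f u - f v"
  using lin_add[of f u "-v"] by (simp add: lin_minus)

lemma lin_sum: "lin f \<Longrightarrow> f (\<Sum>i\<in>I. g i) = (\<Sum>i\<in>I. f (g i))"
  by (induction I rule: infinite_finite_induct) (auto simp: lin_add lin_zero)

end

section \<open>Block Toeplitz matrices acting on sequences by convolution\<close>

definition cv :: "(nat \<Rightarrow> 'v \<Rightarrow> 'v::comm_monoid_add) \<Rightarrow> (nat \<Rightarrow> 'v) \<Rightarrow> nat \<Rightarrow> 'v" where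
  "cv A x i = (\<Sum>j\<le>i. A (i - j) (x j))"

text \<open>If \<open>B\<close> holds the adjoint coefficients, this is block i of S^* y, as
  \<open>cv\<close> is block i of S x. The size N occurs here only: S is causal, so block i of S x
  does not see the later blocks, while S^* sums up to the last one.\<close>

definition ac :: "(nat \<Rightarrow> 'v \<Rightarrow> 'v::comm_monoid_add) \<Rightarrow> nat \<Rightarrow> (nat \<Rightarrow> 'v) \<Rightarrow> nat \<Rightarrow> 'v" where
  "ac B N y i = (\<Sum>k\<in>{i..<N}. B (k - i) (y k))"

definition Qop :: "('v \<Rightarrow> 'v) \<Rightarrow> (nat \<Rightarrow> 'v \<Rightarrow> 'v) \<Rightarrow> (nat \<Rightarrow> 'v \<Rightarrow> 'v) \<Rightarrow> nat \<Rightarrow>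
    (nat \<Rightarrow> 'v::ab_group_add) \<Rightarrow> nat \<Rightarrow> 'v" where
  "Qop J A B N x i = J (x i) - ac B N (\<lambda>k. J (cv A x k)) i"

definition shift :: "(nat \<Rightarrow> 'v::zero) \<Rightarrow> nat \<Rightarrow> 'v" where
  "shift x i = (case i of 0 \<Rightarrow> 0 | Suc j \<Rightarrow> x j)"

lemma shift_simps [simp]: "shift x 0 = 0" "shift x (Suc i) = x i"
  by (simp_all add: shift_def)

lemma sum_triangle:
  "(\<Sum>i<N. \<Sum>j\<le>i. f i j) = (\<Sum>j<N. \<Sum>i\<in>{j..<N}. f i j :: 'a::comm_monoid_add)" for N :: nat
proof -
  have "(\<Sum>i<N. \<Sum>j\<le>i. f i j) = (\<Sum>i\<in>{..<N}. \<Sum>j | j \<in> {..<N} \<and> j \<le> i. f i j)"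
    by (intro sum.cong) auto
  also have "\<dots> = (\<Sum>j\<in>{..<N}. \<Sum>i | i \<in> {..<N} \<and> j \<le> i. f i j)"
    by (rule sum.swap_restrict) auto
  also have "\<dots> = (\<Sum>j<N. \<Sum>i\<in>{j..<N}. f i j)"
    by (intro sum.cong) auto
  finally show ?thesis .
qed

text \<open>Reversing the order of the blocks conjugates the upper triangular Toeplitz matrix into
  the lower triangular one with the same coefficients. The duality between Q and P rests on this
  flip.\<close>

lemma ac_rev: "i < N \<Longrightarrow> ac A N (\<lambda>k. y (N - 1 - k)) i = cv A y (N - 1 - i)"
  unfolding ac_def cv_def
  by (rule sum.reindex_bij_witness[where i="\<lambda>j. N - 1 - j" and j="\<lambda>j. N - 1 - j"]) auto

lemma ac_cong: "(\<And>k. i \<le> k \<Longrightarrow> k < N \<Longrightarrow> y k = z k) \<Longrightarrow> ac A N y i = ac A N z i"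
  by (auto simp: ac_def intro!: sum.cong)

lemma cv_cong: "(\<And>k. k \<le> i \<Longrightarrow> y k = z k) \<Longrightarrow> cv A y i = cv A z i"
  by (auto simp: cv_def intro!: sum.cong)

lemma Qop_cong:
  assumes "\<And>k. k < N \<Longrightarrow> y k = z k" "i < N"
  shows "Qop J A B N y i = Qop J A B N z i"
proof -
  have "cv A y k = cv A z k" if "k < N" for k
    using that assms by (intro cv_cong) auto
  then show ?thesis unfolding Qop_def using assms by (auto intro!: ac_cong)
qed

lemma ac_Suc: "ac B (Suc N) y (Suc i) = ac B N (\<lambda>k. y (Suc k)) i"
  unfolding ac_def
  by (rule sum.reindex_bij_witness[where i=Suc and j="\<lambda>j. j - 1"]) auto

lemma sum_rev: "(\<Sum>i<N. f (N - 1 - i)) = (\<Sum>i<N. f i)" for f :: "nat \<Rightarrow> 'a::comm_monoid_add"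
  by (rule sum.reindex_bij_witness[where i="\<lambda>j. N - 1 - j" and j="\<lambda>j. N - 1 - j"]) auto

locale toeplitz = cip_space sc ip for sc :: "complex \<Rightarrow> 'v::ab_group_add \<Rightarrow> 'v" and ip +
  fixes J :: "'v \<Rightarrow> 'v" and A As :: "nat \<Rightarrow> 'v \<Rightarrow> 'v"
  assumes lin_J: "lin J" and J_adj: "ip (J u) v = ip u (J v)" and J_J: "J (J u) = u"
    and lin_A: "lin (A k)" and lin_As: "lin (As k)" and A_adj: "ip (A k u) v = ip u (As k v)"
begin

text \<open>Together with the flip \<open>ac_rev\<close> this exchange carries statements about Q
  and R over to P and L.\<close>

lemma dual: "toeplitz sc ip J As A"
proof
  show "ip (As k u) v = ip u (A k v)" for k u v
    by (metis A_adj ip_cnj)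
qed (auto simp: lin_J J_adj J_J lin_A lin_As)

lemmas linJ = lin_add[OF lin_J] lin_scale[OF lin_J] lin_zero[OF lin_J] lin_diff[OF lin_J] lin_sum[OF lin_J]

lemma cv_add: "cv A (\<lambda>i. x i + y i) i = cv A x i + cv A y i"
  by (simp add: cv_def lin_add[OF lin_A] sum.distrib)

lemma cv_diff: "cv A (\<lambda>i. x i - y i) i = cv A x i - cv A y i"
  by (simp add: cv_def lin_diff[OF lin_A] sum_subtractf)

lemma cv_scale: "cv A (\<lambda>i. sc c (x i)) i = sc c (cv A x i)"
  by (simp add: cv_def lin_scale[OF lin_A] scale_sum_right)

lemma ac_add: "ac As N (\<lambda>i. x i + y i) i = ac As N x i + ac As N y i"
  by (simp add: ac_def lin_add[OF lin_As] sum.distrib)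

lemma ac_diff: "ac As N (\<lambda>i. x i - y i) i = ac As N x i - ac As N y i"
  by (simp add: ac_def lin_diff[OF lin_As] sum_subtractf)

lemma ac_scale: "ac As N (\<lambda>i. sc c (x i)) i = sc c (ac As N x i)"
  by (simp add: ac_def lin_scale[OF lin_As] scale_sum_right)

lemma Qop_add: "Qop J A As N (\<lambda>i. x i + y i) i = Qop J A As N x i + Qop J A As N y i"
  by (simp add: Qop_def cv_add ac_add linJ)

lemma Qop_diff: "Qop J A As N (\<lambda>i. x i - y i) i = Qop J A As N x i - Qop J A As N y i"
  by (simp add: Qop_def cv_diff ac_diff linJ)

lemma Qop_scale: "Qop J A As N (\<lambda>i. sc c (x i)) i = sc c (Qop J A As N x i)"
  by (simp add: Qop_def cv_scale ac_scale linJ scale_right_diff_distrib)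

lemma ip_cv: "(\<Sum>i<N. ip (cv A x i) (y i)) = (\<Sum>i<N. ip (x i) (ac As N y i))"
proof -
  have "(\<Sum>i<N. ip (cv A x i) (y i)) = (\<Sum>i<N. \<Sum>j\<le>i. ip (x j) (As (i - j) (y i)))"
    by (simp add: cv_def ip_sum_left A_adj)
  also have "\<dots> = (\<Sum>i<N. ip (x i) (ac As N y i))"
    by (simp add: sum_triangle ac_def ip_sum_right)
  finally show ?thesis .
qed

lemma ip_ac: "(\<Sum>i<N. ip (ac As N y i) (x i)) = (\<Sum>i<N. ip (y i) (cv A x i))"
proof -
  have "(\<Sum>i<N. ip (ac As N y i) (x i)) = cnj (\<Sum>i<N. ip (x i) (ac As N y i))"
    by (simp add: ip_cnj)
  also have "\<dots> = (\<Sum>i<N. ip (y i) (cv A x i))"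
    by (simp add: ip_cnj flip: ip_cv)
  finally show ?thesis .
qed

lemma Qop_form: "(\<Sum>i<N. ip (Qop J A As N x i) (y i)) =
    (\<Sum>i<N. ip (J (x i)) (y i) - ip (J (cv A x i)) (cv A y i))"
  by (simp add: Qop_def ip_diff_left sum_subtractf ip_ac)

lemma Qop_sym: "(\<Sum>i<N. ip (Qop J A As N x i) (y i)) = (\<Sum>i<N. ip (x i) (Qop J A As N y i))"
proof -
  have "(\<Sum>i<N. ip (x i) (Qop J A As N y i)) = cnj (\<Sum>i<N. ip (Qop J A As N y i) (x i))"
    by (simp add: ip_cnj)
  also have "\<dots> = cnj (\<Sum>i<N. ip (y i) (J (x i)) - ip (cv A y i) (J (cv A x i)))"
    by (simp add: Qop_form J_adj)
  also have "\<dots> = (\<Sum>i<N. ip (Qop J A As N x i) (y i))"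
    by (simp add: Qop_form ip_cnj)
  finally show ?thesis by simp
qed

lemma cv_shift: "cv A (shift x) (Suc i) = cv A x i" "cv A (shift x) 0 = 0"
proof -
  show "cv A (shift x) (Suc i) = cv A x i"
    unfolding cv_def by (subst sum.atMost_Suc_shift) (simp add: lin_zero[OF lin_A])
qed (simp add: cv_def lin_zero[OF lin_A])

text \<open>S commutes with the delay: a zero put in front of x puts a zero in front of S x. Hence
  Q_{N+1} without its first block row and column is Q_N; the next lemma is the off-diagonal part of
  the first row.\<close>

lemma Qop_shift: "Qop J A As (Suc N) (shift x) (Suc i) = Qop J A As N x i"
  by (simp add: Qop_def ac_Suc cv_shift)

lemma Qop_shift_0:
  "Qop J A As (Suc N) (shift x) 0 = - (\<Sum>i<N. As (Suc i) (J (cv A x i)))"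
proof -
  have "ac As (Suc N) (\<lambda>k. J (cv A (shift x) k)) 0 = (\<Sum>k<Suc N. As k (J (cv A (shift x) k)))"
    by (simp add: ac_def atLeast0LessThan)
  also have "\<dots> = (\<Sum>i<N. As (Suc i) (J (cv A x i)))"
    by (subst sum.lessThan_Suc_shift) (simp add: cv_shift linJ lin_zero[OF lin_As])
  finally show ?thesis by (simp add: Qop_def linJ)
qed

text \<open>Block elimination in Q_{n+1} without inverting the lower right block Q_n: a column V
  with image (R v, 0, ..., 0) does the same service, so R is a Schur complement even if Q_n is
  singular. Subtracting V x_0 from x leaves a vector with first block 0, on which Q_{n+1} acts as
  Q_n.\<close>

lemma Qop_decomp:
  assumes V: "\<And>v i. i \<le> n \<Longrightarrow> Qop J A As (Suc n) (\<lambda>k. V k v) i = (if i = 0 then R v else 0)"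
    and V0: "\<And>v. V 0 v = v"
  defines "y \<equiv> \<lambda>x i. x (Suc i) - V (Suc i) (x 0)"
  shows "i < n \<Longrightarrow> Qop J A As n (y x) i = Qop J A As (Suc n) x (Suc i)"
    and "(\<Sum>i<Suc n. ip (Qop J A As (Suc n) x i) (x i)) =
         ip (R (x 0)) (x 0) + (\<Sum>i<n. ip (Qop J A As n (y x) i) (y x i))"
    and "ip (R u) v = ip u (R v)"
    and "(\<Sum>i<Suc n. ip (Qop J A As (Suc n) x i) (V i v)) = ip (R (x 0)) v"
proof -
  let ?Q = "Qop J A As (Suc n)"
  have dec: "x = (\<lambda>i. V i (x 0) + shift (y x) i)" for x
    by (rule ext) (auto simp: y_def V0 shift_def split: nat.split)
  have Qx: "?Q x i = ?Q (\<lambda>i. V i (x 0)) i + ?Q (shift (y x)) i" for x i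
    by (subst dec) (rule Qop_add)
  show *: "Qop J A As n (y x) i = ?Q x (Suc i)" if "i < n" for x i
    using that by (simp add: Qx[of x] V Qop_shift)
  have QV: "(\<Sum>i<Suc n. ip (?Q (\<lambda>k. V k u) i) (z i)) = ip (R u) (z 0)" for u z
    by (subst sum.lessThan_Suc_shift) (simp add: V)
  show R: "ip (R u) v = ip u (R v)" for u v
  proof -
    have "ip (R u) v = (\<Sum>i<Suc n. ip (?Q (\<lambda>k. V k u) i) (V i v))"
      by (simp only: QV V0)
    also have "\<dots> = (\<Sum>i<Suc n. ip (V i u) (?Q (\<lambda>k. V k v) i))"
      by (rule Qop_sym)
    also have "\<dots> = ip u (R v)"
      by (subst sum.lessThan_Suc_shift) (simp add: V V0)
    finally show ?thesis .
  qed
  show "(\<Sum>i<Suc n. ip (?Q x i) (V i v)) = ip (R (x 0)) v" for v x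
  proof -
    have "(\<Sum>i<Suc n. ip (?Q x i) (V i v)) = (\<Sum>i<Suc n. ip (x i) (?Q (\<lambda>k. V k v) i))"
      by (rule Qop_sym)
    also have "\<dots> = ip (x 0) (R v)"
      by (subst sum.lessThan_Suc_shift) (simp add: V)
    finally show ?thesis by (simp add: R)
  qed
  have QS: "(\<Sum>i<Suc n. ip (?Q (shift (y x)) i) (z i)) =
      ip (?Q (shift (y x)) 0) (z 0) + (\<Sum>i<n. ip (Qop J A As n (y x) i) (z (Suc i)))" for z
    by (subst sum.lessThan_Suc_shift) (simp add: Qop_shift)
  have "(\<Sum>i<Suc n. ip (?Q x i) (x i)) =
      (\<Sum>i<Suc n. ip (?Q (\<lambda>i. V i (x 0)) i) (x i)) + (\<Sum>i<Suc n. ip (?Q (shift (y x)) i) (x i))"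
    by (subst Qx) (simp only: ip_add_left sum.distrib)
  also have "(\<Sum>i<Suc n. ip (?Q (shift (y x)) i) (x i)) =
      (\<Sum>i<Suc n. ip (?Q (shift (y x)) i) (V i (x 0))) + (\<Sum>i<Suc n. ip (?Q (shift (y x)) i) (shift (y x) i))"
    by (subst (3) dec) (simp only: ip_add_right sum.distrib)
  \<comment> \<open>The cross term disappears because the image of V has only its first block, where
    the shifted vector is 0.\<close>
  also have "(\<Sum>i<Suc n. ip (?Q (shift (y x)) i) (V i (x 0))) = 0"
    by (subst Qop_sym, subst sum.lessThan_Suc_shift) (simp add: V)
  also have "(\<Sum>i<Suc n. ip (?Q (shift (y x)) i) (shift (y x) i)) = (\<Sum>i<n. ip (Qop J A As n (y x) i) (y x i))"
    by (subst QS) simp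
  finally show "(\<Sum>i<Suc n. ip (?Q x i) (x i)) =
         ip (R (x 0)) (x 0) + (\<Sum>i<n. ip (Qop J A As n (y x) i) (y x i))"
    by (simp only: QV add_0_left)
qed

text \<open>The vector J e_h - S^* J e_g, where e_h and e_g have the blocks w^(N-1-i) h and
  w^(N-1-i) g. The exponents descend so that deleting block 0 turns size N+1 into size N without a
  factor.\<close>

definition Gv :: "nat \<Rightarrow> complex \<Rightarrow> 'v \<Rightarrow> 'v \<Rightarrow> nat \<Rightarrow> 'v" where
  "Gv N w h g i = J (sc (w ^ (N - 1 - i)) h) - ac As N (\<lambda>k. J (sc (w ^ (N - 1 - k)) g)) i"

lemma Gv_Suc: "i < N \<Longrightarrow> Gv (Suc N) w h g (Suc i) = Gv N w h g i"
  by (simp add: Gv_def ac_Suc)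

text \<open>With a = e_h - x and b = e_g - S x the equation Q x = G says J a = S^* J b. In this form
  it is symmetric: for c = J b in reversed order the dual operator yields b - S a = e_g - S e_h,
  from which x has dropped out. In the difference of the two quadratic forms only the terms of e_h
  and e_g survive, with weights |w|^(2k).\<close>

lemma Qop_dual:
  assumes x: "\<And>i. i < N \<Longrightarrow> Qop J A As N x i = Gv N w h g i"
  defines "c \<equiv> \<lambda>i. J (sc (w ^ i) g - cv A x (N - 1 - i))"
  shows "i < N \<Longrightarrow> Qop J As A N c i = sc (w ^ i) g - ac A N (\<lambda>k. sc (w ^ k) h) i"
    and "(\<Sum>i<N. ip (Qop J A As N x i) (x i)) = (\<Sum>i<N. ip (Qop J As A N c i) (c i)) +
      of_real (\<Sum>k<N. (cmod w)\<^sup>2 ^ k) * (ip (J h) h - ip (J g) g)"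
proof -
  interpret d: toeplitz sc ip J As A by (rule dual)
  define eh eg a b where "eh k = sc (w ^ (N - 1 - k)) h" and "eg k = sc (w ^ (N - 1 - k)) g"
    and "a k = eh k - x k" and "b k = eg k - cv A x k" for k
  have Ja: "J (a i) = ac As N (\<lambda>k. J (b k)) i" if "i < N" for i
    using x[OF that] by (simp add: a_def b_def eh_def eg_def Gv_def Qop_def linJ ac_diff algebra_simps)
  have c: "c i = J (b (N - 1 - i))" if "i < N" for i
    using that by (simp add: c_def b_def eg_def)
  have cvc: "cv As c k = J (a (N - 1 - k))" if "k < N" for k
  proof -
    have "cv As c k = ac As N (\<lambda>l. c (N - 1 - l)) (N - 1 - k)"
      using that by (subst ac_rev) auto
    also have "\<dots> = ac As N (\<lambda>l. J (b l)) (N - 1 - k)"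
      by (rule ac_cong) (simp add: c)
    finally show ?thesis using that by (simp add: Ja)
  qed
  show Qc: "Qop J As A N c i = sc (w ^ i) g - ac A N (\<lambda>k. sc (w ^ k) h) i" if "i < N" for i
  proof -
    have "ac A N (\<lambda>k. J (cv As c k)) i = ac A N (\<lambda>k. sc (w ^ k) h - x (N - 1 - k)) i"
      by (rule ac_cong) (simp add: cvc J_J a_def eh_def)
    also have "\<dots> = ac A N (\<lambda>k. sc (w ^ k) h) i - cv A x (N - 1 - i)"
      using that by (simp only: d.ac_diff ac_rev)
    finally show ?thesis
      using that by (simp add: Qop_def c J_J b_def eg_def)
  qed
  have 1: "(\<Sum>i<N. ip (Qop J A As N x i) (x i)) = (\<Sum>i<N. ip (J (eh i)) (x i)) - (\<Sum>i<N. ip (J (eg i)) (cv A x i))"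
    by (simp add: x Gv_def eh_def eg_def ip_diff_left sum_subtractf ip_ac)
  have "(\<Sum>i<N. ip (Qop J As A N c i) (c i)) =
      (\<Sum>i<N. ip (sc (w ^ i) g) (c i)) - (\<Sum>i<N. ip (ac A N (\<lambda>k. sc (w ^ k) h) i) (c i))"
    by (simp add: Qc ip_diff_left sum_subtractf)
  also have "(\<Sum>i<N. ip (ac A N (\<lambda>k. sc (w ^ k) h) i) (c i)) = (\<Sum>i<N. ip (sc (w ^ i) h) (cv As c i))"
    by (rule d.ip_ac)
  also have "\<dots> = (\<Sum>i<N. ip (eh (N - 1 - i)) (J (a (N - 1 - i))))"
    by (intro sum.cong) (simp_all add: cvc eh_def)
  also have "\<dots> = (\<Sum>i<N. ip (eh i) (J (a i)))"
    by (rule sum_rev)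
  also have "(\<Sum>i<N. ip (sc (w ^ i) g) (c i)) = (\<Sum>i<N. ip (eg (N - 1 - i)) (J (b (N - 1 - i))))"
    by (intro sum.cong) (simp_all add: c eg_def)
  also have "\<dots> = (\<Sum>i<N. ip (eg i) (J (b i)))"
    by (rule sum_rev)
  finally have 2: "(\<Sum>i<N. ip (Qop J As A N c i) (c i)) =
      (\<Sum>i<N. ip (J (eg i)) (eg i) - ip (J (eh i)) (eh i)) + (\<Sum>i<N. ip (J (eh i)) (x i)) - (\<Sum>i<N. ip (J (eg i)) (cv A x i))"
    by (simp add: a_def b_def ip_diff_right linJ sum_subtractf flip: J_adj)
  have "(\<Sum>i<N. ip (J (eg i)) (eg i) - ip (J (eh i)) (eh i)) =
      (\<Sum>i<N. of_real ((cmod w)\<^sup>2 ^ (N - 1 - i)) * (ip (J g) g - ip (J h) h))"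
  proof (intro sum.cong refl)
    fix i
    have "cnj w ^ k * w ^ k = of_real ((cmod w)\<^sup>2 ^ k)" for k
      by (metis complex_norm_square of_real_power power_mult_distrib mult.commute)
    then show "ip (J (eg i)) (eg i) - ip (J (eh i)) (eh i) = of_real ((cmod w)\<^sup>2 ^ (N - 1 - i)) * (ip (J g) g - ip (J h) h)"
      by (simp add: eg_def eh_def linJ ip_scale_left ip_scale_right right_diff_distrib flip: mult.assoc)
  qed
  also have "\<dots> = (\<Sum>i<N. of_real ((cmod w)\<^sup>2 ^ i) * (ip (J g) g - ip (J h) h))"
    by (rule sum_rev[where f="\<lambda>i. of_real ((cmod w)\<^sup>2 ^ i) * (ip (J g) g - ip (J h) h)"])
  also have "\<dots> = - (of_real (\<Sum>k<N. (cmod w)\<^sup>2 ^ k) * (ip (J h) h - ip (J g) g))"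
    by (simp add: sum_distrib_right flip: sum_negf) (simp add: algebra_simps)
  finally show "(\<Sum>i<N. ip (Qop J A As N x i) (x i)) = (\<Sum>i<N. ip (Qop J As A N c i) (c i)) +
      of_real (\<Sum>k<N. (cmod w)\<^sup>2 ^ k) * (ip (J h) h - ip (J g) g)"
    using 1 2 by simp
qed


text \<open>Polynomials h and g of degree n+1 produce solutions of Q x = G when their coefficients
  satisfy S hh = gg up to index n and J hh = S^* J gg from index 1 on. For x take the scaled partial
  sums of h; then S x consists of the partial sums of g, the differences e_h - x and e_g - S x are
  tails, and J a = S^* J b reduces to the second coefficient relation.\<close>

lemma Qop_partial_sums:
  fixes w :: complex
  assumes hg: "\<And>i. i \<le> n \<Longrightarrow> cv A hh i = gg i"
    and gh: "\<And>p. 1 \<le> p \<Longrightarrow> p \<le> Suc n \<Longrightarrow> J (hh p) = ac As (Suc (Suc n)) (\<lambda>k. J (gg k)) p"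
  defines "x \<equiv> \<lambda>i. sc (w ^ (n - i)) (\<Sum>j\<le>i. sc (w ^ j) (hh j))"
    and "h \<equiv> \<Sum>j\<le>Suc n. sc (w ^ j) (hh j)" and "g \<equiv> \<Sum>j\<le>Suc n. sc (w ^ j) (gg j)"
  assumes i: "i \<le> n"
  shows "cv A x i = sc (w ^ (n - i)) (\<Sum>j\<le>i. sc (w ^ j) (gg j))"
    and "Qop J A As (Suc n) x i = Gv (Suc n) w h g i"
proof -
  have x: "sc (w ^ (n - i)) (\<Sum>j\<le>i. sc (w ^ j) (f j)) = (\<Sum>l\<le>i. sc (w ^ (n - l)) (f (i - l)))"
    if "i \<le> n" for i f
    unfolding scale_sum_right
    by (rule sum.reindex_bij_witness[where i="\<lambda>j. i - j" and j="\<lambda>j. i - j"])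
      (use that in \<open>auto simp flip: power_add\<close>)
  have cvx: "cv A x i = sc (w ^ (n - i)) (\<Sum>j\<le>i. sc (w ^ j) (gg j))" if "i \<le> n" for i
  proof -
    have "cv A x i = (\<Sum>k<Suc i. \<Sum>l\<le>k. sc (w ^ (n - l)) (A (i - k) (hh (k - l))))"
      using that unfolding cv_def x_def lessThan_Suc_atMost
      by (intro sum.cong refl) (simp add: x lin_sum[OF lin_A] lin_scale[OF lin_A])
    also have "\<dots> = (\<Sum>l<Suc i. \<Sum>k\<in>{l..<Suc i}. sc (w ^ (n - l)) (A (i - k) (hh (k - l))))"
      by (rule sum_triangle)
    also have "\<dots> = (\<Sum>l\<le>i. sc (w ^ (n - l)) (gg (i - l)))"
      unfolding lessThan_Suc_atMost
    proof (intro sum.cong refl)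
      fix l assume l: "l \<in> {..i}"
      have "(\<Sum>k\<in>{l..<Suc i}. A (i - k) (hh (k - l))) = cv A hh (i - l)"
        unfolding cv_def
        by (rule sum.reindex_bij_witness[where i="\<lambda>j. j + l" and j="\<lambda>j. j - l"]) (use l in auto)
      then show "(\<Sum>k\<in>{l..<Suc i}. sc (w ^ (n - l)) (A (i - k) (hh (k - l)))) = sc (w ^ (n - l)) (gg (i - l))"
        using l that by (simp add: hg flip: scale_sum_right)
    qed
    finally show ?thesis using that by (simp add: x)
  qed
  show "cv A x i = sc (w ^ (n - i)) (\<Sum>j\<le>i. sc (w ^ j) (gg j))" by (rule cvx[OF i])
  \<comment> \<open>Indexing the tail by l = j - i makes the exponent n + l independent of i, so
    that S^* can be taken inside the sum.\<close>
  have tail: "sc (w ^ (n - i)) (\<Sum>j\<le>Suc n. sc (w ^ j) (f j)) - sc (w ^ (n - i)) (\<Sum>j\<le>i. sc (w ^ j) (f j)) =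
      (\<Sum>l | l \<in> {1..Suc n} \<and> i + l \<le> Suc n. sc (w ^ (n + l)) (f (i + l)))" if "i \<le> n" for i f
  proof -
    have "{..Suc n} = {..i} \<union> {i<..Suc n}" using that by auto
    then have "(\<Sum>j\<le>Suc n. sc (w ^ j) (f j)) = (\<Sum>j\<le>i. sc (w ^ j) (f j)) + (\<Sum>j\<in>{i<..Suc n}. sc (w ^ j) (f j))"
      by (simp only:) (rule sum.union_disjoint, auto)
    then have "sc (w ^ (n - i)) (\<Sum>j\<le>Suc n. sc (w ^ j) (f j)) - sc (w ^ (n - i)) (\<Sum>j\<le>i. sc (w ^ j) (f j)) =
        (\<Sum>j\<in>{i<..Suc n}. sc (w ^ (n - i + j)) (f j))"
      by (simp only: scale_right_distrib scale_sum_right power_add scale_scale add_diff_cancel_left')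
    also have "\<dots> = (\<Sum>l | l \<in> {1..Suc n} \<and> i + l \<le> Suc n. sc (w ^ (n + l)) (f (i + l)))"
      by (rule sum.reindex_bij_witness[where i="\<lambda>l. i + l" and j="\<lambda>j. j - i"]) (use that in auto)
    finally show ?thesis .
  qed
  have t: "J (sc (w ^ (n - k)) g) - J (cv A x k) =
      J (\<Sum>l | l \<in> {1..Suc n} \<and> k + l \<le> Suc n. sc (w ^ (n + l)) (gg (k + l)))" if "k \<le> n" for k
    unfolding g_def by (simp only: cvx[OF that] tail[OF that] flip: linJ(4))
  have "ac As (Suc n) (\<lambda>k. J (sc (w ^ (n - k)) g) - J (cv A x k)) i =
      (\<Sum>k\<in>{i..<Suc n}. As (k - i) (J (\<Sum>l | l \<in> {1..Suc n} \<and> k + l \<le> Suc n. sc (w ^ (n + l)) (gg (k + l)))))"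
    unfolding ac_def using i
    by (intro sum.cong refl arg_cong[of _ _ "As _"] t) auto
  also have "\<dots> = (\<Sum>k\<in>{i..<Suc n}. \<Sum>l | l \<in> {1..Suc n} \<and> k + l \<le> Suc n. sc (w ^ (n + l)) (As (k - i) (J (gg (k + l)))))"
    by (simp only: linJ lin_sum[OF lin_As] lin_scale[OF lin_As])
  also have "\<dots> = (\<Sum>l\<in>{1..Suc n}. \<Sum>k | k \<in> {i..<Suc n} \<and> k + l \<le> Suc n. sc (w ^ (n + l)) (As (k - i) (J (gg (k + l)))))"
    by (rule sum.swap_restrict) auto
  also have "\<dots> = (\<Sum>l | l \<in> {1..Suc n} \<and> i + l \<le> Suc n. \<Sum>k | k \<in> {i..<Suc n} \<and> k + l \<le> Suc n. sc (w ^ (n + l)) (As (k - i) (J (gg (k + l)))))"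
    by (rule sum.mono_neutral_right) (auto intro!: sum.neutral)
  also have "\<dots> = (\<Sum>l | l \<in> {1..Suc n} \<and> i + l \<le> Suc n. sc (w ^ (n + l)) (J (hh (i + l))))"
  proof (intro sum.cong refl)
    fix l assume l: "l \<in> {l. l \<in> {1..Suc n} \<and> i + l \<le> Suc n}"
    have "(\<Sum>k | k \<in> {i..<Suc n} \<and> k + l \<le> Suc n. As (k - i) (J (gg (k + l)))) = ac As (Suc (Suc n)) (\<lambda>k. J (gg k)) (i + l)"
      unfolding ac_def
      by (rule sum.reindex_bij_witness[where i="\<lambda>j. j - l" and j="\<lambda>j. j + l"]) (use l in auto)
    then show "(\<Sum>k | k \<in> {i..<Suc n} \<and> k + l \<le> Suc n. sc (w ^ (n + l)) (As (k - i) (J (gg (k + l))))) = sc (w ^ (n + l)) (J (hh (i + l)))"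
      using l gh[of "i + l"] by (simp flip: scale_sum_right)
  qed
  also have "\<dots> = J (sc (w ^ (n - i)) h) - J (x i)"
    using tail[OF i, of hh] by (simp add: h_def x_def flip: linJ)
  finally show "Qop J A As (Suc n) x i = Gv (Suc n) w h g i"
    by (simp add: Qop_def Gv_def ac_diff algebra_simps)
qed

end

section \<open>Resolvent polynomials of a Toeplitz form and their identities\<close>

locale potapov = toeplitz sc ip J A As
  for sc :: "complex \<Rightarrow> 'v::ab_group_add \<Rightarrow> 'v" and ip J A As +
  fixes n :: nat and V Vs T Ts :: "nat \<Rightarrow> 'v \<Rightarrow> 'v" and R L :: "'v \<Rightarrow> 'v"
  assumes lin_V: "lin (V k)" and lin_Vs: "lin (Vs k)" and lin_T: "lin (T k)" and lin_Ts: "lin (Ts k)"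
    and V_adj: "ip (V k u) v = ip u (Vs k v)" and T_adj: "ip (T k u) v = ip u (Ts k v)"
    and V_0: "V 0 v = v" and Ts_0: "Ts 0 v = v"
    and Qop_V: "i \<le> n \<Longrightarrow> Qop J A As (Suc n) (\<lambda>k. V k v) i = (if i = 0 then R v else 0)"
    and Qop_Ts: "i \<le> n \<Longrightarrow> Qop J As A (Suc n) (\<lambda>k. Ts k v) i = (if i = 0 then L v else 0)"
    and V_ker: "(\<And>i. i < n \<Longrightarrow> Qop J A As n x i = 0) \<Longrightarrow> (\<Sum>i<n. ip (V (Suc i) v) (x i)) = 0"
    and Ts_ker: "(\<And>i. i < n \<Longrightarrow> Qop J As A n x i = 0) \<Longrightarrow> (\<Sum>i<n. ip (Ts (Suc i) v) (x i)) = 0"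
begin

lemma Ts_adj: "ip (Ts k u) v = ip u (T k v)"
  by (metis T_adj ip_cnj)

lemma Vs_adj: "ip (Vs k u) v = ip u (V k v)"
  by (metis V_adj ip_cnj)

text \<open>V pairs with \<open>Ts\<close> here, a column with a column. For this reason the locale
  assumptions are imposed on the adjoints of the row blocks T.\<close>

lemma potapov_dual: "potapov sc ip J As A n Ts T Vs V L R"
proof -
  interpret d: toeplitz sc ip J As A by (rule dual)
  show ?thesis
    by unfold_locales (fact lin_V lin_Vs lin_T lin_Ts Ts_adj Vs_adj V_0 Ts_0 Qop_V Qop_Ts |
      erule V_ker Ts_ker)+
qed

text \<open>V and T are the coefficients of rho and tau, both starting with the identity; pi has the
  coefficients S V and sigma the coefficients T S. The names ending in t denote the reciprocal
  polynomials of formal degree n.\<close>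

definition rho :: "complex \<Rightarrow> 'v \<Rightarrow> 'v" where "rho w v = (\<Sum>k\<le>n. sc (w ^ k) (V k v))"
definition ppi :: "complex \<Rightarrow> 'v \<Rightarrow> 'v" where "ppi w v = (\<Sum>k\<le>n. sc (w ^ k) (cv A (\<lambda>j. V j v) k))"
definition tau :: "complex \<Rightarrow> 'v \<Rightarrow> 'v" where "tau w v = (\<Sum>k\<le>n. sc (w ^ k) (T k v))"
definition sigma :: "complex \<Rightarrow> 'v \<Rightarrow> 'v" where
  "sigma w v = (\<Sum>k\<le>n. sc (w ^ k) (\<Sum>j\<le>k. T j (A (k - j) v)))"
definition rhot :: "complex \<Rightarrow> 'v \<Rightarrow> 'v" where "rhot w v = (\<Sum>k\<le>n. sc (w ^ (n - k)) (Vs k v))"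
definition pit :: "complex \<Rightarrow> 'v \<Rightarrow> 'v" where
  "pit w v = (\<Sum>k\<le>n. sc (w ^ (n - k)) (\<Sum>j\<le>k. Vs j (As (k - j) v)))"
definition taut :: "complex \<Rightarrow> 'v \<Rightarrow> 'v" where "taut w v = (\<Sum>k\<le>n. sc (w ^ (n - k)) (Ts k v))"
definition sigmat :: "complex \<Rightarrow> 'v \<Rightarrow> 'v" where
  "sigmat w v = (\<Sum>k\<le>n. sc (w ^ (n - k)) (cv As (\<lambda>j. Ts j v) k))"

lemma lin_R: "lin R"
proof -
  have R: "R v = Qop J A As (Suc n) (\<lambda>k. V k v) 0" for v by (simp add: Qop_V)
  show ?thesis
    unfolding lin_def R by (simp add: lin_add[OF lin_V] lin_scale[OF lin_V] Qop_add Qop_scale)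
qed

lemma lin_L: "lin L"
proof -
  interpret d: potapov sc ip J As A n Ts T Vs V L R by (rule potapov_dual)
  show ?thesis by (rule d.lin_R)
qed

text \<open>The form is reduced twice: along V at x, leaving a form of Q_n at y, and along Ts at the
  dual vector c, leaving a form of the dual of Q_n at d. Since y solves the smaller system with the
  same h and g, it has a dual vector c' of its own, and the images of d and c' differ by the factor
  w. So the reduced forms agree up to |w|^2 and a geometric sum. The three resulting equations e1,
  e2, e3 are linear and eliminate both reduced forms.\<close>

lemma master_identity:
  assumes x: "\<And>i. i \<le> n \<Longrightarrow> Qop J A As (Suc n) x i = Gv (Suc n) w h g i"
  defines "c \<equiv> J (g - cv A x n)"
  shows "ip (J h) h - ip (J g) g = of_real (1 - (cmod w)\<^sup>2) * (\<Sum>i\<le>n. ip (Qop J A As (Suc n) x i) (x i))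
      + of_real ((cmod w)\<^sup>2) * ip (R (x 0)) (x 0) - ip (L c) c"
    and "rhot w (J h) - pit w (J g) = R (x 0)"
    and "tau w g - sigma w h = L c"
proof -
  interpret d: toeplitz sc ip J As A by (rule dual)
  let ?c = "\<lambda>i. J (sc (w ^ i) g - cv A x (Suc n - 1 - i))"
  let ?y = "\<lambda>i. x (Suc i) - V (Suc i) (x 0)"
  let ?d = "\<lambda>i. ?c (Suc i) - Ts (Suc i) (?c 0)"
  let ?c' = "\<lambda>i. J (sc (w ^ i) g - cv A ?y (n - 1 - i))"
  let ?\<delta> = "ip (J h) h - ip (J g) g"
  have c0: "?c 0 = c" by (simp add: c_def)
  note dec = Qop_decomp[OF Qop_V V_0]
  note ddec = d.Qop_decomp[OF Qop_Ts Ts_0]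
  have x': "\<And>i. i < Suc n \<Longrightarrow> Qop J A As (Suc n) x i = Gv (Suc n) w h g i"
    by (rule x) simp
  note dual1 = Qop_dual[OF x']
  have y: "Qop J A As n ?y i = Gv n w h g i" if "i < n" for i
    using dec(1)[OF _ that] that by (simp add: x Gv_Suc)
  note dual2 = Qop_dual[OF y]
  \<comment> \<open>The vectors d and w c' may differ by a kernel element. Equality of the images is
    enough, because the form depends on the image only.\<close>
  have dc: "Qop J As A n ?d i = sc w (Qop J As A n ?c' i)" if "i < n" for i
  proof -
    have "Qop J As A n ?d i = Qop J As A (Suc n) ?c (Suc i)"
      by (rule ddec(1)[OF _ that]) simp
    also have "\<dots> = sc (w ^ Suc i) g - ac A (Suc n) (\<lambda>k. sc (w ^ k) h) (Suc i)"
      by (rule dual1(1)) (use that in auto)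
    also have "ac A (Suc n) (\<lambda>k. sc (w ^ k) h) (Suc i) = sc w (ac A n (\<lambda>k. sc (w ^ k) h) i)"
      by (simp add: ac_Suc flip: d.ac_scale)
    also have "sc (w ^ Suc i) g - sc w (ac A n (\<lambda>k. sc (w ^ k) h) i) = sc w (Qop J As A n ?c' i)"
      by (subst dual2(1)) (use that in \<open>simp_all add: scale_right_diff_distrib\<close>)
    finally show ?thesis .
  qed
  have "(\<Sum>i<n. ip (Qop J As A n ?d i) (?d i)) = (\<Sum>i<n. w * ip (Qop J As A n ?c' i) (?d i))"
    by (intro sum.cong refl) (simp only: dc lessThan_iff ip_scale_left)
  also have "\<dots> = w * (\<Sum>i<n. ip (?c' i) (Qop J As A n ?d i))"
    by (simp only: sum_distrib_left[symmetric] d.Qop_sym)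
  also have "(\<Sum>i<n. ip (?c' i) (Qop J As A n ?d i)) = (\<Sum>i<n. cnj w * ip (?c' i) (Qop J As A n ?c' i))"
    by (intro sum.cong refl) (simp only: dc lessThan_iff ip_scale_right)
  also have "w * \<dots> = of_real ((cmod w)\<^sup>2) * (\<Sum>i<n. ip (Qop J As A n ?c' i) (?c' i))"
    unfolding d.Qop_sym complex_norm_square by (simp only: sum_distrib_left mult.assoc)
  finally have p: "(\<Sum>i<n. ip (Qop J As A n ?d i) (?d i)) =
      of_real ((cmod w)\<^sup>2) * (\<Sum>i<n. ip (Qop J As A n ?c' i) (?c' i))" .
  define q p r where "q = (\<Sum>i<n. ip (Qop J A As n ?y i) (?y i))"
    and "p = (\<Sum>i<n. ip (Qop J As A n ?c' i) (?c' i))"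
    and "r = (\<Sum>k<n. (cmod w)\<^sup>2 ^ k)"
  let ?z = "\<Sum>i<Suc n. ip (Qop J A As (Suc n) x i) (x i)"
  have e1: "?z = ip (R (x 0)) (x 0) + q"
    unfolding q_def by (rule dec(2)) auto
  have e2: "?z = ip (L c) c + of_real ((cmod w)\<^sup>2) * p + of_real (\<Sum>k<Suc n. (cmod w)\<^sup>2 ^ k) * ?\<delta>"
  proof -
    have "?z = (\<Sum>i<Suc n. ip (Qop J As A (Suc n) ?c i) (?c i)) + of_real (\<Sum>k<Suc n. (cmod w)\<^sup>2 ^ k) * ?\<delta>"
      by (rule dual1(2)) simp
    also have "(\<Sum>i<Suc n. ip (Qop J As A (Suc n) ?c i) (?c i)) =
        ip (L (?c 0)) (?c 0) + (\<Sum>i<n. ip (Qop J As A n ?d i) (?d i))"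
      by (rule ddec(2)) auto
    finally show ?thesis unfolding p_def c0 p[unfolded c0] .
  qed
  have "(\<Sum>k<Suc n. (cmod w)\<^sup>2 ^ k) = 1 + (cmod w)\<^sup>2 * r"
    unfolding r_def by (subst sum.lessThan_Suc_shift) (simp add: sum_distrib_left)
  then have e2: "?z = ip (L c) c + of_real ((cmod w)\<^sup>2) * p + (1 + of_real ((cmod w)\<^sup>2) * of_real r) * ?\<delta>"
    using e2 by (simp only: of_real_add of_real_mult of_real_1)
  have e3: "q = p + of_real r * ?\<delta>"
    unfolding p_def q_def r_def by (rule dual2(2)) simp
  have alg: "\<delta> = (1 - a) * z + a * u - l" if "z = u + q" "z = l + a * p + (1 + a * r) * \<delta>" "q = p + r * \<delta>"
    for z u q l a p r \<delta> :: complex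
  proof -
    have "\<delta> = z - l - a * q"
      using that(2) unfolding that(3) by (simp add: algebra_simps)
    moreover have "q = z - u" using that(1) by simp
    ultimately show ?thesis by (simp add: algebra_simps)
  qed
  from alg[OF e1 e2 e3] show "?\<delta> = of_real (1 - (cmod w)\<^sup>2) * (\<Sum>i\<le>n. ip (Qop J A As (Suc n) x i) (x i))
      + of_real ((cmod w)\<^sup>2) * ip (R (x 0)) (x 0) - ip (L c) c"
    by (simp only: lessThan_Suc_atMost of_real_diff of_real_1)
  \<comment> \<open>Pairing Q x with the column V v isolates R x_0. On the other side block i of G
    carries w^(n-i), which is the weight of coefficient i in a reciprocal polynomial. The relation
    with L arises in the same way from Ts.\<close>
  show "rhot w (J h) - pit w (J g) = R (x 0)"
  proof (rule ip_ext)
    fix v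
    have "ip (R (x 0)) v = (\<Sum>i<Suc n. ip (Gv (Suc n) w h g i) (V i v))"
      using dec(4)[where x=x and v=v] x' by (simp add: Qop_V)
    also have "\<dots> = (\<Sum>i<Suc n. ip (J (sc (w ^ (n - i)) h)) (V i v)) - (\<Sum>i<Suc n. ip (J (sc (w ^ (n - i)) g)) (cv A (\<lambda>k. V k v) i))"
      by (simp only: Gv_def ip_diff_left sum_subtractf ip_ac diff_Suc_1)
    also have "\<dots> = ip (rhot w (J h) - pit w (J g)) v"
      unfolding rhot_def pit_def cv_def lessThan_Suc_atMost
      by (simp add: linJ ip_scale_left ip_diff_left ip_sum_left ip_sum_right Vs_adj A_adj d.A_adj sum_distrib_left)
    finally show "ip (rhot w (J h) - pit w (J g)) v = ip (R (x 0)) v" ..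
  qed
  show "tau w g - sigma w h = L c"
  proof (rule ip_ext)
    fix v
    have "ip (L c) v = (\<Sum>i<Suc n. ip (Qop J As A (Suc n) ?c i) (Ts i v))"
      using ddec(4)[where x="?c" and v=v] by (simp add: c_def)
    also have "\<dots> = (\<Sum>i<Suc n. ip (sc (w ^ i) g - ac A (Suc n) (\<lambda>k. sc (w ^ k) h) i) (Ts i v))"
      by (intro sum.cong refl) (subst dual1(1), auto)
    also have "\<dots> = (\<Sum>i<Suc n. ip (sc (w ^ i) g) (Ts i v)) - (\<Sum>i<Suc n. ip (sc (w ^ i) h) (cv As (\<lambda>k. Ts k v) i))"
      by (simp only: ip_diff_left sum_subtractf d.ip_ac)
    also have "\<dots> = ip (tau w g - sigma w h) v"
      unfolding tau_def sigma_def cv_def lessThan_Suc_atMost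
      by (simp add: ip_scale_left ip_diff_left ip_sum_left ip_sum_right T_adj A_adj sum_distrib_left)
    finally show "ip (tau w g - sigma w h) v = ip (L c) v" ..
  qed
qed

lemma lft_solution:
  defines "hh \<equiv> \<lambda>v s j. (if j \<le> n then V j v else 0) + (if j = 0 then 0 else J (cv As (\<lambda>k. Ts k s) (Suc n - j)))"
    and "gg \<equiv> \<lambda>v s j. (if j \<le> n then cv A (\<lambda>k. V k v) j else 0) + (if j = 0 then 0 else J (Ts (Suc n - j) s))"
  defines "x \<equiv> \<lambda>w v s i. sc (w ^ (n - i)) (\<Sum>j\<le>i. sc (w ^ j) (hh v s j))"
    and "h \<equiv> \<lambda>w v s. sc w (J (sigmat w s)) + rho w v" and "g \<equiv> \<lambda>w v s. sc w (J (taut w s)) + ppi w v"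
  shows "i \<le> n \<Longrightarrow> Qop J A As (Suc n) (x w v s) i = Gv (Suc n) w (h w v s) (g w v s) i"
    and "x w v s 0 = sc (w ^ n) v"
    and "J (g w v s - cv A (x w v s) n) = sc (w ^ Suc n) s"
    and "h w v s = (\<Sum>j\<le>Suc n. sc (w ^ j) (hh v s j))"
proof -
  interpret d: toeplitz sc ip J As A by (rule dual)
  have hg: "cv A (hh v s) i = gg v s i" if "i \<le> n" for i v s
  proof -
    have "cv A (hh v s) i = cv A (\<lambda>j. if j \<le> n then V j v else 0) i
        + cv A (\<lambda>j. if j = 0 then 0 else J (cv As (\<lambda>k. Ts k s) (Suc n - j))) i"
      unfolding hh_def by (rule cv_add)
    also have "cv A (\<lambda>j. if j \<le> n then V j v else 0) i = cv A (\<lambda>k. V k v) i"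
      by (rule cv_cong) (use that in auto)
    also have "cv A (\<lambda>j. if j = 0 then 0 else J (cv As (\<lambda>k. Ts k s) (Suc n - j))) i =
        (if i = 0 then 0 else J (Ts (Suc n - i) s))"
    proof (cases "i = 0")
      case False
      then have "J (Ts (Suc n - i) s) = ac A (Suc n) (\<lambda>k. J (cv As (\<lambda>k. Ts k s) k)) (Suc n - i)"
        using Qop_Ts[of "Suc n - i" s] that by (simp add: Qop_def split: if_splits)
      also have "\<dots> = (\<Sum>j\<in>{1..i}. A (i - j) (J (cv As (\<lambda>k. Ts k s) (Suc n - j))))"
        unfolding ac_def
        by (rule sum.reindex_bij_witness[where i="\<lambda>j. Suc n - j" and j="\<lambda>j. Suc n - j"])
            (use that False in \<open>auto simp: add.commute\<close>)
      also have "\<dots> = cv A (\<lambda>j. if j = 0 then 0 else J (cv As (\<lambda>k. Ts k s) (Suc n - j))) i"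
        unfolding cv_def by (rule sum.mono_neutral_cong_left) (auto simp: lin_zero[OF lin_A])
      finally show ?thesis using False by simp
    qed (simp add: cv_def lin_zero[OF lin_A])
    finally show ?thesis using that by (simp add: gg_def)
  qed
  have gh: "J (hh v s p) = ac As (Suc (Suc n)) (\<lambda>k. J (gg v s k)) p" if p: "1 \<le> p" "p \<le> Suc n" for p v s
  proof -
    have "ac As (Suc (Suc n)) (\<lambda>k. J (gg v s k)) p =
        ac As (Suc (Suc n)) (\<lambda>k. J (if k \<le> n then cv A (\<lambda>k. V k v) k else 0)) p
      + ac As (Suc (Suc n)) (\<lambda>k. J (if k = 0 then 0 else J (Ts (Suc n - k) s))) p"
      by (simp only: gg_def linJ ac_add)
    also have "ac As (Suc (Suc n)) (\<lambda>k. J (if k = 0 then 0 else J (Ts (Suc n - k) s))) p =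
        ac As (Suc (Suc n)) (\<lambda>k. Ts (Suc (Suc n) - 1 - k) s) p"
      by (rule ac_cong) (use p in \<open>simp add: J_J\<close>)
    also have "\<dots> = cv As (\<lambda>k. Ts k s) (Suc n - p)"
      by (subst ac_rev) (use p in auto)
    also have "ac As (Suc (Suc n)) (\<lambda>k. J (if k \<le> n then cv A (\<lambda>k. V k v) k else 0)) p =
        J (if p \<le> n then V p v else 0)"
    proof (cases "p \<le> n")
      case True
      have "J (V p v) = ac As (Suc n) (\<lambda>k. J (cv A (\<lambda>k. V k v) k)) p"
        using Qop_V[OF True, of v] p by (simp add: Qop_def)
      also have "\<dots> = ac As (Suc (Suc n)) (\<lambda>k. J (if k \<le> n then cv A (\<lambda>k. V k v) k else 0)) p"
        unfolding ac_def by (rule sum.mono_neutral_cong_left) (auto simp: linJ lin_zero[OF lin_As])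
      finally show ?thesis using True by simp
    next
      case False
      then show ?thesis
        using p unfolding ac_def by (intro trans[OF sum.neutral]) (auto simp: linJ lin_zero[OF lin_As])
    qed
    finally show ?thesis using p by (simp add: hh_def linJ J_J)
  qed
  have h: "h w v s = (\<Sum>j\<le>Suc n. sc (w ^ j) (hh v s j))" for w v s
  proof -
    have "(\<Sum>j\<le>Suc n. sc (w ^ j) (hh v s j)) = (\<Sum>j\<le>Suc n. sc (w ^ j) (if j \<le> n then V j v else 0))
      + (\<Sum>j\<le>Suc n. sc (w ^ j) (if j = 0 then 0 else J (cv As (\<lambda>k. Ts k s) (Suc n - j))))"
      by (simp only: hh_def scale_right_distrib sum.distrib)
    also have "(\<Sum>j\<le>Suc n. sc (w ^ j) (if j \<le> n then V j v else 0)) = rho w v"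
      by (simp add: rho_def)
    also have "(\<Sum>j\<le>Suc n. sc (w ^ j) (if j = 0 then 0 else J (cv As (\<lambda>k. Ts k s) (Suc n - j)))) =
        (\<Sum>j\<le>n. sc (w ^ Suc j) (J (cv As (\<lambda>k. Ts k s) (n - j))))"
      by (subst sum.atMost_Suc_shift) simp
    also have "\<dots> = (\<Sum>k\<le>n. sc (w ^ Suc (n - k)) (J (cv As (\<lambda>k. Ts k s) k)))"
      by (rule sum.reindex_bij_witness[where i="\<lambda>j. n - j" and j="\<lambda>j. n - j"]) auto
    also have "\<dots> = sc w (J (sigmat w s))"
      by (simp add: sigmat_def linJ scale_sum_right)
    finally show ?thesis by (simp add: h_def add.commute)
  qed
  have g: "g w v s = (\<Sum>j\<le>Suc n. sc (w ^ j) (gg v s j))" for w v s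
  proof -
    have "(\<Sum>j\<le>Suc n. sc (w ^ j) (gg v s j)) = (\<Sum>j\<le>Suc n. sc (w ^ j) (if j \<le> n then cv A (\<lambda>k. V k v) j else 0))
      + (\<Sum>j\<le>Suc n. sc (w ^ j) (if j = 0 then 0 else J (Ts (Suc n - j) s)))"
      by (simp only: gg_def scale_right_distrib sum.distrib)
    also have "(\<Sum>j\<le>Suc n. sc (w ^ j) (if j \<le> n then cv A (\<lambda>k. V k v) j else 0)) = ppi w v"
      by (simp add: ppi_def)
    also have "(\<Sum>j\<le>Suc n. sc (w ^ j) (if j = 0 then 0 else J (Ts (Suc n - j) s))) =
        (\<Sum>j\<le>n. sc (w ^ Suc j) (J (Ts (n - j) s)))"
      by (subst sum.atMost_Suc_shift) simp
    also have "\<dots> = (\<Sum>k\<le>n. sc (w ^ Suc (n - k)) (J (Ts k s)))"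
      by (rule sum.reindex_bij_witness[where i="\<lambda>j. n - j" and j="\<lambda>j. n - j"]) auto
    also have "\<dots> = sc w (J (taut w s))"
      by (simp add: taut_def linJ scale_sum_right)
    finally show ?thesis by (simp add: g_def add.commute)
  qed
  show "h w v s = (\<Sum>j\<le>Suc n. sc (w ^ j) (hh v s j))" by (rule h)
  note ps = Qop_partial_sums[where hh="hh v s" and gg="gg v s" and n=n and w=w, OF hg gh]
  show "Qop J A As (Suc n) (x w v s) i = Gv (Suc n) w (h w v s) (g w v s) i" if "i \<le> n" for i
    unfolding h g x_def by (rule ps(2)[OF _ _ _ that]) auto
  show "x w v s 0 = sc (w ^ n) v" by (simp add: x_def hh_def V_0)
  \<comment> \<open>At i = n the scaling w^(n-i) is 1, so S x falls short of g by its top term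
    alone. That term is w^(n+1) J s because Ts starts with the identity.\<close>
  have "cv A (x w v s) n = (\<Sum>j\<le>n. sc (w ^ j) (gg v s j))"
    unfolding x_def by (subst ps(1)) auto
  then have "g w v s - cv A (x w v s) n = sc (w ^ Suc n) (gg v s (Suc n))"
    by (simp add: g)
  then show "J (g w v s - cv A (x w v s) n) = sc (w ^ Suc n) s"
    by (simp add: gg_def linJ J_J Ts_0)
qed

text \<open>The master identity for the explicit solution, where x_0 = w^n v and c = w^(n+1) s. Up
  to R and L, the first two relations recover v and s from the pair (h, g); the factor w^(n+1) in
  the second is the order of interpolation.\<close>

lemma lft_relations:
  fixes w :: complex and v s :: 'v
  defines "h \<equiv> sc w (J (sigmat w s)) + rho w v" and "g \<equiv> sc w (J (taut w s)) + ppi w v"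
  shows "rhot w (J h) - pit w (J g) = sc (w ^ n) (R v)"
    and "tau w g - sigma w h = sc (w ^ Suc n) (L s)"
    and "\<exists>x. ip (J h) h - ip (J g) g = of_real (1 - (cmod w)\<^sup>2) * (\<Sum>i\<le>n. ip (Qop J A As (Suc n) x i) (x i))
      + of_real ((cmod w) ^ (2 * Suc n)) * (ip (R v) v - ip (L s) s)"
proof -
  define x where "x i = sc (w ^ (n - i)) (\<Sum>j\<le>i. sc (w ^ j) ((if j \<le> n then V j v else 0) +
      (if j = 0 then 0 else J (cv As (\<lambda>k. Ts k s) (Suc n - j)))))" for i
  have x: "i \<le> n \<Longrightarrow> Qop J A As (Suc n) x i = Gv (Suc n) w h g i" for i
    unfolding h_def g_def x_def by (rule lft_solution(1))
  have x0: "x 0 = sc (w ^ n) v"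
    unfolding x_def by (rule lft_solution(2))
  have c: "J (g - cv A x n) = sc (w ^ Suc n) s"
    unfolding h_def g_def x_def by (rule lft_solution(3))
  note m = master_identity[OF x, unfolded c x0]
  show "rhot w (J h) - pit w (J g) = sc (w ^ n) (R v)"
    using m(2) by (simp add: lin_scale[OF lin_R])
  show "tau w g - sigma w h = sc (w ^ Suc n) (L s)"
    using m(3) by (simp add: lin_scale[OF lin_L] del: power_Suc)
  have ww: "w ^ k * cnj w ^ k = of_real (cmod w ^ (2 * k))" for k
    by (metis complex_norm_square of_real_power power_mult power_mult_distrib)
  have "ip (R (sc (w ^ n) v)) (sc (w ^ n) v) = of_real (cmod w ^ (2 * n)) * ip (R v) v"
    using ww[of n] by (simp add: lin_scale[OF lin_R] ip_scale_left ip_scale_right mult.assoc[symmetric] del: of_real_power)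
      (simp add: mult_ac)
  moreover have "ip (L (sc (w ^ Suc n) s)) (sc (w ^ Suc n) s) = of_real (cmod w ^ (2 * Suc n)) * ip (L s) s"
    using ww[of "Suc n"] by (simp add: lin_scale[OF lin_L] ip_scale_left ip_scale_right mult.assoc[symmetric] del: of_real_power power_Suc)
      (simp add: mult_ac)
  moreover have "of_real ((cmod w)\<^sup>2) * of_real (cmod w ^ (2 * n)) = (of_real (cmod w ^ (2 * Suc n)) :: complex)"
    by (simp add: power2_eq_square mult_ac)
  ultimately show "\<exists>x. ip (J h) h - ip (J g) g = of_real (1 - (cmod w)\<^sup>2) * (\<Sum>i\<le>n. ip (Qop J A As (Suc n) x i) (x i))
      + of_real ((cmod w) ^ (2 * Suc n)) * (ip (R v) v - ip (L s) s)"
    using m(1) by (intro exI[of _ x]) (simp add: right_diff_distrib mult.assoc[symmetric])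
qed

text \<open>The Moore--Penrose choice of V enters here: its columns are orthogonal to the kernel of Q,
  which contains the quotient of the polynomial by its linear factor.\<close>
lemma lft_coprime:
  assumes h0: "rho w v = 0" and g0: "ppi w v = 0" and w: "w \<noteq> 0" "cmod w < 1"
  shows "v = 0"
proof -
  define x where "x i = sc (w ^ (n - i)) (\<Sum>j\<le>i. sc (w ^ j) ((if j \<le> n then V j v else 0) +
      (if j = 0 then 0 else J (cv As (\<lambda>k. Ts k 0) (Suc n - j)))))" for i
  have z: "cv As (\<lambda>k. 0) i = 0" "Ts i 0 = 0" for i
    by (simp_all add: cv_def lin_zero[OF lin_Ts] lin_zero[OF lin_As])
  have x: "Qop J A As (Suc n) x i = 0" if "i \<le> n" for i
    using lft_solution(1)[of i w v 0, OF that] that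
    unfolding x_def[symmetric]
    by (simp add: h0 g0 sigmat_def taut_def z linJ Gv_def ac_def lin_zero[OF lin_As])
  have x0: "x 0 = sc (w ^ n) v"
    unfolding x_def by (rule lft_solution(2))
  have "sc (w ^ n) (R v) = 0"
    using lft_relations(1)[of w 0 v]
    by (simp add: h0 g0 sigmat_def taut_def z linJ rhot_def pit_def lin_zero[OF lin_Vs] lin_zero[OF lin_As])
  then have Rv: "R v = 0" using w by simp
  have xi: "x i = sc (w ^ (n - i)) (\<Sum>j\<le>i. sc (w ^ j) (V j v))" if "i \<le> n" for i
    unfolding x_def using that by (intro arg_cong[of _ _ "sc (w ^ (n - i))"] sum.cong) (auto simp: z linJ)
  have xn: "x n = 0" using h0 by (simp add: xi rho_def)
  \<comment> \<open>After scaling by w the shift of x differs from x only by a multiple of V v,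
    which Q_{n+1} annihilates since R v = 0. So the shifted vector is in the kernel of Q_{n+1}, that
    is, x is in the kernel of Q_n.\<close>
  have rec: "sc w (x (Suc i)) = x i + sc (w ^ Suc n) (V (Suc i) v)" if "i < n" for i
  proof -
    have e: "w ^ (n - i) = w * w ^ (n - Suc i)" "w ^ Suc n = w ^ (n - i) * w ^ Suc i"
      using that by (simp_all add: Suc_diff_Suc flip: power_Suc power_add)
    have "sc w (x (Suc i)) = sc (w ^ (n - i)) (\<Sum>j\<le>Suc i. sc (w ^ j) (V j v))"
      using that by (simp only: xi Suc_leI scale_scale e(1))
    also have "\<dots> = x i + sc (w ^ Suc n) (V (Suc i) v)"
      using that by (simp only: sum.atMost_Suc scale_right_distrib scale_scale e(2) xi less_imp_le)
    finally show ?thesis .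
  qed
  have "Qop J A As n x i = 0" if "i < n" for i
  proof -
    have "Qop J A As n x i = Qop J A As (Suc n) (shift x) (Suc i)"
      by (simp add: Qop_shift)
    also have "\<dots> = Qop J A As (Suc n) (\<lambda>k. sc w (x k) - sc (w ^ Suc n) (V k v)) (Suc i)"
    proof (rule Qop_cong)
      fix k assume "k < Suc n"
      then show "shift x k = sc w (x k) - sc (w ^ Suc n) (V k v)"
        by (cases k) (simp_all add: x0 V_0 rec)
    qed (use that in simp)
    also have "\<dots> = 0"
      using that by (simp only: Qop_diff Qop_scale x Suc_leI Qop_V Rv) simp
    finally show ?thesis .
  qed
  then have "(\<Sum>i<n. ip (V (Suc i) v) (x i)) = 0" by (rule V_ker)
  then have "(\<Sum>i<n. ip (sc (w ^ Suc n) (V (Suc i) v)) (x i)) = 0"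
    by (simp only: ip_scale_left flip: sum_distrib_left) simp
  moreover define u where "u i = sc (w ^ Suc n) (V (Suc i) v)" for i
  ultimately have ux: "(\<Sum>i<n. ip (u i) (x i)) = 0" by simp
  define N where "N y = Re (ip y y)" for y
  have N: "N y \<ge> 0" for y by (simp add: N_def ip_nonneg)
  have Nw: "N (sc c y) = (cmod c)\<^sup>2 * N y" for c y
  proof -
    have "ip (sc c y) (sc c y) = of_real ((cmod c)\<^sup>2) * ip y y"
      by (simp only: ip_scale_left ip_scale_right complex_norm_square mult_ac)
    then show ?thesis by (simp add: N_def del: of_real_power)
  qed
  \<comment> \<open>By orthogonality the squared norms of x and u add. Hence the norm of x is at
    most |w| times that of its shift; as x_n = 0 the shift has no larger norm than x, and |w| < 1
    leaves x = 0.\<close>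
  have "(\<Sum>i<n. (cmod w)\<^sup>2 * N (x (Suc i))) = (\<Sum>i<n. N (x i) + N (u i) + 2 * Re (ip (u i) (x i)))"
  proof (intro sum.cong refl)
    fix i assume "i \<in> {..<n}"
    then have "sc w (x (Suc i)) = x i + u i" by (simp add: rec u_def)
    moreover have "Re (ip (x i) (u i)) = Re (ip (u i) (x i))"
      by (subst ip_cnj[symmetric]) simp
    ultimately show "(cmod w)\<^sup>2 * N (x (Suc i)) = N (x i) + N (u i) + 2 * Re (ip (u i) (x i))"
      unfolding Nw[symmetric] by (simp add: N_def ip_add_left ip_add_right)
  qed
  also have "\<dots> = (\<Sum>i<n. N (x i)) + (\<Sum>i<n. N (u i)) + 2 * Re (\<Sum>i<n. ip (u i) (x i))"
    by (simp add: sum.distrib sum_distrib_left)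
  finally have "(\<Sum>i<n. N (x i)) \<le> (cmod w)\<^sup>2 * (\<Sum>i<n. N (x (Suc i)))"
    using ux by (simp add: sum_nonneg N flip: sum_distrib_left)
  also have "(\<Sum>i<n. N (x (Suc i))) + N (x 0) = (\<Sum>i<Suc n. N (x i))"
    by (simp only: sum.lessThan_Suc_shift add.commute)
  then have "(\<Sum>i<n. N (x (Suc i))) \<le> (\<Sum>i<n. N (x i))"
    using N[of "x 0"] xn by (simp add: N_def)
  then have "(cmod w)\<^sup>2 * (\<Sum>i<n. N (x (Suc i))) \<le> (cmod w)\<^sup>2 * (\<Sum>i<n. N (x i))"
    by (rule mult_left_mono) simp
  finally have "(1 - (cmod w)\<^sup>2) * (\<Sum>i<n. N (x i)) \<le> 0" by (simp add: algebra_simps)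
  moreover have "0 < 1 - (cmod w)\<^sup>2" using w by (simp add: power_less_one_iff)
  ultimately have "(\<Sum>i<n. N (x i)) \<le> 0" by (simp add: mult_le_0_iff)
  then have "(\<Sum>i<n. N (x i)) = 0" by (intro antisym sum_nonneg N)
  then have "\<forall>i<n. N (x i) = 0" by (simp add: sum_nonneg_eq_0_iff N)
  then have "\<forall>i<n. x i = 0" by (metis N_def ip_self_Re of_real_0 ip_definite)
  then have "x 0 = 0" using xn by (cases n) auto
  then show "v = 0" using x0 w by simp
qed

end

section \<open>Spectral theory of hermitian matrices\<close>

lemma mat_adjoint_dim [simp]: "dim_row (mat_adjoint A) = dim_col A" "dim_col (mat_adjoint A) = dim_row A"
  by (auto simp: mat_adjoint_def)

lemma mat_adjoint_carrier [simp]: "A \<in> carrier_mat n k \<Longrightarrow> mat_adjoint A \<in> carrier_mat k n"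
  by (intro carrier_matI) (simp_all add: carrier_matD)

lemma mat_adjoint_index [simp]:
  "i < dim_col A \<Longrightarrow> j < dim_row A \<Longrightarrow> mat_adjoint A $$ (i, j) = cnj (A $$ (j, i))" for A :: "complex mat"
  by (simp add: mat_adjoint_def mat_of_rows_index)

lemma mult_mat_index:
  assumes "A \<in> carrier_mat a b" "B \<in> carrier_mat b c" "i < a" "j < c"
  shows "(A * B) $$ (i, j) = (\<Sum>k<b. A $$ (i, k) * B $$ (k, j))"
  using assms by (auto simp: scalar_prod_def atLeast0LessThan intro!: sum.cong)

lemma mult_vec_index:
  assumes "A \<in> carrier_mat a b" "v \<in> carrier_vec b" "i < a"
  shows "vec_index (A *\<^sub>v v) i = (\<Sum>k<b. A $$ (i, k) * vec_index v k)"
  using assms by (auto simp: scalar_prod_def atLeast0LessThan intro!: sum.cong)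

lemma mat_adjoint_adjoint [simp]: "mat_adjoint (mat_adjoint A) = A" for A :: "complex mat"
  by (rule eq_matI) auto

lemma mat_adjoint_mult:
  fixes A B :: "complex mat"
  assumes "A \<in> carrier_mat a b" "B \<in> carrier_mat b c"
  shows "mat_adjoint (A * B) = mat_adjoint B * mat_adjoint A"
proof (rule eq_matI)
  show "dim_row (mat_adjoint (A * B)) = dim_row (mat_adjoint B * mat_adjoint A)"
    "dim_col (mat_adjoint (A * B)) = dim_col (mat_adjoint B * mat_adjoint A)"
    using assms by auto
next
  fix i j assume "i < dim_row (mat_adjoint B * mat_adjoint A)" "j < dim_col (mat_adjoint B * mat_adjoint A)"
  then have ij: "i < c" "j < a" using assms by auto
  have "mat_adjoint (A * B) $$ (i, j) = cnj ((A * B) $$ (j, i))"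
    using ij assms by (subst mat_adjoint_index) auto
  also have "\<dots> = (\<Sum>k<b. mat_adjoint B $$ (i, k) * mat_adjoint A $$ (k, j))"
    using ij assms by (subst mult_mat_index[OF assms]) (auto simp: mult.commute intro!: sum.cong)
  also have "\<dots> = (mat_adjoint B * mat_adjoint A) $$ (i, j)"
    using ij assms by (subst mult_mat_index[of _ c b _ a]) auto
  finally show "mat_adjoint (A * B) $$ (i, j) = (mat_adjoint B * mat_adjoint A) $$ (i, j)" .
qed

lemma mat_adjoint_minus:
  fixes A B :: "complex mat"
  assumes "A \<in> carrier_mat a b" "B \<in> carrier_mat a b"
  shows "mat_adjoint (A - B) = mat_adjoint A - mat_adjoint B"
  using assms by (intro eq_matI) auto

lemma mat_adjoint_one [simp]: "mat_adjoint (1\<^sub>m n :: complex mat) = 1\<^sub>m n"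
  by (rule eq_matI) auto

lemma mult_carrier_square [simp]:
  "A \<in> carrier_mat n n \<Longrightarrow> B \<in> carrier_mat n n \<Longrightarrow> A * B \<in> carrier_mat n n"
  by (rule mult_carrier_mat)

definition diag_of :: "nat \<Rightarrow> (nat \<Rightarrow> real) \<Rightarrow> complex mat" where
  "diag_of n d = mat n n (\<lambda>(i,j). if i = j then of_real (d i) else 0)"

lemma diag_of_carrier [simp]: "diag_of n d \<in> carrier_mat n n"
  by (simp add: diag_of_def)

lemma diag_of_mult: "diag_of n d * diag_of n e = diag_of n (\<lambda>i. d i * e i)"
proof (rule eq_matI)
  fix i j assume "i < dim_row (diag_of n (\<lambda>i. d i * e i))" "j < dim_col (diag_of n (\<lambda>i. d i * e i))"
  then have ij: "i < n" "j < n" by (auto simp: diag_of_def)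
  have "(diag_of n d * diag_of n e) $$ (i, j) = (\<Sum>k<n. diag_of n d $$ (i, k) * diag_of n e $$ (k, j))"
    by (rule mult_mat_index) (use ij in simp_all)
  also have "\<dots> = (\<Sum>k<n. if k = i then diag_of n d $$ (i, i) * diag_of n e $$ (i, j) else 0)"
    by (rule sum.cong) (use ij in \<open>auto simp: diag_of_def\<close>)
  finally show "(diag_of n d * diag_of n e) $$ (i, j) = diag_of n (\<lambda>i. d i * e i) $$ (i, j)"
    using ij by (simp add: diag_of_def)
qed (auto simp: diag_of_def)

lemma diag_of_adjoint [simp]: "mat_adjoint (diag_of n d) = diag_of n d"
  by (rule eq_matI) (auto simp: diag_of_def)

lemma diag_conj_index:
  assumes U: "U \<in> carrier_mat n n" and ij: "i < n" "j < n"
  shows "(U * diag_of n d * mat_adjoint U) $$ (i, j) = (\<Sum>k<n. U $$ (i, k) * of_real (d k) * cnj (U $$ (j, k)))"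
proof -
  have "(U * diag_of n d) $$ (i, k) = U $$ (i, k) * of_real (d k)" if "k < n" for k
  proof -
    have "(U * diag_of n d) $$ (i, k) = (\<Sum>l<n. U $$ (i, l) * diag_of n d $$ (l, k))"
      by (rule mult_mat_index) (use ij that U in simp_all)
    also have "\<dots> = (\<Sum>l<n. if l = k then U $$ (i, k) * of_real (d k) else 0)"
      by (rule sum.cong) (use that in \<open>auto simp: diag_of_def\<close>)
    finally show ?thesis using that by simp
  qed
  then show ?thesis
    using ij U by (subst mult_mat_index[of _ n n _ n]) (auto intro!: sum.cong)
qed

text \<open>Gram-Schmidt on a basis that starts with v. It yields orthogonal columns, so the
  normalisation is carried out separately.\<close>

lemma unitary_with_first_column:
  assumes v: "v \<in> carrier_vec (Suc n)" "v \<noteq> 0\<^sub>v (Suc n)"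
  obtains W and c :: complex where "W \<in> carrier_mat (Suc n) (Suc n)" "mat_adjoint W * W = 1\<^sub>m (Suc n)"
    "\<And>i. i < Suc n \<Longrightarrow> W $$ (i, 0) = c * vec_index v i"
proof -
  let ?N = "Suc n"
  interpret cof_vec_space ?N "TYPE(complex)" .
  define b where "b = basis_completion v"
  define ws where "ws = gram_schmidt ?N b"
  from basis_completion[OF v, folded b_def]
  have dist_b: "distinct b" and indep: "\<not> lin_dep (set b)" and b: "set b \<subseteq> carrier_vec ?N"
    and hdb: "hd b = v" and len_b: "length b = ?N" by auto
  from hdb len_b obtain vs where bv: "b = v # vs" by (cases b) auto
  from gram_schmidt_result[OF b dist_b indep refl, folded ws_def]
  have ws: "set ws \<subseteq> carrier_vec ?N" "corthogonal ws" "length ws = ?N"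
    by (auto simp: len_b)
  from gram_schmidt_hd[OF v(1), of vs, folded bv] have hdws: "hd ws = v" unfolding ws_def .
  define nn where "nn j = sqrt (\<Sum>i<?N. (cmod (vec_index (ws ! j) i))\<^sup>2)" for j
  define W where "W = mat ?N ?N (\<lambda>(i,j). vec_index (ws ! j) i / of_real (nn j))"
  have wsj: "ws ! j \<in> carrier_vec ?N" if "j < ?N" for j using ws that by auto
  have dot: "ws ! j \<bullet>c ws ! k = (\<Sum>i<?N. vec_index (ws ! j) i * cnj (vec_index (ws ! k) i))" if "j < ?N" "k < ?N" for j k
    using wsj[OF that(1)] wsj[OF that(2)] by (auto simp: scalar_prod_def atLeast0LessThan intro!: sum.cong)
  have nnsq: "of_real ((nn j)\<^sup>2) = ws ! j \<bullet>c ws ! j" if "j < ?N" for j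
    using that by (simp add: dot nn_def sum_nonneg complex_norm_square del: of_real_power)
  have nn0: "nn j \<noteq> 0" if "j < ?N" for j
    using nnsq[OF that] corthogonalD[OF ws(2), of j j] that ws(3) by auto
  show thesis
  proof (rule that)
    show W: "W \<in> carrier_mat ?N ?N" by (simp add: W_def)
    show "mat_adjoint W * W = 1\<^sub>m ?N"
    proof (rule eq_matI)
      fix j k assume "j < dim_row (1\<^sub>m ?N :: complex mat)" "k < dim_col (1\<^sub>m ?N :: complex mat)"
      then have jk: "j < ?N" "k < ?N" by auto
      have "(mat_adjoint W * W) $$ (j, k) = (\<Sum>i<?N. cnj (vec_index (ws ! j) i / of_real (nn j)) * (vec_index (ws ! k) i / of_real (nn k)))"
        using jk W by (subst mult_mat_index[of _ ?N ?N _ ?N]) (auto simp: W_def intro!: sum.cong)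
      also have "\<dots> = (ws ! k \<bullet>c ws ! j) / (of_real (nn j) * of_real (nn k))"
        using jk by (simp only: dot sum_divide_distrib) (simp add: mult.commute)
      also have "\<dots> = (1\<^sub>m ?N) $$ (j, k)"
      proof (cases "j = k")
        case True
        then show ?thesis using jk nn0[of j] by (simp add: power2_eq_square flip: nnsq)
      next
        case False
        then show ?thesis using jk corthogonalD[OF ws(2), of k j] ws(3) by auto
      qed
      finally show "(mat_adjoint W * W) $$ (j, k) = (1\<^sub>m ?N) $$ (j, k)" .
    qed (use W in auto)
    show "W $$ (i, 0) = (1 / of_real (nn 0)) * vec_index v i" if "i < ?N" for i
    proof -
      have "ws ! 0 = v" using hdws ws(3) by (cases ws) auto
      then show ?thesis using that by (simp add: W_def)
    qed
  qed
qed

text \<open>Deflation: in a unitary basis starting with an eigenvector the first column is (e, 0,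
  ..., 0), hermitian symmetry clears the first row as well and makes e real, and the remaining block
  is hermitian of smaller size.\<close>

theorem hermitian_diagonalization:
  fixes A :: "complex mat"
  assumes "A \<in> carrier_mat n n" "mat_adjoint A = A"
  shows "\<exists>U d. U \<in> carrier_mat n n \<and> mat_adjoint U * U = 1\<^sub>m n \<and> A = U * diag_of n d * mat_adjoint U"
  using assms
proof (induction n arbitrary: A)
  case 0
  then show ?case
    by (intro exI[of _ "1\<^sub>m 0"] exI[of _ "\<lambda>_. 0"]) (auto intro!: eq_matI)
next
  case (Suc n)
  let ?N = "Suc n"
  note assoc = assoc_mult_mat[of _ ?N ?N _ ?N _ ?N]
  have A: "A \<in> carrier_mat ?N ?N" and herm: "mat_adjoint A = A" by fact+
  have "degree (char_poly A) = ?N" using degree_monic_char_poly[OF A] by simp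
  then have "\<not> constant (poly (char_poly A))" by (simp add: constant_degree)
  then obtain e where "poly (char_poly A) e = 0" using Fundamental_Theorem_Algebra.fundamental_theorem_of_algebra by blast
  then have "eigenvalue A e" by (simp add: eigenvalue_root_char_poly[OF A])
  then obtain v where v: "v \<in> carrier_vec ?N" "v \<noteq> 0\<^sub>v ?N" and Av: "A *\<^sub>v v = e \<cdot>\<^sub>v v"
    using A unfolding eigenvalue_def eigenvector_def by auto
  obtain W c where W: "W \<in> carrier_mat ?N ?N" and WW: "mat_adjoint W * W = 1\<^sub>m ?N"
    and W0: "\<And>i. i < ?N \<Longrightarrow> W $$ (i, 0) = c * vec_index v i"
    by (rule unitary_with_first_column[OF v]) blast
  have W': "W * mat_adjoint W = 1\<^sub>m ?N"
    by (rule mat_mult_left_right_inverse[OF _ W WW]) (use W in simp)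
  define B where "B = mat_adjoint W * (A * W)"
  have B: "B \<in> carrier_mat ?N ?N" using A W by (simp add: B_def)
  have Bherm: "mat_adjoint B = B"
    using A W herm by (simp add: B_def mat_adjoint_mult[of _ ?N ?N _ ?N] assoc)
  have Bcnj: "B $$ (i, j) = cnj (B $$ (j, i))" if "i < ?N" "j < ?N" for i j
  proof -
    have "mat_adjoint B $$ (i, j) = cnj (B $$ (j, i))"
      by (rule mat_adjoint_index) (use B that in auto)
    then show ?thesis by (simp only: Bherm)
  qed
  have AW0: "(A * W) $$ (k, 0) = e * W $$ (k, 0)" if "k < ?N" for k
  proof -
    have "(A * W) $$ (k, 0) = c * vec_index (A *\<^sub>v v) k"
      using that A W v by (subst mult_mat_index[of _ ?N ?N _ ?N])
        (auto simp: W0 mult_vec_index[of _ ?N ?N] sum_distrib_left mult_ac simp del: index_mult_mat_vec sum.lessThan_Suc intro!: sum.cong)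
    then show ?thesis using that v by (simp add: Av W0)
  qed
  have B0: "B $$ (k, 0) = (if k = 0 then e else 0)" if "k < ?N" for k
  proof -
    have "B $$ (k, 0) = e * (mat_adjoint W * W) $$ (k, 0)"
      using that A W unfolding B_def
      by (simp only: mult_mat_index[of _ ?N ?N _ ?N] mat_adjoint_carrier mult_carrier_mat[of _ ?N ?N _ ?N] zero_less_Suc)
        (simp add: AW0 sum_distrib_left mult_ac del: index_mult_mat sum.lessThan_Suc)
    then show ?thesis using that by (simp add: WW)
  qed
  have B0': "B $$ (0, k) = (if k = 0 then e else 0)" if "k < ?N" for k
  proof -
    have "B $$ (0, k) = cnj (B $$ (k, 0))"
      using that by (intro Bcnj) auto
    moreover have "B $$ (0, 0) = cnj (B $$ (0, 0))"
      by (intro Bcnj) auto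
    ultimately show ?thesis using that B0[of k] B0[of 0] by auto
  qed
  have e: "of_real (Re e) = e"
  proof -
    have "B $$ (0, 0) = cnj (B $$ (0, 0))"
      by (intro Bcnj) auto
    then show ?thesis using B0[of 0] by (simp add: complex_eq_iff)
  qed
  define B1 where "B1 = mat n n (\<lambda>(i,j). B $$ (Suc i, Suc j))"
  have B1: "B1 \<in> carrier_mat n n" by (simp add: B1_def)
  have "mat_adjoint B1 = B1"
  proof (rule eq_matI)
    fix i j assume "i < dim_row B1" "j < dim_col B1"
    then have ij: "i < n" "j < n" by (auto simp: B1_def)
    have "B $$ (Suc i, Suc j) = cnj (B $$ (Suc j, Suc i))"
      using ij by (intro Bcnj) auto
    then show "mat_adjoint B1 $$ (i, j) = B1 $$ (i, j)" using ij by (simp add: B1_def)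
  qed (auto simp: B1_def)
  from Suc.IH[OF B1 this] obtain U d where U: "U \<in> carrier_mat n n" and UU: "mat_adjoint U * U = 1\<^sub>m n"
    and B1U: "B1 = U * diag_of n d * mat_adjoint U" by blast
  define U1 where "U1 = mat ?N ?N (\<lambda>(i,j). if i = 0 \<or> j = 0 then (if i = j then 1 else 0) else U $$ (i - 1, j - 1))"
  define d1 where "d1 i = (case i of 0 \<Rightarrow> Re e | Suc i \<Rightarrow> d i)" for i
  have U1: "U1 \<in> carrier_mat ?N ?N" by (simp add: U1_def)
  have U1U1: "mat_adjoint U1 * U1 = 1\<^sub>m ?N"
  proof (rule eq_matI)
    fix i j assume "i < dim_row (1\<^sub>m ?N :: complex mat)" "j < dim_col (1\<^sub>m ?N :: complex mat)"
    then have ij: "i < ?N" "j < ?N" by auto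
    have "(mat_adjoint U1 * U1) $$ (i, j) = (\<Sum>k<?N. cnj (U1 $$ (k, i)) * U1 $$ (k, j))"
      using ij U1 by (subst mult_mat_index[of _ ?N ?N _ ?N]) auto
    also have "\<dots> = cnj (U1 $$ (0, i)) * U1 $$ (0, j) + (\<Sum>k<n. cnj (U1 $$ (Suc k, i)) * U1 $$ (Suc k, j))"
      by (rule sum.lessThan_Suc_shift)
    also have "\<dots> = (1\<^sub>m ?N) $$ (i, j)"
    proof (cases "i = 0 \<or> j = 0")
      case True
      then show ?thesis using ij by (auto simp: U1_def)
    next
      case False
      then obtain i' j' where i': "i = Suc i'" "j = Suc j'" by (metis not0_implies_Suc)
      have "(\<Sum>k<n. cnj (U $$ (k, i')) * U $$ (k, j')) = (mat_adjoint U * U) $$ (i', j')"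
        using ij i' U by (subst mult_mat_index[of _ n n _ n]) auto
      then show ?thesis using ij i' by (simp add: U1_def UU)
    qed
    finally show "(mat_adjoint U1 * U1) $$ (i, j) = (1\<^sub>m ?N) $$ (i, j)" .
  qed (use U1 in auto)
  have BU1: "B = U1 * diag_of ?N d1 * mat_adjoint U1"
  proof (rule eq_matI)
    fix i j assume "i < dim_row (U1 * diag_of ?N d1 * mat_adjoint U1)" "j < dim_col (U1 * diag_of ?N d1 * mat_adjoint U1)"
    then have ij: "i < ?N" "j < ?N" using U1 by auto
    have "(U1 * diag_of ?N d1 * mat_adjoint U1) $$ (i, j) = (\<Sum>k<?N. U1 $$ (i, k) * of_real (d1 k) * cnj (U1 $$ (j, k)))"
      by (rule diag_conj_index[OF U1 ij])
    also have "\<dots> = U1 $$ (i, 0) * e * cnj (U1 $$ (j, 0)) + (\<Sum>k<n. U1 $$ (i, Suc k) * of_real (d k) * cnj (U1 $$ (j, Suc k)))"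
      by (subst sum.lessThan_Suc_shift) (simp add: d1_def e)
    also have "\<dots> = B $$ (i, j)"
    proof (cases "i = 0 \<or> j = 0")
      case True
      then show ?thesis using ij by (auto simp: U1_def B0 B0')
    next
      case False
      then obtain i' j' where i': "i = Suc i'" "j = Suc j'" by (metis not0_implies_Suc)
      have "(\<Sum>k<n. U $$ (i', k) * of_real (d k) * cnj (U $$ (j', k))) = B1 $$ (i', j')"
        unfolding B1U by (rule diag_conj_index[OF U, symmetric]) (use ij i' in auto)
      then show ?thesis using ij i' by (simp add: U1_def B1_def)
    qed
    finally show "B $$ (i, j) = (U1 * diag_of ?N d1 * mat_adjoint U1) $$ (i, j)" ..
  qed (use B U1 in auto)
  have "A = (W * mat_adjoint W) * A * (W * mat_adjoint W)"
    unfolding W' using A by simp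
  also have "\<dots> = W * B * mat_adjoint W"
    unfolding B_def using A W by (simp add: assoc)
  also have "\<dots> = (W * U1) * diag_of ?N d1 * mat_adjoint (W * U1)"
    unfolding BU1 using W U1 by (simp add: assoc mat_adjoint_mult[of _ ?N ?N _ ?N])
  finally have "A = (W * U1) * diag_of ?N d1 * mat_adjoint (W * U1)" .
  moreover have "mat_adjoint (W * U1) * (W * U1) = 1\<^sub>m ?N"
  proof -
    have "mat_adjoint (W * U1) * (W * U1) = mat_adjoint U1 * ((mat_adjoint W * W) * U1)"
      using W U1 by (simp add: assoc mat_adjoint_mult[of _ ?N ?N _ ?N])
    then show ?thesis using U1 by (simp add: WW U1U1)
  qed
  moreover have "W * U1 \<in> carrier_mat ?N ?N" using W U1 by simp
  ultimately show ?case by blast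
qed

section \<open>Pseudoinverse, square root and inverse\<close>

lemma psd_carrier: "psd n M \<Longrightarrow> M \<in> carrier_mat n n"
  and psd_hermitian: "psd n M \<Longrightarrow> mat_adjoint M = M"
  by (auto simp: psd_def)

lemma diag_conj_mult:
  assumes U: "U \<in> carrier_mat n n" "mat_adjoint U * U = 1\<^sub>m n"
  shows "(U * diag_of n d * mat_adjoint U) * (U * diag_of n e * mat_adjoint U) = U * diag_of n (\<lambda>i. d i * e i) * mat_adjoint U"
proof -
  note assoc = assoc_mult_mat[of _ n n _ n _ n]
  have "(U * diag_of n d * mat_adjoint U) * (U * diag_of n e * mat_adjoint U) =
      U * (diag_of n d * ((mat_adjoint U * U) * (diag_of n e * mat_adjoint U)))"
    using U(1) by (simp add: assoc)
  also have "\<dots> = U * ((diag_of n d * diag_of n e) * mat_adjoint U)"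
    unfolding U(2) using U(1) by (simp add: assoc left_mult_one_mat[of _ n n])
  also have "\<dots> = U * diag_of n (\<lambda>i. d i * e i) * mat_adjoint U"
    unfolding diag_of_mult using U(1) by (simp only: assoc diag_of_carrier mat_adjoint_carrier)
  finally show ?thesis .
qed

lemma diag_conj_adjoint:
  assumes U: "U \<in> carrier_mat n n"
  shows "mat_adjoint (U * diag_of n d * mat_adjoint U) = U * diag_of n d * mat_adjoint U"
proof -
  have "mat_adjoint (U * diag_of n d * mat_adjoint U) = U * mat_adjoint (U * diag_of n d)"
    using U by (subst mat_adjoint_mult[of _ n n _ n]) simp_all
  also have "mat_adjoint (U * diag_of n d) = diag_of n d * mat_adjoint U"
    using U by (subst mat_adjoint_mult[of _ n n _ n]) simp_all
  finally show ?thesis using U by (simp add: assoc_mult_mat[of _ n n _ n _ n])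
qed

definition mp_conditions :: "complex mat \<Rightarrow> complex mat \<Rightarrow> bool" where
  "mp_conditions A X \<longleftrightarrow> X \<in> carrier_mat (dim_col A) (dim_row A) \<and> A * X * A = A \<and> X * A * X = X
      \<and> mat_adjoint (A * X) = A * X \<and> mat_adjoint (X * A) = X * A"

text \<open>A X and A Y are hermitian and each absorbs the other in a product, so taking adjoints
  shows that they are equal; likewise X A and Y A. Then X = X A X = X A Y = Y A Y = Y.\<close>

lemma mp_conditions_unique:
  assumes A: "A \<in> carrier_mat n n" and X: "mp_conditions A X" and Y: "mp_conditions A Y"
  shows "X = Y"
proof -
  note assoc = assoc_mult_mat[of _ n n _ n _ n]
  have c: "X \<in> carrier_mat n n" "Y \<in> carrier_mat n n" using A X Y by (auto simp: mp_conditions_def)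
  have AX: "A * Z = A * Z'" if Z: "mp_conditions A Z" "mp_conditions A Z'" "Z \<in> carrier_mat n n" "Z' \<in> carrier_mat n n" for Z Z'
  proof -
    have "A * Z = (A * Z' * A) * Z" using Z by (simp add: mp_conditions_def)
    also have "\<dots> = (A * Z') * (A * Z)" using A Z by (simp add: assoc)
    also have "\<dots> = mat_adjoint (A * Z') * mat_adjoint (A * Z)" using Z by (simp add: mp_conditions_def)
    also have "\<dots> = mat_adjoint ((A * Z) * (A * Z'))" using A Z by (simp add: mat_adjoint_mult[of _ n n _ n])
    also have "(A * Z) * (A * Z') = (A * Z * A) * Z'" using A Z by (simp add: assoc)
    also have "mat_adjoint \<dots> = A * Z'" using Z by (simp add: mp_conditions_def)
    finally show ?thesis .
  qed
  have XA: "X * A = Y * A"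
  proof -
    have "X * A = X * (A * Y * A)" using Y by (simp add: mp_conditions_def)
    also have "\<dots> = (X * A) * (Y * A)" using A c by (simp add: assoc)
    also have "\<dots> = mat_adjoint (X * A) * mat_adjoint (Y * A)" using X Y by (simp add: mp_conditions_def)
    also have "\<dots> = mat_adjoint ((Y * A) * (X * A))" using A c by (simp add: mat_adjoint_mult[of _ n n _ n])
    also have "(Y * A) * (X * A) = Y * (A * X * A)" using A c by (simp add: assoc)
    also have "mat_adjoint \<dots> = Y * A" using X Y by (simp add: mp_conditions_def)
    finally show ?thesis .
  qed
  have "X = X * (A * X)" using X A c by (simp add: mp_conditions_def assoc)
  also have "\<dots> = X * (A * Y)" using AX[OF X Y c] by simp
  also have "\<dots> = (X * A) * Y" using A c by (simp add: assoc)
  also have "\<dots> = Y" using XA Y by (simp add: mp_conditions_def)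
  finally show ?thesis .
qed

lemma mp_inv_eqI:
  assumes "A \<in> carrier_mat n n" "mp_conditions A X"
  shows "mp_inv A = X"
  unfolding mp_inv_def mp_conditions_def[symmetric]
  by (rule the_equality) (fact assms(2), rule mp_conditions_unique[OF assms(1) _ assms(2)])

text \<open>The eigenvalues are inverted under the convention \<open>inverse 0 = 0\<close>. The
  spectral formula also shows what the four defining conditions do not display: for hermitian A the
  pseudoinverse is hermitian and commutes with A.\<close>

lemma mp_inv_hermitian:
  assumes A: "A \<in> carrier_mat n n" and herm: "mat_adjoint A = A"
  shows "mp_inv A \<in> carrier_mat n n" "A * mp_inv A * A = A" "mp_inv A * A * mp_inv A = mp_inv A"
    "mat_adjoint (mp_inv A) = mp_inv A" "A * mp_inv A = mp_inv A * A"
proof -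
  obtain U d where U: "U \<in> carrier_mat n n" "mat_adjoint U * U = 1\<^sub>m n" and AU: "A = U * diag_of n d * mat_adjoint U"
    using hermitian_diagonalization[OF A herm] by blast
  define X where "X = U * diag_of n (\<lambda>i. inverse (d i)) * mat_adjoint U"
  have X: "X \<in> carrier_mat n n" using U by (simp add: X_def)
  note m = diag_conj_mult[OF U]
  have f: "(\<lambda>i. d i * inverse (d i) * d i) = d" "(\<lambda>i. inverse (d i) * d i * inverse (d i)) = (\<lambda>i. inverse (d i))"
    by (rule ext, case_tac "d i = 0"; simp)+
  have 1: "A * X * A = A" "X * A * X = X"
    unfolding AU X_def m f by (rule refl)+
  have 2: "mat_adjoint (A * X) = A * X" "mat_adjoint (X * A) = X * A"
    unfolding AU X_def m using U by (simp_all add: diag_conj_adjoint)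
  have 3: "A * X = X * A" unfolding AU X_def m by (simp add: mult.commute)
  have 4: "mat_adjoint X = X" unfolding X_def using U by (simp add: diag_conj_adjoint)
  have "mp_conditions A X" using 1 2 X A by (auto simp: mp_conditions_def)
  then have "mp_inv A = X" by (rule mp_inv_eqI[OF A])
  then show "mp_inv A \<in> carrier_mat n n" "A * mp_inv A * A = A" "mp_inv A * A * mp_inv A = mp_inv A"
    "mat_adjoint (mp_inv A) = mp_inv A" "A * mp_inv A = mp_inv A * A"
    using 1 3 4 X by simp_all
qed

lemma form_col:
  assumes U: "U \<in> carrier_mat n n" and M: "M \<in> carrier_mat n n" and k: "k < n"
  shows "(mat_adjoint U * (M * U)) $$ (k, k) = (\<Sum>i<n. cnj (vec_index (col U k) i) * vec_index (M *\<^sub>v col U k) i)"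
proof -
  have "(M * U) $$ (i, k) = vec_index (M *\<^sub>v col U k) i" if "i < n" for i
    using that U M k by simp
  then show ?thesis
    using U M k by (subst mult_mat_index[of _ n n _ n]) (auto simp del: index_mult_mat(1) index_mult_mat_vec intro!: sum.cong)
qed

lemma psd_diag_conj:
  assumes U: "U \<in> carrier_mat n n" and d: "\<And>i. i < n \<Longrightarrow> 0 \<le> d i"
  shows "psd n (U * diag_of n d * mat_adjoint U)"
proof -
  let ?M = "U * diag_of n d * mat_adjoint U"
  have "0 \<le> Re (\<Sum>i<n. cnj (vec_index v i) * vec_index (?M *\<^sub>v v) i)" if v: "v \<in> carrier_vec n" for v
  proof -
    have "(\<Sum>i<n. cnj (vec_index v i) * vec_index (?M *\<^sub>v v) i) =
        (\<Sum>i<n. \<Sum>j<n. \<Sum>k<n. cnj (vec_index v i) * (U $$ (i, k) * of_real (d k) * cnj (U $$ (j, k)) * vec_index v j))"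
      using U v by (simp add: mult_vec_index[of _ n n] diag_conj_index sum_distrib_left sum_distrib_right mult.assoc
            del: index_mult_mat_vec index_mult_mat)
    also have "\<dots> = (\<Sum>k<n. \<Sum>i<n. \<Sum>j<n. cnj (vec_index v i) * (U $$ (i, k) * of_real (d k) * cnj (U $$ (j, k)) * vec_index v j))"
      by (subst sum.swap[of _ "{..<n}" "{..<n}", symmetric], intro sum.cong refl sum.swap)
    also have "\<dots> = (\<Sum>k<n. of_real (d k) * ((\<Sum>i<n. cnj (vec_index v i) * U $$ (i, k)) * cnj (\<Sum>i<n. cnj (vec_index v i) * U $$ (i, k))))"
      by (simp add: sum_product sum_distrib_left mult_ac)
    also have "\<dots> = of_real (\<Sum>k<n. d k * (cmod (\<Sum>i<n. cnj (vec_index v i) * U $$ (i, k)))\<^sup>2)"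
      by (simp only: complex_norm_square of_real_sum of_real_mult)
    finally have e: "(\<Sum>i<n. cnj (vec_index v i) * vec_index (?M *\<^sub>v v) i) = \<dots>" .
    show ?thesis unfolding e Re_complex_of_real by (intro sum_nonneg mult_nonneg_nonneg d) auto
  qed
  then show ?thesis
    unfolding psd_def by (intro conjI ballI diag_conj_adjoint[OF U]) (use U in simp_all)
qed

lemma psd_diagonalization:
  assumes "psd n A"
  shows "\<exists>U d. U \<in> carrier_mat n n \<and> mat_adjoint U * U = 1\<^sub>m n \<and> A = U * diag_of n d * mat_adjoint U \<and> (\<forall>i<n. 0 \<le> d i)"
proof -
  note assoc = assoc_mult_mat[of _ n n _ n _ n]
  have A: "A \<in> carrier_mat n n" using assms by (rule psd_carrier)
  obtain U d where U: "U \<in> carrier_mat n n" "mat_adjoint U * U = 1\<^sub>m n" and AU: "A = U * diag_of n d * mat_adjoint U"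
    using hermitian_diagonalization[OF A psd_hermitian[OF assms]] by blast
  have "0 \<le> d k" if k: "k < n" for k
  proof -
    have "mat_adjoint U * (A * U) = (mat_adjoint U * U) * diag_of n d * (mat_adjoint U * U)"
      unfolding AU using U(1) by (simp add: assoc)
    also have "\<dots> = diag_of n d"
      unfolding U(2) by (simp add: left_mult_one_mat[of _ n n] right_mult_one_mat[of _ n n])
    finally have "of_real (d k) = (mat_adjoint U * (A * U)) $$ (k, k)"
      using k by (simp add: diag_of_def)
    also have "\<dots> = (\<Sum>i<n. cnj (vec_index (col U k) i) * vec_index (A *\<^sub>v col U k) i)"
      by (rule form_col[OF U(1) A k])
    finally have "Re (of_real (d k)) \<ge> 0"
      using assms U(1) k unfolding psd_def by (metis col_carrier_vec carrier_matD(2))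
    then show ?thesis by simp
  qed
  then show ?thesis using U AU by blast
qed

text \<open>In an eigenbasis of B - C the two matrices differ on the diagonal only. Entry (k, k) of
  B^2 = C^2 becomes d_k (2 c_kk + d_k) = 0, where 2 c_kk + d_k is the sum of the nonnegative
  diagonal entries of B and C. No commutation of B with C enters.\<close>

lemma psd_sqrt_unique:
  assumes B: "psd n B" and C: "psd n C" and BC: "B * B = C * C"
  shows "B = C"
proof -
  note assoc = assoc_mult_mat[of _ n n _ n _ n]
  have c: "B \<in> carrier_mat n n" "C \<in> carrier_mat n n" using B C by (auto simp: psd_def)
  have herm: "mat_adjoint (B - C) = B - C"
    using B C c by (simp add: mat_adjoint_minus[of _ n n] psd_hermitian)
  have "B - C \<in> carrier_mat n n" by (rule minus_carrier_mat) (rule c)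
  then obtain U d where U: "U \<in> carrier_mat n n" "mat_adjoint U * U = 1\<^sub>m n" and DU: "B - C = U * diag_of n d * mat_adjoint U"
    using hermitian_diagonalization[OF _ herm] c by blast
  define X where "X M = mat_adjoint U * (M * U)" for M
  have UU: "U * mat_adjoint U = 1\<^sub>m n"
    by (rule mat_mult_left_right_inverse[OF _ U(1) U(2)]) (use U in simp)
  have Xc: "X M \<in> carrier_mat n n" if "M \<in> carrier_mat n n" for M using that U by (simp add: X_def)
  have Xm: "X (M * N) = X M * X N" if "M \<in> carrier_mat n n" "N \<in> carrier_mat n n" for M N
  proof -
    have "X M * X N = mat_adjoint U * (M * ((U * mat_adjoint U) * (N * U)))"
      unfolding X_def using that U(1) by (simp add: assoc)
    then show ?thesis unfolding UU X_def using that U(1) by (simp add: assoc)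
  qed
  have XD: "X B - X C = diag_of n d"
  proof -
    have "X B - X C = X (B - C)" using c U(1)
      by (simp add: X_def minus_mult_distrib_mat[of _ n n _ _ n] mult_minus_distrib_mat[of _ n n _ n])
    also have "\<dots> = (mat_adjoint U * U) * diag_of n d * (mat_adjoint U * U)"
      unfolding DU X_def using U(1) by (simp add: assoc)
    finally show ?thesis
      unfolding U(2) by (simp add: left_mult_one_mat[of _ n n] right_mult_one_mat[of _ n n])
  qed
  have Xpos: "0 \<le> Re (X M $$ (k, k))" if "psd n M" "k < n" for M k
    unfolding X_def form_col[OF U(1) psd_carrier[OF that(1)] that(2)]
    using that U(1) unfolding psd_def by (metis col_carrier_vec carrier_matD(2))
  have XB: "X B $$ (i, j) = X C $$ (i, j) + (if i = j then of_real (d i) else 0)" if "i < n" "j < n" for i j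
  proof -
    have "(X B - X C) $$ (i, j) = diag_of n d $$ (i, j)" by (simp add: XD)
    then show ?thesis using that Xc[OF c(1)] Xc[OF c(2)] by (simp add: diag_of_def algebra_simps split: if_splits)
  qed
  have "d k = 0" if k: "k < n" for k
  proof (rule ccontr)
    assume dk: "d k \<noteq> 0"
    have "X B * X B = X C * X C" using c BC by (simp flip: Xm)
    then have "(X B * X B) $$ (k, k) = (X C * X C) $$ (k, k)" by simp
    then have "(\<Sum>l<n. X B $$ (k, l) * X B $$ (l, k)) = (\<Sum>l<n. X C $$ (k, l) * X C $$ (l, k))"
      using k Xc[OF c(1)] Xc[OF c(2)] by (simp only: mult_mat_index[of _ n n _ n])
    also have "(\<Sum>l<n. X B $$ (k, l) * X B $$ (l, k)) =
       (\<Sum>l<n. X C $$ (k, l) * X C $$ (l, k) + (if l = k then of_real (d k) * (2 * X C $$ (k, k) + of_real (d k)) else 0))"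
      using k by (intro sum.cong) (auto simp: XB algebra_simps)
    finally have "of_real (d k) * (2 * X C $$ (k, k) + of_real (d k)) = 0"
      using k by (simp add: sum.distrib)
    then have "2 * X C $$ (k, k) + of_real (d k) = 0" using dk by simp
    then have "Re (2 * X C $$ (k, k) + of_real (d k)) = 0" by simp
    moreover have "Re (X C $$ (k, k)) \<ge> 0" "Re (X C $$ (k, k)) + d k \<ge> 0"
      using Xpos[OF C k] Xpos[OF B k] XB[OF k k] by simp_all
    ultimately have "d k = 0" by simp
    with dk show False by simp
  qed
  then have "diag_of n d = 0\<^sub>m n n" by (intro eq_matI) (auto simp: diag_of_def)
  then have "B - C = 0\<^sub>m n n" unfolding DU using U by simp
  show ?thesis
  proof (rule eq_matI)
    fix i j assume "i < dim_row C" "j < dim_col C"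
    then have "(B - C) $$ (i, j) = B $$ (i, j) - C $$ (i, j)" "i < n" "j < n" using c by auto
    then show "B $$ (i, j) = C $$ (i, j)" using \<open>B - C = 0\<^sub>m n n\<close> by simp
  qed (use c in auto)
qed

lemma msqrt_psd:
  assumes A: "psd n A"
  shows "psd n (msqrt A)" "msqrt A * msqrt A = A"
proof -
  obtain U d where U: "U \<in> carrier_mat n n" "mat_adjoint U * U = 1\<^sub>m n" and AU: "A = U * diag_of n d * mat_adjoint U"
    and d: "\<forall>i<n. 0 \<le> d i"
    using psd_diagonalization[OF A] by blast
  define B where "B = U * diag_of n (\<lambda>i. sqrt (d i)) * mat_adjoint U"
  have B: "psd n B" unfolding B_def using d by (intro psd_diag_conj U) simp
  have "diag_of n (\<lambda>i. sqrt (d i) * sqrt (d i)) = diag_of n d"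
    using d by (intro eq_matI) (auto simp: diag_of_def)
  then have BB: "B * B = A" unfolding B_def diag_conj_mult[OF U] AU by (rule arg_cong)
  have dim: "dim_row A = n" using psd_carrier[OF A] by simp
  have "msqrt A = B" unfolding msqrt_def dim
  proof (rule the_equality)
    fix C assume "psd n C \<and> C * C = A"
    then show "C = B" using psd_sqrt_unique[of n C B] B BB by simp
  qed (simp add: B BB)
  then show "psd n (msqrt A)" "msqrt A * msqrt A = A" using B BB by auto
qed

text \<open>The adjugate formula is recorded because it later gives holomorphy of inverses and
  bounds the order of poles by the order of the zero of the determinant.\<close>

lemma minv_det:
  assumes A: "A \<in> carrier_mat n n" and det: "Determinant.det A \<noteq> 0"
  shows "minv A = (1 / Determinant.det A) \<cdot>\<^sub>m adj_mat A" "minv A \<in> carrier_mat n n"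
    "A * minv A = 1\<^sub>m n" "minv A * A = 1\<^sub>m n"
proof -
  define B where "B = (1 / Determinant.det A) \<cdot>\<^sub>m adj_mat A"
  note adj = adj_mat[OF A]
  have B: "B \<in> carrier_mat n n" "A * B = 1\<^sub>m n" "B * A = 1\<^sub>m n"
    using adj A det by (auto simp: B_def mult_smult_distrib[OF A] mult_smult_assoc_mat[of _ n n _ n] intro!: eq_matI)
  have uniq: "C = B" if C: "C \<in> carrier_mat n n" "A * C = 1\<^sub>m n" for C
  proof -
    have "C = (B * A) * C" using B(3) C(1) by (simp add: left_mult_one_mat[of _ n n])
    also have "\<dots> = B * (A * C)" by (rule assoc_mult_mat[OF B(1) A C(1)])
    also have "\<dots> = B" unfolding C(2) using B(1) by (rule right_mult_one_mat)
    finally show ?thesis .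
  qed
  have dim: "dim_row A = n" using A by auto
  have "minv A = B" unfolding minv_def dim
    by (rule the_equality) (use B in simp, use uniq in blast)
  then show "minv A = (1 / Determinant.det A) \<cdot>\<^sub>m adj_mat A" "minv A \<in> carrier_mat n n"
    "A * minv A = 1\<^sub>m n" "minv A * A = 1\<^sub>m n" using B by (auto simp: B_def)
qed

section \<open>Block vectors and matrices as operators\<close>

text \<open>Vectors of all dimensions are encoded as complex polynomials, that is, as finitely supported
  sequences. A matrix acts through \<open>op\<close> on the coefficients within its dimension and kills the others;
  \<open>opE m\<close> is the identity on the coefficients from \<open>m\<close> on, so that an involution stays an involution.\<close>

definition pvec :: "complex vec \<Rightarrow> complex poly" where
  "pvec v = (\<Sum>i<dim_vec v. monom (vec_index v i) i)"

definition vpol :: "nat \<Rightarrow> complex poly \<Rightarrow> complex vec" where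
  "vpol m p = vec m (coeff p)"

definition pip :: "complex poly \<Rightarrow> complex poly \<Rightarrow> complex" where
  "pip p q = (\<Sum>i\<le>degree p. coeff p i * cnj (coeff q i))"

lemma coeff_pvec: "coeff (pvec v) i = (if i < dim_vec v then vec_index v i else 0)"
  by (simp add: pvec_def coeff_sum)

lemma vpol_carrier [simp]: "vpol m p \<in> carrier_vec m" "dim_vec (vpol m p) = m"
  by (simp_all add: vpol_def)

lemma vpol_index [simp]: "i < m \<Longrightarrow> vec_index (vpol m p) i = coeff p i"
  by (simp add: vpol_def)

lemma vpol_pvec [simp]: "v \<in> carrier_vec m \<Longrightarrow> vpol m (pvec v) = v"
  by (intro eq_vecI) (auto simp: coeff_pvec)

lemma pip_eq: "(\<And>i. N \<le> i \<Longrightarrow> coeff p i * cnj (coeff q i) = 0) \<Longrightarrow> pip p q = (\<Sum>i<N. coeff p i * cnj (coeff q i))"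
  unfolding pip_def by (rule sum.mono_neutral_cong) (auto simp: coeff_eq_0 not_less)

interpretation cip: cip_space Polynomial.smult pip
proof
  fix u v x :: "complex poly" and c :: complex
  define N where "N = Suc (degree u + degree v + degree x)"
  have N: "coeff u i = 0" "coeff v i = 0" "coeff x i = 0" if "N \<le> i" for i
    using that by (auto simp: N_def intro!: coeff_eq_0)
  show "pip (u + v) x = pip u x + pip v x"
    by (simp add: pip_eq[of N] N sum.distrib distrib_right)
  show "pip (Polynomial.smult c u) x = c * pip u x"
    by (simp add: pip_eq[of N] N sum_distrib_left mult.assoc)
  show "cnj (pip u v) = pip v u"
    by (simp add: pip_eq[of N] N mult.commute)
  have *: "pip u u = of_real (\<Sum>i<N. (cmod (coeff u i))\<^sup>2)"
    by (simp add: pip_eq[of N] N complex_norm_square del: of_real_power)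
  show "0 \<le> Re (pip u u)" unfolding * Re_complex_of_real by (intro sum_nonneg) simp
  assume "pip u u = 0"
  then have "(\<Sum>i<N. (cmod (coeff u i))\<^sup>2) = 0" unfolding * of_real_eq_0_iff .
  then have "\<forall>i<N. coeff u i = 0" by (subst (asm) sum_nonneg_eq_0_iff) auto
  then show "u = 0" using N by (intro poly_eqI) (metis coeff_0 not_le)
qed (simp_all add: smult_add_right smult_add_left)

definition trunc :: "nat \<Rightarrow> complex poly \<Rightarrow> bool" where
  "trunc m p \<longleftrightarrow> (\<forall>i\<ge>m. coeff p i = 0)"

definition op :: "complex mat \<Rightarrow> complex poly \<Rightarrow> complex poly" where
  "op X p = pvec (X *\<^sub>v vpol (dim_col X) p)"

lemma coeff_op: "coeff (op X p) i = (if i < dim_row X then \<Sum>j<dim_col X. X $$ (i, j) * coeff p j else 0)"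
  by (auto simp: op_def coeff_pvec scalar_prod_def atLeast0LessThan intro!: sum.cong)

lemma op_pvec: "X \<in> carrier_mat a b \<Longrightarrow> v \<in> carrier_vec b \<Longrightarrow> op X (pvec v) = pvec (X *\<^sub>v v)"
  by (auto simp: op_def)

lemma lin_op [simp]: "cip.lin (op X)"
  by (auto simp: cip.lin_def poly_eq_iff coeff_op distrib_left sum.distrib sum_distrib_left mult_ac)

lemma op_mult: "A \<in> carrier_mat a b \<Longrightarrow> B \<in> carrier_mat b c \<Longrightarrow> op (A * B) p = op A (op B p)"
  unfolding op_def by (auto simp: assoc_mult_mat_vec[of A a b B c])

lemma op_adj: "pip (op X u) v = pip u (op (mat_adjoint X) v)"
proof -
  have "pip (op X u) v = (\<Sum>i<dim_row X. \<Sum>j<dim_col X. X $$ (i, j) * coeff u j * cnj (coeff v i))"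
    by (subst pip_eq[of "dim_row X"]) (auto simp: coeff_op sum_distrib_right)
  also have "\<dots> = (\<Sum>j<dim_col X. \<Sum>i<dim_row X. X $$ (i, j) * coeff u j * cnj (coeff v i))"
    by (rule sum.swap)
  also have "\<dots> = pip u (op (mat_adjoint X) v)"
    by (subst pip_eq[of "dim_col X"]) (auto simp: coeff_op sum_distrib_left mult_ac intro!: sum.cong)
  finally show ?thesis .
qed

lemma op_minus: "X \<in> carrier_mat a b \<Longrightarrow> Y \<in> carrier_mat a b \<Longrightarrow> op (X - Y) p = op X p - op Y p"
  by (auto simp: poly_eq_iff coeff_op left_diff_distrib sum_subtractf)

lemma op_add: "X \<in> carrier_mat a b \<Longrightarrow> Y \<in> carrier_mat a b \<Longrightarrow> op (X + Y) p = op X p + op Y p"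
  by (auto simp: poly_eq_iff coeff_op distrib_right sum.distrib)

lemma op_smult: "op (c \<cdot>\<^sub>m X) p = Polynomial.smult c (op X p)"
  by (auto simp: poly_eq_iff coeff_op sum_distrib_left mult_ac)

lemma coeff_op_one: "coeff (op (1\<^sub>m m) p) i = (if i < m then coeff p i else 0)"
proof -
  have "(\<Sum>j<m. 1\<^sub>m m $$ (i, j) * coeff p j) = (\<Sum>j<m. if j = i then coeff p i else 0)" if "i < m"
    using that by (intro sum.cong) auto
  then show ?thesis by (simp add: coeff_op)
qed

lemma op_op_one: "X \<in> carrier_mat a m \<Longrightarrow> op X (op (1\<^sub>m m) p) = op X p"
  using op_mult[of X a m "1\<^sub>m m" m p] by simp

lemma op_one_op: "X \<in> carrier_mat m a \<Longrightarrow> op (1\<^sub>m m) (op X p) = op X p"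
  using op_mult[of "1\<^sub>m m" m m X a p] by simp

lemma trunc_op_one: "trunc m p \<Longrightarrow> op (1\<^sub>m m) p = p"
  by (auto simp: trunc_def poly_eq_iff coeff_op_one)

lemma trunc_op: "X \<in> carrier_mat m a \<Longrightarrow> trunc m (op X p)"
  by (auto simp: trunc_def coeff_op)

lemma trunc_closed: "trunc m p \<Longrightarrow> trunc m q \<Longrightarrow> trunc m (p + q)" "trunc m p \<Longrightarrow> trunc m q \<Longrightarrow> trunc m (p - q)"
  "trunc m p \<Longrightarrow> trunc m (Polynomial.smult c p)" "(\<And>i. i \<in> I \<Longrightarrow> trunc m (f i)) \<Longrightarrow> trunc m (\<Sum>i\<in>I. f i)" "trunc m 0"
  by (auto simp: trunc_def coeff_sum)

lemma trunc_eqI: "trunc m p \<Longrightarrow> trunc m q \<Longrightarrow> (\<And>i. i < m \<Longrightarrow> coeff p i = coeff q i) \<Longrightarrow> p = q"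
  by (metis poly_eqI trunc_def not_le)

definition opE :: "nat \<Rightarrow> complex mat \<Rightarrow> complex poly \<Rightarrow> complex poly" where
  "opE m X p = op X p + (p - op (1\<^sub>m m) p)"

lemma lin_opE [simp]: "cip.lin (opE m X)"
  by (auto simp: cip.lin_def opE_def cip.lin_add[OF lin_op] cip.lin_scale[OF lin_op] smult_add_right smult_diff_right)

lemma opE_op: "X \<in> carrier_mat a m \<Longrightarrow> Y \<in> carrier_mat m b \<Longrightarrow> opE m X (op Y p) = op (X * Y) p"
  by (simp add: opE_def op_one_op op_mult)

lemma opE_trunc: "trunc m p \<Longrightarrow> opE m X p = op X p"
  by (simp add: opE_def trunc_op_one)

lemma op_opE: "X \<in> carrier_mat m m \<Longrightarrow> Y \<in> carrier_mat b m \<Longrightarrow> op Y (opE m X p) = op (Y * X) p"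
  by (simp add: opE_def cip.lin_add[OF lin_op] cip.lin_diff[OF lin_op] op_op_one op_mult)

lemma opE_opE: "X \<in> carrier_mat m m \<Longrightarrow> Y \<in> carrier_mat m m \<Longrightarrow> opE m X (opE m Y p) = opE m (X * Y) p"
proof -
  assume X: "X \<in> carrier_mat m m" and Y: "Y \<in> carrier_mat m m"
  have "op (1\<^sub>m m) (opE m Y p) = op Y p"
    using op_opE[of Y m "1\<^sub>m m" m p] Y by simp
  then show ?thesis
    unfolding opE_def[of m X "opE m Y p"] op_opE[OF Y X] by (simp add: opE_def)
qed

lemma opE_one: "opE m (1\<^sub>m m) p = p"
  by (simp add: opE_def)

lemma opE_adj: "X \<in> carrier_mat m m \<Longrightarrow> pip (opE m X u) v = pip u (opE m (mat_adjoint X) v)"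
  by (simp add: opE_def cip.ip_add_left cip.ip_add_right cip.ip_diff_left cip.ip_diff_right op_adj[of X] op_adj[of "1\<^sub>m m"])

lemma coeff_opE_less:
  "X \<in> carrier_mat m m \<Longrightarrow> i < m \<Longrightarrow> coeff (opE m X p) i = (\<Sum>q<m. X $$ (i, q) * coeff p q)"
  by (simp add: opE_def coeff_op_one) (auto simp: coeff_op)

lemma trunc_opE: "X \<in> carrier_mat m m \<Longrightarrow> trunc m p \<Longrightarrow> trunc m (opE m X p)"
  by (simp add: opE_trunc trunc_op)

text \<open>Pythagoras for the orthogonal projection \<open>op (1\<^sub>m m)\<close> onto the
  coefficients below m.\<close>

lemma pip_split: "pip p q = pip (op (1\<^sub>m m) p) (op (1\<^sub>m m) q) + pip (p - op (1\<^sub>m m) p) (q - op (1\<^sub>m m) q)"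
proof -
  have "op (1\<^sub>m m) (op (1\<^sub>m m) q) = op (1\<^sub>m m) q" by (rule op_op_one[where a=m]) simp
  then have "pip (op (1\<^sub>m m) p) (op (1\<^sub>m m) q) = pip p (op (1\<^sub>m m) q)" "pip (op (1\<^sub>m m) p) q = pip p (op (1\<^sub>m m) q)"
    by (simp_all add: op_adj)
  then show ?thesis by (simp add: cip.ip_diff_left cip.ip_diff_right)
qed

lemma pip_trunc_right: "trunc m p \<Longrightarrow> pip p (op (1\<^sub>m m) q) = pip p q"
  using op_adj[of "1\<^sub>m m" p q] by (simp add: trunc_op_one)

section \<open>Linear systems with a hermitian matrix\<close>

definition hdot :: "nat \<Rightarrow> complex vec \<Rightarrow> complex vec \<Rightarrow> complex" where
  "hdot N u v = (\<Sum>i<N. vec_index u i * cnj (vec_index v i))"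

lemma hdot_adj:
  assumes "X \<in> carrier_mat a b" "u \<in> carrier_vec b" "v \<in> carrier_vec a"
  shows "hdot a (X *\<^sub>v u) v = hdot b u (mat_adjoint X *\<^sub>v v)"
proof -
  have "hdot a (X *\<^sub>v u) v = (\<Sum>i<a. \<Sum>j<b. X $$ (i, j) * vec_index u j * cnj (vec_index v i))"
    unfolding hdot_def by (intro sum.cong refl) (simp add: mult_vec_index[OF assms(1,2)] sum_distrib_right del: index_mult_mat_vec)
  also have "\<dots> = (\<Sum>j<b. \<Sum>i<a. X $$ (i, j) * vec_index u j * cnj (vec_index v i))"
    by (rule sum.swap)
  also have "\<dots> = hdot b u (mat_adjoint X *\<^sub>v v)"
    unfolding hdot_def using assms
    by (intro sum.cong refl) (auto simp: mult_vec_index[of _ b a] sum_distrib_left mult_ac simp del: index_mult_mat_vec)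
  finally show ?thesis .
qed

lemma hdot_definite:
  assumes "v \<in> carrier_vec N" "hdot N v v = 0"
  shows "v = 0\<^sub>v N"
proof -
  have "hdot N v v = of_real (\<Sum>i<N. (cmod (vec_index v i))\<^sup>2)"
    by (simp add: hdot_def complex_norm_square del: of_real_power)
  then have "(\<Sum>i<N. (cmod (vec_index v i))\<^sup>2) = 0" using assms(2) by (metis of_real_eq_0_iff)
  then have "\<forall>i<N. vec_index v i = 0" by (subst (asm) sum_nonneg_eq_0_iff) auto
  then show ?thesis using assms(1) by (intro eq_vecI) auto
qed

lemma hdot_zero: "hdot N u (0\<^sub>v N) = 0"
  by (simp add: hdot_def)

context
  fixes M :: "complex mat" and N :: nat
  assumes M: "M \<in> carrier_mat N N" and herm: "mat_adjoint M = M"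
begin

lemmas mp = mp_inv_hermitian[OF M herm]

lemma mp_range: "c \<in> carrier_vec N \<Longrightarrow> M *\<^sub>v (mp_inv M *\<^sub>v (M *\<^sub>v c)) = M *\<^sub>v c"
proof -
  assume c: "c \<in> carrier_vec N"
  have "M *\<^sub>v (mp_inv M *\<^sub>v (M *\<^sub>v c)) = (M * mp_inv M * M) *\<^sub>v c"
    using M mp(1) c by (simp add: assoc_mult_mat_vec[of _ N N _ N])
  then show ?thesis by (simp add: mp(2))
qed

text \<open>For hermitian M the range of the pseudoinverse is the range of M, hence orthogonal to
  the kernel. V and W inherit the orthogonality needed in \<open>lft_coprime\<close> from
  here.\<close>

lemma mp_kernel:
  assumes b: "b \<in> carrier_vec N" and x: "x \<in> carrier_vec N" "M *\<^sub>v x = 0\<^sub>v N"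
  shows "hdot N (mp_inv M *\<^sub>v b) x = 0"
proof -
  have "mp_inv M *\<^sub>v b = (M * mp_inv M * mp_inv M) *\<^sub>v b"
    using mp(3,5) by simp
  also have "\<dots> = M *\<^sub>v (mp_inv M *\<^sub>v (mp_inv M *\<^sub>v b))"
    using M mp(1) b by (simp add: assoc_mult_mat_vec[of _ N N _ N])
  finally have "hdot N (mp_inv M *\<^sub>v b) x = hdot N (M *\<^sub>v (mp_inv M *\<^sub>v (mp_inv M *\<^sub>v b))) x" by simp
  also have "\<dots> = hdot N (mp_inv M *\<^sub>v (mp_inv M *\<^sub>v b)) (mat_adjoint M *\<^sub>v x)"
    by (rule hdot_adj) (use M mp(1) b x in auto)
  finally show ?thesis by (simp add: herm x hdot_zero)
qed

text \<open>The residual e = M M^+ b - b lies in the kernel of M. There it is orthogonal to b by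
  hypothesis and to M M^+ b because M is hermitian, so it is orthogonal to itself.\<close>

lemma mp_solve:
  assumes b: "b \<in> carrier_vec N" and ker: "\<And>x. x \<in> carrier_vec N \<Longrightarrow> M *\<^sub>v x = 0\<^sub>v N \<Longrightarrow> hdot N b x = 0"
  shows "M *\<^sub>v (mp_inv M *\<^sub>v b) = b"
proof -
  define y where "y = M *\<^sub>v (mp_inv M *\<^sub>v b)"
  define e where "e = y - b"
  have y: "y \<in> carrier_vec N" using M mp(1) b by (simp add: y_def)
  have e: "e \<in> carrier_vec N" using y b by (simp add: e_def)
  have "M *\<^sub>v y = (M * (M * mp_inv M)) *\<^sub>v b"
    unfolding y_def using M mp(1) b by (simp add: assoc_mult_mat_vec[of _ N N _ N])
  also have "M * (M * mp_inv M) = M * (mp_inv M * M)"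
    by (rule arg_cong[OF mp(5)])
  also have "\<dots> = M * mp_inv M * M"
    by (rule assoc_mult_mat[OF M mp(1) M, symmetric])
  finally have "M *\<^sub>v y = M *\<^sub>v b" by (simp add: mp(2))
  then have Me: "M *\<^sub>v e = 0\<^sub>v N"
    using M y b by (simp add: e_def mult_minus_distrib_mat_vec[of _ N N])
  have "hdot N y e = hdot N (mp_inv M *\<^sub>v b) (mat_adjoint M *\<^sub>v e)"
    unfolding y_def by (rule hdot_adj) (use M mp(1) b e in auto)
  then have "hdot N y e = 0" by (simp add: herm Me hdot_zero)
  moreover have "hdot N b e = 0" by (rule ker[OF e Me])
  moreover have "hdot N e e = hdot N y e - hdot N b e"
    using y b by (auto simp: hdot_def e_def left_diff_distrib sum_subtractf)
  ultimately have "e = 0\<^sub>v N" using hdot_definite[OF e] by simp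
  have "vec_index y i = vec_index b i" if "i < N" for i
  proof -
    have "vec_index e i = vec_index y i - vec_index b i" using that y b by (simp add: e_def)
    then show ?thesis using that \<open>e = 0\<^sub>v N\<close> by simp
  qed
  then show ?thesis unfolding y_def[symmetric] using y b by (intro eq_vecI) auto
qed

end

section \<open>Block vectors as sequences of truncated polynomials\<close>

definition bvec :: "nat \<Rightarrow> nat \<Rightarrow> (nat \<Rightarrow> complex poly) \<Rightarrow> complex vec" where
  "bvec m N x = vec (N * m) (\<lambda>r. coeff (x (r div m)) (r mod m))"

definition unb :: "nat \<Rightarrow> complex vec \<Rightarrow> nat \<Rightarrow> complex poly" where
  "unb m u i = pvec (vec m (\<lambda>l. vec_index u (i * m + l)))"

lemma bvec_carrier [simp]: "bvec m N x \<in> carrier_vec (N * m)" "dim_vec (bvec m N x) = N * m"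
  by (simp_all add: bvec_def)

lemma trunc_unb: "trunc m (unb m u i)"
  by (simp add: trunc_def unb_def coeff_pvec)

lemma sum_blocks: "(\<Sum>c<N * m. f c) = (\<Sum>j<N. \<Sum>l<m. f (j * m + l :: nat) :: 'a :: comm_monoid_add)"
proof -
  have "(\<Sum>c<N * m. f c) = (\<Sum>j<N. sum f {j * m..<j * m + m})"
    by (rule sum.nat_group[symmetric])
  also have "\<dots> = (\<Sum>j<N. \<Sum>l<m. f (j * m + l))"
  proof (rule sum.cong[OF refl])
    fix j assume "j \<in> {..<N}"
    show "sum f {j * m..<j * m + m} = (\<Sum>l<m. f (j * m + l))"
      by (rule sum.reindex_bij_witness[where i="\<lambda>l. j * m + l" and j="\<lambda>c. c - j * m"]) auto
  qed
  finally show ?thesis .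
qed

context
  fixes m :: nat assumes m: "0 < m"
begin

lemma div_mod_block [simp]: "l < m \<Longrightarrow> (j * m + l) div m = j" "l < m \<Longrightarrow> (j * m + l) mod m = l"
  by auto

lemma div_lt: "r < N * m \<Longrightarrow> r div m < N" "r mod m < m"
  using m by (auto simp: less_mult_imp_div_less)

lemma block_lt: "j < N \<Longrightarrow> l < m \<Longrightarrow> j * m + l < N * m"
  by (metis add.commute div_mod_block(1) less_mult_imp_div_less m mult.commute nat_less_le not_less div_less_iff_less_mult)

lemma bvec_unb: "u \<in> carrier_vec (N * m) \<Longrightarrow> bvec m N (unb m u) = u"
  by (intro eq_vecI) (auto simp: bvec_def unb_def coeff_pvec div_lt)

lemma bvec_index_block: "j < N \<Longrightarrow> l < m \<Longrightarrow> vec_index (bvec m N x) (j * m + l) = coeff (x j) l"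
  by (simp add: bvec_def block_lt)

lemma bvec_eqD:
  assumes "bvec m N x = bvec m N y" "i < N" "trunc m (x i)" "trunc m (y i)"
  shows "x i = y i"
  using assms(3,4)
proof (rule trunc_eqI)
  fix l assume "l < m"
  then show "coeff (x i) l = coeff (y i) l"
    using bvec_index_block[OF assms(2), of l x] bvec_index_block[OF assms(2), of l y] assms(1) by simp
qed

lemma bvec_cong: "(\<And>i. i < N \<Longrightarrow> x i = y i) \<Longrightarrow> bvec m N x = bvec m N y"
  by (intro eq_vecI) (auto simp: bvec_def div_lt)

lemma hdot_bvec: "hdot (N * m) (bvec m N x) (bvec m N y) = (\<Sum>i<N. pip (op (1\<^sub>m m) (x i)) (op (1\<^sub>m m) (y i)))"
proof -
  have "pip (op (1\<^sub>m m) p) (op (1\<^sub>m m) q) = (\<Sum>l<m. coeff p l * cnj (coeff q l))" for p q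
    by (subst pip_eq[of m]) (auto simp: coeff_op_one)
  then show ?thesis by (simp add: hdot_def sum_blocks bvec_index_block)
qed

lemma hdot_bvec_trunc:
  "(\<And>i. i < N \<Longrightarrow> trunc m (x i)) \<Longrightarrow> hdot (N * m) (bvec m N x) (bvec m N y) = (\<Sum>i<N. pip (x i) (y i))"
  by (simp add: hdot_bvec trunc_op_one pip_trunc_right)

lemma bvec_zeroI: "(\<And>i. i < N \<Longrightarrow> x i = 0) \<Longrightarrow> bvec m N x = 0\<^sub>v (N * m)"
  by (intro eq_vecI) (auto simp: bvec_def div_lt)

lemma bvec_diff: "bvec m N x - bvec m N y = bvec m N (\<lambda>i. x i - y i)"
  by (intro eq_vecI) (auto simp: bvec_def)

context
  fixes A :: "nat \<Rightarrow> complex mat" and J :: "complex mat" and k :: nat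
  assumes A: "\<forall>j\<le>k. A j \<in> carrier_mat m m" and J: "J \<in> carrier_mat m m"
begin

lemma blk_carrier [simp]: "S_blk m A k \<in> carrier_mat (Suc k * m) (Suc k * m)" "J_blk m J k \<in> carrier_mat (Suc k * m) (Suc k * m)"
  by (simp_all add: S_blk_def J_blk_def)

text \<open>First entry of the dictionary between block matrices and convolutions. With the versions
  for the adjoint and for J it expresses Q and P by \<open>Qop\<close>, after which no index
  arithmetic with \<open>div\<close> and \<open>mod\<close> is left.\<close>

lemma S_blk_bvec: "S_blk m A k *\<^sub>v bvec m (Suc k) x = bvec m (Suc k) (cv (\<lambda>k. op (A k)) x)"
proof (rule eq_vecI)
  fix r assume "r < dim_vec (bvec m (Suc k) (cv (\<lambda>k. op (A k)) x))"
  then have r: "r < Suc k * m" by simp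
  define i l where "i = r div m" and "l = r mod m"
  have i: "i < Suc k" and l: "l < m" using div_lt(1)[OF r] div_lt(2) by (auto simp: i_def l_def)
  have "vec_index (S_blk m A k *\<^sub>v bvec m (Suc k) x) r = (\<Sum>c<Suc k * m. S_blk m A k $$ (r, c) * vec_index (bvec m (Suc k) x) c)"
    by (rule mult_vec_index[OF blk_carrier(1) bvec_carrier(1) r])
  also have "\<dots> = (\<Sum>j<Suc k. \<Sum>q<m. S_blk m A k $$ (r, j * m + q) * coeff (x j) q)"
    unfolding sum_blocks by (intro sum.cong refl) (simp add: bvec_index_block)
  also have "\<dots> = (\<Sum>j<Suc k. if j \<le> i then \<Sum>q<m. A (i - j) $$ (l, q) * coeff (x j) q else 0)"
    using r by (intro sum.cong refl) (auto simp: S_blk_def i_def l_def block_lt[of _ "Suc k"] simp del: mult_Suc)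
  also have "\<dots> = (\<Sum>j\<le>i. \<Sum>q<m. A (i - j) $$ (l, q) * coeff (x j) q)"
    by (rule sum.mono_neutral_cong_right) (use i in auto)
  also have "\<dots> = (\<Sum>j\<le>i. coeff (op (A (i - j)) (x j)) l)"
  proof (intro sum.cong refl)
    fix j have "A (i - j) \<in> carrier_mat m m" using A i by simp
    then show "(\<Sum>q<m. A (i - j) $$ (l, q) * coeff (x j) q) = coeff (op (A (i - j)) (x j)) l"
      using l by (auto simp: coeff_op)
  qed
  also have "\<dots> = vec_index (bvec m (Suc k) (cv (\<lambda>k. op (A k)) x)) r"
    using r by (simp add: bvec_def cv_def coeff_sum i_def l_def)
  finally show "vec_index (S_blk m A k *\<^sub>v bvec m (Suc k) x) r = vec_index (bvec m (Suc k) (cv (\<lambda>k. op (A k)) x)) r" .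
qed (simp add: S_blk_def)

lemma S_blk_adj_bvec:
  "mat_adjoint (S_blk m A k) *\<^sub>v bvec m (Suc k) y = bvec m (Suc k) (ac (\<lambda>k. op (mat_adjoint (A k))) (Suc k) y)"
proof (rule eq_vecI)
  fix r assume "r < dim_vec (bvec m (Suc k) (ac (\<lambda>k. op (mat_adjoint (A k))) (Suc k) y))"
  then have r: "r < Suc k * m" by simp
  define i l where "i = r div m" and "l = r mod m"
  have i: "i < Suc k" and l: "l < m" using div_lt(1)[OF r] div_lt(2) by (auto simp: i_def l_def)
  have "vec_index (mat_adjoint (S_blk m A k) *\<^sub>v bvec m (Suc k) y) r =
      (\<Sum>c<Suc k * m. mat_adjoint (S_blk m A k) $$ (r, c) * vec_index (bvec m (Suc k) y) c)"
    by (rule mult_vec_index[OF mat_adjoint_carrier[OF blk_carrier(1)] bvec_carrier(1) r])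
  also have "\<dots> = (\<Sum>j<Suc k. \<Sum>q<m. mat_adjoint (S_blk m A k) $$ (r, j * m + q) * coeff (y j) q)"
    unfolding sum_blocks by (intro sum.cong refl) (simp add: bvec_index_block)
  also have "\<dots> = (\<Sum>j<Suc k. if i \<le> j then \<Sum>q<m. cnj (A (j - i) $$ (q, l)) * coeff (y j) q else 0)"
  proof (intro sum.cong refl)
    fix j assume j: "j \<in> {..<Suc k}"
    have "mat_adjoint (S_blk m A k) $$ (r, j * m + q) = (if i \<le> j then cnj (A (j - i) $$ (q, l)) else 0)" if "q < m" for q
    proof -
      have lt: "j * m + q < Suc k * m" using j that by (intro block_lt) auto
      have "mat_adjoint (S_blk m A k) $$ (r, j * m + q) = cnj (S_blk m A k $$ (j * m + q, r))"
        by (rule mat_adjoint_index) (use r lt blk_carrier(1) in auto)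
      then show ?thesis using r lt that by (simp add: S_blk_def i_def l_def del: mult_Suc)
    qed
    then show "(\<Sum>q<m. mat_adjoint (S_blk m A k) $$ (r, j * m + q) * coeff (y j) q) =
      (if i \<le> j then \<Sum>q<m. cnj (A (j - i) $$ (q, l)) * coeff (y j) q else 0)" by simp
  qed
  also have "\<dots> = (\<Sum>j\<in>{i..<Suc k}. \<Sum>q<m. cnj (A (j - i) $$ (q, l)) * coeff (y j) q)"
    by (rule sum.mono_neutral_cong_right) auto
  also have "\<dots> = (\<Sum>j\<in>{i..<Suc k}. coeff (op (mat_adjoint (A (j - i))) (y j)) l)"
  proof (intro sum.cong refl)
    fix j assume "j \<in> {i..<Suc k}"
    then have "A (j - i) \<in> carrier_mat m m" using A by auto
    then show "(\<Sum>q<m. cnj (A (j - i) $$ (q, l)) * coeff (y j) q) = coeff (op (mat_adjoint (A (j - i))) (y j)) l"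
      using l by (auto simp: coeff_op)
  qed
  also have "\<dots> = vec_index (bvec m (Suc k) (ac (\<lambda>k. op (mat_adjoint (A k))) (Suc k) y)) r"
    using r by (simp add: bvec_def ac_def coeff_sum i_def l_def)
  finally show "vec_index (mat_adjoint (S_blk m A k) *\<^sub>v bvec m (Suc k) y) r =
     vec_index (bvec m (Suc k) (ac (\<lambda>k. op (mat_adjoint (A k))) (Suc k) y)) r" .
qed (simp add: S_blk_def)

lemma J_blk_bvec: "J_blk m J k *\<^sub>v bvec m (Suc k) x = bvec m (Suc k) (\<lambda>i. opE m J (x i))"
proof (rule eq_vecI)
  fix r assume "r < dim_vec (bvec m (Suc k) (\<lambda>i. opE m J (x i)))"
  then have r: "r < Suc k * m" by simp
  define i l where "i = r div m" and "l = r mod m"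
  have i: "i < Suc k" and l: "l < m" using div_lt(1)[OF r] div_lt(2) by (auto simp: i_def l_def)
  have "vec_index (J_blk m J k *\<^sub>v bvec m (Suc k) x) r = (\<Sum>c<Suc k * m. J_blk m J k $$ (r, c) * vec_index (bvec m (Suc k) x) c)"
    by (rule mult_vec_index[OF blk_carrier(2) bvec_carrier(1) r])
  also have "\<dots> = (\<Sum>j<Suc k. \<Sum>q<m. J_blk m J k $$ (r, j * m + q) * coeff (x j) q)"
    unfolding sum_blocks by (intro sum.cong refl) (simp add: bvec_index_block)
  also have "\<dots> = (\<Sum>j<Suc k. if j = i then \<Sum>q<m. J $$ (l, q) * coeff (x i) q else 0)"
    using r by (intro sum.cong refl) (auto simp: J_blk_def i_def l_def block_lt[of _ "Suc k"] simp del: mult_Suc)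
  also have "\<dots> = (\<Sum>q<m. J $$ (l, q) * coeff (x i) q)"
    using i by simp
  also have "\<dots> = vec_index (bvec m (Suc k) (\<lambda>i. opE m J (x i))) r"
    using r l J by (simp add: bvec_def coeff_opE_less flip: i_def l_def)
  finally show "vec_index (J_blk m J k *\<^sub>v bvec m (Suc k) x) r = vec_index (bvec m (Suc k) (\<lambda>i. opE m J (x i))) r" .
qed (simp add: J_blk_def)

lemma Q_mat_bvec: "Q_mat m J A k *\<^sub>v bvec m (Suc k) x =
    bvec m (Suc k) (Qop (opE m J) (\<lambda>k. op (A k)) (\<lambda>k. op (mat_adjoint (A k))) (Suc k) x)"
proof -
  let ?S = "S_blk m A k" and ?J = "J_blk m J k"
  define N where "N = Suc k * m"
  have c: "?S \<in> carrier_mat N N" "?J \<in> carrier_mat N N" "bvec m (Suc k) x \<in> carrier_vec N"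
    unfolding N_def by (rule blk_carrier bvec_carrier)+
  have "Q_mat m J A k *\<^sub>v bvec m (Suc k) x = ?J *\<^sub>v bvec m (Suc k) x - (mat_adjoint ?S * ?J * ?S) *\<^sub>v bvec m (Suc k) x"
    unfolding Q_mat_def by (rule minus_mult_distrib_mat_vec[of _ N N]) (use c in auto)
  also have "(mat_adjoint ?S * ?J * ?S) *\<^sub>v bvec m (Suc k) x = mat_adjoint ?S *\<^sub>v (?J *\<^sub>v (?S *\<^sub>v bvec m (Suc k) x))"
    using c by (simp add: assoc_mult_mat_vec[of _ N N _ N] mult_mat_vec_carrier[of _ N N])
  finally show ?thesis
    unfolding S_blk_bvec J_blk_bvec S_blk_adj_bvec bvec_diff Qop_def .
qed

lemma P_mat_bvec: "P_mat m J A k *\<^sub>v bvec m (Suc k) x =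
    bvec m (Suc k) (\<lambda>i. opE m J (x i) - cv (\<lambda>k. op (A k)) (\<lambda>j. opE m J (ac (\<lambda>k. op (mat_adjoint (A k))) (Suc k) x j)) i)"
proof -
  let ?S = "S_blk m A k" and ?J = "J_blk m J k"
  define N where "N = Suc k * m"
  have c: "?S \<in> carrier_mat N N" "?J \<in> carrier_mat N N" "bvec m (Suc k) x \<in> carrier_vec N"
    unfolding N_def by (rule blk_carrier bvec_carrier)+
  have "P_mat m J A k *\<^sub>v bvec m (Suc k) x = ?J *\<^sub>v bvec m (Suc k) x - (?S * ?J * mat_adjoint ?S) *\<^sub>v bvec m (Suc k) x"
    unfolding P_mat_def by (rule minus_mult_distrib_mat_vec[of _ N N]) (use c in auto)
  also have "(?S * ?J * mat_adjoint ?S) *\<^sub>v bvec m (Suc k) x = ?S *\<^sub>v (?J *\<^sub>v (mat_adjoint ?S *\<^sub>v bvec m (Suc k) x))"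
    using c by (simp add: assoc_mult_mat_vec[of _ N N _ N] mult_mat_vec_carrier[of _ N N])
  finally show ?thesis
    unfolding S_blk_bvec J_blk_bvec S_blk_adj_bvec bvec_diff .
qed

end

end

section \<open>The Potapov--Ginzburg transform\<close>

context toeplitz begin

text \<open>The standard argument for semidefinite forms: if <Q x, y> were nonzero, adding a large
  multiple of x to y would make the form negative. The final test vector is the block Q x i
  itself.\<close>

lemma Qop_form_zero:
  assumes pos: "\<And>x. 0 \<le> Re (\<Sum>i<N. ip (Qop J A As N x i) (x i))"
    and zero: "(\<Sum>i<N. ip (Qop J A As N x i) (x i)) = 0" and i: "i < N"
  shows "Qop J A As N x i = 0"
proof -
  define B where "B y = (\<Sum>i<N. ip (Qop J A As N x i) (y i))" for y
  have "B y = 0" for y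
  proof (rule ccontr)
    assume "B y \<noteq> 0"
    define F where "F = Re (\<Sum>i<N. ip (Qop J A As N y i) (y i))"
    have F: "0 \<le> F - 2 * t * (cmod (B y))\<^sup>2" for t
    proof -
      define c where "c = - of_real t * cnj (B y)"
      have "(\<Sum>i<N. ip (Qop J A As N (\<lambda>i. y i + sc c (x i)) i) (y i + sc c (x i))) =
          (\<Sum>i<N. ip (Qop J A As N y i) (y i)) + cnj c * (\<Sum>i<N. ip (Qop J A As N y i) (x i)) + c * B y"
        using zero by (simp add: Qop_add Qop_scale ip_add_left ip_add_right ip_scale_left ip_scale_right
            sum.distrib B_def flip: sum_distrib_left)
      also have "(\<Sum>i<N. ip (Qop J A As N y i) (x i)) = cnj (B y)"
        unfolding Qop_sym by (simp add: B_def ip_cnj)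
      finally have e: "(\<Sum>i<N. ip (Qop J A As N (\<lambda>i. y i + sc c (x i)) i) (y i + sc c (x i))) =
          (\<Sum>i<N. ip (Qop J A As N y i) (y i)) + cnj c * cnj (B y) + c * B y" .
      have cB: "c * B y = - of_real (t * (cmod (B y))\<^sup>2)"
        by (simp add: c_def complex_norm_square mult.commute del: of_real_power)
      then have "cnj c * cnj (B y) = - of_real (t * (cmod (B y))\<^sup>2)"
        by (metis complex_cnj_complex_of_real complex_cnj_minus complex_cnj_mult)
      then have "Re (\<Sum>i<N. ip (Qop J A As N (\<lambda>i. y i + sc c (x i)) i) (y i + sc c (x i))) = F - 2 * t * (cmod (B y))\<^sup>2"
        unfolding e cB F_def by simp
      then show ?thesis using pos[of "\<lambda>i. y i + sc c (x i)"] by simp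
    qed
    \<comment> \<open>For this t the lower bound is F - 2 (F + 1) = - F - 2, while t = 0 gives F >=
      0.\<close>
    from F[of "(F + 1) / (cmod (B y))\<^sup>2"] F[of 0] \<open>B y \<noteq> 0\<close> show False by simp
  qed
  then have "B (\<lambda>j. if j = i then Qop J A As N x i else 0) = 0" .
  moreover have "B (\<lambda>j. if j = i then Qop J A As N x i else 0) = (\<Sum>j<N. if j = i then ip (Qop J A As N x i) (Qop J A As N x i) else 0)"
    unfolding B_def by (intro sum.cong) auto
  ultimately have "ip (Qop J A As N x i) (Qop J A As N x i) = 0" using i by simp
  then show ?thesis by (rule ip_definite)
qed

text \<open>A kernel vector of Q_n with a zero in front makes the form of Q_{n+1} vanish, so
  nonnegativity puts it into the kernel of Q_{n+1}; the new information is the first row. It is the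
  solvability condition for V and W: their right-hand sides are orthogonal to the kernel.\<close>

lemma Qop_kernel_orth:
  assumes pos: "\<And>x. 0 \<le> Re (\<Sum>i<Suc n. ip (Qop J A As (Suc n) x i) (x i))"
    and ker: "\<And>i. i < n \<Longrightarrow> Qop J A As n x i = 0"
  shows "(\<Sum>i<n. As (Suc i) (J (cv A x i))) = 0"
proof -
  have "(\<Sum>i<Suc n. ip (Qop J A As (Suc n) (shift x) i) (shift x i)) = 0"
    by (subst sum.lessThan_Suc_shift) (simp add: Qop_shift ker)
  then have "Qop J A As (Suc n) (shift x) 0 = 0"
    by (rule Qop_form_zero[OF pos]) simp
  then show ?thesis by (simp add: Qop_shift_0)
qed

text \<open>The right-hand side is a row of P = J - S J S^*. Thus P is the dual \<open>Qop\<close>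
  read backwards.\<close>

lemma Qop_dual_rev:
  assumes "i < N"
  shows "Qop J As A N (\<lambda>i. z (N - 1 - i)) i = J (z (N - 1 - i)) - cv A (\<lambda>k. J (ac As N z k)) (N - 1 - i)"
proof -
  have "cv As (\<lambda>i. z (N - 1 - i)) k = ac As N z (N - 1 - k)" if "k < N" for k
  proof -
    have "cv As (\<lambda>i. z (N - 1 - i)) k = ac As N (\<lambda>l. z (N - 1 - (N - 1 - l))) (N - 1 - k)"
      using that by (subst ac_rev) auto
    also have "\<dots> = ac As N z (N - 1 - k)"
      by (rule ac_cong) simp
    finally show ?thesis .
  qed
  then have "ac A N (\<lambda>k. J (cv As (\<lambda>i. z (N - 1 - i)) k)) i = ac A N (\<lambda>k. J (ac As N z (N - 1 - k))) i"
    by (intro ac_cong) simp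
  then show ?thesis
    using assms ac_rev[of i N A "\<lambda>k. J (ac As N z k)"] by (simp add: Qop_def)
qed

text \<open>In the application y is the column V p, and b consists of the coefficients of pi beyond
  the first, applied to p. The hypothesis then says S^* J b = J y. Consequently P (J b) = b - S y =
  (A_1 p, ..., A_n p), which ties the pseudoinverse in V to that of P, and (p, y) has an image under
  Q_{n+1} that is concentrated in block 0.\<close>

lemma central_extension:
  assumes sol: "\<And>i. i < n \<Longrightarrow> Qop J A As n y i = ac As n (\<lambda>k. J (A (Suc k) p)) i"
  defines "b \<equiv> \<lambda>i. A (Suc i) p + cv A y i" and "r \<equiv> case_nat p y"
  shows "i < n \<Longrightarrow> Qop J As A n (\<lambda>i. J (b (n - 1 - i))) i = A (n - i) p"
    and "i < n \<Longrightarrow> Qop J A As (Suc n) r (Suc i) = 0"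
    and "Qop J A As (Suc n) r 0 = J p - As 0 (J (A 0 p)) - (\<Sum>i<n. As (Suc i) (J (b i)))"
proof -
  interpret d: toeplitz sc ip J As A by (rule dual)
  have acb: "ac As n (\<lambda>k. J (b k)) i = J (y i)" if "i < n" for i
  proof -
    have "ac As n (\<lambda>k. J (b k)) i = ac As n (\<lambda>k. J (A (Suc k) p)) i + ac As n (\<lambda>k. J (cv A y k)) i"
      by (simp only: b_def linJ ac_add)
    also have "\<dots> = J (y i)" using sol[OF that] by (simp add: Qop_def algebra_simps)
    finally show ?thesis .
  qed
  show "Qop J As A n (\<lambda>i. J (b (n - 1 - i))) i = A (n - i) p" if "i < n" for i
  proof -
    have "cv A (\<lambda>k. J (ac As n (\<lambda>k. J (b k)) k)) (n - 1 - i) = cv A y (n - 1 - i)"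
      by (rule cv_cong) (use that in \<open>simp add: acb J_J\<close>)
    then show ?thesis
      using that by (subst Qop_dual_rev) (simp_all add: J_J b_def Suc_diff_Suc)
  qed
  have cvr: "cv A r (Suc i) = b i" "cv A r 0 = A 0 p" for i
    unfolding cv_def b_def r_def by (subst sum.atMost_Suc_shift) simp_all
  show "Qop J A As (Suc n) r (Suc i) = 0" if "i < n" for i
    using that by (simp add: Qop_def ac_Suc cvr acb) (simp add: r_def)
  have "ac As (Suc n) (\<lambda>k. J (cv A r k)) 0 = (\<Sum>k<Suc n. As k (J (cv A r k)))"
    by (simp add: ac_def atLeast0LessThan)
  also have "\<dots> = As 0 (J (A 0 p)) + (\<Sum>i<n. As (Suc i) (J (b i)))"
    by (subst sum.lessThan_Suc_shift) (simp add: cvr)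
  finally show "Qop J A As (Suc n) r 0 = J p - As 0 (J (A 0 p)) - (\<Sum>i<n. As (Suc i) (J (b i)))"
    by (simp add: Qop_def) (simp add: r_def)
qed

text \<open>Any two solutions of the dual system differ by a kernel vector, and its pairing with the
  right-hand side is zero because the latter lies in the range. So J b may be replaced by the
  solution that P^+ provides, and this is the shape in which \<open>R_next\<close> is
  defined.\<close>

lemma central_extension_R:
  assumes sol: "\<And>q i. i < n \<Longrightarrow> Qop J A As n (y q) i = ac As n (\<lambda>k. J (A (Suc k) q)) i"
    and u: "\<And>i. i < n \<Longrightarrow> Qop J As A n u i = A (n - i) p"
  shows "Qop J A As (Suc n) (case_nat p (y p)) 0 = J p - As 0 (J (A 0 p)) - (\<Sum>i<n. As (n - i) (u i))"
proof -
  interpret d: toeplitz sc ip J As A by (rule dual)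
  define b where "b q i = A (Suc i) q + cv A (y q) i" for q i
  note c = central_extension[OF sol, folded b_def]
  define e where "e i = J (b p (n - 1 - i)) - u i" for i
  have Qe: "Qop J As A n e i = 0" if "i < n" for i
  proof -
    have "e = (\<lambda>i. J (b p (n - 1 - i)) - u i)" by (rule ext) (rule e_def)
    then show ?thesis
      using c(1)[OF _ that] u[OF that] by (simp only: d.Qop_diff) simp
  qed
  have "(\<Sum>i<n. As (n - i) (e i)) = 0"
  proof (rule ip_ext)
    fix q
    have "ip (\<Sum>i<n. As (n - i) (e i)) q = (\<Sum>i<n. ip (e i) (A (n - i) q))"
      by (simp add: ip_sum_left d.A_adj)
    also have "\<dots> = (\<Sum>i<n. ip (e i) (Qop J As A n (\<lambda>i. J (b q (n - 1 - i))) i))"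
    proof (rule sum.cong[OF refl])
      fix i assume "i \<in> {..<n}"
      then have i: "i < n" by (rule lessThan_iff[THEN iffD1])
      have "Qop J As A n (\<lambda>i. J (b q (n - 1 - i))) i = A (n - i) q" by (rule c(1)[OF _ i])
      then show "ip (e i) (A (n - i) q) = ip (e i) (Qop J As A n (\<lambda>i. J (b q (n - 1 - i))) i)" by simp
    qed
    also have "\<dots> = 0" by (simp add: Qe flip: d.Qop_sym)
    finally show "ip (\<Sum>i<n. As (n - i) (e i)) q = ip 0 q" by simp
  qed
  then have "(\<Sum>i<n. As (n - i) (u i)) = (\<Sum>i<n. As (n - i) (J (b p (n - 1 - i))))"
    by (simp add: e_def lin_diff[OF lin_As] sum_subtractf)
  also have "\<dots> = (\<Sum>i<n. As (Suc (n - 1 - i)) (J (b p (n - 1 - i))))"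
    by (intro sum.cong refl) (simp add: Suc_diff_Suc)
  also have "\<dots> = (\<Sum>i<n. As (Suc i) (J (b p i)))"
    by (rule sum_rev)
  finally have s: "(\<Sum>i<n. As (n - i) (u i)) = (\<Sum>i<n. As (Suc i) (J (b p i)))" .
  show ?thesis unfolding s by (rule c(3))
qed

end

abbreviation "nrm p \<equiv> Re (pip p p)"

lemma pip_vec: "M \<in> carrier_mat m m \<Longrightarrow> v \<in> carrier_vec m \<Longrightarrow>
    pip (op M (pvec v)) (pvec v) = (\<Sum>i<m. cnj (vec_index v i) * vec_index (M *\<^sub>v v) i)"
  by (subst pip_eq[of m]) (auto simp: coeff_pvec op_pvec mult.commute intro!: sum.cong)

lemma psd_pip: "psd m M \<Longrightarrow> 0 \<le> Re (pip (op M p) p)"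
proof -
  assume M: "psd m M"
  then have Mc: "M \<in> carrier_mat m m" by (rule psd_carrier)
  have e: "pvec (vpol m p) = op (1\<^sub>m m) p" by (simp add: op_def)
  have "pip (op M p) p = pip (op M (pvec (vpol m p))) (pvec (vpol m p))"
    unfolding e using Mc by (simp add: op_op_one pip_trunc_right[OF trunc_op[OF Mc]])
  also have "\<dots> = (\<Sum>i<m. cnj (vec_index (vpol m p) i) * vec_index (M *\<^sub>v vpol m p) i)"
    by (rule pip_vec[OF Mc]) simp
  finally show ?thesis using M unfolding psd_def by (metis vpol_carrier(1))
qed

lemma psd_pipI:
  assumes "M \<in> carrier_mat m m" "mat_adjoint M = M" "\<And>p. 0 \<le> Re (pip (op M p) p)"
  shows "psd m M"
  unfolding psd_def using assms pip_vec[OF assms(1)] by (metis)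

lemma coeff_op_monom:
  assumes "M \<in> carrier_mat m m" "i < m" "j < m"
  shows "coeff (op M (monom 1 j)) i = M $$ (i, j)"
proof -
  have "coeff (op M (monom 1 j)) i = (\<Sum>k<m. M $$ (i, k) * coeff (monom 1 j) k)"
    using assms by (auto simp: coeff_op)
  also have "\<dots> = (\<Sum>k<m. if k = j then M $$ (i, j) else 0)"
    by (rule sum.cong) auto
  finally show ?thesis using assms by simp
qed

lemma adjoint_eqI:
  assumes M: "M \<in> carrier_mat m m" and sym: "\<And>u v. pip (op M u) v = pip u (op M v)"
  shows "mat_adjoint M = M"
proof (rule eq_matI)
  fix i j assume "i < dim_row M" "j < dim_col M"
  then have ij: "i < m" "j < m" using M by auto
  note e = coeff_op_monom[OF M]
  have p: "pip u (monom 1 i) = coeff u i" "pip (monom 1 i) u = cnj (coeff u i)" for u i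
  proof -
    show *: "pip (monom 1 i) u = cnj (coeff u i)" for i u
      by (subst pip_eq[of "Suc i"]) auto
    show "pip u (monom 1 i) = coeff u i" by (subst cip.ip_cnj[symmetric]) (simp add: *)
  qed
  have "M $$ (i, j) = cnj (M $$ (j, i))"
    using sym[of "monom 1 j" "monom 1 i"] ij by (simp add: p e)
  then show "mat_adjoint M $$ (i, j) = M $$ (i, j)" using ij M by auto
qed (use M in auto)

lemma det_nonzero_iff:
  assumes "X \<in> carrier_mat m m"
  shows "Determinant.det X \<noteq> 0 \<longleftrightarrow> (\<forall>p. trunc m p \<longrightarrow> op X p = 0 \<longrightarrow> p = 0)"
proof -
  have z: "pvec v = 0 \<longleftrightarrow> v = 0\<^sub>v m" if "v \<in> carrier_vec m" for v
    using that by (auto simp: poly_eq_iff coeff_pvec)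
  have "Determinant.det X = 0 \<longleftrightarrow> (\<exists>v. v \<in> carrier_vec m \<and> v \<noteq> 0\<^sub>v m \<and> X *\<^sub>v v = 0\<^sub>v m)"
    by (rule det_0_iff_vec_prod_zero[OF assms])
  also have "\<dots> \<longleftrightarrow> (\<exists>p. trunc m p \<and> op X p = 0 \<and> p \<noteq> 0)"
  proof safe
    fix v assume v: "v \<in> carrier_vec m" "v \<noteq> 0\<^sub>v m" "X *\<^sub>v v = 0\<^sub>v m"
    show "\<exists>p. trunc m p \<and> op X p = 0 \<and> p \<noteq> 0"
    proof (intro exI conjI)
      show "trunc m (pvec v)" using v(1) by (simp add: trunc_def coeff_pvec)
      show "op X (pvec v) = 0" unfolding op_pvec[OF assms v(1)] v(3) using z[of "0\<^sub>v m"] by simp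
      show "pvec v \<noteq> 0" using z[OF v(1)] v(2) by simp
    qed
  next
    fix p assume p: "trunc m p" "op X p = 0" "p \<noteq> 0"
    have pv: "pvec (vpol m p) = p"
      using p(1) by (auto simp: poly_eq_iff coeff_pvec trunc_def)
    have "X *\<^sub>v vpol m p \<in> carrier_vec m" using assms by simp
    moreover have "pvec (X *\<^sub>v vpol m p) = 0" using p(2) assms by (simp add: op_def)
    ultimately have "X *\<^sub>v vpol m p = 0\<^sub>v m" using z by blast
    moreover have "vpol m p \<noteq> 0\<^sub>v m" using p(3) pv z[of "vpol m p"] by auto
    ultimately show "\<exists>v. v \<in> carrier_vec m \<and> v \<noteq> 0\<^sub>v m \<and> X *\<^sub>v v = 0\<^sub>v m"
      by (intro exI[of _ "vpol m p"]) simp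
  qed
  finally show ?thesis by blast
qed

lemma nrm_eq_0: "nrm p = 0 \<Longrightarrow> p = 0"
  by (metis cip.ip_definite cip.ip_self_Re of_real_0)

lemma nrm_nonneg: "0 \<le> nrm p"
  by (rule cip.ip_nonneg)

section \<open>The transform of a single matrix\<close>

definition J_plus :: "nat \<Rightarrow> complex mat \<Rightarrow> complex mat" where
  "J_plus m J = (1 / 2) \<cdot>\<^sub>m (1\<^sub>m m + J)"
definition J_minus :: "nat \<Rightarrow> complex mat \<Rightarrow> complex mat" where
  "J_minus m J = (1 / 2) \<cdot>\<^sub>m (1\<^sub>m m - J)"
text \<open>Write P and Q for the spectral projections of J to the eigenvalues 1 and -1. The
  transform exchanges the Q components of the input u and the output X u: it sends P u + Q X u to P
  X u + Q u.\<close>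

definition pg_den :: "nat \<Rightarrow> complex mat \<Rightarrow> complex mat \<Rightarrow> complex mat" where
  "pg_den m J X = J_minus m J * X + J_plus m J"
definition pg_num :: "nat \<Rightarrow> complex mat \<Rightarrow> complex mat \<Rightarrow> complex mat" where
  "pg_num m J X = J_plus m J * X + J_minus m J"

context
  fixes m :: nat and J :: "complex mat"
  assumes sig: "sig_mat m J"
begin

lemma J_carrier: "J \<in> carrier_mat m m" using sig by (simp add: sig_mat_def)
lemma J_plus_carrier [simp]: "J_plus m J \<in> carrier_mat m m" and J_minus_carrier [simp]: "J_minus m J \<in> carrier_mat m m"
  using J_carrier minus_carrier_mat[OF J_carrier, of "1\<^sub>m m"] by (simp_all add: J_plus_def J_minus_def)

lemma op_J_J: "op J (op J p) = op (1\<^sub>m m) p"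
  using sig by (simp add: sig_mat_def flip: op_mult[of J m m J m])

lemma op_J_sym: "pip (op J u) v = pip u (op J v)"
  using sig by (simp add: sig_mat_def op_adj)

lemma op_one_idem: "op (1\<^sub>m m) (op (1\<^sub>m m) p) = op (1\<^sub>m m) p"
  by (rule op_op_one[of _ m]) simp

lemma op_one_J: "op (1\<^sub>m m) (op J p) = op J p" "op J (op (1\<^sub>m m) p) = op J p"
  by (rule op_one_op op_op_one; use J_carrier in simp)+

lemma op_J_plus: "op (J_plus m J) p = Polynomial.smult (1/2) (op (1\<^sub>m m) p + op J p)"
  using J_carrier by (simp add: J_plus_def op_smult op_add[of _ m m])

lemma op_J_minus: "op (J_minus m J) p = Polynomial.smult (1/2) (op (1\<^sub>m m) p - op J p)"
  unfolding J_minus_def op_smult by (subst op_minus[of _ m m]) (use J_carrier in auto)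

lemma J_pm_mult:
  "op (J_plus m J) (op (J_plus m J) p) = op (J_plus m J) p"
  "op (J_minus m J) (op (J_minus m J) p) = op (J_minus m J) p"
  "op (J_plus m J) (op (J_minus m J) p) = 0"
  "op (J_minus m J) (op (J_plus m J) p) = 0"
  by (rule poly_eqI, simp add: op_J_plus op_J_minus cip.lin_add[OF lin_op] cip.lin_diff[OF lin_op]
      cip.lin_scale[OF lin_op] op_J_J op_one_J op_one_idem, (simp add: field_simps)?)+

lemma J_pm_sum:
  "op (J_plus m J) p + op (J_minus m J) p = op (1\<^sub>m m) p" "op (J_plus m J) p - op (J_minus m J) p = op J p"
  by (rule poly_eqI, simp add: op_J_plus op_J_minus, (simp add: field_simps)?)+

lemma J_pm_sym: "pip (op (J_plus m J) u) v = pip u (op (J_plus m J) v)"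
  "pip (op (J_minus m J) u) v = pip u (op (J_minus m J) v)"
  using op_adj[of "1\<^sub>m m" u v]
  by (simp_all add: op_J_plus op_J_minus cip.ip_scale_left cip.ip_scale_right cip.ip_add_left cip.ip_add_right
      cip.ip_diff_left cip.ip_diff_right op_J_sym)

lemma J_form: "pip (op J p) p = of_real (nrm (op (J_plus m J) p) - nrm (op (J_minus m J) p))"
proof -
  have "pip (op J p) p = pip (op (J_plus m J) p) (op (J_plus m J) p) - pip (op (J_minus m J) p) (op (J_minus m J) p)"
    by (simp add: J_pm_sym J_pm_mult cip.ip_diff_right[symmetric] J_pm_sum(2) op_J_sym)
  then show ?thesis by (metis cip.ip_self_Re of_real_diff)
qed

lemma nrm_pm: "nrm (op (J_plus m J) u + op (J_minus m J) v) = nrm (op (J_plus m J) u) + nrm (op (J_minus m J) v)"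
  by (simp add: cip.ip_add_left cip.ip_add_right) (simp add: J_pm_sym J_pm_mult)

lemma nrm_pm_diff: "nrm (op (J_plus m J) u - op (J_minus m J) v) = nrm (op (J_plus m J) u) + nrm (op (J_minus m J) v)"
  by (simp add: cip.ip_diff_left cip.ip_diff_right) (simp add: J_pm_sym J_pm_mult)

lemma pg_carrier [simp]: "X \<in> carrier_mat m m \<Longrightarrow> pg_den m J X \<in> carrier_mat m m"
  "X \<in> carrier_mat m m \<Longrightarrow> pg_num m J X \<in> carrier_mat m m"
  by (simp_all add: pg_den_def pg_num_def)

lemma op_pg:
  assumes X: "X \<in> carrier_mat m m"
  shows "op (pg_den m J X) p = op (J_minus m J) (op X p) + op (J_plus m J) p"
    "op (pg_num m J X) p = op (J_plus m J) (op X p) + op (J_minus m J) p"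
  using X by (simp_all add: pg_den_def pg_num_def op_add[of _ m m] op_mult[of _ m m _ m])

text \<open>After the exchange of the Q components the defect of the indefinite form becomes a
  difference of squared norms. So J-contractive turns into contractive.\<close>

lemma J_gap:
  "nrm (op (J_plus m J) u + op (J_minus m J) v) - nrm (op (J_plus m J) v + op (J_minus m J) u) =
    Re (pip (op J u) u - pip (op J v) v)"
  by (simp add: nrm_pm J_form)

context
  fixes X :: "complex mat"
  assumes X: "X \<in> carrier_mat m m" and contr: "psd m (J - mat_adjoint X * J * X)"
begin

lemma J_contr_form: "0 \<le> Re (pip (op J p) p - pip (op J (op X p)) (op X p))"
proof -
  have "pip (op (J - mat_adjoint X * J * X) p) p = pip (op J p) p - pip (op (mat_adjoint X * J * X) p) p"
    using X J_carrier by (subst op_minus[of _ m m]) (auto simp: cip.ip_diff_left)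
  also have "op (mat_adjoint X * J * X) p = op (mat_adjoint X) (op J (op X p))"
    using X J_carrier by (simp add: op_mult[of _ m m _ m])
  also have "pip \<dots> p = pip (op J (op X p)) (op X p)"
    by (simp add: op_adj)
  finally show ?thesis using psd_pip[OF contr, of p] by simp
qed

text \<open>For a kernel vector p both P p and Q X p vanish. The J-form of p is then nonpositive and
  that of X p nonnegative, and J-contractivity leaves only p = 0.\<close>

lemma pg_den_det: "Determinant.det (pg_den m J X) \<noteq> 0"
  unfolding det_nonzero_iff[OF pg_carrier(1)[OF X]]
proof safe
  fix p assume p: "trunc m p" and "op (pg_den m J X) p = 0"
  then have e: "op (J_minus m J) (op X p) + op (J_plus m J) p = 0" by (simp add: op_pg X)
  have "op (J_plus m J) (op (J_minus m J) (op X p) + op (J_plus m J) p) = 0"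
    "op (J_minus m J) (op (J_minus m J) (op X p) + op (J_plus m J) p) = 0" unfolding e
    by (rule cip.lin_zero[OF lin_op])+
  then have Pp: "op (J_plus m J) p = 0" and QX: "op (J_minus m J) (op X p) = 0"
    by (simp_all add: cip.lin_add[OF lin_op] J_pm_mult)
  have "0 \<le> - nrm (op (J_minus m J) p) - nrm (op (J_plus m J) (op X p))"
    using J_contr_form[of p] by (simp add: J_form Pp QX)
  then have "nrm (op (J_minus m J) p) = 0"
    using nrm_nonneg[of "op (J_minus m J) p"] nrm_nonneg[of "op (J_plus m J) (op X p)"] by linarith
  then have "op (J_minus m J) p = 0" by (rule nrm_eq_0)
  then show "p = 0" using J_pm_sum(1)[of p] Pp p by (simp add: trunc_op_one)
qed

definition pg where "pg = pg_num m J X * minv (pg_den m J X)"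

text \<open>Exchanging the Q components twice restores them, so the transform is an involution, and
  X is recovered from its contractive transform by the same formula.\<close>

lemma pg_facts:
  shows "pg \<in> carrier_mat m m" and "pg * pg_den m J X = pg_num m J X"
    and "pg_den m J pg * pg_den m J X = 1\<^sub>m m" and "pg_num m J pg * pg_den m J X = X"
    and "nrm (op pg p) \<le> nrm p"
proof -
  let ?D = "pg_den m J X" and ?P = "J_plus m J" and ?Q = "J_minus m J"
  note assoc = assoc_mult_mat[of _ m m _ m _ m]
  note mi = minv_det[OF pg_carrier(1)[OF X] pg_den_det]
  have JJ: "J * J = 1\<^sub>m m" and J: "J \<in> carrier_mat m m" using sig by (auto simp: sig_mat_def)
  show pg: "pg \<in> carrier_mat m m" using mi(2) X by (simp add: pg_def)
  show e: "pg * ?D = pg_num m J X"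
    unfolding pg_def using mi(2,4) X by (simp add: assoc right_mult_one_mat[of _ m m])
  have mat_eqI: "M = M'" if "M \<in> carrier_mat m m" "M' \<in> carrier_mat m m" "\<And>p. op M p = op M' p" for M M'
  proof (rule eq_matI)
    fix i j assume "i < dim_row M'" "j < dim_col M'"
    then have ij: "i < m" "j < m" using that by auto
    note e = coeff_op_monom[OF _ ij]
    show "M $$ (i, j) = M' $$ (i, j)" using e[OF that(1)] e[OF that(2)] that(3) by simp
  qed (use that in auto)
  have ope: "op pg (op ?D p) = op (pg_num m J X) p" for p
    using arg_cong[OF e, of "\<lambda>M. op M p"] pg X by (simp add: op_mult[of _ m m _ m])
  have Xt: "op (1\<^sub>m m) (op X p) = op X p" for p using X by (rule op_one_op)
  show "pg_den m J pg * ?D = 1\<^sub>m m"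
  proof (rule mat_eqI)
    fix p
    have "op (pg_den m J pg * ?D) p = op ?Q (op pg (op ?D p)) + op ?P (op ?D p)"
      using X pg by (simp add: op_mult[of _ m m _ m] op_pg)
    also have "\<dots> = op ?Q p + op ?P p"
      unfolding ope using X by (simp add: op_pg cip.lin_add[OF lin_op] J_pm_mult)
    finally show "op (pg_den m J pg * ?D) p = op (1\<^sub>m m) p"
      using J_pm_sum(1)[of p] by (simp add: add.commute)
  qed (use X pg in auto)
  show "pg_num m J pg * ?D = X"
  proof (rule mat_eqI)
    fix p
    have "op (pg_num m J pg * ?D) p = op ?P (op pg (op ?D p)) + op ?Q (op ?D p)"
      using X pg by (simp add: op_mult[of _ m m _ m] op_pg)
    also have "\<dots> = op ?P (op X p) + op ?Q (op X p)"
      unfolding ope using X by (simp add: op_pg cip.lin_add[OF lin_op] J_pm_mult)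
    finally show "op (pg_num m J pg * ?D) p = op X p"
      using J_pm_sum(1)[of "op X p"] by (simp add: Xt)
  qed (use X pg in auto)
  have c: "nrm (op pg (op ?D q)) \<le> nrm (op ?D q)" for q
    unfolding ope using J_contr_form[of q] J_gap[of q "op X q"] X by (simp add: op_pg add.commute)
  have "op ?D (op (minv ?D) p) = op (1\<^sub>m m) p"
    using op_mult[of ?D m m "minv ?D" m p] mi X by simp
  then have "nrm (op pg (op (1\<^sub>m m) p)) \<le> nrm (op (1\<^sub>m m) p)" using c[of "op (minv ?D) p"] by simp
  moreover have "op pg (op (1\<^sub>m m) p) = op pg p" by (rule op_op_one[OF pg])
  moreover have "nrm (op (1\<^sub>m m) p) \<le> nrm p"
    using pip_split[of p p m] nrm_nonneg[of "p - op (1\<^sub>m m) p"] by simp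
  ultimately show "nrm (op pg p) \<le> nrm p" by simp
qed

end

end

text \<open>2 |Y^* p|^2 = 2 Re <p, Y Y^* p> is at most |p|^2 + |Y Y^* p|^2, whose last term is at
  most |Y^* p|^2.\<close>

lemma contractive_adjoint:
  assumes Y: "\<And>p. nrm (op Y p) \<le> nrm p"
  shows "nrm (op (mat_adjoint Y) p) \<le> nrm p"
proof -
  define a where "a = op (mat_adjoint Y) p"
  have cs: "2 * Re (pip u v) \<le> nrm u + nrm v" for u v
  proof -
    have "0 \<le> nrm (u - v)" by (rule nrm_nonneg)
    moreover have "Re (pip v u) = Re (pip u v)" by (subst cip.ip_cnj[symmetric]) simp
    ultimately show ?thesis by (simp add: cip.ip_diff_left cip.ip_diff_right)
  qed
  have "pip a a = pip p (op Y a)"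
    unfolding a_def using op_adj[of "mat_adjoint Y" p "op (mat_adjoint Y) p"] by simp
  then have "2 * nrm a \<le> nrm p + nrm (op Y a)" using cs[of p "op Y a"] by simp
  with Y[of a] show ?thesis unfolding a_def by simp
qed

text \<open>Up to signs the adjoint of the transform of X is the transform of the adjoint of X: it
  maps a to b. It is a contraction together with the transform itself, and |b| <= |a| is the
  required inequality once the components are sorted by P and Q.\<close>

lemma J_contractive_adjoint:
  assumes sig: "sig_mat m J" and X: "X \<in> carrier_mat m m" and contr: "psd m (J - mat_adjoint X * J * X)"
  shows "psd m (J - X * J * mat_adjoint X)"
proof (rule psd_pipI)
  have J: "J \<in> carrier_mat m m" "mat_adjoint J = J" using sig by (auto simp: sig_mat_def)
  show "J - X * J * mat_adjoint X \<in> carrier_mat m m" using X J by (intro minus_carrier_mat) simp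
  have "mat_adjoint (X * J * mat_adjoint X) = X * J * mat_adjoint X"
    using X J by (simp add: mat_adjoint_mult[of _ m m _ m] assoc_mult_mat[of _ m m _ m _ m])
  then show "mat_adjoint (J - X * J * mat_adjoint X) = J - X * J * mat_adjoint X"
    using X J by (subst mat_adjoint_minus[of _ m m]) auto
  fix p
  let ?P = "J_plus m J" and ?Q = "J_minus m J" and ?Y = "pg m J X" and ?Xs = "mat_adjoint X"
  note Y = pg_facts[OF sig X contr]
  note pm = J_pm_mult[OF sig]
  define a where "a = op ?P p - op ?Q (op ?Xs p)"
  define b where "b = op ?P (op ?Xs p) - op ?Q p"
  have adjs: "pip (op ?Xs u) v = pip u (op X v)" for u v by (simp add: op_adj)
  have P: "op ?P v = op (1\<^sub>m m) v - op ?Q v" for v using J_pm_sum(1)[OF sig, of v] by (simp add: eq_diff_eq)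
  have tr: "pip (op ?Xs u) (op (1\<^sub>m m) v) = pip u (op X v)" for u v
    using pip_trunc_right[of m "op ?Xs u" v] trunc_op[of ?Xs m m u] X by (simp add: adjs)
  have Xt: "op (1\<^sub>m m) (op X p) = op X p" for p using X by (rule op_one_op)
  have Xst: "op (1\<^sub>m m) (op ?Xs p) = op ?Xs p" for p using X by (intro op_one_op[where a=m]) simp
  have inv: "\<exists>q. op (pg_den m J X) q = op (1\<^sub>m m) u" for u
  proof -
    note mi = minv_det[OF pg_carrier(1)[OF sig X] pg_den_det[OF sig X contr]]
    show ?thesis using op_mult[of "pg_den m J X" m m "minv (pg_den m J X)" m u] mi X sig
      by (intro exI[of _ "op (minv (pg_den m J X)) u"]) simp
  qed
  \<comment> \<open>Tested on the range of the denominator, which by invertibility contains every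
    vector below m; both sides have no other coefficients.\<close>
  have "op (mat_adjoint ?Y) a = b"
  proof (rule cip.ip_ext)
    fix u
    obtain q where q: "op (pg_den m J X) q = op (1\<^sub>m m) u" using inv by blast
    have tb: "trunc m a" "trunc m b" "trunc m (op (mat_adjoint ?Y) a)"
      unfolding a_def b_def by (intro trunc_closed trunc_op[of _ m m]; use sig Y(1) in simp)+
    have s: "pip (op (mat_adjoint ?Y) a) u = pip (op (mat_adjoint ?Y) a) (op (pg_den m J X) q)"
      "pip b u = pip b (op (pg_den m J X) q)"
      unfolding q using tb by (simp_all add: pip_trunc_right)
    have "pip (op (mat_adjoint ?Y) a) (op (pg_den m J X) q) = pip a (op (?Y * pg_den m J X) q)"
      using X Y(1) sig by (simp add: op_adj op_mult[of _ m m _ m])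
    also have "\<dots> = pip a (op (pg_num m J X) q)" unfolding Y(2) ..
    also have "\<dots> = pip b (op (pg_den m J X) q)"
      unfolding a_def b_def op_pg[OF sig X]
      by (simp add: cip.ip_diff_left cip.ip_add_right J_pm_sym[OF sig] pm)
        (simp add: P cip.ip_diff_right tr op_op_one[OF X] op_one_op[OF X])
    finally show "pip (op (mat_adjoint ?Y) a) u = pip b u" unfolding s .
  qed
  then have "nrm b \<le> nrm a" using contractive_adjoint[OF Y(5), of a] by simp
  moreover have "pip (op (J - X * J * mat_adjoint X) p) p = pip (op J p) p - pip (op J (op ?Xs p)) (op ?Xs p)"
  proof -
    have "pip (op (J - X * J * mat_adjoint X) p) p = pip (op J p) p - pip (op (X * J * mat_adjoint X) p) p"
      using X J by (subst op_minus[of _ m m]) (auto simp: cip.ip_diff_left)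
    also have "op (X * J * mat_adjoint X) p = op X (op J (op ?Xs p))"
      using X J by (simp add: op_mult[of _ m m _ m])
    also have "pip \<dots> p = pip (op J (op ?Xs p)) (op ?Xs p)"
      by (simp add: op_adj)
    finally show ?thesis .
  qed
  ultimately show "0 \<le> Re (pip (op (J - X * J * mat_adjoint X) p) p)"
    by (simp add: a_def b_def nrm_pm_diff[OF sig] J_form[OF sig])
qed

section \<open>Potapov data of a matrix sequence\<close>

locale potapov_data =
  fixes m n :: nat and J :: "complex mat" and A :: "nat \<Rightarrow> complex mat"
  assumes m: "0 < m" and sig: "sig_mat m J" and A: "\<forall>j\<le>n. A j \<in> carrier_mat m m" and pot: "J_Potapov m J A n"
begin

definition "Jo = opE m J"
definition "Ao k = op (A k)"
definition "Aos k = op (mat_adjoint (A k))"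
definition "R = R_next m J A n"
definition "L = L_next m J A n"
text \<open>Coefficient k of rho and of tau. W is multiplied by a column of descending powers of w,
  so the block belonging to w^k is the one with index n - k.\<close>

definition "Vc k = (if k = 0 then 1\<^sub>m m else mat m m (\<lambda>(i,j). V_box m J A n $$ ((k - 1) * m + i, j)))"
definition "Tc k = (if k = 0 then 1\<^sub>m m else mat m m (\<lambda>(i,j). W_box m J A n $$ (i, (n - k) * m + j)))"
text \<open>At k = 0 the operator is the identity on all polynomials and not the truncation
  \<open>op (1\<^sub>m m)\<close>, since the abstract locale demands \<open>V_0\<close> and
  \<open>Ts_0\<close> for every vector.\<close>

definition "Vo k = (if k = 0 then (\<lambda>p. p) else op (Vc k))"
definition "Vos k = (if k = 0 then (\<lambda>p. p) else op (mat_adjoint (Vc k)))"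
definition "To k = (if k = 0 then (\<lambda>p. p) else op (Tc k))"
definition "Tos k = (if k = 0 then (\<lambda>p. p) else op (mat_adjoint (Tc k)))"

lemma Jc: "J \<in> carrier_mat m m" "mat_adjoint J = J" "J * J = 1\<^sub>m m"
  using sig by (auto simp: sig_mat_def)

lemma Ac: "j \<le> n \<Longrightarrow> A j \<in> carrier_mat m m" "j \<le> n \<Longrightarrow> mat_adjoint (A j) \<in> carrier_mat m m"
  using A by auto

lemma Vc [simp]: "Vc k \<in> carrier_mat m m" and Tc [simp]: "Tc k \<in> carrier_mat m m"
  by (auto simp: Vc_def Tc_def)

sublocale toep: toeplitz Polynomial.smult pip Jo Ao Aos
proof
  show "pip (Jo u) v = pip u (Jo v)" for u v
    unfolding Jo_def using opE_adj[OF Jc(1)] by (simp add: Jc)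
  show "Jo (Jo u) = u" for u
    unfolding Jo_def using opE_opE[OF Jc(1) Jc(1)] by (simp add: Jc opE_one)
  show "pip (Ao k u) v = pip u (Aos k v)" for k u v
    unfolding Ao_def Aos_def by (rule op_adj)
qed (simp_all add: Jo_def Ao_def Aos_def)

sublocale dtoep: toeplitz Polynomial.smult pip Jo Aos Ao
  by (rule toep.dual)

lemma Jo_trunc: "trunc m p \<Longrightarrow> trunc m (Jo p)"
  unfolding Jo_def by (rule trunc_opE[OF Jc(1)])

lemma trunc_Ao: "j \<le> n \<Longrightarrow> trunc m (Ao j p)" "j \<le> n \<Longrightarrow> trunc m (Aos j p)"
  unfolding Ao_def Aos_def by (rule trunc_op, erule Ac)+

lemma trunc_cv: "i \<le> n \<Longrightarrow> trunc m (cv Ao x i)" "i \<le> n \<Longrightarrow> trunc m (cv Aos x i)"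
  unfolding cv_def by (intro trunc_closed trunc_Ao; simp)+

lemma trunc_ac: "N \<le> Suc n \<Longrightarrow> trunc m (ac Ao N x i)" "N \<le> Suc n \<Longrightarrow> trunc m (ac Aos N x i)"
  unfolding ac_def by (intro trunc_closed trunc_Ao; auto)+

lemma trunc_Qop: "N \<le> Suc n \<Longrightarrow> trunc m (x i) \<Longrightarrow> trunc m (Qop Jo Ao Aos N x i)"
  "N \<le> Suc n \<Longrightarrow> trunc m (x i) \<Longrightarrow> trunc m (Qop Jo Aos Ao N x i)"
  unfolding Qop_def by (intro trunc_closed Jo_trunc trunc_ac; simp)+

lemma Ak: "k \<le> n \<Longrightarrow> \<forall>j\<le>k. A j \<in> carrier_mat m m"
  using A by auto

lemma Q_bvec: "k \<le> n \<Longrightarrow> Q_mat m J A k *\<^sub>v bvec m (Suc k) x = bvec m (Suc k) (Qop Jo Ao Aos (Suc k) x)"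
  unfolding Jo_def Ao_def Aos_def by (rule Q_mat_bvec[OF m Ak Jc(1)])

lemma P_bvec: "k \<le> n \<Longrightarrow> P_mat m J A k *\<^sub>v bvec m (Suc k) z = bvec m (Suc k) (\<lambda>i. Qop Jo Aos Ao (Suc k) (\<lambda>i. z (k - i)) (k - i))"
proof -
  assume k: "k \<le> n"
  have "P_mat m J A k *\<^sub>v bvec m (Suc k) z = bvec m (Suc k) (\<lambda>i. Jo (z i) - cv Ao (\<lambda>j. Jo (ac Aos (Suc k) z j)) i)"
    unfolding Jo_def Ao_def Aos_def by (rule P_mat_bvec[OF m Ak[OF k] Jc(1)])
  also have "\<dots> = bvec m (Suc k) (\<lambda>i. Qop Jo Aos Ao (Suc k) (\<lambda>i. z (k - i)) (k - i))"
  proof (rule bvec_cong[OF m])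
    fix i assume "i < Suc k"
    then show "Jo (z i) - cv Ao (\<lambda>j. Jo (ac Aos (Suc k) z j)) i = Qop Jo Aos Ao (Suc k) (\<lambda>i. z (k - i)) (k - i)"
      using toep.Qop_dual_rev[of "k - i" "Suc k" z] by simp
  qed
  finally show ?thesis .
qed

lemma Q_carrier: "Q_mat m J A k \<in> carrier_mat (Suc k * m) (Suc k * m)" "P_mat m J A k \<in> carrier_mat (Suc k * m) (Suc k * m)"
  unfolding Q_mat_def P_mat_def by (intro minus_carrier_mat mult_carrier_square mat_adjoint_carrier; simp add: S_blk_def J_blk_def)+

text \<open>From coefficient m on J acts as the identity and A as 0, so Q leaves these coefficients
  alone. They add their squared norm to the form of the block matrix, which is why positivity holds
  for arbitrary polynomials.\<close>

lemma hdot_bvec_rest: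
  assumes "\<And>i. i < N \<Longrightarrow> y i - op (1\<^sub>m m) (y i) = x i - op (1\<^sub>m m) (x i)"
  shows "(\<Sum>i<N. pip (y i) (x i)) = hdot (N * m) (bvec m N y) (bvec m N x) + (\<Sum>i<N. pip (x i - op (1\<^sub>m m) (x i)) (x i - op (1\<^sub>m m) (x i)))"
  unfolding hdot_bvec[OF m] sum.distrib[symmetric] using assms by (intro sum.cong refl) (subst pip_split[of _ _ m], simp)

lemma Jo_rest: "Jo p - op (1\<^sub>m m) (Jo p) = p - op (1\<^sub>m m) p"
  using op_opE[OF Jc(1), of "1\<^sub>m m" m p] Jc(1) by (simp add: Jo_def) (simp add: opE_def)

lemma Qop_rest:
  assumes "N \<le> Suc n"
  shows "Qop Jo Ao Aos N x i - op (1\<^sub>m m) (Qop Jo Ao Aos N x i) = x i - op (1\<^sub>m m) (x i)"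
    "Qop Jo Aos Ao N x i - op (1\<^sub>m m) (Qop Jo Aos Ao N x i) = x i - op (1\<^sub>m m) (x i)"
  using Jo_rest[of "x i"] trunc_ac[OF assms]
  by (simp_all add: Qop_def cip.lin_diff[OF lin_op] trunc_op_one algebra_simps)

lemma J_blk_hermitian: "mat_adjoint (J_blk m J k) = J_blk m J k"
proof (rule eq_matI)
  fix r c assume "r < dim_row (J_blk m J k)" "c < dim_col (J_blk m J k)"
  then have rc: "r < Suc k * m" "c < Suc k * m" by (simp_all add: J_blk_def)
  have "mat_adjoint (J_blk m J k) $$ (r, c) = cnj (J_blk m J k $$ (c, r))"
    by (rule mat_adjoint_index) (use rc in \<open>simp_all add: J_blk_def\<close>)
  moreover have "cnj (J $$ (c mod m, r mod m)) = J $$ (r mod m, c mod m)"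
  proof -
    have "mat_adjoint J $$ (r mod m, c mod m) = cnj (J $$ (c mod m, r mod m))"
      by (rule mat_adjoint_index) (use Jc(1) m in auto)
    then show ?thesis by (simp add: Jc)
  qed
  ultimately show "mat_adjoint (J_blk m J k) $$ (r, c) = J_blk m J k $$ (r, c)"
    using rc by (simp add: J_blk_def)
qed (simp_all add: J_blk_def)

lemma QP_hermitian: "mat_adjoint (Q_mat m J A k) = Q_mat m J A k" "mat_adjoint (P_mat m J A k) = P_mat m J A k"
proof -
  define N where "N = Suc k * m"
  have c: "S_blk m A k \<in> carrier_mat N N" "J_blk m J k \<in> carrier_mat N N"
    by (simp_all add: S_blk_def J_blk_def N_def)
  note assoc = assoc_mult_mat[of _ N N _ N _ N]
  show "mat_adjoint (Q_mat m J A k) = Q_mat m J A k"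
    unfolding Q_mat_def using c
    by (subst mat_adjoint_minus[of _ N N]) (simp_all add: mat_adjoint_mult[of _ N N _ N] J_blk_hermitian assoc)
  show "mat_adjoint (P_mat m J A k) = P_mat m J A k"
    unfolding P_mat_def using c
    by (subst mat_adjoint_minus[of _ N N]) (simp_all add: mat_adjoint_mult[of _ N N _ N] J_blk_hermitian assoc)
qed

lemma J_blk_sig: "sig_mat (Suc n * m) (J_blk m J n)"
proof -
  let ?N = "Suc n * m"
  have c: "J_blk m J n \<in> carrier_mat ?N ?N" by (simp add: J_blk_def)
  have Jb: "J_blk m J n *\<^sub>v bvec m (Suc n) x = bvec m (Suc n) (\<lambda>i. Jo (x i))" for x
    unfolding Jo_def by (rule J_blk_bvec[OF m A Jc(1)])
  have "J_blk m J n * J_blk m J n = 1\<^sub>m ?N"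
  proof (rule mat_col_eqI)
    fix j assume "j < dim_col (1\<^sub>m ?N :: complex mat)"
    then have j: "j < ?N" by simp
    have u: "unit_vec ?N j = bvec m (Suc n) (unb m (unit_vec ?N j))"
      by (rule bvec_unb[OF m, symmetric]) simp
    have "col (J_blk m J n * J_blk m J n) j = J_blk m J n *\<^sub>v (J_blk m J n *\<^sub>v unit_vec ?N j)"
    proof -
      have cu: "B *\<^sub>v unit_vec ?N j = col B j" if "B \<in> carrier_mat ?N ?N" for B :: "complex mat"
        using that j by (intro eq_vecI) (auto simp: scalar_prod_right_unit[of _ ?N] simp del: mult_Suc)
      show ?thesis
        unfolding cu[OF c] by (rule col_mult2[OF c c j])
    qed
    also have "\<dots> = unit_vec ?N j"
    proof -
      have "J_blk m J n *\<^sub>v (J_blk m J n *\<^sub>v bvec m (Suc n) x) = bvec m (Suc n) x" for x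
        by (simp only: Jb toep.J_J)
      from this[of "unb m (unit_vec ?N j)"] show ?thesis unfolding u[symmetric] .
    qed
    finally show "col (J_blk m J n * J_blk m J n) j = col (1\<^sub>m ?N) j" using j by simp
  qed (use c in auto)
  then show ?thesis using c by (simp add: sig_mat_def J_blk_hermitian)
qed

lemma psd_Q: "psd (Suc n * m) (Q_mat m J A n)"
  using pot by (simp add: J_Potapov_def)

text \<open>Q >= 0 says that the block matrix S is contractive for the block signature matrix, so
  its adjoint is too.\<close>

lemma psd_P: "psd (Suc n * m) (P_mat m J A n)"
  unfolding P_mat_def
  by (rule J_contractive_adjoint[OF J_blk_sig]) (use psd_Q in \<open>simp_all add: S_blk_def Q_mat_def\<close>)

lemma hdot_psd:
  assumes "psd N M" "v \<in> carrier_vec N"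
  shows "0 \<le> Re (hdot N (M *\<^sub>v v) v)"
  using assms unfolding psd_def hdot_def by (simp add: mult.commute)

lemma Q_pos: "0 \<le> Re (\<Sum>i<Suc n. pip (Qop Jo Ao Aos (Suc n) x i) (x i))"
proof -
  have "(\<Sum>i<Suc n. pip (Qop Jo Ao Aos (Suc n) x i) (x i)) =
      hdot (Suc n * m) (Q_mat m J A n *\<^sub>v bvec m (Suc n) x) (bvec m (Suc n) x)
      + (\<Sum>i<Suc n. pip (x i - op (1\<^sub>m m) (x i)) (x i - op (1\<^sub>m m) (x i)))"
    unfolding Q_bvec[OF order.refl] by (rule hdot_bvec_rest) (rule Qop_rest, simp)
  moreover have "0 \<le> Re (\<Sum>i<Suc n. pip (x i - op (1\<^sub>m m) (x i)) (x i - op (1\<^sub>m m) (x i)))"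
    unfolding Re_sum by (intro sum_nonneg nrm_nonneg)
  ultimately show ?thesis
    using hdot_psd[OF psd_Q bvec_carrier(1), of x] by (simp only: plus_complex.simps add_nonneg_nonneg)
qed

lemma P_pos: "0 \<le> Re (\<Sum>i<Suc n. pip (Qop Jo Aos Ao (Suc n) x i) (x i))"
proof -
  let ?z = "\<lambda>i. x (n - i)" and ?Q = "Qop Jo Aos Ao (Suc n)"
  have Qz: "?Q (\<lambda>i. ?z (n - i)) i = ?Q x i" if "i < Suc n" for i
    by (rule Qop_cong) (use that in auto)
  have "(\<Sum>i<Suc n. pip (?Q x i) (x i)) = (\<Sum>i<Suc n. pip (?Q x (Suc n - 1 - i)) (x (Suc n - 1 - i)))"
    by (rule sum_rev[symmetric])
  also have "\<dots> = (\<Sum>i<Suc n. pip (?Q (\<lambda>i. ?z (n - i)) (n - i)) (?z i))"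
    by (intro sum.cong refl) (simp add: Qz)
  also have "\<dots> = hdot (Suc n * m) (P_mat m J A n *\<^sub>v bvec m (Suc n) ?z) (bvec m (Suc n) ?z)
      + (\<Sum>i<Suc n. pip (?z i - op (1\<^sub>m m) (?z i)) (?z i - op (1\<^sub>m m) (?z i)))"
    unfolding P_bvec[OF order.refl] by (rule hdot_bvec_rest) (use Qop_rest(2)[of "Suc n"] in \<open>simp add: Qz\<close>)
  finally have e: "(\<Sum>i<Suc n. pip (?Q x i) (x i)) =
      hdot (Suc n * m) (P_mat m J A n *\<^sub>v bvec m (Suc n) ?z) (bvec m (Suc n) ?z)
      + (\<Sum>i<Suc n. pip (?z i - op (1\<^sub>m m) (?z i)) (?z i - op (1\<^sub>m m) (?z i)))" .
  have "0 \<le> Re (\<Sum>i<Suc n. pip (?z i - op (1\<^sub>m m) (?z i)) (?z i - op (1\<^sub>m m) (?z i)))"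
    unfolding Re_sum by (intro sum_nonneg nrm_nonneg)
  then show ?thesis
    unfolding e using hdot_psd[OF psd_P bvec_carrier(1), of ?z]
    by (simp only: plus_complex.simps add_nonneg_nonneg)
qed

lemma col_bvec:
  assumes B: "B \<in> carrier_mat (N * m) m" and C: "\<And>i. i < N \<Longrightarrow> C i = mat m m (\<lambda>(a,b). B $$ (i * m + a, b))"
  shows "bvec m N (\<lambda>i. op (C i) p) = B *\<^sub>v vpol m p"
proof (rule eq_vecI)
  fix r assume "r < dim_vec (B *\<^sub>v vpol m p)"
  then have r: "r < N * m" using B by simp
  have "vec_index (B *\<^sub>v vpol m p) r = (\<Sum>j<m. B $$ (r, j) * coeff p j)"
    using mult_vec_index[OF B vpol_carrier(1) r, of p] by simp
  then show "vec_index (bvec m N (\<lambda>i. op (C i) p)) r = vec_index (B *\<^sub>v vpol m p) r"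
    using r div_lt(1)[OF m r] div_lt(2)[OF m, of r] C by (simp add: bvec_def coeff_op)
qed (use B in simp)

lemma row_bvec:
  assumes B: "B \<in> carrier_mat m (N * m)" and C: "\<And>i. i < N \<Longrightarrow> C i = mat m m (\<lambda>(a,b). B $$ (a, i * m + b))"
  shows "B *\<^sub>v bvec m N x = vpol m (\<Sum>i<N. op (C i) (x i))"
proof (rule eq_vecI)
  fix r assume "r < dim_vec (vpol m (\<Sum>i<N. op (C i) (x i)))"
  then have r: "r < m" by simp
  have "vec_index (B *\<^sub>v bvec m N x) r = (\<Sum>i<N. \<Sum>l<m. B $$ (r, i * m + l) * coeff (x i) l)"
    unfolding mult_vec_index[OF B bvec_carrier(1) r] sum_blocks
    by (intro sum.cong refl) (simp add: bvec_index_block[OF m])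
  also have "\<dots> = (\<Sum>i<N. coeff (op (C i) (x i)) r)"
    using r by (intro sum.cong refl) (simp add: coeff_op C)
  finally show "vec_index (B *\<^sub>v bvec m N x) r = vec_index (vpol m (\<Sum>i<N. op (C i) (x i))) r"
    using r by (simp add: coeff_sum)
qed (use B in simp)

lemma pvec_vpol: "trunc m p \<Longrightarrow> pvec (vpol m p) = p"
  by (auto simp: poly_eq_iff coeff_pvec trunc_def)

lemma y_col_carrier: "y_col m A k \<in> carrier_mat (k * m) m" "z_row m A k \<in> carrier_mat m (k * m)"
  by (simp_all add: y_col_def z_row_def)

lemma y_block: "i < n \<Longrightarrow> A (Suc i) = mat m m (\<lambda>(a,b). y_col m A n $$ (i * m + a, b))"
  and y_block_adj: "i < n \<Longrightarrow> mat_adjoint (A (Suc i)) = mat m m (\<lambda>(a,b). mat_adjoint (y_col m A n) $$ (a, i * m + b))"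
proof -
  assume i: "i < n"
  have Ai: "A (Suc i) \<in> carrier_mat m m" using A i by simp
  have e: "y_col m A n $$ (i * m + a, b) = A (Suc i) $$ (a, b)" if "a < m" "b < m" for a b
    using that block_lt[OF m i that(1)] div_mod_block[OF m that(1), of i] by (simp add: y_col_def)
  show "A (Suc i) = mat m m (\<lambda>(a,b). y_col m A n $$ (i * m + a, b))"
    using Ai by (intro eq_matI) (auto simp: e)
  have e': "mat_adjoint (y_col m A n) $$ (a, i * m + b) = cnj (A (Suc i) $$ (b, a))" if "a < m" "b < m" for a b
    using that block_lt[OF m i that(2)] y_col_carrier(1)[of n] by (subst mat_adjoint_index) (auto simp: e)
  show "mat_adjoint (A (Suc i)) = mat m m (\<lambda>(a,b). mat_adjoint (y_col m A n) $$ (a, i * m + b))"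
    using Ai by (intro eq_matI) (auto simp: e')
qed

lemma z_block: "i < n \<Longrightarrow> A (n - i) = mat m m (\<lambda>(a,b). z_row m A n $$ (a, i * m + b))"
  and z_block_adj: "i < n \<Longrightarrow> mat_adjoint (A (n - i)) = mat m m (\<lambda>(a,b). mat_adjoint (z_row m A n) $$ (i * m + a, b))"
proof -
  assume i: "i < n"
  have Ai: "A (n - i) \<in> carrier_mat m m" using A i by simp
  have e: "z_row m A n $$ (a, i * m + b) = A (n - i) $$ (a, b)" if "a < m" "b < m" for a b
    using that block_lt[OF m i that(2)] div_mod_block[OF m that(2), of i] by (simp add: z_row_def)
  show "A (n - i) = mat m m (\<lambda>(a,b). z_row m A n $$ (a, i * m + b))"
    using Ai by (intro eq_matI) (auto simp: e)
  have e': "mat_adjoint (z_row m A n) $$ (i * m + a, b) = cnj (A (n - i) $$ (b, a))" if "a < m" "b < m" for a b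
    using that block_lt[OF m i that(1)] y_col_carrier(2)[of n] by (subst mat_adjoint_index) (auto simp: e)
  show "mat_adjoint (A (n - i)) = mat m m (\<lambda>(a,b). mat_adjoint (z_row m A n) $$ (i * m + a, b))"
    using Ai by (intro eq_matI) (auto simp: e')
qed

lemma Aos_J_Ao: "Aos 0 (Jo (Ao 0 p)) = op (mat_adjoint (A 0) * J * A 0) p"
  and Ao_J_Aos: "Ao 0 (Jo (Aos 0 p)) = op (A 0 * J * mat_adjoint (A 0)) p"
proof -
  have A0: "A 0 \<in> carrier_mat m m" "mat_adjoint (A 0) \<in> carrier_mat m m" using Ac[of 0] by auto
  have *: "op X (Jo (op Y p)) = op (X * J * Y) p" if "X \<in> carrier_mat m m" "Y \<in> carrier_mat m m" for X Y
    unfolding Jo_def opE_op[OF Jc(1) that(2)] assoc_mult_mat[OF that(1) Jc(1) that(2)]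
    by (rule op_mult[symmetric, OF that(1) mult_carrier_mat[OF Jc(1) that(2)]])
  show "Aos 0 (Jo (Ao 0 p)) = op (mat_adjoint (A 0) * J * A 0) p"
    "Ao 0 (Jo (Aos 0 p)) = op (A 0 * J * mat_adjoint (A 0)) p"
    unfolding Aos_def Ao_def by (intro * A0)+
qed

section \<open>Solving the block equations for n >= 1\<close>

context
  fixes k :: nat assumes n: "n = Suc k"
begin

abbreviation (input) "Qm \<equiv> Q_mat m J A k"
abbreviation (input) "Pm \<equiv> P_mat m J A k"
abbreviation (input) "Sm \<equiv> S_blk m A k"
abbreviation (input) "Jm \<equiv> J_blk m J k"

lemma nk: "n - 1 = k" "n - Suc 0 = k" "n \<noteq> 0"
  using n by simp_all

lemma carriers: "Qm \<in> carrier_mat (n * m) (n * m)" "Pm \<in> carrier_mat (n * m) (n * m)"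
  "Sm \<in> carrier_mat (n * m) (n * m)" "Jm \<in> carrier_mat (n * m) (n * m)"
  "y_col m A n \<in> carrier_mat (n * m) m" "z_row m A n \<in> carrier_mat m (n * m)"
  unfolding n by (rule Q_carrier y_col_carrier | simp add: S_blk_def J_blk_def)+

lemmas mpQ = mp_inv_hermitian[OF carriers(1) QP_hermitian(1)]
lemmas mpP = mp_inv_hermitian[OF carriers(2) QP_hermitian(2)]

lemma Qm_bvec: "Qm *\<^sub>v bvec m n x = bvec m n (Qop Jo Ao Aos n x)"
  using Q_bvec[of k x] by (simp only: n le_SucI order.refl)

lemma Pm_bvec: "Pm *\<^sub>v bvec m n z = bvec m n (\<lambda>i. Qop Jo Aos Ao n (\<lambda>i. z (k - i)) (k - i))"
  using P_bvec[of k z] by (simp only: n le_SucI order.refl)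

lemma Sm_bvec: "Sm *\<^sub>v bvec m n x = bvec m n (cv Ao x)" "mat_adjoint Sm *\<^sub>v bvec m n x = bvec m n (ac Aos n x)"
    "Jm *\<^sub>v bvec m n x = bvec m n (\<lambda>i. Jo (x i))"
  unfolding n Ao_def Aos_def Jo_def
  by (rule S_blk_bvec[OF m Ak Jc(1)] S_blk_adj_bvec[OF m Ak Jc(1)] J_blk_bvec[OF m Ak Jc(1)]; simp add: n)+

lemma y_bvec: "bvec m n (\<lambda>i. Ao (Suc i) p) = y_col m A n *\<^sub>v vpol m p"
  unfolding Ao_def by (rule col_bvec[OF carriers(5) y_block])

lemma y_adj_bvec: "mat_adjoint (y_col m A n) *\<^sub>v bvec m n x = vpol m (\<Sum>i<n. Aos (Suc i) (x i))"
  unfolding Aos_def by (rule row_bvec[OF mat_adjoint_carrier[OF carriers(5)] y_block_adj])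

lemma z_bvec: "z_row m A n *\<^sub>v bvec m n x = vpol m (\<Sum>i<n. Ao (n - i) (x i))"
  unfolding Ao_def by (rule row_bvec[OF carriers(6) z_block])

lemma z_adj_bvec: "bvec m n (\<lambda>i. Aos (n - i) p) = mat_adjoint (z_row m A n) *\<^sub>v vpol m p"
  unfolding Aos_def by (rule col_bvec[OF mat_adjoint_carrier[OF carriers(6)] z_block_adj])

lemma V_bvec: "bvec m n (\<lambda>i. op (Vc (Suc i)) p) = mp_inv Qm *\<^sub>v bvec m n (ac Aos n (\<lambda>l. Jo (Ao (Suc l) p)))"
proof -
  have V: "V_box m J A n = mp_inv Qm * mat_adjoint Sm * Jm * y_col m A n"
    by (simp add: V_box_def n)
  have Vcar: "V_box m J A n \<in> carrier_mat (n * m) m"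
    unfolding V using carriers mpQ(1) by (intro mult_carrier_mat[of _ _ "n * m"]) auto
  have "bvec m n (\<lambda>i. op (Vc (Suc i)) p) = V_box m J A n *\<^sub>v vpol m p"
    by (rule col_bvec[OF Vcar]) (simp add: Vc_def)
  also have "\<dots> = mp_inv Qm *\<^sub>v (mat_adjoint Sm *\<^sub>v (Jm *\<^sub>v (y_col m A n *\<^sub>v vpol m p)))"
    unfolding V using carriers mpQ(1)
    by (simp add: assoc_mult_mat_vec[of _ "n * m" "n * m" _ "n * m"] assoc_mult_mat_vec[of _ "n * m" "n * m" _ m]
        mult_mat_vec_carrier[of _ "n * m" m])
  finally show ?thesis by (simp only: y_bvec[symmetric] Sm_bvec)
qed

lemma W_bvec: "bvec m n (\<lambda>i. op (mat_adjoint (Tc (n - i))) p) = mp_inv Pm *\<^sub>v bvec m n (cv Ao (\<lambda>i. Jo (Aos (n - i) p)))"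
proof -
  have W: "W_box m J A n = z_row m A n * Jm * mat_adjoint Sm * mp_inv Pm"
    by (simp add: W_box_def n)
  have Wcar: "W_box m J A n \<in> carrier_mat m (n * m)"
    unfolding W using carriers mpP(1) by (intro mult_carrier_mat[of _ _ "n * m"]) auto
  have Wadj: "mat_adjoint (W_box m J A n) = mp_inv Pm * (Sm * (Jm * mat_adjoint (z_row m A n)))"
    unfolding W using carriers mpP(1)
    by (simp add: mat_adjoint_mult[of _ m "n * m" _ "n * m"] mult_carrier_mat[of _ m "n * m"] mpP(4) J_blk_hermitian)
  have blk: "mat_adjoint (Tc (n - i)) = mat m m (\<lambda>(a,b). mat_adjoint (W_box m J A n) $$ (i * m + a, b))" if "i < n" for i
  proof -
    have e: "mat_adjoint (W_box m J A n) $$ (i * m + a, b) = cnj (W_box m J A n $$ (b, i * m + a))" if "a < m" "b < m" for a b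
      using that block_lt[OF m \<open>i < n\<close> that(1)] Wcar by (subst mat_adjoint_index) auto
    show ?thesis using \<open>i < n\<close> by (intro eq_matI) (auto simp: e Tc_def)
  qed
  have "bvec m n (\<lambda>i. op (mat_adjoint (Tc (n - i))) p) = mat_adjoint (W_box m J A n) *\<^sub>v vpol m p"
    by (rule col_bvec[OF mat_adjoint_carrier[OF Wcar] blk])
  also have "\<dots> = mp_inv Pm *\<^sub>v (Sm *\<^sub>v (Jm *\<^sub>v (mat_adjoint (z_row m A n) *\<^sub>v vpol m p)))"
    unfolding Wadj using carriers mpP(1)
    by (simp add: assoc_mult_mat_vec[of _ "n * m" "n * m" _ m] mult_carrier_mat[of _ "n * m" "n * m" _ m])
  finally show ?thesis by (simp only: z_adj_bvec[symmetric] Sm_bvec)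
qed

lemma bvec_zeroD: "bvec m n x = 0\<^sub>v (n * m) \<Longrightarrow> i < n \<Longrightarrow> trunc m (x i) \<Longrightarrow> x i = 0"
  using bvec_eqD[OF m, of n x "\<lambda>_. 0" i] bvec_zeroI[OF m, of n "\<lambda>_. 0"] by (simp add: trunc_closed)

text \<open>That the pseudoinverse really solves the equation, instead of only approximating a
  solution, is due to the orthogonality of the right-hand side to the kernel,
  \<open>Qop_kernel_orth\<close>.\<close>

lemma V_sol:
  assumes "i < n"
  shows "Qop Jo Ao Aos n (\<lambda>i. op (Vc (Suc i)) p) i = ac Aos n (\<lambda>l. Jo (Ao (Suc l) p)) i"
proof -
  let ?b = "ac Aos n (\<lambda>l. Jo (Ao (Suc l) p))"
  have tb: "trunc m (?b i)" for i by (rule trunc_ac) simp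
  have "Qm *\<^sub>v (mp_inv Qm *\<^sub>v bvec m n ?b) = bvec m n ?b"
  proof (rule mp_solve[OF carriers(1) QP_hermitian(1) bvec_carrier(1)])
    fix x assume x: "x \<in> carrier_vec (n * m)" "Qm *\<^sub>v x = 0\<^sub>v (n * m)"
    let ?x = "unb m x"
    have xb: "x = bvec m n ?x" using bvec_unb[OF m x(1)] ..
    have "bvec m n (Qop Jo Ao Aos n ?x) = 0\<^sub>v (n * m)" using x(2) xb Qm_bvec by metis
    then have ker: "Qop Jo Ao Aos n ?x i = 0" if "i < n" for i
      using that by (rule bvec_zeroD) (intro trunc_Qop trunc_unb, simp)
    have "hdot (n * m) (bvec m n ?b) (bvec m n ?x) = (\<Sum>i<n. pip (?b i) (?x i))"
      by (rule hdot_bvec_trunc[OF m tb])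
    also have "\<dots> = (\<Sum>i<n. pip (Jo (Ao (Suc i) p)) (cv Ao ?x i))"
      by (rule toep.ip_ac)
    also have "\<dots> = pip p (\<Sum>i<n. Aos (Suc i) (Jo (cv Ao ?x i)))"
      by (simp add: toep.J_adj toep.A_adj cip.ip_sum_right)
    also have "\<dots> = 0" by (subst toep.Qop_kernel_orth[OF Q_pos ker]) simp_all
    finally show "hdot (n * m) (bvec m n ?b) x = 0" using xb by simp
  qed
  then have "bvec m n (Qop Jo Ao Aos n (\<lambda>i. op (Vc (Suc i)) p)) = bvec m n ?b"
    by (simp only: V_bvec[symmetric] Qm_bvec)
  then show ?thesis
    by (rule bvec_eqD[OF m _ assms]) (intro trunc_Qop trunc_op[of _ m m] tb, simp_all add: tb)
qed

text \<open>The counterpart for P, solvable because \<open>P_pos\<close> gives the dual form of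
  \<open>Qop_kernel_orth\<close>. Most of the work is the reversal of the blocks on both
  sides.\<close>

lemma T_sol:
  assumes i: "i < n"
  shows "Qop Jo Aos Ao n (\<lambda>i. op (mat_adjoint (Tc (Suc i))) p) i = ac Ao n (\<lambda>l. Jo (Aos (Suc l) p)) i"
proof -
  let ?g = "\<lambda>i. Jo (Aos (n - i) p)" and ?z = "\<lambda>i. op (mat_adjoint (Tc (n - i))) p"
  let ?b = "cv Ao ?g"
  have tb: "trunc m (?b i)" if "i < n" for i using that by (intro trunc_cv) simp
  have "Pm *\<^sub>v (mp_inv Pm *\<^sub>v bvec m n ?b) = bvec m n ?b"
  proof (rule mp_solve[OF carriers(2) QP_hermitian(2) bvec_carrier(1)])
    fix x assume x: "x \<in> carrier_vec (n * m)" "Pm *\<^sub>v x = 0\<^sub>v (n * m)"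
    let ?x = "unb m x"
    let ?y = "\<lambda>i. ?x (k - i)"
    have xb: "x = bvec m n ?x" using bvec_unb[OF m x(1)] ..
    have 0: "bvec m n (\<lambda>i. Qop Jo Aos Ao n ?y (k - i)) = 0\<^sub>v (n * m)" using x(2) xb Pm_bvec by metis
    have ker: "Qop Jo Aos Ao n ?y i = 0" if "i < n" for i
    proof -
      have "Qop Jo Aos Ao n ?y (k - (k - i)) = 0"
        by (rule bvec_zeroD[OF 0]) (use n in simp, intro trunc_Qop trunc_unb, simp)
      then show ?thesis using that n by simp
    qed
    have "hdot (n * m) (bvec m n ?b) (bvec m n ?x) = (\<Sum>i<n. pip (?b i) (?x i))"
      by (rule hdot_bvec_trunc[OF m tb])
    also have "\<dots> = (\<Sum>i<n. pip (?g i) (ac Aos n ?x i))"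
      by (rule toep.ip_cv)
    also have "\<dots> = (\<Sum>i<n. pip (?g (n - 1 - i)) (ac Aos n ?x (n - 1 - i)))"
      by (rule sum_rev[symmetric])
    also have "\<dots> = (\<Sum>i<n. pip (Jo (Aos (Suc i) p)) (cv Aos ?y i))"
    proof (intro sum.cong refl)
      fix i assume "i \<in> {..<n}"
      then have i: "i < n" by simp
      have "cv Aos ?y i = ac Aos n (\<lambda>l. ?y (n - 1 - l)) (n - 1 - i)"
        using i by (subst ac_rev) auto
      also have "\<dots> = ac Aos n ?x (n - 1 - i)"
        by (rule ac_cong) (simp add: n)
      finally show "pip (?g (n - 1 - i)) (ac Aos n ?x (n - 1 - i)) = pip (Jo (Aos (Suc i) p)) (cv Aos ?y i)"
        using i by (simp add: Suc_diff_Suc)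
    qed
    also have "\<dots> = pip p (\<Sum>i<n. Ao (Suc i) (Jo (cv Aos ?y i)))"
      by (simp add: toep.J_adj dtoep.A_adj cip.ip_sum_right)
    also have "\<dots> = 0" by (subst dtoep.Qop_kernel_orth[OF P_pos ker]) simp_all
    finally show "hdot (n * m) (bvec m n ?b) x = 0" using xb by simp
  qed
  then have "bvec m n (\<lambda>i. Qop Jo Aos Ao n (\<lambda>i. ?z (k - i)) (k - i)) = bvec m n ?b"
    by (simp only: W_bvec[symmetric] Pm_bvec)
  then have "Qop Jo Aos Ao n (\<lambda>i. ?z (k - i)) (k - (k - i)) = ?b (k - i)"
  proof (rule bvec_eqD[OF m])
    show "k - i < n" using n by simp
    then show "trunc m (?b (k - i))" by (rule tb)
    show "trunc m (Qop Jo Aos Ao n (\<lambda>i. ?z (k - i)) (k - (k - i)))"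
      by (intro trunc_Qop trunc_op[of _ m m]) simp_all
  qed
  moreover have "Qop Jo Aos Ao n (\<lambda>i. ?z (k - i)) i = Qop Jo Aos Ao n (\<lambda>i. op (mat_adjoint (Tc (Suc i))) p) i"
    by (rule Qop_cong) (use i n in \<open>auto simp: Suc_diff_le\<close>)
  moreover have "?b (n - 1 - i) = ac Ao n (\<lambda>l. ?g (n - 1 - l)) i"
    using i by (rule ac_rev[symmetric])
  moreover have "ac Ao n (\<lambda>l. ?g (n - 1 - l)) i = ac Ao n (\<lambda>l. Jo (Aos (Suc l) p)) i"
    by (rule ac_cong) (simp add: Suc_diff_Suc)
  moreover have "k - (k - i) = i" "n - 1 - i = k - i" using i n by auto
  ultimately show ?thesis by simp
qed

text \<open>V is built with Q^+ but \<open>R_next\<close> with P^+. The vector w is the solution P^+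
  yields, and \<open>central_extension_R\<close> allows it to replace the one obtained from
  V.\<close>

lemma R_sol: "Qop Jo Ao Aos (Suc n) (case_nat p (\<lambda>i. op (Vc (Suc i)) p)) 0 = opE m R p"
proof -
  define b where "b i = Ao (Suc i) p + cv Ao (\<lambda>i. op (Vc (Suc i)) p) i" for i
  define w where "w = mp_inv Pm *\<^sub>v (y_col m A n *\<^sub>v vpol m p)"
  let ?u = "\<lambda>i. unb m w (n - 1 - i)"
  note ce = toep.central_extension(1)[of n "\<lambda>i. op (Vc (Suc i)) p" p, OF V_sol, folded b_def]
  \<comment> \<open>The column lies in the range of P with J b as a preimage. Hence P^+ applied to
    it is an honest solution, whatever the kernel of P.\<close>
  have yP: "y_col m A n *\<^sub>v vpol m p = Pm *\<^sub>v bvec m n (\<lambda>i. Jo (b i))"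
    unfolding Pm_bvec y_bvec[symmetric]
  proof (rule bvec_cong[OF m])
    fix i assume i: "i < n"
    have "Qop Jo Aos Ao n (\<lambda>i. Jo (b (n - 1 - i))) (k - i) = Ao (n - (k - i)) p"
      by (rule ce) (use i n in auto)
    then show "Ao (Suc i) p = Qop Jo Aos Ao n (\<lambda>i. Jo (b (k - i))) (k - i)"
      using i n by (simp add: Suc_diff_le)
  qed
  have wc: "w \<in> carrier_vec (n * m)" unfolding w_def using mpP(1) carriers(5) by simp
  have "Pm *\<^sub>v w = y_col m A n *\<^sub>v vpol m p"
    unfolding w_def yP by (rule mp_range[OF carriers(2) QP_hermitian(2) bvec_carrier(1)])
  then have "Pm *\<^sub>v bvec m n (unb m w) = bvec m n (\<lambda>i. Ao (Suc i) p)"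
    by (simp add: bvec_unb[OF m wc] y_bvec)
  then have eq: "bvec m n (\<lambda>i. Qop Jo Aos Ao n (\<lambda>i. unb m w (k - i)) (k - i)) = bvec m n (\<lambda>i. Ao (Suc i) p)"
    by (simp only: Pm_bvec)
  have u: "Qop Jo Aos Ao n ?u i = Ao (n - i) p" if i: "i < n" for i
  proof -
    have "Qop Jo Aos Ao n (\<lambda>i. unb m w (k - i)) (k - (k - i)) = Ao (Suc (k - i)) p"
      by (rule bvec_eqD[OF m eq]) (use n in simp, intro trunc_Qop trunc_unb, use n in \<open>simp_all add: trunc_Ao\<close>)
    then show ?thesis using i n by (simp add: Suc_diff_le)
  qed
  have "Qop Jo Ao Aos (Suc n) (case_nat p (\<lambda>i. op (Vc (Suc i)) p)) 0 =
      Jo p - Aos 0 (Jo (Ao 0 p)) - (\<Sum>i<n. Aos (n - i) (?u i))"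
    by (rule toep.central_extension_R[of n "\<lambda>p i. op (Vc (Suc i)) p", OF V_sol u])
  also have "(\<Sum>i<n. Aos (n - i) (?u i)) = (\<Sum>i<n. Aos (Suc (n - 1 - i)) (?u i))"
    by (intro sum.cong refl) (simp add: Suc_diff_Suc)
  also have "\<dots> = (\<Sum>i<n. Aos (Suc i) (unb m w i))"
    by (rule sum_rev)
  also have "\<dots> = pvec (mat_adjoint (y_col m A n) *\<^sub>v w)"
  proof -
    have "trunc m (\<Sum>i<n. Aos (Suc i) (unb m w i))" by (intro trunc_closed trunc_Ao) simp
    then show ?thesis using y_adj_bvec[of "unb m w"] by (simp add: bvec_unb[OF m wc] pvec_vpol)
  qed
  also have "mat_adjoint (y_col m A n) *\<^sub>v w = (mat_adjoint (y_col m A n) * mp_inv Pm * y_col m A n) *\<^sub>v vpol m p"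
    unfolding w_def using mpP(1) carriers(5)
    by (simp add: assoc_mult_mat_vec[of _ m "n * m" _ m] assoc_mult_mat_vec[of _ m "n * m" _ "n * m"]
        mult_carrier_mat[of _ m "n * m" _ "n * m"] mult_mat_vec_carrier[of _ "n * m" m])
  also have "pvec \<dots> = op (mat_adjoint (y_col m A n) * mp_inv Pm * y_col m A n) p"
    using carriers(5) by (simp add: op_def)
  finally have e: "Qop Jo Ao Aos (Suc n) (case_nat p (\<lambda>i. op (Vc (Suc i)) p)) 0 =
      Jo p - Aos 0 (Jo (Ao 0 p)) - op (mat_adjoint (y_col m A n) * mp_inv Pm * y_col m A n) p" .
  have A0: "A 0 \<in> carrier_mat m m" using A by simp
  have yy: "mat_adjoint (y_col m A n) * mp_inv Pm * y_col m A n \<in> carrier_mat m m"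
    using carriers(5) mpP(1) by (intro mult_carrier_mat[of _ _ "n * m"]) auto
  have "R = J - mat_adjoint (A 0) * J * A 0 - mat_adjoint (y_col m A n) * mp_inv Pm * y_col m A n"
    unfolding R_def R_next_def using nk by simp
  then have "op R p = op J p - op (mat_adjoint (A 0) * J * A 0) p - op (mat_adjoint (y_col m A n) * mp_inv Pm * y_col m A n) p"
    using Jc(1) A0 yy by (simp add: op_minus[of _ m m] minus_carrier_mat)
  moreover note Aos_J_Ao[of p]
  ultimately show ?thesis unfolding e by (simp add: Jo_def opE_def)
qed

lemma L_sol: "Qop Jo Aos Ao (Suc n) (case_nat p (\<lambda>i. op (mat_adjoint (Tc (Suc i))) p)) 0 = opE m L p"
proof -
  define b where "b i = Aos (Suc i) p + cv Aos (\<lambda>i. op (mat_adjoint (Tc (Suc i))) p) i" for i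
  define w where "w = mp_inv Qm *\<^sub>v (mat_adjoint (z_row m A n) *\<^sub>v vpol m p)"
  note ce = dtoep.central_extension(1)[of n "\<lambda>i. op (mat_adjoint (Tc (Suc i))) p" p, OF T_sol, folded b_def]
  have yP: "mat_adjoint (z_row m A n) *\<^sub>v vpol m p = Qm *\<^sub>v bvec m n (\<lambda>i. Jo (b (n - 1 - i)))"
    unfolding Qm_bvec z_adj_bvec[symmetric] by (rule bvec_cong[OF m], rule ce[symmetric])
  have wc: "w \<in> carrier_vec (n * m)" unfolding w_def using mpQ(1) mat_adjoint_carrier[OF carriers(6)] by simp
  have "Qm *\<^sub>v w = mat_adjoint (z_row m A n) *\<^sub>v vpol m p"
    unfolding w_def yP by (rule mp_range[OF carriers(1) QP_hermitian(1) bvec_carrier(1)])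
  then have "Qm *\<^sub>v bvec m n (unb m w) = bvec m n (\<lambda>i. Aos (n - i) p)"
    by (simp add: bvec_unb[OF m wc] z_adj_bvec)
  then have eq: "bvec m n (Qop Jo Ao Aos n (unb m w)) = bvec m n (\<lambda>i. Aos (n - i) p)"
    by (simp only: Qm_bvec)
  have u: "Qop Jo Ao Aos n (unb m w) i = Aos (n - i) p" if i: "i < n" for i
    by (rule bvec_eqD[OF m eq i]) (intro trunc_Qop trunc_unb, simp_all add: trunc_Ao)
  have "Qop Jo Aos Ao (Suc n) (case_nat p (\<lambda>i. op (mat_adjoint (Tc (Suc i))) p)) 0 =
      Jo p - Ao 0 (Jo (Aos 0 p)) - (\<Sum>i<n. Ao (n - i) (unb m w i))"
    by (rule dtoep.central_extension_R[of n "\<lambda>p i. op (mat_adjoint (Tc (Suc i))) p", OF T_sol u])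
  also have "(\<Sum>i<n. Ao (n - i) (unb m w i)) = pvec (z_row m A n *\<^sub>v w)"
  proof -
    have "trunc m (\<Sum>i<n. Ao (n - i) (unb m w i))" by (intro trunc_closed trunc_Ao) simp
    then show ?thesis using z_bvec[of "unb m w"] by (simp add: bvec_unb[OF m wc] pvec_vpol)
  qed
  also have "z_row m A n *\<^sub>v w = (z_row m A n * mp_inv Qm * mat_adjoint (z_row m A n)) *\<^sub>v vpol m p"
    unfolding w_def using mpQ(1) carriers(6)
    by (simp add: assoc_mult_mat_vec[of _ m "n * m" _ m] assoc_mult_mat_vec[of _ m "n * m" _ "n * m"]
        mult_carrier_mat[of _ m "n * m" _ "n * m"] mult_mat_vec_carrier[of _ "n * m" m])
  also have "pvec \<dots> = op (z_row m A n * mp_inv Qm * mat_adjoint (z_row m A n)) p"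
    using carriers(6) by (simp add: op_def)
  finally have e: "Qop Jo Aos Ao (Suc n) (case_nat p (\<lambda>i. op (mat_adjoint (Tc (Suc i))) p)) 0 =
      Jo p - Ao 0 (Jo (Aos 0 p)) - op (z_row m A n * mp_inv Qm * mat_adjoint (z_row m A n)) p" .
  have A0: "A 0 \<in> carrier_mat m m" using A by simp
  have yy: "z_row m A n * mp_inv Qm * mat_adjoint (z_row m A n) \<in> carrier_mat m m"
    using carriers(6) mpQ(1) by (intro mult_carrier_mat[of _ _ "n * m"]) auto
  have "L = J - A 0 * J * mat_adjoint (A 0) - z_row m A n * mp_inv Qm * mat_adjoint (z_row m A n)"
    unfolding L_def L_next_def using nk by simp
  then have "op L p = op J p - op (A 0 * J * mat_adjoint (A 0)) p - op (z_row m A n * mp_inv Qm * mat_adjoint (z_row m A n)) p"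
    using Jc(1) A0 yy by (simp add: op_minus[of _ m m] minus_carrier_mat)
  moreover note Ao_J_Aos[of p]
  ultimately show ?thesis unfolding e by (simp add: Jo_def opE_def)
qed

lemma V_kernel:
  assumes "\<And>i. i < n \<Longrightarrow> Qop Jo Ao Aos n x i = 0"
  shows "(\<Sum>i<n. pip (op (Vc (Suc i)) v) (x i)) = 0"
proof -
  have "Qm *\<^sub>v bvec m n x = 0\<^sub>v (n * m)"
    unfolding Qm_bvec by (rule bvec_zeroI[OF m assms])
  then have "hdot (n * m) (bvec m n (\<lambda>i. op (Vc (Suc i)) v)) (bvec m n x) = 0"
    unfolding V_bvec by (intro mp_kernel[OF carriers(1) QP_hermitian(1)]) simp_all
  moreover have "hdot (n * m) (bvec m n (\<lambda>i. op (Vc (Suc i)) v)) (bvec m n x) = (\<Sum>i<n. pip (op (Vc (Suc i)) v) (x i))"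
    by (rule hdot_bvec_trunc[OF m]) (rule trunc_op[of _ m m], simp)
  ultimately show ?thesis by simp
qed

lemma T_kernel:
  assumes 0: "\<And>i. i < n \<Longrightarrow> Qop Jo Aos Ao n x i = 0"
  shows "(\<Sum>i<n. pip (op (mat_adjoint (Tc (Suc i))) v) (x i)) = 0"
proof -
  let ?z = "\<lambda>i. x (k - i)" and ?T = "\<lambda>i. op (mat_adjoint (Tc (n - i))) v"
  have "Qop Jo Aos Ao n (\<lambda>i. ?z (k - i)) (k - i) = 0" if "i < n" for i
    using Qop_cong[of n "\<lambda>i. ?z (k - i)" x "k - i" Jo Aos Ao] n that 0[of "k - i"] by simp
  then have "Pm *\<^sub>v bvec m n ?z = 0\<^sub>v (n * m)"
    unfolding Pm_bvec by (rule bvec_zeroI[OF m])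
  then have "hdot (n * m) (bvec m n ?T) (bvec m n ?z) = 0"
    unfolding W_bvec by (intro mp_kernel[OF carriers(2) QP_hermitian(2)]) simp_all
  moreover have "hdot (n * m) (bvec m n ?T) (bvec m n ?z) = (\<Sum>i<n. pip (?T i) (?z i))"
    by (rule hdot_bvec_trunc[OF m]) (rule trunc_op[of _ m m], simp)
  moreover have "(\<Sum>i<n. pip (?T i) (?z i)) = (\<Sum>i<n. pip (op (mat_adjoint (Tc (Suc (n - 1 - i)))) v) (x (n - 1 - i)))"
    by (intro sum.cong refl) (simp add: n Suc_diff_le)
  ultimately show ?thesis
    using sum_rev[of "\<lambda>i. pip (op (mat_adjoint (Tc (Suc i))) v) (x i)" n] by simp
qed

end

sublocale pot: potapov Polynomial.smult pip Jo Ao Aos n Vo Vos To Tos "opE m R" "opE m L"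
proof
  show "cip.lin (Vo k)" "cip.lin (Vos k)" "cip.lin (To k)" "cip.lin (Tos k)" for k
    by (simp_all add: Vo_def Vos_def To_def Tos_def) (simp_all add: cip.lin_def)
  show "pip (Vo k u) v = pip u (Vos k v)" "pip (To k u) v = pip u (Tos k v)" for k u v
    by (simp_all add: Vo_def Vos_def To_def Tos_def op_adj)
  show "Vo 0 v = v" "Tos 0 v = v" for v by (simp_all add: Vo_def Tos_def)
  have cn: "(\<lambda>j. Vo j v) = case_nat v (\<lambda>i. op (Vc (Suc i)) v)" "(\<lambda>j. Tos j v) = case_nat v (\<lambda>i. op (mat_adjoint (Tc (Suc i))) v)" for v
    by (auto simp: Vo_def Tos_def fun_eq_iff split: nat.split)
  have A0: "A 0 \<in> carrier_mat m m" using A by simp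
  show "Qop Jo Ao Aos (Suc n) (\<lambda>k. Vo k v) i = (if i = 0 then opE m R v else 0)" if "i \<le> n" for i v
  \<comment> \<open>For n = 0 there is no smaller system: V reduces to the identity and the single
    row of the form is already R.\<close>
  proof (cases n)
    case 0
    have "R = J - mat_adjoint (A 0) * J * A 0" unfolding R_def R_next_def using 0 by simp
    then have "op R v = op J v - op (mat_adjoint (A 0) * J * A 0) v"
      using Jc(1) A0 by (simp add: op_minus[of _ m m])
    moreover note Aos_J_Ao[of v]
    moreover have "i = 0" "{0..<Suc n} = {0}" using that 0 by auto
    ultimately show ?thesis
      by (simp add: Qop_def ac_def cv_def Vo_def) (simp add: Jo_def opE_def)
  next
    case (Suc k)
    show ?thesis
      unfolding cn using R_sol[OF Suc, of v] toep.central_extension(2)[of n "\<lambda>i. op (Vc (Suc i)) v" v, OF V_sol[OF Suc]] that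
      by (cases i) auto
  qed
  show "Qop Jo Aos Ao (Suc n) (\<lambda>k. Tos k v) i = (if i = 0 then opE m L v else 0)" if "i \<le> n" for i v
  proof (cases n)
    case 0
    have "L = J - A 0 * J * mat_adjoint (A 0)" unfolding L_def L_next_def using 0 by simp
    then have "op L v = op J v - op (A 0 * J * mat_adjoint (A 0)) v"
      using Jc(1) A0 by (simp add: op_minus[of _ m m])
    moreover note Ao_J_Aos[of v]
    moreover have "i = 0" "{0..<Suc n} = {0}" using that 0 by auto
    ultimately show ?thesis
      by (simp add: Qop_def ac_def cv_def Tos_def) (simp add: Jo_def opE_def)
  next
    case (Suc k)
    show ?thesis
      unfolding cn using L_sol[OF Suc, of v] dtoep.central_extension(2)[of n "\<lambda>i. op (mat_adjoint (Tc (Suc i))) v" v, OF T_sol[OF Suc]] that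
      by (cases i) auto
  qed
  show "(\<Sum>i<n. pip (Vo (Suc i) v) (x i)) = 0" if "\<And>i. i < n \<Longrightarrow> Qop Jo Ao Aos n x i = 0" for x v
  proof (cases "n = 0")
    case True
    then have "{..<n} = {}" by simp
    then show ?thesis by (simp only: sum.empty)
  next
    case False
    then have "n = Suc (n - 1)" by simp
    from V_kernel[OF this that, of v] show ?thesis by (simp add: Vo_def)
  qed
  show "(\<Sum>i<n. pip (Tos (Suc i) v) (x i)) = 0" if "\<And>i. i < n \<Longrightarrow> Qop Jo Aos Ao n x i = 0" for x v
  proof (cases "n = 0")
    case True
    then have "{..<n} = {}" by simp
    then show ?thesis by (simp only: sum.empty)
  next
    case False
    then have "n = Suc (n - 1)" by simp
    from T_kernel[OF this that, of v] show ?thesis by (simp add: Tos_def)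
  qed
qed

end

section \<open>The resolvent matrix polynomials\<close>

lemma taylor_coeff_polynomial:
  assumes "k \<le> n"
  shows "(deriv ^^ k) (\<lambda>z. \<Sum>l\<le>n. c l * z ^ l) 0 / of_nat (fact k) = (c k :: complex)"
proof -
  have "(\<lambda>z. \<Sum>l\<le>n. c l * z ^ l) has_fps_expansion (\<Sum>l\<le>n. fps_const (c l) * fps_X ^ l)"
    by (intro fps_expansion_intros)
  from fps_nth_fps_expansion[OF this, of k]
  have "(deriv ^^ k) (\<lambda>z. \<Sum>l\<le>n. c l * z ^ l) 0 / fact k = (\<Sum>l\<le>n. c l * (if k = l then 1 else 0))"
    by (simp add: fps_sum_nth)
  also have "\<dots> = (\<Sum>l\<le>n. if l = k then c k else 0)"
    by (intro sum.cong) auto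
  finally show ?thesis using assms by simp
qed

lemma mat_tilde_poly:
  assumes b: "\<And>z i j. i < m \<Longrightarrow> j < m \<Longrightarrow> b z $$ (i, j) = (\<Sum>k\<le>n. z ^ k * B k $$ (i, j))"
  shows "mat_tilde m n b w = mat m m (\<lambda>(i,j). \<Sum>k\<le>n. w ^ (n - k) * cnj (B k $$ (j, i)))"
proof -
  have "(deriv ^^ k) (\<lambda>z. b z $$ (j, i)) 0 / of_nat (fact k) = B k $$ (j, i)" if "i < m" "j < m" "k \<le> n" for i j k
    using taylor_coeff_polynomial[OF that(3), of "\<lambda>k. B k $$ (j, i)"] that by (simp add: b mult.commute)
  then show ?thesis
    unfolding mat_tilde_def
    by (intro eq_matI) (simp_all del: of_nat_fact complex_cnj_divide cong: sum.cong_simp)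
qed

lemma coeff_sum_op: "X \<in> carrier_mat m m \<Longrightarrow> (\<And>k. k \<in> I \<Longrightarrow> C k \<in> carrier_mat m m) \<Longrightarrow>
    (\<And>i j. i < m \<Longrightarrow> j < m \<Longrightarrow> X $$ (i, j) = (\<Sum>k\<in>I. a k * C k $$ (i, j))) \<Longrightarrow>
    op X p = (\<Sum>k\<in>I. Polynomial.smult (a k) (op (C k) p))"
proof (rule poly_eqI)
  fix i
  assume X: "X \<in> carrier_mat m m" and C: "\<And>k. k \<in> I \<Longrightarrow> C k \<in> carrier_mat m m"
    and e: "\<And>i j. i < m \<Longrightarrow> j < m \<Longrightarrow> X $$ (i, j) = (\<Sum>k\<in>I. a k * C k $$ (i, j))"
  show "coeff (op X p) i = coeff (\<Sum>k\<in>I. Polynomial.smult (a k) (op (C k) p)) i"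
  proof (cases "i < m")
    case True
    have "coeff (op X p) i = (\<Sum>j<m. \<Sum>k\<in>I. a k * C k $$ (i, j) * coeff p j)"
      using X True by (simp add: coeff_op e sum_distrib_right)
    also have "\<dots> = (\<Sum>k\<in>I. \<Sum>j<m. a k * C k $$ (i, j) * coeff p j)"
      by (rule sum.swap)
    also have "\<dots> = (\<Sum>k\<in>I. a k * coeff (op (C k) p) i)"
    proof (rule sum.cong[OF refl])
      fix k assume "k \<in> I"
      then show "(\<Sum>j<m. a k * C k $$ (i, j) * coeff p j) = a k * coeff (op (C k) p) i"
        using C[of k] True by (auto simp: coeff_op sum_distrib_left mult.assoc)
    qed
    finally show ?thesis by (simp add: coeff_sum)
  next
    case False
    have "coeff (op (C k) p) i = 0" if "k \<in> I" for k using C[OF that] False by (auto simp: coeff_op)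
    then show ?thesis using X False by (simp add: coeff_sum coeff_op)
  qed
qed

lemma sum_rev_atMost: "(\<Sum>i<n. f (n - i)) = (\<Sum>k\<in>{1..n}. f k)" for f :: "nat \<Rightarrow> 'a::comm_monoid_add"
  by (rule sum.reindex_bij_witness[where i="\<lambda>k. n - k" and j="\<lambda>i. n - i"]) auto

lemma sum_split_0: "(\<Sum>k\<le>n. f k) = f 0 + (\<Sum>i<n. f (Suc i))" for f :: "nat \<Rightarrow> 'a::comm_monoid_add"
  unfolding lessThan_Suc_atMost[symmetric] by (rule sum.lessThan_Suc_shift)

context potapov_data
begin

text \<open>Blocks of pi and sigma read off from their closed formulas, in the same indexing as
  \<open>Vc\<close> and \<open>Tc\<close>. The convolution form of the abstract locale is
  established in \<open>op_Pc\<close> and \<open>op_Sc\<close>.\<close>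

definition "Pc k = (if k = 0 then A 0 else
   mat m m (\<lambda>(i,j). (y_col m A n + S_blk m A (n - 1) * V_box m J A n) $$ ((k - 1) * m + i, j)))"
definition "Sc k = (if k = 0 then A 0 else
   mat m m (\<lambda>(i,j). (W_box m J A n * S_blk m A (n - 1) + z_row m A n) $$ (i, (n - k) * m + j)))"

lemma Pc [simp]: "Pc k \<in> carrier_mat m m" and Sc [simp]: "Sc k \<in> carrier_mat m m"
  using Ac[of 0] by (auto simp: Pc_def Sc_def)

lemma V_box_carrier: "n = Suc k \<Longrightarrow> V_box m J A n \<in> carrier_mat (n * m) m"
  and W_box_carrier: "n = Suc k \<Longrightarrow> W_box m J A n \<in> carrier_mat m (n * m)"
proof -
  assume n: "n = Suc k"
  note c = carriers[OF n] and nk = nk[OF n]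
  show "V_box m J A n \<in> carrier_mat (n * m) m"
    unfolding V_box_def nk using c mpQ(1)[OF n] by (intro mult_carrier_mat[of _ _ "n * m"]) auto
  show "W_box m J A n \<in> carrier_mat m (n * m)"
    unfolding W_box_def nk using c mpP(1)[OF n] by (intro mult_carrier_mat[of _ _ "n * m"]) auto
qed

lemma e_row_mult:
  assumes n: "n = Suc k" and M: "M \<in> carrier_mat (n * m) m" and ij: "i < m" "j < m"
  shows "((w \<cdot>\<^sub>m e_row m (n - 1) w) * M) $$ (i, j) = (\<Sum>l<n. w ^ Suc l * M $$ (l * m + i, j))"
proof -
  have e: "w \<cdot>\<^sub>m e_row m (n - 1) w \<in> carrier_mat m (n * m)"
    by (simp add: e_row_def nk[OF n]) (simp add: n)
  have "((w \<cdot>\<^sub>m e_row m (n - 1) w) * M) $$ (i, j) = (\<Sum>l<n. \<Sum>q<m. (w \<cdot>\<^sub>m e_row m (n - 1) w) $$ (i, l * m + q) * M $$ (l * m + q, j))"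
    unfolding mult_mat_index[OF e M ij] sum_blocks ..
  also have "\<dots> = (\<Sum>l<n. \<Sum>q<m. if q = i then w ^ Suc l * M $$ (l * m + i, j) else 0)"
  proof (intro sum.cong refl)
    fix l q assume "l \<in> {..<n}" "q \<in> {..<m}"
    then have lq: "l * m + q < n * m" "q < m" using block_lt[OF m, of l n q] by auto
    have "(w \<cdot>\<^sub>m e_row m (n - 1) w) $$ (i, l * m + q) = w * (if i = q then w ^ l else 0)"
      using lq ij n by (simp add: e_row_def div_mod_block[OF m])
    then show "(w \<cdot>\<^sub>m e_row m (n - 1) w) $$ (i, l * m + q) * M $$ (l * m + q, j) = (if q = i then w ^ Suc l * M $$ (l * m + i, j) else 0)"
      by simp
  qed
  finally show ?thesis using ij by simp
qed

lemma eps_col_mult: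
  assumes n: "n = Suc k" and M: "M \<in> carrier_mat m (n * m)" and ij: "i < m" "j < m"
  shows "(M * (w \<cdot>\<^sub>m eps_col m (n - 1) w)) $$ (i, j) = (\<Sum>l<n. w ^ (n - l) * M $$ (i, l * m + j))"
proof -
  have e: "w \<cdot>\<^sub>m eps_col m (n - 1) w \<in> carrier_mat (n * m) m"
    by (simp add: eps_col_def nk[OF n]) (simp add: n)
  have "(M * (w \<cdot>\<^sub>m eps_col m (n - 1) w)) $$ (i, j) = (\<Sum>l<n. \<Sum>q<m. M $$ (i, l * m + q) * (w \<cdot>\<^sub>m eps_col m (n - 1) w) $$ (l * m + q, j))"
    unfolding mult_mat_index[OF M e ij] sum_blocks ..
  also have "\<dots> = (\<Sum>l<n. \<Sum>q<m. if q = j then w ^ (n - l) * M $$ (i, l * m + j) else 0)"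
  proof (intro sum.cong refl)
    fix l q assume l: "l \<in> {..<n}" and q: "q \<in> {..<m}"
    then have lq: "l * m + q < n * m" "q < m" using block_lt[OF m, of l n q] by auto
    have "w * w ^ (n - 1 - l) = w ^ (n - l)" using l by (simp add: Suc_diff_Suc flip: power_Suc)
    then have "(w \<cdot>\<^sub>m eps_col m (n - 1) w) $$ (l * m + q, j) = (if q = j then w ^ (n - l) else 0)"
      using lq ij n by (simp add: eps_col_def div_mod_block[OF m])
    then show "M $$ (i, l * m + q) * (w \<cdot>\<^sub>m eps_col m (n - 1) w) $$ (l * m + q, j) = (if q = j then w ^ (n - l) * M $$ (i, l * m + j) else 0)"
      by simp
  qed
  finally show ?thesis using ij by simp
qed

lemma poly_carriers:
  "rho_poly m J A n w \<in> carrier_mat m m" "pi_poly m J A n w \<in> carrier_mat m m"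
  "sigma_poly m J A n w \<in> carrier_mat m m" "tau_poly m J A n w \<in> carrier_mat m m"
proof -
  have A0: "A 0 \<in> carrier_mat m m" using Ac[of 0] by simp
  have "rho_poly m J A n w \<in> carrier_mat m m \<and> pi_poly m J A n w \<in> carrier_mat m m \<and>
    sigma_poly m J A n w \<in> carrier_mat m m \<and> tau_poly m J A n w \<in> carrier_mat m m"
  proof (cases "n = 0")
    case True
    then show ?thesis using A0 by (simp add: rho_poly_def pi_poly_def sigma_poly_def tau_poly_def)
  next
    case False
    then obtain k where n: "n = Suc k" by (cases n) auto
    have e: "w \<cdot>\<^sub>m e_row m (n - 1) w \<in> carrier_mat m (n * m)" "w \<cdot>\<^sub>m eps_col m (n - 1) w \<in> carrier_mat (n * m) m"
      by (simp_all add: e_row_def eps_col_def nk[OF n]) (simp_all add: n)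
    note c = carriers[OF n] V_box_carrier[OF n] W_box_carrier[OF n]
    have "y_col m A n + S_blk m A (n - 1) * V_box m J A n \<in> carrier_mat (n * m) m"
      "W_box m J A n * S_blk m A (n - 1) + z_row m A n \<in> carrier_mat m (n * m)"
      unfolding nk[OF n] using c by (auto intro!: add_carrier_mat mult_carrier_mat[of _ _ "n * m"])
    then show ?thesis
      using False c e A0
      by (auto simp: rho_poly_def pi_poly_def sigma_poly_def tau_poly_def intro!: add_carrier_mat mult_carrier_mat[of _ _ "n * m"])
  qed
  then show "rho_poly m J A n w \<in> carrier_mat m m" "pi_poly m J A n w \<in> carrier_mat m m"
    "sigma_poly m J A n w \<in> carrier_mat m m" "tau_poly m J A n w \<in> carrier_mat m m" by auto
qed

lemma poly_index:
  assumes ij: "i < m" "j < m"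
  shows "rho_poly m J A n w $$ (i, j) = (\<Sum>k\<le>n. w ^ k * Vc k $$ (i, j))"
    "pi_poly m J A n w $$ (i, j) = (\<Sum>k\<le>n. w ^ k * Pc k $$ (i, j))"
    "sigma_poly m J A n w $$ (i, j) = (\<Sum>k\<le>n. w ^ k * Sc k $$ (i, j))"
    "tau_poly m J A n w $$ (i, j) = (\<Sum>k\<le>n. w ^ k * Tc k $$ (i, j))"
proof -
  have A0: "A 0 \<in> carrier_mat m m" using Ac[of 0] by simp
  have "rho_poly m J A n w $$ (i, j) = (\<Sum>k\<le>n. w ^ k * Vc k $$ (i, j)) \<and>
    pi_poly m J A n w $$ (i, j) = (\<Sum>k\<le>n. w ^ k * Pc k $$ (i, j)) \<and>
    sigma_poly m J A n w $$ (i, j) = (\<Sum>k\<le>n. w ^ k * Sc k $$ (i, j)) \<and>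
    tau_poly m J A n w $$ (i, j) = (\<Sum>k\<le>n. w ^ k * Tc k $$ (i, j))"
  proof (cases "n = 0")
    case True
    then have s: "{..n} = {0}" by auto
    show ?thesis
      unfolding s rho_poly_def pi_poly_def sigma_poly_def tau_poly_def Vc_def Pc_def Sc_def Tc_def
      using True ij by simp
  next
    case False
    then obtain k where n: "n = Suc k" by (cases n) auto
    note c = carriers[OF n] V_box_carrier[OF n] W_box_carrier[OF n]
    have e: "w \<cdot>\<^sub>m e_row m (n - 1) w \<in> carrier_mat m (n * m)" "w \<cdot>\<^sub>m eps_col m (n - 1) w \<in> carrier_mat (n * m) m"
      by (simp_all add: e_row_def eps_col_def nk[OF n]) (simp_all add: n)
    define Y where "Y = y_col m A n + S_blk m A (n - 1) * V_box m J A n"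
    define Z where "Z = W_box m J A n * S_blk m A (n - 1) + z_row m A n"
    have YZ: "Y \<in> carrier_mat (n * m) m" "Z \<in> carrier_mat m (n * m)"
      unfolding Y_def Z_def nk[OF n] using c by (auto intro!: add_carrier_mat mult_carrier_mat[of _ _ "n * m"])
    have rev: "(\<Sum>l<n. w ^ (n - l) * f l) = (\<Sum>k\<in>{1..n}. w ^ k * f (n - k))" for f :: "nat \<Rightarrow> complex"
    proof -
      have "(\<Sum>l<n. w ^ (n - l) * f l) = (\<Sum>l<n. w ^ (n - l) * f (n - (n - l)))"
        by (intro sum.cong) auto
      then show ?thesis by (simp only: sum_rev_atMost[of "\<lambda>k. w ^ k * f (n - k)"])
    qed
    have s0: "(\<Sum>k\<le>n. f k) = (\<Sum>k\<in>{1..n}. f k) + f 0" for f :: "nat \<Rightarrow> complex"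
      by (simp add: sum.atMost_Suc_shift atMost_atLeast0 sum.atLeast_Suc_atMost add.commute)
    have add: "(X + Z) $$ (i, j) = X $$ (i, j) + Z $$ (i, j)" if "Z \<in> carrier_mat m m" for X Z :: "complex mat"
      using that ij by simp
    have eM: "w \<cdot>\<^sub>m e_row m (n - 1) w * M \<in> carrier_mat m m" if "M \<in> carrier_mat (n * m) m" for M
      by (rule mult_carrier_mat[OF e(1) that])
    have 1: "rho_poly m J A n w $$ (i, j) = (\<Sum>k\<le>n. w ^ k * Vc k $$ (i, j))"
      unfolding rho_poly_def if_not_P[OF False] add[OF eM[OF c(7)]] e_row_mult[OF n c(7) ij] sum_split_0
      using ij by (simp add: Vc_def)
    have 2: "pi_poly m J A n w $$ (i, j) = (\<Sum>k\<le>n. w ^ k * Pc k $$ (i, j))"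
      unfolding pi_poly_def if_not_P[OF False] Pc_def Y_def[symmetric] add[OF eM[OF YZ(1)]] e_row_mult[OF n YZ(1) ij] sum_split_0
      using ij by simp
    have 3: "sigma_poly m J A n w $$ (i, j) = (\<Sum>k\<le>n. w ^ k * Sc k $$ (i, j))"
      unfolding sigma_poly_def if_not_P[OF False] Sc_def Z_def[symmetric] add[OF A0] eps_col_mult[OF n YZ(2) ij] s0 rev
      using ij by simp
    have 4: "tau_poly m J A n w $$ (i, j) = (\<Sum>k\<le>n. w ^ k * Tc k $$ (i, j))"
      unfolding tau_poly_def if_not_P[OF False] add[OF one_carrier_mat] eps_col_mult[OF n c(8) ij] s0 rev
      using ij by (simp add: Tc_def)
    show ?thesis using 1 2 3 4 by blast
  qed
  then show "rho_poly m J A n w $$ (i, j) = (\<Sum>k\<le>n. w ^ k * Vc k $$ (i, j))"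
    "pi_poly m J A n w $$ (i, j) = (\<Sum>k\<le>n. w ^ k * Pc k $$ (i, j))"
    "sigma_poly m J A n w $$ (i, j) = (\<Sum>k\<le>n. w ^ k * Sc k $$ (i, j))"
    "tau_poly m J A n w $$ (i, j) = (\<Sum>k\<le>n. w ^ k * Tc k $$ (i, j))" by auto
qed

lemma tilde_carrier [simp]: "mat_tilde m n b w \<in> carrier_mat m m"
  by (simp add: mat_tilde_def)

lemma op_poly:
  "op (rho_poly m J A n w) p = (\<Sum>k\<le>n. Polynomial.smult (w ^ k) (op (Vc k) p))"
  "op (pi_poly m J A n w) p = (\<Sum>k\<le>n. Polynomial.smult (w ^ k) (op (Pc k) p))"
  "op (sigma_poly m J A n w) p = (\<Sum>k\<le>n. Polynomial.smult (w ^ k) (op (Sc k) p))"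
  "op (tau_poly m J A n w) p = (\<Sum>k\<le>n. Polynomial.smult (w ^ k) (op (Tc k) p))"
  by (intro coeff_sum_op[of _ m]; simp add: poly_carriers poly_index)+

lemma op_tilde_aux:
  assumes "\<And>z i j. i < m \<Longrightarrow> j < m \<Longrightarrow> b z $$ (i, j) = (\<Sum>k\<le>n. z ^ k * B k $$ (i, j))"
    and B: "\<And>k. B k \<in> carrier_mat m m"
  shows "op (mat_tilde m n b w) p = (\<Sum>k\<le>n. Polynomial.smult (w ^ (n - k)) (op (mat_adjoint (B k)) p))"
proof (rule coeff_sum_op[of _ m])
  fix i j assume "i < m" "j < m"
  moreover have "mat_adjoint (B k) $$ (i, j) = cnj (B k $$ (j, i))" for k
    using B[of k] \<open>i < m\<close> \<open>j < m\<close> by auto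
  ultimately show "mat_tilde m n b w $$ (i, j) = (\<Sum>k\<le>n. w ^ (n - k) * mat_adjoint (B k) $$ (i, j))"
    using mat_tilde_poly[where b=b and B=B and m=m and n=n and w=w] assms(1) by simp
qed (use B in simp_all)

lemma op_tilde:
  "op (mat_tilde m n (rho_poly m J A n) w) p = (\<Sum>k\<le>n. Polynomial.smult (w ^ (n - k)) (op (mat_adjoint (Vc k)) p))"
  "op (mat_tilde m n (pi_poly m J A n) w) p = (\<Sum>k\<le>n. Polynomial.smult (w ^ (n - k)) (op (mat_adjoint (Pc k)) p))"
  "op (mat_tilde m n (sigma_poly m J A n) w) p = (\<Sum>k\<le>n. Polynomial.smult (w ^ (n - k)) (op (mat_adjoint (Sc k)) p))"
  "op (mat_tilde m n (tau_poly m J A n) w) p = (\<Sum>k\<le>n. Polynomial.smult (w ^ (n - k)) (op (mat_adjoint (Tc k)) p))"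
  by (rule op_tilde_aux; simp add: poly_index)+

lemma op_Vc: "trunc m p \<Longrightarrow> op (Vc k) p = Vo k p" "trunc m p \<Longrightarrow> op (Tc k) p = To k p"
  "trunc m p \<Longrightarrow> op (mat_adjoint (Vc k)) p = Vos k p" "trunc m p \<Longrightarrow> op (mat_adjoint (Tc k)) p = Tos k p"
  by (auto simp: Vo_def Vos_def To_def Tos_def Vc_def Tc_def trunc_op_one)

lemma op_Pc: assumes "k \<le> n" shows "op (Pc k) p = cv Ao (\<lambda>j. Vo j p) k"
proof (cases k)
  case 0
  then show ?thesis by (simp add: Pc_def cv_def Vo_def Ao_def)
next
  case (Suc i)
  with assms obtain k' where n: "n = Suc k'" by (cases n) auto
  note c = carriers[OF n] V_box_carrier[OF n]
  have i: "i < n" using Suc assms by simp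
  define Y where "Y = y_col m A n + S_blk m A (n - 1) * V_box m J A n"
  have Y: "Y \<in> carrier_mat (n * m) m"
    unfolding Y_def nk[OF n] using c by (auto intro!: add_carrier_mat mult_carrier_mat[of _ _ "n * m"])
  have "bvec m n (\<lambda>i. op (Pc (Suc i)) p) = Y *\<^sub>v vpol m p"
    by (rule col_bvec[OF Y]) (simp add: Pc_def Y_def)
  also have "\<dots> = y_col m A n *\<^sub>v vpol m p + S_blk m A k' *\<^sub>v (V_box m J A n *\<^sub>v vpol m p)"
    unfolding Y_def nk[OF n] using c
    by (simp add: add_mult_distrib_mat_vec[of _ "n * m" m] assoc_mult_mat_vec[of _ "n * m" "n * m" _ m]
        mult_carrier_mat[of _ "n * m" "n * m" _ m])
  also have "V_box m J A n *\<^sub>v vpol m p = bvec m n (\<lambda>i. op (Vc (Suc i)) p)"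
    by (rule col_bvec[OF c(7), symmetric]) (simp add: Vc_def)
  also have "y_col m A n *\<^sub>v vpol m p + S_blk m A k' *\<^sub>v bvec m n (\<lambda>i. op (Vc (Suc i)) p) =
      bvec m n (\<lambda>i. Ao (Suc i) p + cv Ao (\<lambda>i. op (Vc (Suc i)) p) i)"
    unfolding Sm_bvec[OF n] y_bvec[OF n, symmetric] by (intro eq_vecI) (auto simp: bvec_def)
  finally have "op (Pc (Suc i)) p = Ao (Suc i) p + cv Ao (\<lambda>i. op (Vc (Suc i)) p) i"
    by (rule bvec_eqD[OF m]) (use i in \<open>auto intro!: trunc_op[of _ m m] trunc_closed trunc_Ao trunc_cv\<close>)
  then show ?thesis
    unfolding Suc cv_def by (subst sum.atMost_Suc_shift) (simp add: Vo_def)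
qed

text \<open>W is a block row, while the dictionary treats columns. So the adjoint of sigma is
  computed here and \<open>op_Sc\<close> follows by passing to adjoints.\<close>

lemma op_Sc_adj: assumes "k \<le> n" shows "op (mat_adjoint (Sc k)) p = cv Aos (\<lambda>j. Tos j p) k"
proof (cases k)
  case 0
  then show ?thesis by (simp add: Sc_def cv_def Tos_def Aos_def)
next
  case (Suc i)
  with assms obtain k' where n: "n = Suc k'" by (cases n) auto
  note c = carriers[OF n] W_box_carrier[OF n]
  have i: "i < n" using Suc assms by simp
  define Z where "Z = W_box m J A n * S_blk m A (n - 1) + z_row m A n"
  have Z: "Z \<in> carrier_mat m (n * m)"
    unfolding Z_def nk[OF n] using c by (auto intro!: add_carrier_mat mult_carrier_mat[of _ _ "n * m"])
  have blk: "mat_adjoint (mat m m (\<lambda>(a,b). M $$ (a, l * m + b))) = mat m m (\<lambda>(a,b). mat_adjoint M $$ (l * m + a, b))"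
    if "M \<in> carrier_mat m (n * m)" "l < n" for M :: "complex mat" and l
    using that block_lt[OF m that(2)] by (intro eq_matI) auto
  have "bvec m n (\<lambda>l. op (mat_adjoint (Sc (n - l))) p) = mat_adjoint Z *\<^sub>v vpol m p"
  proof (rule col_bvec[OF mat_adjoint_carrier[OF Z]])
    fix l assume l: "l < n"
    then have "Sc (n - l) = mat m m (\<lambda>(a,b). Z $$ (a, l * m + b))" by (simp add: Sc_def Z_def)
    then show "mat_adjoint (Sc (n - l)) = mat m m (\<lambda>(a,b). mat_adjoint Z $$ (l * m + a, b))"
      using blk[OF Z l] by simp
  qed
  also have "mat_adjoint Z = mat_adjoint (S_blk m A k') * mat_adjoint (W_box m J A n) + mat_adjoint (z_row m A n)"
  proof -
    have "mat_adjoint Z = mat_adjoint (W_box m J A n * S_blk m A k') + mat_adjoint (z_row m A n)"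
      unfolding Z_def nk[OF n] using c mult_carrier_mat[OF c(7) c(3)] by (intro eq_matI) (auto simp del: index_mult_mat(1))
    then show ?thesis using c by (simp add: mat_adjoint_mult[of _ m "n * m" _ "n * m"])
  qed
  also have "\<dots> *\<^sub>v vpol m p = mat_adjoint (S_blk m A k') *\<^sub>v (mat_adjoint (W_box m J A n) *\<^sub>v vpol m p) + mat_adjoint (z_row m A n) *\<^sub>v vpol m p"
    using c by (simp add: add_mult_distrib_mat_vec[of _ "n * m" m] assoc_mult_mat_vec[of _ "n * m" "n * m" _ m]
        mult_carrier_mat[of _ "n * m" "n * m" _ m])
  also have "mat_adjoint (W_box m J A n) *\<^sub>v vpol m p = bvec m n (\<lambda>l. op (mat_adjoint (Tc (n - l))) p)"
  proof (rule col_bvec[OF mat_adjoint_carrier[OF c(7)], symmetric])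
    fix l assume l: "l < n"
    then have "Tc (n - l) = mat m m (\<lambda>(a,b). W_box m J A n $$ (a, l * m + b))" by (simp add: Tc_def)
    then show "mat_adjoint (Tc (n - l)) = mat m m (\<lambda>(a,b). mat_adjoint (W_box m J A n) $$ (l * m + a, b))"
      using blk[OF c(7) l] by simp
  qed
  also have "mat_adjoint (S_blk m A k') *\<^sub>v bvec m n (\<lambda>l. op (mat_adjoint (Tc (n - l))) p) + mat_adjoint (z_row m A n) *\<^sub>v vpol m p =
      bvec m n (\<lambda>l. ac Aos n (\<lambda>l. op (mat_adjoint (Tc (n - l))) p) l + Aos (n - l) p)"
    unfolding Sm_bvec[OF n] z_adj_bvec[OF n, symmetric] by (intro eq_vecI) (auto simp: bvec_def)
  finally have "op (mat_adjoint (Sc (n - (n - k)))) p = ac Aos n (\<lambda>l. op (mat_adjoint (Tc (n - l))) p) (n - k) + Aos (n - (n - k)) p"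
    by (rule bvec_eqD[OF m]) (use i Suc assms in \<open>auto intro!: trunc_op[of _ m m] trunc_closed trunc_Ao trunc_ac\<close>)
  then have e: "op (mat_adjoint (Sc k)) p = ac Aos n (\<lambda>l. op (mat_adjoint (Tc (n - l))) p) (n - k) + Aos k p"
    using assms by simp
  have "ac Aos n (\<lambda>l. op (mat_adjoint (Tc (n - l))) p) (n - k) = (\<Sum>j<k. Aos (k - Suc j) (op (mat_adjoint (Tc (Suc j))) p))"
    unfolding ac_def
    by (rule sum.reindex_bij_witness[where i="\<lambda>j. n - Suc j" and j="\<lambda>l. n - Suc l"]) (use assms Suc in \<open>auto simp: Suc_diff_Suc add.commute\<close>)
  then show ?thesis
    unfolding e cv_def sum_split_0 by (simp add: Tos_def add.commute)
qed

lemma op_Pc_adj: assumes "k \<le> n" shows "op (mat_adjoint (Pc k)) p = (\<Sum>j\<le>k. Vos j (Aos (k - j) p))"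
proof (rule cip.ip_ext)
  fix q
  have "pip (op (mat_adjoint (Pc k)) p) q = pip p (op (Pc k) q)" by (simp add: op_adj)
  also have "\<dots> = pip (\<Sum>j\<le>k. Vos j (Aos (k - j) p)) q"
    unfolding op_Pc[OF assms] cv_def
    by (simp add: cip.ip_sum_left cip.ip_sum_right pot.Vs_adj dtoep.A_adj)
  finally show "pip (op (mat_adjoint (Pc k)) p) q = pip (\<Sum>j\<le>k. Vos j (Aos (k - j) p)) q" .
qed

lemma op_Sc: assumes "k \<le> n" shows "op (Sc k) p = (\<Sum>j\<le>k. To j (Ao (k - j) p))"
proof (rule cip.ip_ext)
  fix q
  have "pip (op (Sc k) p) q = pip p (op (mat_adjoint (Sc k)) q)" by (simp add: op_adj)
  also have "\<dots> = pip (\<Sum>j\<le>k. To j (Ao (k - j) p)) q"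
    unfolding op_Sc_adj[OF assms] cv_def
    by (simp add: cip.ip_sum_left cip.ip_sum_right pot.T_adj toep.A_adj)
  finally show "pip (op (Sc k) p) q = pip (\<Sum>j\<le>k. To j (Ao (k - j) p)) q" .
qed

lemma op_polys:
  assumes p: "trunc m p"
  shows "op (rho_poly m J A n w) p = pot.rho w p" "op (pi_poly m J A n w) p = pot.ppi w p"
    "op (sigma_poly m J A n w) p = pot.sigma w p" "op (tau_poly m J A n w) p = pot.tau w p"
    "op (mat_tilde m n (rho_poly m J A n) w) p = pot.rhot w p" "op (mat_tilde m n (pi_poly m J A n) w) p = pot.pit w p"
    "op (mat_tilde m n (sigma_poly m J A n) w) p = pot.sigmat w p" "op (mat_tilde m n (tau_poly m J A n) w) p = pot.taut w p"
  unfolding op_poly op_tilde pot.rho_def pot.ppi_def pot.sigma_def pot.tau_def pot.rhot_def pot.pit_def pot.sigmat_def pot.taut_def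
  by (intro sum.cong refl arg_cong[of _ _ "Polynomial.smult _"]; simp add: op_Vc[OF p] op_Pc op_Sc op_Sc_adj op_Pc_adj)+

end

section \<open>Pointwise properties of the linear fractional transformation\<close>

context potapov begin

text \<open>For w \<noteq> 0 the relation tau g - sigma h = w^(n+1) L s gives L s = 0, so s = 0 and
  the coprimeness of rho and pi applies. At w = 0 the denominator is v itself. The hypothesis on L
  holds when s is in the range of the pseudoinverse of its root.\<close>

lemma lft_injective:
  assumes h: "sc w (J (sigmat w s)) + rho w v = 0" and g: "sc w (J (taut w s)) + ppi w v = 0"
    and w: "cmod w < 1" and L: "L s = 0 \<Longrightarrow> s = 0"
  shows "v = 0"
proof (cases "w = 0")
  case True
  have "rho 0 v = (\<Sum>k\<le>n. if k = 0 then v else 0)"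
    unfolding rho_def by (intro sum.cong refl) (simp add: V_0)
  with h True show ?thesis by simp
next
  case False
  have "tau w 0 - sigma w 0 = sc (w ^ Suc n) (L s)"
    using lft_relations(2)[of w s v] unfolding h g .
  moreover have "tau w 0 = 0" "sigma w 0 = 0"
    by (simp_all add: tau_def sigma_def lin_zero[OF lin_T] lin_zero[OF lin_A])
  ultimately have "L s = 0" using False by simp
  then have s: "s = 0" by (rule L)
  have "sigmat w 0 = 0" "taut w 0 = 0"
    by (simp_all add: sigmat_def taut_def cv_def lin_zero[OF lin_Ts] lin_zero[OF lin_As])
  then show ?thesis
    using h g lft_coprime[of w v] False w by (simp add: s linJ)
qed

end

text \<open>The product of root and pseudoinverse is the orthogonal projection onto the range of M,
  whence the norm bound. The last claim, injectivity of M on the range of the pseudoinverse, is what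
  the factor in front of the Schur parameter is good for.\<close>

lemma sqrt_ops:
  assumes M: "psd m M"
  defines "s \<equiv> msqrt M" and "p \<equiv> mp_inv (msqrt M)"
  shows "s \<in> carrier_mat m m" "p \<in> carrier_mat m m"
    and "op s (op s v) = op M v" "pip (op s u) v = pip u (op s v)" "pip (op p u) v = pip u (op p v)"
    and "op s (op p (op s v)) = op s v" "op p (op s (op p v)) = op p v" "op s (op p v) = op p (op s v)"
    and "pip (op M v) v = of_real (nrm (op s v))" and "nrm (op s (op p v)) \<le> nrm v"
    and "op M (op p v) = 0 \<Longrightarrow> op p v = 0"
proof -
  note ps = msqrt_psd[OF M, folded s_def]
  show s: "s \<in> carrier_mat m m" using psd_carrier[OF ps(1)] .
  have p_eq: "p = mp_inv s" by (simp add: p_def s_def)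
  note mp = mp_inv_hermitian[OF s psd_hermitian[OF ps(1)], folded p_eq]
  show p: "p \<in> carrier_mat m m" by (rule mp(1))
  show ss: "op s (op s v) = op M v" for v using op_mult[OF s s] ps(2) by simp
  show sy: "pip (op s u) v = pip u (op s v)" for u v by (simp add: op_adj psd_hermitian[OF ps(1)])
  show py: "pip (op p u) v = pip u (op p v)" for u v by (simp add: op_adj mp(4))
  show sps: "op s (op p (op s v)) = op s v" for v
    using mp(2) op_mult[OF s p] op_mult[OF mult_carrier_mat[OF s p] s] by simp
  show psp: "op p (op s (op p v)) = op p v" for v
    using mp(3) op_mult[OF p s] op_mult[OF mult_carrier_mat[OF p s] p] by simp
  show comm: "op s (op p v) = op p (op s v)" for v
    using mp(5) op_mult[OF p s] op_mult[OF s p] by simp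
  have e: "pip (op M v) v = pip (op s v) (op s v)" for v by (simp add: ss[symmetric] sy)
  show n: "pip (op M v) v = of_real (nrm (op s v))" for v unfolding e by (rule cip.ip_self_Re)
  show "nrm (op s (op p v)) \<le> nrm v" for v
  proof -
    have k: "op p (op s (op s (op p v))) = op s (op p v)" by (simp only: comm[of v] psp)
    have 0: "pip (op s (op p v)) (op s (op p v)) = pip v (op s (op p v))" by (simp only: sy py k)
    have 1: "pip (op s (op p v)) v = pip (op s (op p v)) (op s (op p v))"
      unfolding 0 by (simp only: sy py comm[of v])
    note 2 = 0[symmetric]
    have "0 \<le> nrm (v - op s (op p v))" by (rule nrm_nonneg)
    also have "nrm (v - op s (op p v)) = nrm v - nrm (op s (op p v))"
      by (simp add: cip.ip_diff_left cip.ip_diff_right 1 2)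
    finally show ?thesis by simp
  qed
  show "op p v = 0" if "op M (op p v) = 0" for v
  proof -
    have "of_real (nrm (op s (op p v))) = (0 :: complex)" unfolding n[symmetric] that by simp
    then have "op s (op p v) = 0" using nrm_eq_0 of_real_eq_0_iff by blast
    then have "op p (op s (op p v)) = 0" by (simp add: cip.lin_zero[OF lin_op])
    then show ?thesis by (simp add: psp)
  qed
qed

lemma det_adjoint_nonzero:
  fixes X :: "complex mat"
  assumes X: "X \<in> carrier_mat m m" and det: "Determinant.det (mat_adjoint X) \<noteq> 0"
  shows "Determinant.det X \<noteq> 0"
proof -
  have Xs: "mat_adjoint X \<in> carrier_mat m m" using X by simp
  note mi = minv_det[OF Xs det]
  have "mat_adjoint (minv (mat_adjoint X)) * X = mat_adjoint (mat_adjoint X * minv (mat_adjoint X))"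
    using X mi(2) by (simp add: mat_adjoint_mult[of _ m m _ m])
  then have "mat_adjoint (minv (mat_adjoint X)) * X = 1\<^sub>m m" by (simp add: mi(3))
  then have "Determinant.det (mat_adjoint (minv (mat_adjoint X))) * Determinant.det X = 1"
    using det_mult[of "mat_adjoint (minv (mat_adjoint X))" m X] X mi(2) by simp
  then show ?thesis by auto
qed

lemma J_defect_hermitian:
  assumes "sig_mat m J" "F \<in> carrier_mat m m"
  shows "mat_adjoint (J - mat_adjoint F * J * F) = J - mat_adjoint F * J * F"
proof -
  have J: "J \<in> carrier_mat m m" "mat_adjoint J = J" using assms by (auto simp: sig_mat_def)
  have "mat_adjoint (mat_adjoint F * J * F) = mat_adjoint F * J * F"
    using assms J by (simp add: mat_adjoint_mult[of _ m m _ m] assoc_mult_mat[of _ m m _ m _ m])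
  then show ?thesis using assms J by (subst mat_adjoint_minus[of _ m m]) auto
qed

lemma J_contractive_quotient:
  assumes sig: "sig_mat m J" and D: "D \<in> carrier_mat m m" and N: "N \<in> carrier_mat m m"
    and det: "Determinant.det D \<noteq> 0"
    and gap: "\<And>p. trunc m p \<Longrightarrow> 0 \<le> Re (pip (op J (op D p)) (op D p) - pip (op J (op N p)) (op N p))"
  shows "J_contractive m J (N * minv D)"
proof -
  let ?F = "N * minv D"
  have J: "J \<in> carrier_mat m m" "mat_adjoint J = J" using sig by (auto simp: sig_mat_def)
  note mi = minv_det[OF D det]
  have F: "?F \<in> carrier_mat m m" using N mi(2) by simp
  have "psd m (J - mat_adjoint ?F * J * ?F)"
  proof (rule psd_pipI)
    show "J - mat_adjoint ?F * J * ?F \<in> carrier_mat m m" using F J by (intro minus_carrier_mat) simp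
    show "mat_adjoint (J - mat_adjoint ?F * J * ?F) = J - mat_adjoint ?F * J * ?F"
      by (rule J_defect_hermitian[OF sig F])
    fix p
    define q where "q = op (minv D) p"
    have q: "trunc m q" unfolding q_def by (rule trunc_op[OF mi(2)])
    have Dq: "op D q = op (1\<^sub>m m) p" unfolding q_def using op_mult[OF D mi(2), of p] mi(3) by simp
    have Fp: "op ?F p = op N q" unfolding q_def by (rule op_mult[OF N mi(2)])
    have "pip (op (J - mat_adjoint ?F * J * ?F) p) p = pip (op J p) p - pip (op (mat_adjoint ?F * J * ?F) p) p"
      using F J by (subst op_minus[of _ m m]) (auto simp: cip.ip_diff_left)
    also have "op (mat_adjoint ?F * J * ?F) p = op (mat_adjoint ?F) (op J (op ?F p))"
      using F J op_mult[OF mult_carrier_mat[OF mat_adjoint_carrier[OF F] J(1)] F, of p]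
        op_mult[OF mat_adjoint_carrier[OF F] J(1)] by simp
    also have "pip \<dots> p = pip (op J (op N q)) (op N q)"
      by (simp add: op_adj Fp[symmetric])
    also have "pip (op J p) p = pip (op J (op D q)) (op D q)"
      unfolding Dq using op_op_one[OF J(1)] pip_trunc_right[OF trunc_op[OF J(1)]] by simp
    finally show "0 \<le> Re (pip (op (J - mat_adjoint ?F * J * ?F) p) p)" using gap[OF q] by simp
  qed
  then show ?thesis by (simp add: J_contractive_def)
qed

context potapov_data
begin

lemma R_carrier: "R \<in> carrier_mat m m" and L_carrier: "L \<in> carrier_mat m m"
proof -
  have A0: "A 0 \<in> carrier_mat m m" "mat_adjoint (A 0) \<in> carrier_mat m m" using Ac[of 0] by auto
  have "R \<in> carrier_mat m m \<and> L \<in> carrier_mat m m"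
  proof (cases "n = 0")
    case True
    then show ?thesis unfolding R_def L_def R_next_def L_next_def using A0 Jc(1)
      by (simp add: minus_carrier_mat)
  next
    case False
    then obtain k where n: "n = Suc k" by (cases n) auto
    note c = carriers[OF n] mpP(1)[OF n] mpQ(1)[OF n]
    show ?thesis unfolding R_def L_def R_next_def L_next_def if_not_P[OF False] nk[OF n]
      by (intro conjI minus_carrier_mat mult_carrier_mat[of _ _ "n * m"] mult_carrier_mat[of _ m "n * m"])
        (use c in \<open>auto intro: mat_adjoint_carrier\<close>)
  qed
  then show "R \<in> carrier_mat m m" "L \<in> carrier_mat m m" by auto
qed

lemma opE_psd:
  assumes M: "M \<in> carrier_mat m m" and sym: "\<And>u v. pip (opE m M u) v = pip u (opE m M v)"
    and pos: "\<And>v. 0 \<le> Re (pip (opE m M v) v)"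
  shows "psd m M"
proof (rule psd_pipI[OF M])
  have t: "pip (op (1\<^sub>m m) u) v = pip u (op (1\<^sub>m m) v)" for u v by (simp add: op_adj)
  have "pip (op M u) v = pip u (op M v)" for u v
    using sym[of u v] t[of u v] by (simp add: opE_def cip.ip_add_left cip.ip_add_right cip.ip_diff_left cip.ip_diff_right)
  then show "mat_adjoint M = M" by (rule adjoint_eqI[OF M])
  fix p
  have "pip (op M p) p = pip (opE m M (op (1\<^sub>m m) p)) (op (1\<^sub>m m) p)"
    using M by (subst opE_trunc[OF trunc_op[of _ m m]]) (simp_all add: op_op_one pip_trunc_right[OF trunc_op[OF M]])
  then show "0 \<le> Re (pip (op M p) p)" using pos by simp
qed

lemma R_psd: "psd m R"
proof (rule opE_psd[OF R_carrier])
  show "pip (opE m R u) v = pip u (opE m R v)" for u v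
    by (rule toep.Qop_decomp(3)[OF pot.Qop_V pot.V_0])
  fix v
  have "(\<Sum>i<Suc n. pip (Qop Jo Ao Aos (Suc n) (\<lambda>k. Vo k v) i) (Vo i v)) = pip (opE m R v) v"
    by (subst sum.lessThan_Suc_shift) (simp add: pot.Qop_V pot.V_0)
  then show "0 \<le> Re (pip (opE m R v) v)" using Q_pos by metis
qed

lemma L_psd: "psd m L"
proof (rule opE_psd[OF L_carrier])
  show "pip (opE m L u) v = pip u (opE m L v)" for u v
    by (rule dtoep.Qop_decomp(3)[OF pot.Qop_Ts pot.Ts_0])
  fix v
  have "(\<Sum>i<Suc n. pip (Qop Jo Aos Ao (Suc n) (\<lambda>k. Tos k v) i) (Tos i v)) = pip (opE m L v) v"
    by (subst sum.lessThan_Suc_shift) (simp add: pot.Qop_Ts pot.Ts_0)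
  then show "0 \<le> Re (pip (opE m L v) v)" using P_pos by metis
qed

definition "sL = msqrt L"
definition "pL = mp_inv (msqrt L)"
definition "sR = msqrt R"
definition "pR = mp_inv (msqrt R)"

lemmas sqrtL = sqrt_ops[OF L_psd, folded sL_def pL_def]
lemmas sqrtR = sqrt_ops[OF R_psd, folded sR_def pR_def]

text \<open>The matrix K stands for the value of the Schur function at w. Separating the two makes
  the following lemmas linear algebra at a single point.\<close>

definition "D1 K w = w \<cdot>\<^sub>m (J * mat_tilde m n (sigma_poly m J A n) w * pL * K * sR) + rho_poly m J A n w"
definition "N1 K w = w \<cdot>\<^sub>m (J * mat_tilde m n (tau_poly m J A n) w * pL * K * sR) + pi_poly m J A n w"
definition "D2 K w = w \<cdot>\<^sub>m (sL * K * pR * mat_tilde m n (pi_poly m J A n) w * J) + tau_poly m J A n w"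
definition "N2 K w = w \<cdot>\<^sub>m (sL * K * pR * mat_tilde m n (rho_poly m J A n) w * J) + sigma_poly m J A n w"

lemma den_num: "den1 m J A n S w = D1 (S w) w" "num1 m J A n S w = N1 (S w) w"
  "den2 m J A n S w = D2 (S w) w" "num2 m J A n S w = N2 (S w) w"
  by (simp_all add: den1_def num1_def den2_def num2_def D1_def N1_def D2_def N2_def sL_def pL_def sR_def pR_def L_def R_def)

lemma op_J: "trunc m p \<Longrightarrow> op J p = Jo p"
  unfolding Jo_def by (rule opE_trunc[symmetric])

context
  fixes K :: "complex mat" and w :: complex
  assumes K: "K \<in> carrier_mat m m"
begin

lemma DN_carrier: "D1 K w \<in> carrier_mat m m" "N1 K w \<in> carrier_mat m m" "D2 K w \<in> carrier_mat m m" "N2 K w \<in> carrier_mat m m"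
  unfolding D1_def N1_def D2_def N2_def by (intro add_carrier_mat poly_carriers)+

lemma op_D1:
  fixes p :: "complex poly"
  assumes p: "trunc m p"
  defines "s \<equiv> op pL (op K (op sR p))"
  shows "op (D1 K w) p = Polynomial.smult w (Jo (pot.sigmat w s)) + pot.rho w p"
    and "op (N1 K w) p = Polynomial.smult w (Jo (pot.taut w s)) + pot.ppi w p"
proof -
  have s: "trunc m s" unfolding s_def by (rule trunc_op[OF sqrtL(2)])
  have *: "op (w \<cdot>\<^sub>m (J * mat_tilde m n b w * pL * K * sR)) p = Polynomial.smult w (Jo (op (mat_tilde m n b w) s))" for b
    unfolding op_smult op_J[OF trunc_op[OF tilde_carrier], symmetric] s_def
    using K Jc(1) sqrtL(2) sqrtR(1) by (simp add: op_mult[of _ m m _ m])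
  have c: "w \<cdot>\<^sub>m (J * mat_tilde m n b w * pL * K * sR) \<in> carrier_mat m m" for b
    using K Jc(1) sqrtL(2) sqrtR(1) by simp
  show "op (D1 K w) p = Polynomial.smult w (Jo (pot.sigmat w s)) + pot.rho w p"
    unfolding D1_def op_add[OF c poly_carriers(1)] * op_polys[OF p] op_polys[OF s] ..
  show "op (N1 K w) p = Polynomial.smult w (Jo (pot.taut w s)) + pot.ppi w p"
    unfolding N1_def op_add[OF c poly_carriers(2)] * op_polys[OF p] op_polys[OF s] ..
qed

lemma op_D2:
  assumes p: "trunc m p"
  shows "op (D2 K w) p = Polynomial.smult w (op sL (op K (op pR (pot.pit w (Jo p))))) + pot.tau w p"
    and "op (N2 K w) p = Polynomial.smult w (op sL (op K (op pR (pot.rhot w (Jo p))))) + pot.sigma w p"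
proof -
  have s: "trunc m (Jo p)" by (rule Jo_trunc[OF p])
  have *: "op (w \<cdot>\<^sub>m (sL * K * pR * mat_tilde m n b w * J)) p = Polynomial.smult w (op sL (op K (op pR (op (mat_tilde m n b w) (Jo p)))))" for b
    unfolding op_smult op_J[OF p, symmetric]
    using K Jc(1) sqrtL(1) sqrtR(2) by (simp add: op_mult[of _ m m _ m])
  have c: "w \<cdot>\<^sub>m (sL * K * pR * mat_tilde m n b w * J) \<in> carrier_mat m m" for b
    using K Jc(1) sqrtL(1) sqrtR(2) by simp
  show "op (D2 K w) p = Polynomial.smult w (op sL (op K (op pR (pot.pit w (Jo p))))) + pot.tau w p"
    unfolding D2_def op_add[OF c poly_carriers(4)] * op_polys[OF p] op_polys[OF s] ..
  show "op (N2 K w) p = Polynomial.smult w (op sL (op K (op pR (pot.rhot w (Jo p))))) + pot.sigma w p"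
    unfolding N2_def op_add[OF c poly_carriers(3)] * op_polys[OF p] op_polys[OF s] ..
qed

text \<open>By the two relations, the pairs have R p up to w^n and L s up to w^(n+1). Since pR R p =
  sR p and L s = sL K sR p, the second is w times the image of the first under sL K pR; written out,
  this is the identity between the two representations.\<close>

lemma D2_N1:
  assumes p: "trunc m p"
  shows "op (D2 K w) (op (N1 K w) p) = op (N2 K w) (op (D1 K w) p)"
proof -
  define s where "s = op pL (op K (op sR p))"
  define h where "h = op (D1 K w) p"
  define g where "g = op (N1 K w) p"
  have t: "trunc m h" "trunc m g" "trunc m s"
    unfolding h_def g_def s_def by (rule trunc_op[OF DN_carrier(1)] trunc_op[OF DN_carrier(2)] trunc_op[OF sqrtL(2)])+
  have h: "h = Polynomial.smult w (Jo (pot.sigmat w s)) + pot.rho w p"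
    and g: "g = Polynomial.smult w (Jo (pot.taut w s)) + pot.ppi w p"
    unfolding h_def g_def s_def by (rule op_D1[OF p])+
  note rel = pot.lft_relations[of w s p, folded h g, unfolded opE_trunc[OF p] opE_trunc[OF t(3)]]
  have Ls: "op L s = op sL (op K (op sR p))"
    unfolding s_def sqrtL(3)[symmetric] by (simp only: sqrtL(8)[of "op K (op sR p)"] sqrtL(6))
  have pRR: "op pR (op R p) = op sR p"
    unfolding sqrtR(3)[symmetric] by (simp only: sqrtR(8)[of "op sR p", symmetric] sqrtR(6))
  have "pot.tau w g - pot.sigma w h = Polynomial.smult w (op sL (op K (op pR (Polynomial.smult (w ^ n) (op R p)))))"
    unfolding rel(2) Ls by (simp add: cip.lin_scale[OF lin_op] pRR)
  also have "\<dots> = Polynomial.smult w (op sL (op K (op pR (pot.rhot w (Jo h))))) - Polynomial.smult w (op sL (op K (op pR (pot.pit w (Jo g)))))"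
    unfolding rel(1)[symmetric] by (simp add: cip.lin_diff[OF lin_op] smult_diff_right)
  finally show ?thesis
    unfolding h_def[symmetric] g_def[symmetric] op_D2[OF t(1)] op_D2[OF t(2)] by (simp add: algebra_simps)
qed

lemma DN1_injective:
  assumes w: "cmod w < 1" and p: "trunc m p" "op (D1 K w) p = 0" "op (N1 K w) p = 0"
  shows "p = 0"
proof (rule pot.lft_injective[OF _ _ w])
  let ?s = "op pL (op K (op sR p))"
  show "Polynomial.smult w (Jo (pot.sigmat w ?s)) + pot.rho w p = 0" "Polynomial.smult w (Jo (pot.taut w ?s)) + pot.ppi w p = 0"
    using p(2,3) unfolding op_D1[OF p(1)] .
  show "?s = 0" if "opE m L ?s = 0"
    using that sqrtL(11) by (simp add: opE_trunc[OF trunc_op[OF sqrtL(2)]])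
qed

text \<open>The adjoints of D2 and N2 at w are denominator and numerator of the dual problem at the
  conjugate of w, with the adjoint of K as parameter. So this is \<open>lft_injective\<close> for
  the dual data.\<close>

lemma DN2_injective:
  assumes w: "cmod w < 1" and u: "trunc m u" "op (mat_adjoint (D2 K w)) u = 0" "op (mat_adjoint (N2 K w)) u = 0"
  shows "u = 0"
proof -
  interpret d: potapov Polynomial.smult pip Jo Aos Ao n Tos To Vos Vo "opE m L" "opE m R"
    by (rule pot.potapov_dual)
  let ?s = "op pR (op (mat_adjoint K) (op sL u))"
  have s: "pip u (op sL (op K (op pR v))) = pip ?s v" for v
    by (simp add: sqrtL(4)[symmetric] sqrtR(5)) (simp add: op_adj)
  have ext: "x = y" if "trunc m x" "\<And>v. trunc m v \<Longrightarrow> pip x v = pip y v" "trunc m y" for x y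
  proof (rule cip.ip_ext)
    fix v
    have "pip x (op (1\<^sub>m m) v) = pip y (op (1\<^sub>m m) v)" by (rule that(2), rule trunc_op[of _ m m]) simp
    then show "pip x v = pip y v" using that(1,3) by (simp add: pip_trunc_right)
  qed
  have t: "trunc m (Polynomial.smult c (Jo (d.sigmat c ?s)) + d.rho c u)"
    "trunc m (Polynomial.smult c (Jo (d.taut c ?s)) + d.ppi c u)" for c
  proof -
    have 1: "trunc m (Vo k ?s)" "trunc m (Tos k u)" for k
      using u(1) trunc_op[OF sqrtR(2)] by (auto simp: Vo_def Tos_def intro!: trunc_op[of _ m m])
    show "trunc m (Polynomial.smult c (Jo (d.sigmat c ?s)) + d.rho c u)"
      "trunc m (Polynomial.smult c (Jo (d.taut c ?s)) + d.ppi c u)"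
      unfolding d.sigmat_def d.rho_def d.taut_def d.ppi_def
      by (intro trunc_closed Jo_trunc 1 trunc_cv; simp)+
  qed
  have "op (mat_adjoint (D2 K w)) u = Polynomial.smult (cnj w) (Jo (d.sigmat (cnj w) ?s)) + d.rho (cnj w) u"
  proof (rule ext[OF trunc_op _ t(1)])
    show "mat_adjoint (D2 K w) \<in> carrier_mat m m" using DN_carrier(3) by simp
    fix v assume v: "trunc m v"
    have "pip (op (mat_adjoint (D2 K w)) u) v = pip u (op (D2 K w) v)" by (simp add: op_adj)
    also have "\<dots> = cnj w * pip ?s (pot.pit w (Jo v)) + pip u (pot.tau w v)"
      unfolding op_D2[OF v] cip.ip_add_right cip.ip_scale_right s ..
    also have "\<dots> = pip (Polynomial.smult (cnj w) (Jo (d.sigmat (cnj w) ?s)) + d.rho (cnj w) u) v"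
      by (simp add: cip.ip_add_left cip.ip_scale_left cip.ip_scale_right cip.ip_sum_left cip.ip_sum_right pot.pit_def pot.tau_def d.sigmat_def
        d.rho_def cv_def toep.J_adj toep.A_adj pot.V_adj pot.Ts_adj cip.ip_cnj)
    finally show "pip (op (mat_adjoint (D2 K w)) u) v = pip (Polynomial.smult (cnj w) (Jo (d.sigmat (cnj w) ?s)) + d.rho (cnj w) u) v" .
  qed
  then have h: "Polynomial.smult (cnj w) (Jo (d.sigmat (cnj w) ?s)) + d.rho (cnj w) u = 0" using u(2) by simp
  have "op (mat_adjoint (N2 K w)) u = Polynomial.smult (cnj w) (Jo (d.taut (cnj w) ?s)) + d.ppi (cnj w) u"
  proof (rule ext[OF trunc_op _ t(2)])
    show "mat_adjoint (N2 K w) \<in> carrier_mat m m" using DN_carrier(4) by simp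
    fix v assume v: "trunc m v"
    have "pip (op (mat_adjoint (N2 K w)) u) v = pip u (op (N2 K w) v)" by (simp add: op_adj)
    also have "\<dots> = cnj w * pip ?s (pot.rhot w (Jo v)) + pip u (pot.sigma w v)"
      unfolding op_D2[OF v] cip.ip_add_right cip.ip_scale_right s ..
    also have "\<dots> = pip (Polynomial.smult (cnj w) (Jo (d.taut (cnj w) ?s)) + d.ppi (cnj w) u) v"
      by (simp add: cip.ip_add_left cip.ip_scale_left cip.ip_scale_right cip.ip_sum_left cip.ip_sum_right pot.rhot_def pot.sigma_def d.taut_def
        d.ppi_def cv_def toep.J_adj dtoep.A_adj pot.V_adj pot.Ts_adj cip.ip_cnj)
    finally show "pip (op (mat_adjoint (N2 K w)) u) v = pip (Polynomial.smult (cnj w) (Jo (d.taut (cnj w) ?s)) + d.ppi (cnj w) u) v" .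
  qed
  then have g: "Polynomial.smult (cnj w) (Jo (d.taut (cnj w) ?s)) + d.ppi (cnj w) u = 0" using u(3) by simp
  show ?thesis
  proof (rule d.lft_injective[OF h g])
    show "cmod (cnj w) < 1" using w by simp
    show "?s = 0" if "opE m R ?s = 0"
      using that sqrtR(11) by (simp add: opE_trunc[OF trunc_op[OF sqrtR(2)]])
  qed
qed

text \<open>By D2 N1 = N2 D1 the matrix N1 sends the kernel of D1 into the kernel of D2, and D1, N1
  have no common kernel vector. The other direction is the same argument for adjoints.\<close>

lemma det_D1_iff_D2:
  assumes w: "cmod w < 1"
  shows "Determinant.det (D1 K w) \<noteq> 0 \<longleftrightarrow> Determinant.det (D2 K w) \<noteq> 0"
proof
  assume det: "Determinant.det (D2 K w) \<noteq> 0"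
  show "Determinant.det (D1 K w) \<noteq> 0"
    unfolding det_nonzero_iff[OF DN_carrier(1)]
  proof safe
    fix p assume p: "trunc m p" "op (D1 K w) p = 0"
    have "op (D2 K w) (op (N1 K w) p) = 0"
      using D2_N1[OF p(1)] by (simp add: p(2) cip.lin_zero[OF lin_op])
    then have "op (N1 K w) p = 0"
      using det trunc_op[OF DN_carrier(2)] unfolding det_nonzero_iff[OF DN_carrier(3)] by blast
    then show "p = 0" by (rule DN1_injective[OF w p])
  qed
next
  assume det: "Determinant.det (D1 K w) \<noteq> 0"
  note mi = minv_det[OF DN_carrier(1) det]
  show "Determinant.det (D2 K w) \<noteq> 0"
  proof (rule det_adjoint_nonzero[OF DN_carrier(3)])
    have c: "mat_adjoint (D2 K w) \<in> carrier_mat m m" "mat_adjoint (N2 K w) \<in> carrier_mat m m"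
      using DN_carrier by simp_all
    show "Determinant.det (mat_adjoint (D2 K w)) \<noteq> 0"
      unfolding det_nonzero_iff[OF c(1)]
    proof safe
      fix u assume u: "trunc m u" "op (mat_adjoint (D2 K w)) u = 0"
      define v where "v = op (mat_adjoint (N2 K w)) u"
      define q where "q = op (minv (D1 K w)) v"
      have v: "trunc m v" unfolding v_def by (rule trunc_op[OF c(2)])
      have q: "trunc m q" unfolding q_def by (rule trunc_op[OF mi(2)])
      have Dq: "op (D1 K w) q = v"
        unfolding q_def using op_mult[OF DN_carrier(1) mi(2), of v] mi(3) by (simp add: trunc_op_one[OF v])
      have "pip v v = pip u (op (N2 K w) (op (D1 K w) q))"
        unfolding Dq by (simp add: v_def op_adj)
      also have "\<dots> = pip (op (mat_adjoint (D2 K w)) u) (op (N1 K w) q)"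
        by (simp add: D2_N1[OF q, symmetric] op_adj)
      finally have "v = 0" unfolding u(2) by (intro cip.ip_definite) simp
      then show "u = 0" unfolding v_def by (rule DN2_injective[OF w u])
    qed
  qed
qed

text \<open>The projection bound gives <L s, s> <= |K sR p|^2 <= <R p, p>, so both terms of the
  quadratic identity are nonnegative.\<close>

lemma DN1_gap:
  assumes w: "cmod w < 1" and contr: "\<And>p. nrm (op K p) \<le> nrm p" and p: "trunc m p"
  shows "0 \<le> Re (pip (op J (op (D1 K w) p)) (op (D1 K w) p) - pip (op J (op (N1 K w) p)) (op (N1 K w) p))"
proof -
  define s where "s = op pL (op K (op sR p))"
  define h where "h = op (D1 K w) p"
  define g where "g = op (N1 K w) p"
  have t: "trunc m h" "trunc m g" "trunc m s"
    unfolding h_def g_def s_def by (rule trunc_op[OF DN_carrier(1)] trunc_op[OF DN_carrier(2)] trunc_op[OF sqrtL(2)])+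
  have h: "h = Polynomial.smult w (Jo (pot.sigmat w s)) + pot.rho w p"
    and g: "g = Polynomial.smult w (Jo (pot.taut w s)) + pot.ppi w p"
    unfolding h_def g_def s_def by (rule op_D1[OF p])+
  obtain x where x: "pip (Jo h) h - pip (Jo g) g = of_real (1 - (cmod w)\<^sup>2) * (\<Sum>i\<le>n. pip (Qop Jo Ao Aos (Suc n) x i) (x i))
      + of_real (cmod w ^ (2 * Suc n)) * (pip (op R p) p - pip (op L s) s)"
    using pot.lft_relations(3)[of w s p, folded h g, unfolded opE_trunc[OF p] opE_trunc[OF t(3)]] by blast
  have "nrm (op sL s) \<le> nrm (op K (op sR p))" unfolding s_def by (rule sqrtL(10))
  also have "\<dots> \<le> nrm (op sR p)" by (rule contr)
  finally have "0 \<le> Re (pip (op R p) p - pip (op L s) s)" by (simp add: sqrtL(9) sqrtR(9))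
  moreover have "0 \<le> Re (\<Sum>i\<le>n. pip (Qop Jo Ao Aos (Suc n) x i) (x i))"
    using Q_pos[of x] unfolding lessThan_Suc_atMost .
  moreover have "0 \<le> 1 - (cmod w)\<^sup>2" using w by (simp add: abs_square_le_1)
  moreover have rr: "Re (of_real r * z) = r * Re z" for r z by simp
  ultimately have "0 \<le> Re (pip (Jo h) h - pip (Jo g) g)"
    unfolding x plus_complex.sel rr by (intro add_nonneg_nonneg mult_nonneg_nonneg zero_le_power) auto
  then show ?thesis unfolding h_def[symmetric] g_def[symmetric] op_J[OF t(1)] op_J[OF t(2)] .
qed

end

text \<open>The hypothesis is a quadratic function of x that stays nonnegative. Along the kernel of
  Q it is affine, so its linear part vanishes there and Q X = G has a solution; at the minimiser -X
  it says <Q X, X> <= \<delta> / (1 - |w|^2). With this bound the term containing Q cancels in the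
  master identity. The factor of the last summand is the tail of the geometric series that completes
  the sum of |w|^(2k), k <= n, to 1 / (1 - |w|^2).\<close>

theorem fundamental_inequality:
  assumes w: "cmod w < 1" and h: "trunc m h" and g: "trunc m g"
    and fmi: "\<And>x. 0 \<le> Re (\<Sum>i\<le>n. pip (Jo (x i + Polynomial.smult (w ^ (n - i)) h)) (x i + Polynomial.smult (w ^ (n - i)) h)
        - pip (Jo (cv Ao x i + Polynomial.smult (w ^ (n - i)) g)) (cv Ao x i + Polynomial.smult (w ^ (n - i)) g))
      + (cmod w)\<^sup>2 ^ Suc n / (1 - (cmod w)\<^sup>2) * Re (pip (Jo h) h - pip (Jo g) g)"
  shows "\<exists>a c. pot.rhot w (Jo h) - pot.pit w (Jo g) = op R a \<and> pot.tau w g - pot.sigma w h = op L c \<and>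
    nrm (op sL c) \<le> (cmod w)\<^sup>2 * nrm (op sR a)"
proof -
  let ?Q = "Qop Jo Ao Aos (Suc n)" and ?G = "toep.Gv (Suc n) w h g"
  define \<delta> where "\<delta> = Re (pip (Jo h) h - pip (Jo g) g)"
  define eh where "eh i = Polynomial.smult (w ^ (n - i)) h" for i
  define eg where "eg i = Polynomial.smult (w ^ (n - i)) g" for i
  have w2: "0 < 1 - (cmod w)\<^sup>2" using w by (simp add: abs_square_less_1)
  have G: "?G i = Jo (eh i) - ac Aos (Suc n) (\<lambda>k. Jo (eg k)) i" for i
    by (simp add: toep.Gv_def eh_def eg_def)
  have cross: "(\<Sum>i<Suc n. pip (x i) (?G i)) = (\<Sum>i<Suc n. pip (x i) (Jo (eh i)) - pip (cv Ao x i) (Jo (eg i)))" for x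
    unfolding sum_subtractf toep.ip_cv G by (simp only: cip.ip_diff_right sum_subtractf)
  have const: "(\<Sum>i<Suc n. Re (pip (Jo (eh i)) (eh i) - pip (Jo (eg i)) (eg i))) = (\<Sum>k<Suc n. (cmod w)\<^sup>2 ^ k) * \<delta>"
  proof -
    have "Re (pip (Jo (eh i)) (eh i) - pip (Jo (eg i)) (eg i)) = (cmod w)\<^sup>2 ^ (n - i) * \<delta>" for i
    proof -
      have "w ^ (n - i) * cnj (w ^ (n - i)) = of_real ((cmod w)\<^sup>2 ^ (n - i))"
        by (metis complex_norm_square of_real_power power_mult_distrib complex_cnj_power)
      moreover have "pip (Jo (eh i)) (eh i) - pip (Jo (eg i)) (eg i) = (w ^ (n - i) * cnj (w ^ (n - i))) * (pip (Jo h) h - pip (Jo g) g)"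
        by (simp only: eh_def eg_def toep.linJ cip.ip_scale_left cip.ip_scale_right) (simp add: algebra_simps)
      ultimately have "pip (Jo (eh i)) (eh i) - pip (Jo (eg i)) (eg i) = of_real ((cmod w)\<^sup>2 ^ (n - i)) * (pip (Jo h) h - pip (Jo g) g)"
        by simp
      then show ?thesis by (simp add: \<delta>_def del: of_real_power)
    qed
    then have "(\<Sum>i<Suc n. Re (pip (Jo (eh i)) (eh i) - pip (Jo (eg i)) (eg i))) = (\<Sum>i<Suc n. (cmod w)\<^sup>2 ^ (Suc n - 1 - i) * \<delta>)"
      by (simp only: diff_Suc_1)
    also have "\<dots> = (\<Sum>i<Suc n. (cmod w)\<^sup>2 ^ i * \<delta>)"
      by (rule sum_rev[where f="\<lambda>i. (cmod w)\<^sup>2 ^ i * \<delta>"])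
    finally show ?thesis by (simp only: sum_distrib_right)
  qed
  have geo: "(\<Sum>k<Suc n. (cmod w)\<^sup>2 ^ k) * \<delta> + (cmod w)\<^sup>2 ^ Suc n / (1 - (cmod w)\<^sup>2) * \<delta> = \<delta> / (1 - (cmod w)\<^sup>2)"
  proof -
    have "(\<Sum>k<Suc n. (cmod w)\<^sup>2 ^ k) = (1 - (cmod w)\<^sup>2 ^ Suc n) / (1 - (cmod w)\<^sup>2)"
      using w2 by (subst sum_gp_strict) simp
    then have "(\<Sum>k<Suc n. (cmod w)\<^sup>2 ^ k) * \<delta> + (cmod w)\<^sup>2 ^ Suc n / (1 - (cmod w)\<^sup>2) * \<delta>
        = ((1 - (cmod w)\<^sup>2 ^ Suc n) / (1 - (cmod w)\<^sup>2) + (cmod w)\<^sup>2 ^ Suc n / (1 - (cmod w)\<^sup>2)) * \<delta>"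
      by (simp only: distrib_right)
    also have "\<dots> = \<delta> / (1 - (cmod w)\<^sup>2)" by (simp only: add_divide_distrib[symmetric]) simp
    finally show ?thesis .
  qed
  have F: "0 \<le> Re (\<Sum>i<Suc n. pip (?Q x i) (x i)) + 2 * Re (\<Sum>i<Suc n. pip (x i) (?G i)) + \<delta> / (1 - (cmod w)\<^sup>2)" for x
  proof -
    have e: "Re (pip (Jo (x i + eh i)) (x i + eh i) - pip (Jo (cv Ao x i + eg i)) (cv Ao x i + eg i)) =
        Re (pip (Jo (x i)) (x i) - pip (Jo (cv Ao x i)) (cv Ao x i)) + 2 * Re (pip (x i) (Jo (eh i)) - pip (cv Ao x i) (Jo (eg i)))
        + Re (pip (Jo (eh i)) (eh i) - pip (Jo (eg i)) (eg i))" for i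
    proof -
      have "Re (pip (Jo u) v) = Re (pip v (Jo u))" for u v by (subst cip.ip_cnj[symmetric]) simp
      then show ?thesis
        by (simp add: toep.linJ cip.ip_add_left cip.ip_add_right toep.J_adj[symmetric])
    qed
    have "Re (\<Sum>i\<le>n. pip (Jo (x i + eh i)) (x i + eh i) - pip (Jo (cv Ao x i + eg i)) (cv Ao x i + eg i)) =
       Re (\<Sum>i<Suc n. pip (?Q x i) (x i)) + 2 * Re (\<Sum>i<Suc n. pip (x i) (?G i)) + (\<Sum>k<Suc n. (cmod w)\<^sup>2 ^ k) * \<delta>"
      unfolding cross toep.Qop_form const[symmetric] lessThan_Suc_atMost[symmetric] Re_sum
      by (simp only: e sum.distrib sum_distrib_left)
    then show ?thesis using fmi[of x, folded eh_def eg_def \<delta>_def] geo by linarith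
  qed
  have tG: "trunc m (?G i)" for i
    unfolding G eh_def by (intro trunc_closed Jo_trunc h trunc_ac order.refl)
  define X where "X = unb m (mp_inv (Q_mat m J A n) *\<^sub>v bvec m (Suc n) ?G)"
  have herm: "mat_adjoint (Q_mat m J A n) = Q_mat m J A n" by (rule QP_hermitian)
  have "Q_mat m J A n *\<^sub>v (mp_inv (Q_mat m J A n) *\<^sub>v bvec m (Suc n) ?G) = bvec m (Suc n) ?G"
  proof (rule mp_solve[OF Q_carrier(1) herm bvec_carrier(1)])
    fix x assume x: "x \<in> carrier_vec (Suc n * m)" "Q_mat m J A n *\<^sub>v x = 0\<^sub>v (Suc n * m)"
    let ?x = "unb m x"
    have xb: "x = bvec m (Suc n) ?x" using bvec_unb[OF m x(1)] ..
    have z: "bvec m (Suc n) (?Q ?x) = bvec m (Suc n) (\<lambda>_. 0)"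
      using x(2) xb Q_bvec[OF order.refl, of ?x] bvec_zeroI[OF m, of "Suc n" "\<lambda>_. 0"] by simp
    have ker: "?Q ?x i = 0" if "i < Suc n" for i
      by (rule bvec_eqD[OF m z that]) (auto intro!: trunc_Qop trunc_unb trunc_closed)
    define \<beta> where "\<beta> = (\<Sum>i<Suc n. pip (?x i) (?G i))"
    have "\<beta> = 0"
    proof (rule ccontr)
      assume "\<beta> \<noteq> 0"
      define C where "C = \<delta> / (1 - (cmod w)\<^sup>2)"
      have "0 \<le> C - 2 * t * (cmod \<beta>)\<^sup>2" for t
      proof -
        define c where "c = - of_real t * cnj \<beta>"
        have "(\<Sum>i<Suc n. pip (?Q (\<lambda>i. Polynomial.smult c (?x i)) i) (Polynomial.smult c (?x i))) = 0"
          by (intro sum.neutral ballI) (simp add: toep.Qop_scale ker)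
        moreover have "(\<Sum>i<Suc n. pip (Polynomial.smult c (?x i)) (?G i)) = c * \<beta>"
          unfolding \<beta>_def by (simp only: cip.ip_scale_left sum_distrib_left)
        moreover have "c * \<beta> = - of_real (t * (cmod \<beta>)\<^sup>2)"
          by (simp add: c_def complex_norm_square mult.commute del: of_real_power)
        ultimately show ?thesis using F[of "\<lambda>i. Polynomial.smult c (?x i)"] by (simp add: C_def)
      qed
      from this[of "(C + 1) / (cmod \<beta>)\<^sup>2"] this[of 0] \<open>\<beta> \<noteq> 0\<close> show False by simp
    qed
    have "hdot (Suc n * m) (bvec m (Suc n) ?G) x = (\<Sum>i<Suc n. pip (?G i) (?x i))"
      by (subst xb) (rule hdot_bvec_trunc[OF m tG])
    also have "\<dots> = cnj \<beta>" by (simp add: \<beta>_def cip.ip_cnj)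
    finally show "hdot (Suc n * m) (bvec m (Suc n) ?G) x = 0" using \<open>\<beta> = 0\<close> by simp
  qed
  moreover have "bvec m (Suc n) X = mp_inv (Q_mat m J A n) *\<^sub>v bvec m (Suc n) ?G"
    unfolding X_def
    by (rule bvec_unb[OF m mult_mat_vec_carrier[OF mp_inv_hermitian(1)[OF Q_carrier(1) herm] bvec_carrier(1)]])
  ultimately have "bvec m (Suc n) (?Q X) = bvec m (Suc n) ?G"
    by (simp add: Q_bvec[OF order.refl, symmetric])
  then have QX: "?Q X i = ?G i" if "i \<le> n" for i
    by (rule bvec_eqD[OF m]) (use that tG in \<open>auto intro!: trunc_Qop simp: X_def trunc_unb\<close>)
  define q where "q = Re (\<Sum>i<Suc n. pip (?Q X i) (X i))"
  have "0 \<le> q - 2 * q + \<delta> / (1 - (cmod w)\<^sup>2)"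
  proof -
    have Qm: "?Q (\<lambda>i. - X i) i = - ?Q X i" for i
      using toep.Qop_scale[of "Suc n" "-1" X i] by simp
    have "(\<Sum>i<Suc n. pip (?Q (\<lambda>i. - X i) i) (- X i)) = (\<Sum>i<Suc n. pip (?Q X i) (X i))"
      by (simp only: Qm cip.ip_minus_left cip.ip_minus_right minus_minus)
    moreover have "Re (\<Sum>i<Suc n. pip (- X i) (?G i)) = - q"
    proof -
      have "(\<Sum>i<Suc n. pip (- X i) (?G i)) = - (\<Sum>i<Suc n. pip (X i) (?Q X i))"
        by (simp add: QX cip.ip_minus_left sum_negf)
      then show ?thesis by (simp add: q_def toep.Qop_sym)
    qed
    ultimately show ?thesis using F[of "\<lambda>i. - X i"] by (simp add: q_def)
  qed
  then have "q \<le> \<delta> / (1 - (cmod w)\<^sup>2)" by simp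
  then have q: "(1 - (cmod w)\<^sup>2) * q \<le> \<delta>" using w2 by (simp add: pos_le_divide_eq mult.commute)
  define c where "c = Jo (g - cv Ao X n)"
  have tc: "trunc m c" "trunc m (X 0)"
    unfolding c_def X_def by (intro Jo_trunc trunc_closed g trunc_cv trunc_unb order.refl)+
  note mi = pot.master_identity[OF QX, folded c_def, unfolded opE_trunc[OF tc(1)] opE_trunc[OF tc(2)] sqrtL(9) sqrtR(9)]
  have rr: "Re (of_real r * z) = r * Re z" for r z by simp
  have e: "pip (Jo h) h - pip (Jo g) g = of_real (1 - (cmod w)\<^sup>2) * (\<Sum>i\<le>n. pip (?Q X i) (X i))
      + of_real ((cmod w)\<^sup>2) * of_real (nrm (op sR (X 0))) - of_real (nrm (op sL c))"
    by (rule mi(1))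
  have "\<delta> = (1 - (cmod w)\<^sup>2) * q + (cmod w)\<^sup>2 * nrm (op sR (X 0)) - nrm (op sL c)"
    unfolding \<delta>_def q_def lessThan_Suc_atMost e
    by (simp only: plus_complex.sel minus_complex.sel rr Re_complex_of_real)
  then have "nrm (op sL c) \<le> (cmod w)\<^sup>2 * nrm (op sR (X 0))" using q by linarith
  moreover have "pot.rhot w (Jo h) - pot.pit w (Jo g) = op R (X 0)" by (rule mi(2))
  moreover have "pot.tau w g - pot.sigma w h = op L c" by (rule mi(3))
  ultimately show ?thesis by blast
qed

end

section \<open>Holomorphic matrix functions\<close>

definition mholo :: "nat \<Rightarrow> complex set \<Rightarrow> (complex \<Rightarrow> complex mat) \<Rightarrow> bool" where
  "mholo m S F \<longleftrightarrow> (\<forall>z\<in>S. F z \<in> carrier_mat m m) \<and> (\<forall>i<m. \<forall>j<m. (\<lambda>z. F z $$ (i, j)) holomorphic_on S)"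

lemma mholoI:
  "(\<And>z. z \<in> S \<Longrightarrow> F z \<in> carrier_mat m m) \<Longrightarrow> (\<And>i j. i < m \<Longrightarrow> j < m \<Longrightarrow> (\<lambda>z. F z $$ (i, j)) holomorphic_on S) \<Longrightarrow> mholo m S F"
  by (simp add: mholo_def)

lemma mholoD: "mholo m S F \<Longrightarrow> z \<in> S \<Longrightarrow> F z \<in> carrier_mat m m"
  "mholo m S F \<Longrightarrow> i < m \<Longrightarrow> j < m \<Longrightarrow> (\<lambda>z. F z $$ (i, j)) holomorphic_on S"
  by (simp_all add: mholo_def)

lemma mholo_subset: "mholo m S F \<Longrightarrow> T \<subseteq> S \<Longrightarrow> mholo m T F"
  unfolding mholo_def by (blast intro: holomorphic_on_subset)

lemma mholo_const: "C \<in> carrier_mat m m \<Longrightarrow> mholo m S (\<lambda>z. C)"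
  by (simp add: mholo_def)

lemma mholo_add:
  assumes "mholo m S F" "mholo m S G" shows "mholo m S (\<lambda>z. F z + G z)"
proof (rule mholoI)
  fix i j assume ij: "i < m" "j < m"
  have "(\<lambda>z. F z $$ (i, j) + G z $$ (i, j)) holomorphic_on S"
    using assms ij by (intro holomorphic_intros mholoD(2))
  moreover have "(F z + G z) $$ (i, j) = F z $$ (i, j) + G z $$ (i, j)" if "z \<in> S" for z
    using mholoD(1)[OF assms(2) that] ij by simp
  ultimately show "(\<lambda>z. (F z + G z) $$ (i, j)) holomorphic_on S"
    by (subst holomorphic_cong[OF refl]) auto
qed (use mholoD(1)[OF assms(1)] mholoD(1)[OF assms(2)] in auto)

lemma mholo_mult:
  assumes "mholo m S F" "mholo m S G" shows "mholo m S (\<lambda>z. F z * G z)"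
proof (rule mholoI)
  fix i j assume ij: "i < m" "j < m"
  have "(\<lambda>z. \<Sum>k<m. F z $$ (i, k) * G z $$ (k, j)) holomorphic_on S"
    using assms ij by (intro holomorphic_intros mholoD(2)) auto
  moreover have "(F z * G z) $$ (i, j) = (\<Sum>k<m. F z $$ (i, k) * G z $$ (k, j))" if "z \<in> S" for z
    by (rule mult_mat_index[OF mholoD(1)[OF assms(1) that] mholoD(1)[OF assms(2) that] ij])
  ultimately show "(\<lambda>z. (F z * G z) $$ (i, j)) holomorphic_on S"
    by (subst holomorphic_cong[OF refl]) auto
qed (use mholoD(1)[OF assms(1)] mholoD(1)[OF assms(2)] in auto)

lemma mholo_smult:
  assumes "f holomorphic_on S" "mholo m S F" shows "mholo m S (\<lambda>z. f z \<cdot>\<^sub>m F z)"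
proof (rule mholoI)
  fix i j assume ij: "i < m" "j < m"
  have "(\<lambda>z. f z * F z $$ (i, j)) holomorphic_on S"
    using assms ij by (intro holomorphic_intros mholoD(2))
  moreover have "(f z \<cdot>\<^sub>m F z) $$ (i, j) = f z * F z $$ (i, j)" if "z \<in> S" for z
    using mholoD(1)[OF assms(2) that] ij by simp
  ultimately show "(\<lambda>z. (f z \<cdot>\<^sub>m F z) $$ (i, j)) holomorphic_on S"
    by (subst holomorphic_cong[OF refl]) auto
qed (use mholoD(1)[OF assms(2)] in auto)

lemma mholo_minus:
  assumes "mholo m S F" "mholo m S G" shows "mholo m S (\<lambda>z. F z - G z)"
proof (rule mholoI)
  fix i j assume ij: "i < m" "j < m"
  have "(\<lambda>z. F z $$ (i, j) - G z $$ (i, j)) holomorphic_on S"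
    using assms ij by (intro holomorphic_intros mholoD(2))
  moreover have "(F z - G z) $$ (i, j) = F z $$ (i, j) - G z $$ (i, j)" if "z \<in> S" for z
    using mholoD(1)[OF assms(2) that] ij by simp
  ultimately show "(\<lambda>z. (F z - G z) $$ (i, j)) holomorphic_on S"
    by (subst holomorphic_cong[OF refl]) auto
qed (use mholoD(1)[OF assms(1)] mholoD(1)[OF assms(2)] in \<open>auto intro: minus_carrier_mat\<close>)

lemma mholo_cong: "(\<And>z. z \<in> S \<Longrightarrow> F z = G z) \<Longrightarrow> mholo m S F \<longleftrightarrow> mholo m S G"
  unfolding mholo_def by (metis (no_types, lifting) holomorphic_cong)

lemma holo_det:
  assumes "\<And>z. z \<in> S \<Longrightarrow> F z \<in> carrier_mat k k"
    and "\<And>i j. i < k \<Longrightarrow> j < k \<Longrightarrow> (\<lambda>z. F z $$ (i, j)) holomorphic_on S"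
  shows "(\<lambda>z. Determinant.det (F z)) holomorphic_on S"
proof -
  have "(\<lambda>z. \<Sum>p | p permutes {0..<k}. signof p * (\<Prod>i = 0..<k. F z $$ (i, p i))) holomorphic_on S"
  proof (intro holomorphic_intros)
    fix p i assume "p \<in> {p. p permutes {0..<k}}" "i \<in> {0..<k}"
    then have "p i < k" by (metis atLeastLessThan_iff mem_Collect_eq permutes_in_image)
    then show "(\<lambda>z. F z $$ (i, p i)) holomorphic_on S" using assms(2) \<open>i \<in> {0..<k}\<close> by simp
  qed
  then show ?thesis
    by (subst holomorphic_cong[OF refl det_def'[OF assms(1)]]) auto
qed

lemma mholo_det: "mholo m S F \<Longrightarrow> (\<lambda>z. Determinant.det (F z)) holomorphic_on S"
  by (rule holo_det) (auto simp: mholo_def)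

lemma mholo_adj_mat:
  assumes F: "mholo m S F" shows "mholo m S (\<lambda>z. adj_mat (F z))"
proof (rule mholoI)
  show "adj_mat (F z) \<in> carrier_mat m m" if "z \<in> S" for z by (rule adj_mat(1)[OF mholoD(1)[OF F that]])
  fix i j assume ij: "i < m" "j < m"
  have c: "F z \<in> carrier_mat m m" if "z \<in> S" for z by (rule mholoD(1)[OF F that])
  have "(\<lambda>z. Determinant.det (mat_delete (F z) j i)) holomorphic_on S"
  proof (rule holo_det)
    show "mat_delete (F z) j i \<in> carrier_mat (m - 1) (m - 1)" if "z \<in> S" for z
      using c[OF that] by (simp add: mat_delete_def)
    fix i' j' assume ij': "i' < m - 1" "j' < m - 1"
    have "mat_delete (F z) j i $$ (i', j') = F z $$ (if i' < j then i' else Suc i', if j' < i then j' else Suc j')" if "z \<in> S" for z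
      using c[OF that] ij' by (simp add: mat_delete_def)
    moreover have "(\<lambda>z. F z $$ (if i' < j then i' else Suc i', if j' < i then j' else Suc j')) holomorphic_on S"
      using ij' by (intro mholoD(2)[OF F]) auto
    ultimately show "(\<lambda>z. mat_delete (F z) j i $$ (i', j')) holomorphic_on S"
      by (subst holomorphic_cong[OF refl]) auto
  qed
  then have "(\<lambda>z. (-1) ^ (j + i) * Determinant.det (mat_delete (F z) j i)) holomorphic_on S"
    by (intro holomorphic_intros)
  moreover have "adj_mat (F z) $$ (i, j) = (-1) ^ (j + i) * Determinant.det (mat_delete (F z) j i)" if "z \<in> S" for z
    using c[OF that] ij by (simp add: adj_mat_def cofactor_def)
  ultimately show "(\<lambda>z. adj_mat (F z) $$ (i, j)) holomorphic_on S"
    by (subst holomorphic_cong[OF refl]) auto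
qed

lemma mholo_minv:
  assumes F: "mholo m S F" and det: "\<And>z. z \<in> S \<Longrightarrow> Determinant.det (F z) \<noteq> 0"
  shows "mholo m S (\<lambda>z. minv (F z))"
proof -
  have "mholo m S (\<lambda>z. (1 / Determinant.det (F z)) \<cdot>\<^sub>m adj_mat (F z))"
    using det by (intro mholo_smult mholo_adj_mat F holomorphic_intros mholo_det[OF F])
  then show ?thesis
    by (subst mholo_cong) (use minv_det(1)[OF mholoD(1)[OF F] det] in auto)
qed

section \<open>Removable singularities and exceptional sets\<close>

lemma bounded_extension_point:
  assumes f: "f holomorphic_on (ball p r - {p})" and r: "0 < r" and B: "\<And>z. z \<in> ball p r - {p} \<Longrightarrow> cmod (f z) \<le> B"
  shows "\<exists>g. g holomorphic_on ball p r \<and> (\<forall>z\<in>ball p r - {p}. g z = f z)"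
proof -
  \<comment> \<open>The factor z - p turns boundedness into the limit 0, so the singularity is
    removed for the product first. As F vanishes at p, its difference quotient there is f
    again.\<close>
  define F where "F = (\<lambda>z. if z = p then 0 else (z - p) * f z)"
  have lim: "((\<lambda>z. (z - p) * f z) \<longlongrightarrow> 0) (at p)"
  proof (rule Lim_null_comparison)
    show "\<forall>\<^sub>F z in at p. cmod ((z - p) * f z) \<le> cmod (z - p) * \<bar>B\<bar>"
      using eventually_at_ball[OF r, of p UNIV]
    proof (rule eventually_mono[OF eventually_conj[OF _ eventually_neq_at_within[of p p UNIV]]])
      fix z assume "(z \<in> ball p r \<and> z \<in> UNIV) \<and> z \<noteq> p"
      then have "cmod (f z) \<le> \<bar>B\<bar>" using B[of z] by auto
      then show "cmod ((z - p) * f z) \<le> cmod (z - p) * \<bar>B\<bar>"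
        by (simp add: norm_mult mult_left_mono)
    qed
    show "((\<lambda>z. cmod (z - p) * \<bar>B\<bar>) \<longlongrightarrow> 0) (at p)"
      by (auto intro!: tendsto_eq_intros)
  qed
  have "(\<lambda>z. (z - p) * f z) holomorphic_on ball p r - {p}"
    by (intro holomorphic_intros f)
  from removable_singularity[OF this open_ball lim] have F: "F holomorphic_on ball p r"
    by (simp add: F_def)
  define g where "g = (\<lambda>z. if z = p then deriv F p else (F z - F p) / (z - p))"
  have "g holomorphic_on ball p r"
    unfolding g_def by (rule pole_lemma[OF F]) (use r in simp)
  moreover have "\<forall>z\<in>ball p r - {p}. g z = f z" by (auto simp: g_def F_def)
  ultimately show ?thesis by blast
qed

text \<open>Z has no accumulation point in D. Posing the condition at every point of D, and not only
  at the points of Z, also makes D and D - Z open.\<close>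

definition sparse_in_set :: "complex set \<Rightarrow> complex set \<Rightarrow> bool" where
  "sparse_in_set D Z \<longleftrightarrow> (\<forall>p\<in>D. \<exists>r>0. ball p r \<subseteq> D \<and> (ball p r - {p}) \<inter> Z = {})"

lemma sparse_in_setE:
  assumes "sparse_in_set D Z" "p \<in> D"
  obtains r where "0 < r" "ball p r \<subseteq> D" "(ball p r - {p}) \<inter> Z = {}"
  using assms unfolding sparse_in_set_def by blast

lemma sparse_in_setI:
  assumes "\<And>p. p \<in> D \<Longrightarrow> \<exists>r>0. ball p r \<subseteq> D \<and> (ball p r - {p}) \<inter> Z = {}"
  shows "sparse_in_set D Z"
  using assms unfolding sparse_in_set_def by blast

lemma holomorphic_isCont: "f holomorphic_on S \<Longrightarrow> open S \<Longrightarrow> z \<in> S \<Longrightarrow> isCont f z"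
  using holomorphic_on_imp_continuous_on[of f S] continuous_on_eq_continuous_at[of S f] by blast

lemma sparse_in_set_Un:
  assumes "sparse_in_set D Y" "sparse_in_set D Z" shows "sparse_in_set D (Y \<union> Z)"
  unfolding sparse_in_set_def
proof
  fix p assume p: "p \<in> D"
  obtain r s where "0 < r" "ball p r \<subseteq> D" "(ball p r - {p}) \<inter> Y = {}"
    and "0 < s" "ball p s \<subseteq> D" "(ball p s - {p}) \<inter> Z = {}"
    by (rule sparse_in_setE[OF assms(1) p], rule sparse_in_setE[OF assms(2) p])
  moreover have "ball p (min r s) \<subseteq> ball p r" "ball p (min r s) \<subseteq> ball p s" by auto
  ultimately show "\<exists>r>0. ball p r \<subseteq> D \<and> (ball p r - {p}) \<inter> (Y \<union> Z) = {}"
    by (intro exI[of _ "min r s"] conjI) (simp, blast, blast)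
qed

lemma sparse_in_set_singleton: "open D \<Longrightarrow> sparse_in_set D {a}"
  unfolding sparse_in_set_def
proof
  fix p assume "open D" "p \<in> D"
  then obtain r where r: "0 < r" "ball p r \<subseteq> D" by (rule openE)
  show "\<exists>r>0. ball p r \<subseteq> D \<and> (ball p r - {p}) \<inter> {a} = {}"
  proof (cases "a = p")
    case False
    then show ?thesis using r by (intro exI[of _ "min r (dist p a)"]) auto
  qed (use r in auto)
qed

lemma sparse_in_set_zeros:
  assumes f: "f holomorphic_on D" and D: "open D" "connected D" and a: "a \<in> D" "f a \<noteq> 0"
  shows "sparse_in_set D {z. f z = 0}"
  unfolding sparse_in_set_def
proof
  fix p assume p: "p \<in> D"
  show "\<exists>r>0. ball p r \<subseteq> D \<and> (ball p r - {p}) \<inter> {z. f z = 0} = {}"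
  proof (cases "f p = 0")
    case True
    obtain r where "0 < r" "ball p r \<subseteq> D" "\<And>z. z \<in> ball p r - {p} \<Longrightarrow> f z \<noteq> 0"
      using isolated_zeros[OF f D p True a] by blast
    then show ?thesis by (intro exI[of _ r]) blast
  next
    case False
    have "continuous_on D f" using f by (rule holomorphic_on_imp_continuous_on)
    then have "open (D \<inter> f -` (- {0}))" using D by (intro continuous_open_preimage) auto
    moreover have "p \<in> D \<inter> f -` (- {0})" using p False by simp
    ultimately obtain r where "0 < r" "ball p r \<subseteq> D \<inter> f -` (- {0})" by (rule openE)
    then show ?thesis by (intro exI[of _ r]) auto
  qed
qed

lemma sparse_open_complement:
  assumes "sparse_in_set D Z" shows "open (D - Z)"
  unfolding open_contains_ball
proof
  fix p assume p: "p \<in> D - Z"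
  obtain r where "0 < r" "ball p r \<subseteq> D" "(ball p r - {p}) \<inter> Z = {}"
    using sparse_in_setE[OF assms, of p] p by auto
  then show "\<exists>e>0. ball p e \<subseteq> D - Z" using p by (intro exI[of _ r]) auto
qed

text \<open>Each local extension is determined by its limit at the exceptional point, so a single
  definition with \<open>Lim\<close> glues all of them.\<close>

lemma bounded_extension:
  assumes Z: "sparse_in_set D Z" and f: "f holomorphic_on (D - Z)" and B: "\<And>z. z \<in> D - Z \<Longrightarrow> cmod (f z) \<le> B"
  shows "\<exists>g. g holomorphic_on D \<and> (\<forall>z\<in>D - Z. g z = f z)"
proof -
  define g where "g p = (if p \<in> Z then Lim (at p) f else f p)" for p
  have "\<exists>r>0. ball p r \<subseteq> D \<and> g holomorphic_on ball p r" if p: "p \<in> D" for p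
  proof -
    obtain r where r: "0 < r" "ball p r \<subseteq> D" "(ball p r - {p}) \<inter> Z = {}"
      by (rule sparse_in_setE[OF Z p])
    have sub: "ball p r - {p} \<subseteq> D - Z" using r by blast
    obtain h where h: "h holomorphic_on ball p r" "\<forall>z\<in>ball p r - {p}. h z = f z"
      using bounded_extension_point[OF holomorphic_on_subset[OF f sub] r(1), of B] B sub by blast
    have "isCont h p"
      by (rule holomorphic_isCont[OF h(1) open_ball]) (simp add: r(1))
    then have "(h \<longlongrightarrow> h p) (at p)" by (simp add: isCont_def)
    moreover have "\<forall>\<^sub>F z in at p. h z = f z"
      using eventually_at_ball[OF r(1), of p UNIV]
      by (rule eventually_mono[OF eventually_conj[OF _ eventually_neq_at_within[of p p UNIV]]]) (use h in auto)
    ultimately have lim: "(f \<longlongrightarrow> h p) (at p)" by (rule Lim_transform_eventually)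
    have gp: "g p = h p"
    proof (cases "p \<in> Z")
      case True
      then show ?thesis unfolding g_def using tendsto_Lim[OF _ lim] by simp
    next
      case False
      then have "p \<in> D - Z" using p by simp
      then have "isCont f p"
        by (rule holomorphic_isCont[OF f sparse_open_complement[OF Z]])
      then have "(f \<longlongrightarrow> f p) (at p)" by (simp add: isCont_def)
      then show ?thesis using LIM_unique[OF _ lim] False by (auto simp: g_def)
    qed
    have gh: "g z = h z" if "z \<in> ball p r" for z
    proof (cases "z = p")
      case False
      then have "z \<notin> Z" "h z = f z" using that h(2) r(3) by blast+
      then show ?thesis by (simp add: g_def)
    qed (simp add: gp)
    have "g holomorphic_on ball p r" by (rule holomorphic_transform[OF h(1)]) (simp add: gh)
    then show ?thesis using r by blast
  qed
  then have "g analytic_on D" unfolding analytic_on_def by blast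
  then have "g holomorphic_on D" by (rule analytic_imp_holomorphic)
  then show ?thesis by (intro exI[of _ g]) (auto simp: g_def)
qed

text \<open>Every point of D is a limit of points off Z. This is how inequalities and identities
  proved off the exceptional set are carried over to it.\<close>

lemma sparse_closure:
  assumes Z: "sparse_in_set D Z" and f: "continuous_on D f" and pos: "\<And>z. z \<in> D - Z \<Longrightarrow> (0::real) \<le> f z" and p: "p \<in> D"
  shows "0 \<le> f p"
proof -
  obtain r where r: "0 < r" "ball p r \<subseteq> D" "(ball p r - {p}) \<inter> Z = {}"
    by (rule sparse_in_setE[OF Z p])
  have pos': "0 \<le> f z" if "z \<in> ball p r" "z \<noteq> p" for z
    using that r by (intro pos) blast
  have "isCont f p"
    using continuous_on_subset[OF f r(2)] r(1) by (simp add: continuous_on_eq_continuous_at)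
  then have "(f \<longlongrightarrow> f p) (at p)" by (simp add: isCont_def)
  moreover have "\<forall>\<^sub>F z in at p. 0 \<le> f z"
    using eventually_at_ball[OF r(1), of p UNIV]
    by (rule eventually_mono[OF eventually_conj[OF _ eventually_neq_at_within[of p p UNIV]]]) (use pos' in auto)
  ultimately show ?thesis by (rule tendsto_lowerbound) simp
qed

lemma sparse_eq:
  assumes Z: "sparse_in_set D Z" and f: "continuous_on D f" and g: "continuous_on D g"
    and eq: "\<And>z. z \<in> D - Z \<Longrightarrow> f z = (g z :: complex)" and p: "p \<in> D"
  shows "f p = g p"
proof -
  have "0 \<le> - cmod (f p - g p)"
    by (rule sparse_closure[OF Z _ _ p, of "\<lambda>z. - cmod (f z - g z)"]) (use eq in \<open>auto intro!: continuous_intros f g\<close>)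
  then show ?thesis by simp
qed

section \<open>Taylor coefficients and contractive Toeplitz sections\<close>

definition tc :: "(complex \<Rightarrow> complex) \<Rightarrow> nat \<Rightarrow> complex" where
  "tc f k = (deriv ^^ k) f 0 / fact k"

lemma tc_0 [simp]: "tc f 0 = f 0"
  by (simp add: tc_def)

lemma tc_fps: "f has_fps_expansion F \<Longrightarrow> tc f k = fps_nth F k"
  by (simp add: tc_def fps_nth_fps_expansion)

lemma analytic_fps: "f analytic_on {0} \<Longrightarrow> f has_fps_expansion fps_expansion f 0"
  by (rule analytic_at_imp_has_fps_expansion_0)

lemma tc_cong: "(\<forall>\<^sub>F z in nhds 0. f z = g z) \<Longrightarrow> tc f k = tc g k"
  unfolding tc_def by (subst higher_deriv_cong_ev[OF _ refl]) auto

lemma tc_const_mult: "f analytic_on {0} \<Longrightarrow> tc (\<lambda>z. c * f z) k = c * tc f k"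
  by (simp add: tc_fps[OF has_fps_expansion_cmult_left[OF analytic_fps]] tc_fps[OF analytic_fps])

lemma tc_mult:
  assumes "f analytic_on {0}" "g analytic_on {0}"
  shows "tc (\<lambda>z. f z * g z) k = (\<Sum>j\<le>k. tc f (k - j) * tc g j)"
proof -
  have "tc (\<lambda>z. f z * g z) k = (\<Sum>i=0..k. tc f i * tc g (k - i))"
    using assms by (simp add: tc_fps[OF has_fps_expansion_mult[OF analytic_fps analytic_fps]] tc_fps[OF analytic_fps] fps_mult_nth)
  also have "\<dots> = (\<Sum>j\<le>k. tc f (k - j) * tc g j)"
    by (rule sum.reindex_bij_witness[where i="\<lambda>j. k - j" and j="\<lambda>j. k - j"]) auto
  finally show ?thesis .
qed

lemma tc_add: "f analytic_on {0} \<Longrightarrow> g analytic_on {0} \<Longrightarrow> tc (\<lambda>z. f z + g z) k = tc f k + tc g k"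
  by (simp add: tc_fps[OF has_fps_expansion_add[OF analytic_fps analytic_fps]] tc_fps[OF analytic_fps])

lemma tc_zero [simp]: "tc (\<lambda>z. 0) k = 0"
  by (simp add: tc_fps[OF has_fps_expansion_0])

lemma tc_sum: "finite I \<Longrightarrow> (\<And>i. i \<in> I \<Longrightarrow> f i analytic_on {0}) \<Longrightarrow> tc (\<lambda>z. \<Sum>i\<in>I. f i z) k = (\<Sum>i\<in>I. tc (f i) k)"
proof (induction I rule: finite_induct)
  case (insert i I)
  have "(\<lambda>z. \<Sum>i\<in>I. f i z) analytic_on {0}" using insert by (intro analytic_intros) auto
  then show ?case using insert by (simp add: tc_add)
qed simp

lemma tc_poly: "k \<le> n \<Longrightarrow> tc (\<lambda>z. \<Sum>l\<le>n. z ^ l * c l) k = c k"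
  using taylor_coeff_polynomial[of k n c] by (simp add: tc_def mult.commute)

lemma tc_monom_mult:
  assumes f: "f analytic_on {0}"
  shows "tc (\<lambda>z. z ^ N * f z) k = (if k < N then 0 else tc f (k - N))"
proof -
  have "(\<lambda>z. z ^ N * f z) has_fps_expansion fps_X ^ N * fps_expansion f 0"
    by (intro fps_expansion_intros analytic_fps f)
  then show ?thesis by (simp add: tc_fps tc_fps[OF analytic_fps[OF f]] fps_X_power_mult_nth)
qed

text \<open>One power of z is divided off per step. Tracking the value of the quotient at 0 allows
  the next coefficient to be recognised as its zero.\<close>

lemma holomorphic_factor_power:
  assumes f: "f holomorphic_on D" and D: "open D" "0 \<in> D" and z: "\<And>k. k < n \<Longrightarrow> tc f k = 0"
  shows "\<exists>g. g holomorphic_on D \<and> (\<forall>z\<in>D. f z = z ^ n * g z) \<and> g 0 = tc f n"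
  using z
proof (induction n)
  case 0
  then show ?case using f by auto
next
  case (Suc n)
  then obtain g where g: "g holomorphic_on D" "\<forall>z\<in>D. f z = z ^ n * g z" "g 0 = tc f n" by auto
  define h where "h = (\<lambda>z. if z = 0 then deriv g 0 else (g z - g 0) / (z - 0))"
  have h: "h holomorphic_on D" unfolding h_def by (rule pole_lemma_open[OF g(1) D(1)])
  have g0: "g 0 = 0" using g(3) Suc.prems[of n] by simp
  have "f z = z ^ Suc n * h z" if "z \<in> D" for z
    using g(2) that g0 by (auto simp: h_def)
  moreover have "h 0 = tc f (Suc n)"
  proof -
    have han: "h analytic_on {0}" using h D unfolding analytic_at by blast
    have "tc f (Suc n) = tc (\<lambda>z. z ^ Suc n * h z) (Suc n)"
      using calculation by (intro tc_cong eventually_mono[OF eventually_nhds_in_open[OF D]]) auto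
    then show ?thesis using tc_monom_mult[OF han, of "Suc n" "Suc n"] by simp
  qed
  ultimately show ?case using h by blast
qed

section \<open>Taylor coefficients of vector and matrix functions\<close>

definition vtc :: "nat \<Rightarrow> (complex \<Rightarrow> complex poly) \<Rightarrow> nat \<Rightarrow> complex poly" where
  "vtc m \<phi> k = (\<Sum>i<m. monom (tc (\<lambda>z. coeff (\<phi> z) i) k) i)"

definition mtc :: "nat \<Rightarrow> (complex \<Rightarrow> complex mat) \<Rightarrow> nat \<Rightarrow> complex mat" where
  "mtc m F k = mat m m (\<lambda>(i,j). tc (\<lambda>z. F z $$ (i, j)) k)"

definition vana :: "(complex \<Rightarrow> complex poly) \<Rightarrow> bool" where
  "vana \<phi> \<longleftrightarrow> (\<forall>i. (\<lambda>z. coeff (\<phi> z) i) analytic_on {0})"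

definition mana :: "nat \<Rightarrow> (complex \<Rightarrow> complex mat) \<Rightarrow> bool" where
  "mana m F \<longleftrightarrow> (\<exists>r>0. mholo m (ball 0 r) F)"

lemma coeff_vtc: "coeff (vtc m \<phi> k) i = (if i < m then tc (\<lambda>z. coeff (\<phi> z) i) k else 0)"
  by (simp add: vtc_def coeff_sum)

lemma trunc_vtc [simp]: "trunc m (vtc m \<phi> k)"
  by (simp add: trunc_def coeff_vtc)

lemma mtc_carrier [simp]: "mtc m F k \<in> carrier_mat m m" "dim_row (mtc m F k) = m" "dim_col (mtc m F k) = m"
  by (simp_all add: mtc_def)

lemma vtc_0: "trunc m (\<phi> 0) \<Longrightarrow> vtc m \<phi> 0 = \<phi> 0"
  by (auto simp: poly_eq_iff coeff_vtc trunc_def)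

lemma vtc_cong: "(\<forall>\<^sub>F z in nhds 0. \<phi> z = \<psi> z) \<Longrightarrow> vtc m \<phi> k = vtc m \<psi> k"
  by (auto simp: poly_eq_iff coeff_vtc elim: eventually_mono intro!: tc_cong)

lemma vtc_add: "vana \<phi> \<Longrightarrow> vana \<psi> \<Longrightarrow> vtc m (\<lambda>z. \<phi> z + \<psi> z) k = vtc m \<phi> k + vtc m \<psi> k"
  by (simp add: poly_eq_iff coeff_vtc vana_def tc_add)

lemma vtc_monom: "vana \<phi> \<Longrightarrow> vtc m (\<lambda>z. Polynomial.smult (z ^ N) (\<phi> z)) k = (if k < N then 0 else vtc m \<phi> (k - N))"
  by (simp add: poly_eq_iff coeff_vtc vana_def tc_monom_mult)

lemma vtc_poly: "k \<le> N \<Longrightarrow> vtc m (\<lambda>z. \<Sum>l\<le>N. Polynomial.smult (z ^ l) (b l)) k = op (1\<^sub>m m) (b k)"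
  by (simp add: poly_eq_iff coeff_vtc coeff_op_one coeff_sum tc_poly)

lemma vana_poly: "vana (\<lambda>z. \<Sum>l\<le>N. Polynomial.smult (z ^ l) (b l))"
  by (auto simp: vana_def coeff_sum intro!: analytic_intros)

lemma vana_const: "vana (\<lambda>z. p)"
  by (simp add: vana_def)

lemma mana_entry: "mana m F \<Longrightarrow> i < m \<Longrightarrow> j < m \<Longrightarrow> (\<lambda>z. F z $$ (i, j)) analytic_on {0}"
  unfolding mana_def using analytic_at_ball mholoD(2) by blast

lemma mana_carrier: "mana m F \<Longrightarrow> \<forall>\<^sub>F z in nhds 0. F z \<in> carrier_mat m m"
proof -
  assume "mana m F"
  then obtain r where r: "0 < r" "mholo m (ball 0 r) F" unfolding mana_def by blast
  have "\<forall>\<^sub>F z in nhds 0. z \<in> ball (0::complex) r" using r(1) by (intro eventually_nhds_in_open) auto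
  then show ?thesis by (rule eventually_mono) (rule mholoD(1)[OF r(2)])
qed

lemma op_cong_ev: "mana m F \<Longrightarrow> \<forall>\<^sub>F z in nhds 0. coeff (op (F z) (\<phi> z)) i = (if i < m then \<Sum>j<m. F z $$ (i, j) * coeff (\<phi> z) j else 0)"
  by (rule eventually_mono[OF mana_carrier]) (auto simp: coeff_op)

lemma vana_op:
  assumes F: "mana m F" and \<phi>: "vana \<phi>" shows "vana (\<lambda>z. op (F z) (\<phi> z))"
  unfolding vana_def
proof
  fix i
  have "(\<lambda>z. if i < m then \<Sum>j<m. F z $$ (i, j) * coeff (\<phi> z) j else 0) analytic_on {0}"
    using \<phi> mana_entry[OF F, of i] unfolding vana_def by (cases "i < m") (auto intro!: analytic_intros)
  then show "(\<lambda>z. coeff (op (F z) (\<phi> z)) i) analytic_on {0}"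
    by (subst analytic_at_cong[OF op_cong_ev[OF F, where i=i and \<phi>=\<phi>] refl])
qed

text \<open>The Cauchy product, read as the action of the Toeplitz matrix of F. It connects
  holomorphic functions with the convolutions \<open>cv\<close>.\<close>

lemma vtc_op:
  assumes F: "mana m F" and \<phi>: "vana \<phi>"
  shows "vtc m (\<lambda>z. op (F z) (\<phi> z)) k = cv (\<lambda>i. op (mtc m F i)) (vtc m \<phi>) k"
proof (rule poly_eqI)
  fix i
  show "coeff (vtc m (\<lambda>z. op (F z) (\<phi> z)) k) i = coeff (cv (\<lambda>i. op (mtc m F i)) (vtc m \<phi>) k) i"
  proof (cases "i < m")
    case True
    have a: "(\<lambda>z. F z $$ (i, j) * coeff (\<phi> z) j) analytic_on {0}" if "j < m" for j
      using \<phi> mana_entry[OF F True that] unfolding vana_def by (auto intro!: analytic_intros)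
    have "tc (\<lambda>z. coeff (op (F z) (\<phi> z)) i) k = tc (\<lambda>z. \<Sum>j<m. F z $$ (i, j) * coeff (\<phi> z) j) k"
      by (rule tc_cong[OF eventually_mono[OF op_cong_ev[OF F, where i=i and \<phi>=\<phi>]]]) (use True in simp)
    also have "\<dots> = (\<Sum>j<m. \<Sum>l\<le>k. tc (\<lambda>z. F z $$ (i, j)) (k - l) * tc (\<lambda>z. coeff (\<phi> z) j) l)"
      using \<phi> mana_entry[OF F True] by (subst tc_sum) (auto simp: a vana_def tc_mult intro!: sum.cong)
    also have "\<dots> = (\<Sum>l\<le>k. \<Sum>j<m. tc (\<lambda>z. F z $$ (i, j)) (k - l) * tc (\<lambda>z. coeff (\<phi> z) j) l)"
      by (rule sum.swap)
    also have "\<dots> = coeff (cv (\<lambda>i. op (mtc m F i)) (vtc m \<phi>) k) i"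
      using True by (auto simp: cv_def coeff_sum coeff_op coeff_vtc mtc_def intro!: sum.cong)
    finally show ?thesis using True by (simp add: coeff_vtc)
  qed (auto simp: coeff_vtc cv_def coeff_sum coeff_op)
qed

lemma vtc_op_const:
  assumes F: "mana m F" shows "vtc m (\<lambda>z. op (F z) p) k = op (mtc m F k) p"
proof -
  have c: "vtc m (\<lambda>z. p) j = (if j = 0 then op (1\<^sub>m m) p else 0)" for j
  proof -
    have "tc (\<lambda>z. c) j = (if j = 0 then c else 0)" for c
      by (simp add: tc_fps[OF has_fps_expansion_const])
    then show ?thesis by (auto simp: poly_eq_iff coeff_vtc coeff_op_one)
  qed
  have "cv (\<lambda>i. op (mtc m F i)) (vtc m (\<lambda>z. p)) k = (\<Sum>j\<le>k. if j = 0 then op (mtc m F k) p else 0)"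
    unfolding cv_def c by (intro sum.cong refl) (auto simp: op_op_one[of _ m m] cip.lin_zero[OF lin_op])
  then show ?thesis by (simp add: vtc_op[OF F vana_const])
qed

lemma mana_mholo: "mholo m D F \<Longrightarrow> open D \<Longrightarrow> 0 \<in> D \<Longrightarrow> mana m F"
  unfolding mana_def by (erule (1) openE) (blast intro: mholo_subset)

lemma mtc_poly:
  assumes c: "\<And>z. F z \<in> carrier_mat m m" and F: "\<And>z i j. i < m \<Longrightarrow> j < m \<Longrightarrow> F z $$ (i, j) = (\<Sum>k\<le>n. z ^ k * B k $$ (i, j))"
  shows "mholo m S F" and "k \<le> n \<Longrightarrow> B k \<in> carrier_mat m m \<Longrightarrow> mtc m F k = B k"
  using c by (auto simp: mholo_def F mtc_def tc_poly intro!: holomorphic_intros)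

text \<open>On the circle of radius r the conjugate of z is r^2 / z. So multiplying by its k-th
  power and averaging is Cauchy's formula for coefficient k, with weight r^(2k).\<close>

lemma circlepath_taylor:
  assumes f: "f holomorphic_on ball 0 1" and r: "0 < r" "r < 1"
  shows "((\<lambda>t. f (circlepath 0 r t) * cnj (circlepath 0 r t) ^ k) has_integral of_real (r ^ (2 * k)) * tc f k) {0..1}"
proof -
  let ?g = "circlepath 0 r"
  have g: "?g t = r * exp (2 * of_real pi * \<i> * t)" "?g t \<noteq> 0" "?g t * cnj (?g t) = of_real (r\<^sup>2)" for t
  proof -
    show e: "?g t = r * exp (2 * of_real pi * \<i> * t)" by (simp add: circlepath)
    show "?g t \<noteq> 0" unfolding e using r by simp
    have "cmod (?g t) = r" unfolding e using r by (simp add: norm_mult)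
    then show "?g t * cnj (?g t) = of_real (r\<^sup>2)" by (simp add: complex_norm_square[symmetric] del: of_real_power)
  qed
  have "cball 0 r \<subseteq> ball (0::complex) 1" using r by auto
  then have "((\<lambda>u. f u / (u - 0) ^ Suc k) has_contour_integral ((2 * pi * \<i>) / fact k * (deriv ^^ k) f 0)) ?g"
    using r by (intro Cauchy_has_contour_integral_higher_derivative_circlepath holomorphic_on_imp_continuous_on
        holomorphic_on_subset[OF f]) auto
  then have int: "((\<lambda>t. f (?g t) / ?g t ^ Suc k * vector_derivative ?g (at t within {0..1})) has_integral (2 * pi * \<i>) * tc f k) {0..1}"
    by (simp add: has_contour_integral_def tc_def)
  have e: "c / z * (z * t) = c * t" if "z \<noteq> 0" for c z t :: complex using that by simp
  from has_integral_mult_right[OF int, of "of_real (r ^ (2 * k)) / (2 * pi * \<i>)"]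
  have "((\<lambda>t. of_real (r ^ (2 * k)) / (2 * pi * \<i>) * (f (?g t) / ?g t ^ Suc k * vector_derivative ?g (at t within {0..1})))
      has_integral of_real (r ^ (2 * k)) * tc f k) {0..1}"
    by (subst (asm) e) auto
  moreover have "of_real (r ^ (2 * k)) / (2 * pi * \<i>) * (f (?g t) / ?g t ^ Suc k * vector_derivative ?g (at t within {0..1}))
      = f (?g t) * cnj (?g t) ^ k" if "t \<in> {0..1}" for t
  proof -
    have d: "vector_derivative ?g (at t within {0..1}) = 2 * pi * \<i> * ?g t"
      using that vector_derivative_circlepath01[of t 0 r] by (simp add: g(1))
    have "of_real (r ^ (2 * k)) = ?g t ^ k * cnj (?g t) ^ k"
      by (simp add: power_mult_distrib[symmetric] g(3) power_mult)
    have e2: "q / z * (F / (g ^ Suc k) * (z * g)) = F * C" if "q = g ^ k * C" "g \<noteq> 0" "z \<noteq> 0" for q z F g C :: complex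
      using that by simp
    show ?thesis unfolding d by (rule e2[OF \<open>of_real (r ^ (2 * k)) = _\<close> g(2)]) simp
  qed
  ultimately show ?thesis by (rule has_integral_eq[rotated])
qed

text \<open>Parseval's identity against a polynomial: finitely many coefficients take part, and no
  series has to be integrated.\<close>

lemma circlepath_pip:
  assumes f: "\<And>i. (\<lambda>z. coeff (\<phi> z) i) holomorphic_on ball 0 1" and t: "\<And>z. trunc m (\<phi> z)" and r: "0 < r" "r < 1"
  shows "((\<lambda>t. pip (\<phi> (circlepath 0 r t)) (\<Sum>k\<le>N. Polynomial.smult (circlepath 0 r t ^ k) (b k))) has_integral
    (\<Sum>k\<le>N. of_real (r ^ (2 * k)) * pip (vtc m \<phi> k) (b k))) {0..1}"
proof -
  let ?g = "circlepath 0 r"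
  have c: "coeff (\<phi> z) i = 0" if "m \<le> i" for i z using t that by (auto simp: trunc_def)
  have "((\<lambda>t. \<Sum>k\<le>N. \<Sum>i<m. (coeff (\<phi> (?g t)) i * cnj (?g t) ^ k) * cnj (coeff (b k) i)) has_integral
    (\<Sum>k\<le>N. \<Sum>i<m. (of_real (r ^ (2 * k)) * tc (\<lambda>z. coeff (\<phi> z) i) k) * cnj (coeff (b k) i))) {0..1}"
    by (intro has_integral_sum has_integral_mult_left circlepath_taylor f r) auto
  moreover have "pip (\<phi> z) (\<Sum>k\<le>N. Polynomial.smult (z ^ k) (b k)) = (\<Sum>k\<le>N. \<Sum>i<m. (coeff (\<phi> z) i * cnj z ^ k) * cnj (coeff (b k) i))" for z
    unfolding cip.ip_sum_right cip.ip_scale_right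
    by (intro sum.cong refl) (simp add: pip_eq[of m] c sum_distrib_left mult_ac)
  moreover have "of_real (r ^ (2 * k)) * pip (vtc m \<phi> k) (b k) = (\<Sum>i<m. (of_real (r ^ (2 * k)) * tc (\<lambda>z. coeff (\<phi> z) i) k) * cnj (coeff (b k) i))" for k
    by (subst pip_eq[of m]) (simp_all add: coeff_vtc sum_distrib_left mult_ac)
  ultimately show ?thesis by simp
qed

lemma nrm_op_one: "nrm (op (1\<^sub>m m) p) = Re (pip (op (1\<^sub>m m) p) p)"
  by (simp add: op_adj op_op_one[of _ m m])

text \<open>Let b be the section of X a. On a circle inside the disc 2 Re <X a, b> <= |X a|^2 +
  |b|^2 <= |a|^2 + |b|^2 pointwise, and in the average the left side is twice the weighted norm of
  b. So b is its own test polynomial and |X a|^2 is never integrated. The weights r^(2k) disappear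
  as r tends to 1.\<close>

lemma toeplitz_contraction:
  assumes X: "mholo m (ball 0 1) X" and contr: "\<And>z p. z \<in> ball 0 1 \<Longrightarrow> nrm (op (X z) p) \<le> nrm p"
  shows "(\<Sum>k\<le>N. nrm (cv (\<lambda>i. op (mtc m X i)) a k)) \<le> (\<Sum>k\<le>N. nrm (op (1\<^sub>m m) (a k)))"
proof -
  define b where "b = cv (\<lambda>i. op (mtc m X i)) a"
  define pa where "pa = (\<lambda>z. \<Sum>k\<le>N. Polynomial.smult (z ^ k) (a k))"
  define pb where "pb = (\<lambda>z. \<Sum>k\<le>N. Polynomial.smult (z ^ k) (b k))"
  have X0: "mana m X" by (rule mana_mholo[OF X]) auto
  have tb: "trunc m (b k)" for k
    unfolding b_def cv_def by (intro trunc_closed trunc_op[of _ m m]) simp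
  then have tpb: "trunc m (pb z)" for z unfolding pb_def by (intro trunc_closed) auto
  \<comment> \<open>outside the disc the entries of X are arbitrary\<close>
  define Xa where "Xa z = (if z \<in> ball 0 1 then op (X z) (pa z) else 0)" for z
  have tXa: "trunc m (Xa z)" for z
    unfolding Xa_def using trunc_op[OF mholoD(1)[OF X]] trunc_closed(5) by auto
  have holo: "(\<lambda>z. coeff (\<Sum>k\<le>N. Polynomial.smult (z ^ k) (c k)) i) holomorphic_on ball 0 1" for c i
    unfolding coeff_sum coeff_smult by (intro holomorphic_intros)
  have hXa: "(\<lambda>z. coeff (Xa z) i) holomorphic_on ball 0 1" for i
  proof (cases "i < m")
    case True
    have "(\<lambda>z. \<Sum>j<m. X z $$ (i, j) * coeff (pa z) j) holomorphic_on ball 0 1"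
      using True unfolding pa_def by (intro holomorphic_intros holo mholoD(2)[OF X]) auto
    then show ?thesis
      by (rule holomorphic_transform) (use True mholoD(1)[OF X] in \<open>auto simp: Xa_def coeff_op\<close>)
  next
    case False
    then show ?thesis using tXa by (simp add: trunc_def)
  qed
  have hI: "(\<lambda>z. coeff (op (1\<^sub>m m) (pa z)) i) holomorphic_on ball 0 1" for i
    unfolding coeff_op_one pa_def by (cases "i < m") (simp_all add: holo)
  have vXa: "vtc m Xa k = b k" if "k \<le> N" for k
  proof -
    have "vtc m Xa k = vtc m (\<lambda>z. op (X z) (pa z)) k"
      by (rule vtc_cong, rule eventually_mono[OF eventually_nhds_in_open[of "ball 0 1"]]) (auto simp: Xa_def)
    also have "\<dots> = cv (\<lambda>i. op (mtc m X i)) (vtc m pa) k"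
      unfolding pa_def by (rule vtc_op[OF X0 vana_poly])
    also have "\<dots> = b k"
      unfolding b_def cv_def
      by (intro sum.cong refl) (use that in \<open>simp add: pa_def vtc_poly op_op_one[of _ m m]\<close>)
    finally show ?thesis .
  qed
  have vI: "vtc m (\<lambda>z. op (1\<^sub>m m) (pa z)) k = op (1\<^sub>m m) (a k)" if "k \<le> N" for k
    using that by (simp add: poly_eq_iff coeff_vtc coeff_op_one pa_def coeff_sum tc_poly)
  have vpb: "vtc m pb k = b k" if "k \<le> N" for k
    using vtc_poly[OF that, of m b] tb by (simp add: pb_def trunc_op_one)
  have ineq: "(\<Sum>k\<le>N. r ^ (2 * k) * nrm (b k)) \<le> (\<Sum>k\<le>N. r ^ (2 * k) * nrm (op (1\<^sub>m m) (a k)))" if r: "0 < r" "r < 1" for r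
  proof -
    let ?g = "circlepath 0 r"
    note I1 = circlepath_pip[OF hXa tXa r, where N=N and b=b, folded pb_def]
    have tI: "trunc m (op (1\<^sub>m m) (pa z))" for z by (rule trunc_op[of _ m m]) simp
    note I2 = circlepath_pip[OF hI tI r, where N=N and b=a, folded pa_def]
    note I3 = circlepath_pip[OF _ tpb r, where N=N and b=b, folded pb_def]
    have Rel: "((\<lambda>t. Re (f t)) has_integral Re I) {0..1}" if "(f has_integral I) {0..1}" for f I
      using has_integral_linear[OF that bounded_linear_Re] by (simp add: o_def)
    have le: "2 * Re (pip (Xa (?g t)) (pb (?g t))) \<le> Re (pip (op (1\<^sub>m m) (pa (?g t))) (pa (?g t))) + Re (pip (pb (?g t)) (pb (?g t)))" for t
    proof -
      have g: "?g t \<in> ball 0 1" using r by (simp add: circlepath norm_mult)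
      have "0 \<le> nrm (Xa (?g t) - pb (?g t))" by (rule nrm_nonneg)
      also have "\<dots> = nrm (Xa (?g t)) + nrm (pb (?g t)) - 2 * Re (pip (Xa (?g t)) (pb (?g t)))"
        using arg_cong[OF cip.ip_cnj[of "Xa (?g t)" "pb (?g t)"], of Re]
        by (simp add: cip.ip_diff_left cip.ip_diff_right)
      finally have "2 * Re (pip (Xa (?g t)) (pb (?g t))) \<le> nrm (Xa (?g t)) + nrm (pb (?g t))" by simp
      moreover have "Xa (?g t) = op (X (?g t)) (op (1\<^sub>m m) (pa (?g t)))"
        using g mholoD(1)[OF X g] by (simp add: Xa_def op_op_one)
      then have "nrm (Xa (?g t)) \<le> nrm (op (1\<^sub>m m) (pa (?g t)))" using contr[OF g] by simp
      ultimately show ?thesis by (simp add: nrm_op_one)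
    qed
    have "2 * Re (\<Sum>k\<le>N. of_real (r ^ (2 * k)) * pip (vtc m Xa k) (b k)) \<le>
        Re (\<Sum>k\<le>N. of_real (r ^ (2 * k)) * pip (vtc m (\<lambda>z. op (1\<^sub>m m) (pa z)) k) (a k))
      + Re (\<Sum>k\<le>N. of_real (r ^ (2 * k)) * pip (vtc m pb k) (b k))"
      by (rule has_integral_le[OF has_integral_mult_right[OF Rel[OF I1]] has_integral_add[OF Rel[OF I2] Rel[OF I3]]])
        (use le in \<open>auto simp: holo pa_def pb_def\<close>)
    then show ?thesis
      by (simp add: vXa vI vpb nrm_op_one Re_sum del: of_real_power cong: sum.cong_simp)
  qed
  define f where "f r = (\<Sum>k\<le>N. r ^ (2 * k) * nrm (op (1\<^sub>m m) (a k))) - (\<Sum>k\<le>N. r ^ (2 * k) * nrm (b k))" for r :: real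
  have "(f \<longlongrightarrow> f 1) (at_left 1)" unfolding f_def by (intro tendsto_intros)
  moreover have "\<forall>\<^sub>F r in at_left 1. 0 \<le> f r"
    using eventually_at_left_real[of 0 "1::real"] by (rule eventually_mono) (use ineq in \<open>auto simp: f_def\<close>)
  ultimately have "0 \<le> f 1" by (rule tendsto_lowerbound) simp
  then show ?thesis by (simp add: f_def b_def)
qed

lemma schur_norm_power: "cmod w < 1 \<Longrightarrow> (cmod w)\<^sup>2 < 1"
  by (simp add: abs_square_less_1)

lemma nrm_tendsto:
  assumes c: "\<And>i. ((\<lambda>k. coeff (Y k) i) \<longlongrightarrow> coeff y i) F" and t: "\<And>k. trunc m (Y k)" "trunc m y"
  shows "((\<lambda>k. nrm (Y k)) \<longlongrightarrow> nrm y) F"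
proof -
  have e: "nrm p = Re (\<Sum>i<m. coeff p i * cnj (coeff p i))" if "trunc m p" for p
    using that by (subst pip_eq[of m]) (auto simp: trunc_def)
  show ?thesis unfolding e[OF t(1)] e[OF t(2)] by (intro tendsto_intros c)
qed

text \<open>The test sequence has M + n + 1 blocks w^(M+n-k) h, and only the last n + 1 of them
  carry x in addition. Its image contains the partial sums Y of the power series for X(w) h. The
  first M blocks form the geometric part: \<kappa> is the sum of |w|^(2(n+1+p)) over p >= 0.\<close>

theorem schur_extension:
  fixes n :: nat
  assumes X: "mholo m (ball 0 1) X" and contr: "\<And>z p. z \<in> ball 0 1 \<Longrightarrow> nrm (op (X z) p) \<le> nrm p" and w: "cmod w < 1"
  defines "Xo \<equiv> \<lambda>i. op (mtc m X i)" and "\<kappa> \<equiv> (cmod w)\<^sup>2 ^ Suc n / (1 - (cmod w)\<^sup>2)"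
  shows "(\<Sum>i\<le>n. nrm (cv Xo x i + Polynomial.smult (w ^ (n - i)) (op (X w) h))) + \<kappa> * nrm (op (X w) h)
    \<le> (\<Sum>i\<le>n. nrm (x i + Polynomial.smult (w ^ (n - i)) h)) + \<kappa> * nrm h"
proof -
  let ?q = "(cmod w)\<^sup>2"
  have q: "0 \<le> ?q" "?q < 1" using schur_norm_power[OF w] by auto
  have wB: "w \<in> ball 0 1" using w by simp
  note Xw = mholoD(1)[OF X wB]
  define Y where "Y k = (\<Sum>l\<le>k. Polynomial.smult (w ^ l) (Xo l h))" for k
  have tXo: "trunc m (Xo i p)" for i p unfolding Xo_def by (rule trunc_op[of _ m m]) simp
  have tY: "trunc m (Y k)" for k unfolding Y_def by (intro trunc_closed tXo)
  have tcv: "trunc m (cv Xo x i)" for i unfolding cv_def by (intro trunc_closed tXo)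
  have Ylim: "(\<lambda>k. coeff (Y k) i) \<longlonglongrightarrow> coeff (op (X w) h) i" for i
  proof (cases "i < m")
    case True
    have s: "(\<lambda>k. \<Sum>l\<le>k. tc (\<lambda>z. X z $$ (i, j)) l * w ^ l) \<longlonglongrightarrow> X w $$ (i, j)" if "j < m" for j
      using holomorphic_power_series[OF mholoD(2)[OF X True that] wB] by (simp add: sums_def_le tc_def)
    have "(\<lambda>k. \<Sum>j<m. (\<Sum>l\<le>k. tc (\<lambda>z. X z $$ (i, j)) l * w ^ l) * coeff h j) \<longlonglongrightarrow> (\<Sum>j<m. X w $$ (i, j) * coeff h j)"
      by (intro tendsto_intros s) simp
    moreover have "coeff (Y k) i = (\<Sum>j<m. (\<Sum>l\<le>k. tc (\<lambda>z. X z $$ (i, j)) l * w ^ l) * coeff h j)" for k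
    proof -
      have "coeff (Y k) i = (\<Sum>l\<le>k. \<Sum>j<m. tc (\<lambda>z. X z $$ (i, j)) l * w ^ l * coeff h j)"
        using True by (simp add: Y_def Xo_def coeff_sum coeff_op mtc_def sum_distrib_left mult_ac)
      then show ?thesis unfolding sum_distrib_right by (subst sum.swap) simp
    qed
    ultimately show ?thesis using True Xw by (simp add: coeff_op)
  next
    case False
    then show ?thesis using tY Xw by (simp add: trunc_def coeff_op)
  qed
  \<comment> \<open>Of the first M image blocks only the K nearest to the end are kept. The sum is
    then finite while M tends to infinity, and K follows afterwards, so no exchange of limits
    occurs.\<close>
  have fin: "(\<Sum>i\<le>n. nrm (cv Xo x i + Polynomial.smult (w ^ (n - i)) (Y (M + i)))) + (\<Sum>p<K. ?q ^ (Suc n + p) * nrm (Y (M - 1 - p)))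
      \<le> (\<Sum>i\<le>n. nrm (x i + Polynomial.smult (w ^ (n - i)) h)) + \<kappa> * nrm h" if KM: "K \<le> M" for K M
  proof -
    define a where "a k = Polynomial.smult (w ^ (M + n - k)) h + (if M \<le> k then x (k - M) else 0)" for k
    have cva: "cv Xo a k = Polynomial.smult (w ^ (M + n - k)) (Y k) + (if M \<le> k then cv Xo x (k - M) else 0)" if "k \<le> M + n" for k
    proof -
      have lin: "Xo i (u + v) = Xo i u + Xo i v" "Xo i (Polynomial.smult c u) = Polynomial.smult c (Xo i u)" "Xo i 0 = 0" for i u v c
        by (simp_all add: Xo_def cip.lin_add[OF lin_op] cip.lin_scale[OF lin_op] cip.lin_zero[OF lin_op])
      have "cv Xo a k = (\<Sum>j\<le>k. Polynomial.smult (w ^ (M + n - j)) (Xo (k - j) h)) + (\<Sum>j\<le>k. Xo (k - j) (if M \<le> j then x (j - M) else 0))"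
        unfolding cv_def a_def lin sum.distrib ..
      also have "(\<Sum>j\<le>k. Polynomial.smult (w ^ (M + n - j)) (Xo (k - j) h)) = (\<Sum>l\<le>k. Polynomial.smult (w ^ (M + n - k + l)) (Xo l h))"
        by (rule sum.reindex_bij_witness[where i="\<lambda>j. k - j" and j="\<lambda>j. k - j"]) (use that in \<open>auto simp: add.commute\<close>)
      also have "\<dots> = Polynomial.smult (w ^ (M + n - k)) (Y k)"
        by (simp add: Y_def cip.scale_sum_right power_add)
      also have "(\<Sum>j\<le>k. Xo (k - j) (if M \<le> j then x (j - M) else 0)) = (if M \<le> k then cv Xo x (k - M) else 0)"
      proof (cases "M \<le> k")
        case True
        have "(\<Sum>j\<le>k. Xo (k - j) (if M \<le> j then x (j - M) else 0)) = (\<Sum>j\<in>{M..k}. Xo (k - j) (x (j - M)))"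
          by (rule sum.mono_neutral_cong_right) (auto simp: lin)
        also have "\<dots> = cv Xo x (k - M)"
          unfolding cv_def by (rule sum.reindex_bij_witness[where i="\<lambda>j. j + M" and j="\<lambda>j. j - M"]) (use True in auto)
        finally show ?thesis using True by simp
      qed (auto intro!: sum.neutral simp: lin)
      finally show ?thesis .
    qed
    have split: "(\<Sum>k\<le>M + n. f k) = (\<Sum>p<M. f (M - 1 - p)) + (\<Sum>i\<le>n. f (M + i))" for f :: "nat \<Rightarrow> real"
    proof -
      have "(\<Sum>k\<le>M + n. f k) = (\<Sum>k<M. f k) + (\<Sum>i\<le>n. f (M + i))"
        by (induction n) (simp_all flip: lessThan_Suc_atMost)
      also have "(\<Sum>k<M. f k) = (\<Sum>p<M. f (M - 1 - p))" using sum.nat_diff_reindex[of f M] by simp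
      finally show ?thesis .
    qed
    have sc: "nrm (Polynomial.smult (w ^ k) p) = ?q ^ k * nrm p" for k p
    proof -
      have "w ^ k * cnj (w ^ k) = of_real (?q ^ k)"
        by (metis complex_norm_square of_real_power power_mult_distrib complex_cnj_power)
      moreover have "pip (Polynomial.smult (w ^ k) p) (Polynomial.smult (w ^ k) p) = (w ^ k * cnj (w ^ k)) * pip p p"
        by (simp add: cip.ip_scale_left cip.ip_scale_right mult_ac)
      moreover have "Re (of_real r * z) = r * Re z" for r z by simp
      ultimately show ?thesis by presburger
    qed
    have low: "nrm (cv Xo a (M - 1 - p)) = ?q ^ (Suc n + p) * nrm (Y (M - 1 - p))" "nrm (a (M - 1 - p)) = ?q ^ (Suc n + p) * nrm h" if "p < M" for p
    proof -
      have i: "M + n - (M - 1 - p) = Suc n + p" "\<not> M \<le> M - 1 - p" "M - 1 - p \<le> M + n" using that by auto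
      show "nrm (cv Xo a (M - 1 - p)) = ?q ^ (Suc n + p) * nrm (Y (M - 1 - p))"
        unfolding cva[OF i(3)] i(1) if_not_P[OF i(2)] add_0_right by (rule sc)
      show "nrm (a (M - 1 - p)) = ?q ^ (Suc n + p) * nrm h"
        unfolding a_def i(1) if_not_P[OF i(2)] add_0_right by (rule sc)
    qed
    have "(\<Sum>k\<le>M + n. nrm (cv Xo a k)) \<le> (\<Sum>k\<le>M + n. nrm (a k))"
    proof -
      have "nrm (op (1\<^sub>m m) p) \<le> nrm p" for p
      proof -
        have "nrm p = nrm (op (1\<^sub>m m) p) + nrm (p - op (1\<^sub>m m) p)"
          by (simp add: pip_split[of p p m])
        then show ?thesis using nrm_nonneg[of "p - op (1\<^sub>m m) p"] by simp
      qed
      then show ?thesis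
        using toeplitz_contraction[OF X contr, of a "M + n", folded Xo_def] by (meson order_trans sum_mono)
    qed
    moreover have "(\<Sum>k\<le>M + n. nrm (cv Xo a k)) = (\<Sum>p<M. ?q ^ (Suc n + p) * nrm (Y (M - 1 - p))) + (\<Sum>i\<le>n. nrm (cv Xo x i + Polynomial.smult (w ^ (n - i)) (Y (M + i))))"
      unfolding split
      by (intro arg_cong2[where f="(+)"] sum.cong refl) (simp_all only: low lessThan_iff, simp add: cva add.commute)
    moreover have "(\<Sum>k\<le>M + n. nrm (a k)) = (\<Sum>p<M. ?q ^ (Suc n + p) * nrm h) + (\<Sum>i\<le>n. nrm (x i + Polynomial.smult (w ^ (n - i)) h))"
      unfolding split
      by (intro arg_cong2[where f="(+)"] sum.cong refl) (simp_all only: low lessThan_iff, simp add: a_def add.commute)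
    moreover have "(\<Sum>p<K. ?q ^ (Suc n + p) * nrm (Y (M - 1 - p))) \<le> (\<Sum>p<M. ?q ^ (Suc n + p) * nrm (Y (M - 1 - p)))"
      by (rule sum_mono2) (use KM nrm_nonneg in auto)
    moreover have "(\<Sum>p<M. ?q ^ (Suc n + p) * nrm h) \<le> \<kappa> * nrm h"
    proof -
      have "(\<Sum>p<M. ?q ^ (Suc n + p)) = ?q ^ Suc n * ((1 - ?q ^ M) / (1 - ?q))"
        using q by (simp add: power_add sum_distrib_left[symmetric] sum_gp_strict)
      also have "\<dots> \<le> \<kappa>"
        using q unfolding \<kappa>_def times_divide_eq_right by (intro divide_right_mono mult_left_le) auto
      finally show ?thesis using nrm_nonneg[of h] by (simp add: sum_distrib_right[symmetric] mult_right_mono)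
    qed
    ultimately show ?thesis by linarith
  qed
  have lim1: "(\<Sum>i\<le>n. nrm (cv Xo x i + Polynomial.smult (w ^ (n - i)) (op (X w) h))) + (\<Sum>p<K. ?q ^ (Suc n + p) * nrm (op (X w) h))
      \<le> (\<Sum>i\<le>n. nrm (x i + Polynomial.smult (w ^ (n - i)) h)) + \<kappa> * nrm h" for K
  proof (rule tendsto_upperbound)
    have f: "filterlim (\<lambda>M. M + i) sequentially sequentially" "filterlim (\<lambda>M. M - Suc i) sequentially sequentially" for i
      by (rule filterlim_add_const_nat_at_top filterlim_minus_const_nat_at_top)+
    have L: "(\<lambda>M. nrm (u + Polynomial.smult c (Y (g M)))) \<longlonglongrightarrow> nrm (u + Polynomial.smult c (op (X w) h))"
      if g: "filterlim g sequentially sequentially" and u: "trunc m u" for g u c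
    proof (rule nrm_tendsto[where m=m])
      show "(\<lambda>M. coeff (u + Polynomial.smult c (Y (g M))) i) \<longlonglongrightarrow> coeff (u + Polynomial.smult c (op (X w) h)) i" for i
        unfolding coeff_add coeff_smult by (intro tendsto_add tendsto_mult tendsto_const filterlim_compose[OF Ylim g])
    qed (intro trunc_closed(1,3) u tY trunc_op[OF Xw])+
    have L0: "(\<lambda>M. nrm (Y (M - 1 - p))) \<longlonglongrightarrow> nrm (op (X w) h)" for p
      using L[OF f(2)[of p] trunc_closed(5), of 1] by simp
    show "(\<lambda>M. (\<Sum>i\<le>n. nrm (cv Xo x i + Polynomial.smult (w ^ (n - i)) (Y (M + i)))) + (\<Sum>p<K. ?q ^ (Suc n + p) * nrm (Y (M - 1 - p))))
      \<longlonglongrightarrow> (\<Sum>i\<le>n. nrm (cv Xo x i + Polynomial.smult (w ^ (n - i)) (op (X w) h))) + (\<Sum>p<K. ?q ^ (Suc n + p) * nrm (op (X w) h))"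
      by (intro tendsto_add tendsto_sum tendsto_mult tendsto_const L[OF f(1) tcv] L0)
    show "\<forall>\<^sub>F M in sequentially. (\<Sum>i\<le>n. nrm (cv Xo x i + Polynomial.smult (w ^ (n - i)) (Y (M + i)))) + (\<Sum>p<K. ?q ^ (Suc n + p) * nrm (Y (M - 1 - p)))
      \<le> (\<Sum>i\<le>n. nrm (x i + Polynomial.smult (w ^ (n - i)) h)) + \<kappa> * nrm h"
      using eventually_ge_at_top[of K] by (rule eventually_mono) (rule fin)
  qed simp
  have "(\<lambda>p. ?q ^ Suc n * ?q ^ p) sums (?q ^ Suc n * (1 / (1 - ?q)))"
    by (intro sums_mult geometric_sums) (use q in simp)
  then have "(\<lambda>K. \<Sum>p<K. ?q ^ (Suc n + p)) \<longlonglongrightarrow> \<kappa>"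
    by (simp add: sums_def power_add \<kappa>_def mult.assoc)
  then have "(\<lambda>K. (\<Sum>i\<le>n. nrm (cv Xo x i + Polynomial.smult (w ^ (n - i)) (op (X w) h))) + (\<Sum>p<K. ?q ^ (Suc n + p)) * nrm (op (X w) h))
    \<longlonglongrightarrow> (\<Sum>i\<le>n. nrm (cv Xo x i + Polynomial.smult (w ^ (n - i)) (op (X w) h))) + \<kappa> * nrm (op (X w) h)"
    by (intro tendsto_intros)
  then show ?thesis
    by (rule tendsto_upperbound) (use lim1 in \<open>simp_all add: sum_distrib_right\<close>)
qed

text \<open>Contractivity on vectors of length m and on all polynomials agree, because the
  coefficients from m on only enlarge the right-hand norm.\<close>

lemma schur_class_iff:
  "schur_class m S \<longleftrightarrow> mholo m (ball 0 1) S \<and> (\<forall>z\<in>ball 0 1. \<forall>p. nrm (op (S z) p) \<le> nrm p)"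
proof -
  have n: "nrm (pvec v) = (\<Sum>i<m. (cmod (vec_index v i))\<^sup>2)" if "v \<in> carrier_vec m" for v
    using that by (subst pip_eq[of m]) (auto simp: coeff_pvec Re_sum complex_mult_cnj cmod_power2 simp del: of_real_power of_real_add intro!: sum.cong)
  have "(\<forall>v\<in>carrier_vec m. (\<Sum>i<m. (cmod (vec_index (M *\<^sub>v v) i))\<^sup>2) \<le> (\<Sum>i<m. (cmod (vec_index v i))\<^sup>2)) \<longleftrightarrow> (\<forall>p. nrm (op M p) \<le> nrm p)"
    if M: "M \<in> carrier_mat m m" for M
  proof safe
    fix p assume *: "\<forall>v\<in>carrier_vec m. (\<Sum>i<m. (cmod (vec_index (M *\<^sub>v v) i))\<^sup>2) \<le> (\<Sum>i<m. (cmod (vec_index v i))\<^sup>2)"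
    have o: "op (1\<^sub>m m) p = pvec (vpol m p)" by (auto simp: poly_eq_iff coeff_pvec coeff_op_one)
    have "nrm (op M p) = nrm (pvec (M *\<^sub>v vpol m p))" using M by (simp add: op_def)
    also have "\<dots> \<le> nrm (op (1\<^sub>m m) p)" using *[rule_format, of "vpol m p"] M by (simp add: n o)
    also have "\<dots> \<le> nrm p"
      using nrm_nonneg[of "p - op (1\<^sub>m m) p"] by (simp add: pip_split[of p p m])
    finally show "nrm (op M p) \<le> nrm p" .
  next
    fix v :: "complex vec" assume *: "\<forall>p. nrm (op M p) \<le> nrm p" and v: "v \<in> carrier_vec m"
    have "nrm (op M (pvec v)) \<le> nrm (pvec v)" using * by blast
    then show "(\<Sum>i<m. (cmod (vec_index (M *\<^sub>v v) i))\<^sup>2) \<le> (\<Sum>i<m. (cmod (vec_index v i))\<^sup>2)"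
      using v M by (simp add: op_pvec[OF M v] n)
  qed
  note eq = this
  have "schur_class m S \<longleftrightarrow> mholo m (ball 0 1) S \<and> (\<forall>w\<in>ball 0 1. \<forall>v\<in>carrier_vec m.
      (\<Sum>i<m. (cmod (vec_index (S w *\<^sub>v v) i))\<^sup>2) \<le> (\<Sum>i<m. (cmod (vec_index v i))\<^sup>2))"
    unfolding schur_class_def mholo_def by (simp only: conj_assoc)
  also have "\<dots> \<longleftrightarrow> mholo m (ball 0 1) S \<and> (\<forall>z\<in>ball 0 1. \<forall>p. nrm (op (S z) p) \<le> nrm p)"
    by (intro conj_cong ball_cong refl eq mholoD(1))
  finally show ?thesis .
qed

section \<open>Meromorphic matrix functions\<close>

lemma common_radius:
  fixes m :: nat
  assumes ex: "\<And>i j. i < m \<Longrightarrow> j < m \<Longrightarrow> \<exists>r>0. P i j r"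
    and mono: "\<And>i j r s. i < m \<Longrightarrow> j < m \<Longrightarrow> P i j r \<Longrightarrow> 0 < s \<Longrightarrow> s \<le> r \<Longrightarrow> P i j s" and e: "0 < (e::real)"
  shows "\<exists>r>0. r \<le> e \<and> (\<forall>i<m. \<forall>j<m. P i j r)"
proof -
  obtain R where R: "\<And>i j. i < m \<Longrightarrow> j < m \<Longrightarrow> 0 < R i j \<and> P i j (R i j)" using ex by metis
  define r where "r = Min (insert e ((\<lambda>(i,j). R i j) ` ({..<m} \<times> {..<m})))"
  have fin: "finite (insert e ((\<lambda>(i,j). R i j) ` ({..<m} \<times> {..<m})))" by simp
  have "0 < r" unfolding r_def using R e by (subst Min_gr_iff[OF fin]) auto
  moreover have "r \<le> e" unfolding r_def by (rule Min_le[OF fin]) simp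
  moreover have "r \<le> R i j" if "i < m" "j < m" for i j
    unfolding r_def by (rule Min_le[OF fin]) (use that in auto)
  ultimately show ?thesis using R mono by blast
qed

lemma mat_analytic_atI: "mholo m U F \<Longrightarrow> open U \<Longrightarrow> p \<in> U \<Longrightarrow> mat_analytic_at m F p"
  unfolding mat_analytic_at_def analytic_at using mholoD(2) by blast

lemma mat_analytic_ball:
  assumes "mat_analytic_at m F p" "0 < e"
  shows "\<exists>r>0. r \<le> e \<and> (\<forall>i<m. \<forall>j<m. (\<lambda>z. F z $$ (i, j)) holomorphic_on ball p r)"
proof (rule common_radius[OF _ _ assms(2)])
  show "\<exists>r>0. (\<lambda>z. F z $$ (i, j)) holomorphic_on ball p r" if "i < m" "j < m" for i j
    using assms(1) that unfolding mat_analytic_at_def analytic_on_def by blast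
  show "(\<lambda>z. F z $$ (i, j)) holomorphic_on ball p s"
    if "(\<lambda>z. F z $$ (i, j)) holomorphic_on ball p r" "s \<le> r" for i j r s
    by (rule holomorphic_on_subset[OF that(1)]) (rule subset_ball[OF that(2)])
qed

lemma mat_analytic_ev:
  assumes "mat_analytic_at m F p" shows "\<exists>r>0. \<forall>z\<in>ball p r. mat_analytic_at m F z"
proof -
  obtain r where r: "0 < r" "\<forall>i<m. \<forall>j<m. (\<lambda>z. F z $$ (i, j)) holomorphic_on ball p r"
    using mat_analytic_ball[OF assms, of 1] by auto
  then have "\<forall>z\<in>ball p r. mat_analytic_at m F z"
    unfolding mat_analytic_at_def analytic_at using open_ball by blast
  then show ?thesis using r(1) by blast
qed

lemma mat_analytic_removable: "mat_analytic_at m F p \<Longrightarrow> mat_removable_at m F p"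
  unfolding mat_analytic_at_def mat_removable_at_def analytic_on_def by blast

lemma mat_removable_ball:
  assumes "mat_removable_at m F p" "0 < e"
  shows "\<exists>r>0. r \<le> e \<and> (\<exists>G. mholo m (ball p r) G \<and> (\<forall>z\<in>ball p r - {p}. \<forall>i<m. \<forall>j<m. F z $$ (i, j) = G z $$ (i, j)))"
proof -
  obtain r where r: "0 < r" "r \<le> e" and
    ex: "\<forall>i<m. \<forall>j<m. \<exists>g. g holomorphic_on ball p r \<and> (\<forall>z\<in>ball p r - {p}. F z $$ (i, j) = g z)"
  proof -
    have "\<exists>r>0. r \<le> e \<and> (\<forall>i<m. \<forall>j<m. \<exists>g. g holomorphic_on ball p r \<and> (\<forall>z\<in>ball p r - {p}. F z $$ (i, j) = g z))"
    proof (rule common_radius[OF _ _ assms(2)])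
      show "\<exists>r>0. \<exists>g. g holomorphic_on ball p r \<and> (\<forall>z\<in>ball p r - {p}. F z $$ (i, j) = g z)" if "i < m" "j < m" for i j
        using assms(1) that unfolding mat_removable_at_def by blast
      fix i j r s
      assume "\<exists>g. g holomorphic_on ball p r \<and> (\<forall>z\<in>ball p r - {p}. F z $$ (i, j) = g z)" "s \<le> (r::real)"
      then obtain g where g: "g holomorphic_on ball p r" "\<And>z. z\<in>ball p r - {p} \<Longrightarrow> F z $$ (i, j) = g z" by blast
      have "ball p s \<subseteq> ball p r" using \<open>s \<le> r\<close> by (rule subset_ball)
      then show "\<exists>g. g holomorphic_on ball p s \<and> (\<forall>z\<in>ball p s - {p}. F z $$ (i, j) = g z)"
        using g holomorphic_on_subset by (intro exI[of _ g]) blast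
    qed
    then show ?thesis using that by blast
  qed
  obtain G where G: "\<And>i j. i < m \<Longrightarrow> j < m \<Longrightarrow> G i j holomorphic_on ball p r \<and> (\<forall>z\<in>ball p r - {p}. F z $$ (i, j) = G i j z)"
    using ex by metis
  define H where "H z = mat m m (\<lambda>(i,j). G i j z)" for z
  have "mholo m (ball p r) H" using G by (auto simp: mholo_def H_def)
  moreover have "\<forall>z\<in>ball p r - {p}. \<forall>i<m. \<forall>j<m. F z $$ (i, j) = H z $$ (i, j)" using G by (auto simp: H_def)
  ultimately show ?thesis using r by blast
qed

lemma mat_removable_cong:
  assumes F: "mat_removable_at m F p" and r: "0 < r" and eq: "\<And>z. z \<in> ball p r - {p} \<Longrightarrow> F z = G z"
  shows "mat_removable_at m G p"
proof -
  obtain s H where s: "0 < s" "s \<le> r" "mholo m (ball p s) H" "\<forall>z\<in>ball p s - {p}. \<forall>i<m. \<forall>j<m. F z $$ (i, j) = H z $$ (i, j)"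
    using mat_removable_ball[OF F r] by blast
  have "G z $$ (i, j) = H z $$ (i, j)" if "z \<in> ball p s - {p}" "i < m" "j < m" for z i j
    using s(2,4) eq[of z] that by (metis Diff_iff subsetD subset_ball)
  then show ?thesis unfolding mat_removable_at_def using s(1) mholoD(2)[OF s(3)] by blast
qed

lemma mat_meromorphic_punctured:
  assumes F: "mat_meromorphic_on D m F" and p: "p \<in> D"
  shows "\<exists>r>0. ball p r \<subseteq> D \<and> ball p r - {p} \<subseteq> mat_H D m F"
proof -
  obtain r where r: "0 < r" "ball p r \<subseteq> D" and
    F: "\<forall>i<m. \<forall>j<m. \<exists>k::nat. \<exists>g. g holomorphic_on ball p r \<and> (\<forall>z\<in>ball p r - {p}. F z $$ (i,j) = g z / (z - p) ^ k)"
    using assms unfolding mat_meromorphic_on_def by blast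
  have "(\<lambda>z. F z $$ (i, j)) analytic_on {z}" if z: "z \<in> ball p r - {p}" and ij: "i < m" "j < m" for z i j
  proof -
    obtain k g where g: "g holomorphic_on ball p r" "\<And>z. z\<in>ball p r - {p} \<Longrightarrow> F z $$ (i,j) = g z / (z - p) ^ k"
      using F ij by blast
    have "(\<lambda>z. g z / (z - p) ^ k) holomorphic_on (ball p r - {p})"
      by (intro holomorphic_intros holomorphic_on_subset[OF g(1)]) auto
    then have "(\<lambda>z. F z $$ (i, j)) holomorphic_on (ball p r - {p})"
      by (rule holomorphic_transform) (simp add: g(2))
    moreover have "open (ball p r - {p})" by (intro open_Diff) auto
    ultimately show ?thesis using z unfolding analytic_at by blast
  qed
  then have "ball p r - {p} \<subseteq> mat_H D m F"
    using r(2) unfolding mat_H_def mat_analytic_at_def by blast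
  then show ?thesis using r by blast
qed

lemma mat_meromorphic_sparse: "mat_meromorphic_on D m F \<Longrightarrow> sparse_in_set D (D - mat_H D m F)"
  by (rule sparse_in_setI, drule (1) mat_meromorphic_punctured) blast

lemma mat_H_holo:
  assumes F: "mat_meromorphic_on D m F" shows "open (mat_H D m F)" "mholo m (mat_H D m F) F"
proof -
  have D: "open D" using F by (simp add: mat_meromorphic_on_def)
  have "\<exists>e>0. ball p e \<subseteq> mat_H D m F" if "p \<in> mat_H D m F" for p
  proof -
    have p: "p \<in> D" "mat_analytic_at m F p" using that by (auto simp: mat_H_def)
    obtain r where r: "0 < r" "ball p r \<subseteq> D" using D p(1) by (rule openE)
    obtain s where s: "0 < s" "\<forall>z\<in>ball p s. mat_analytic_at m F z" using mat_analytic_ev[OF p(2)] by blast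
    have "ball p (min r s) \<subseteq> mat_H D m F" using r(2) s(2) by (auto simp: mat_H_def)
    then show ?thesis using r(1) s(1) by (intro exI[of _ "min r s"]) simp
  qed
  then show o: "open (mat_H D m F)" unfolding open_contains_ball by blast
  show "mholo m (mat_H D m F) F"
  proof (rule mholoI)
    show "F z \<in> carrier_mat m m" if "z \<in> mat_H D m F" for z
      using F that by (auto simp: mat_meromorphic_on_def)
    show "(\<lambda>z. F z $$ (i, j)) holomorphic_on mat_H D m F" if "i < m" "j < m" for i j
    proof (rule analytic_imp_holomorphic)
      show "(\<lambda>z. F z $$ (i, j)) analytic_on mat_H D m F"
        using that by (subst analytic_on_analytic_at) (auto simp: mat_H_def mat_analytic_at_def)
    qed
  qed
qed

text \<open>\<open>mero_eq\<close> compares values at points of holomorphy only. That suffices,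
  since a small punctured disc about any point consists of such points and poles are described
  there.\<close>

lemma mat_meromorphic_mero_eq:
  assumes G: "mat_meromorphic_on D m G" and eq: "mero_eq D m F G"
  shows "mat_meromorphic_on D m F"
  unfolding mat_meromorphic_on_def
proof (intro conjI ballI impI)
  have H: "mat_H D m F = mat_H D m G" "\<And>z. z \<in> mat_H D m G \<Longrightarrow> F z = G z" using eq by (auto simp: mero_eq_def)
  show "open D" using G by (simp add: mat_meromorphic_on_def)
  show "F w \<in> carrier_mat m m" if "w \<in> mat_H D m F" for w
    using G H that by (simp add: mat_meromorphic_on_def)
  fix p assume p: "p \<in> D"
  obtain s where s: "0 < s" "ball p s \<subseteq> D" "ball p s - {p} \<subseteq> mat_H D m G"
    using mat_meromorphic_punctured[OF G p] by blast
  have FG: "F z = G z" if "z \<in> ball p s - {p}" for z using s(3) H(2) that by blast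
  obtain r where r: "0 < r" "ball p r \<subseteq> D" and
    g: "\<forall>i<m. \<forall>j<m. \<exists>k::nat. \<exists>g. g holomorphic_on ball p r \<and> (\<forall>z\<in>ball p r - {p}. G z $$ (i,j) = g z / (z - p) ^ k)"
    using G p unfolding mat_meromorphic_on_def by blast
  define e where "e = min r s"
  have e: "0 < e" "ball p e \<subseteq> ball p r" "ball p e \<subseteq> ball p s" using r(1) s(1) by (auto simp: e_def)
  have "\<exists>k::nat. \<exists>g. g holomorphic_on ball p e \<and> (\<forall>z\<in>ball p e - {p}. F z $$ (i,j) = g z / (z - p) ^ k)" if ij: "i < m" "j < m" for i j
  proof -
    obtain k h where h: "h holomorphic_on ball p r" "\<And>z. z \<in> ball p r - {p} \<Longrightarrow> G z $$ (i,j) = h z / (z - p) ^ k" using g ij by blast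
    have "F z $$ (i,j) = h z / (z - p) ^ k" if "z \<in> ball p e - {p}" for z
    proof -
      have "z \<in> ball p s - {p}" "z \<in> ball p r - {p}" using that e(2,3) by blast+
      then show ?thesis using FG h(2) by simp
    qed
    then show ?thesis using holomorphic_on_subset[OF h(1) e(2)] by blast
  qed
  then show "\<exists>r>0. ball p r \<subseteq> D \<and> (\<forall>i<m. \<forall>j<m. \<exists>k::nat. \<exists>g. g holomorphic_on ball p r \<and>
      (\<forall>z\<in>ball p r - {p}. F z $$ (i,j) = g z / (z - p) ^ k))"
    using e s(2) by (intro exI[of _ e]) blast
  assume "mat_removable_at m F p"
  then have "mat_removable_at m G p" by (rule mat_removable_cong[OF _ s(1) FG])
  then have "p \<in> mat_H D m G" using G p by (simp add: mat_meromorphic_on_def mat_H_def)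
  then show "mat_analytic_at m F p" unfolding H(1)[symmetric] by (simp add: mat_H_def)
qed

text \<open>Common points of holomorphy are settled by continuity; a point of holomorphy of one function is
  a removable singularity of the other.\<close>
lemma mero_eqI:
  assumes F: "mat_meromorphic_on D m F" and G: "mat_meromorphic_on D m G"
    and Z: "sparse_in_set D Z" and eq: "\<And>z. z \<in> D - Z \<Longrightarrow> F z = G z"
  shows "mero_eq D m F G"
proof -
  have sub: "mat_H D m F \<subseteq> mat_H D m G"
    if F: "mat_meromorphic_on D m F" and G: "mat_meromorphic_on D m G" and eq: "\<And>z. z \<in> D - Z \<Longrightarrow> F z = G z" for F G
  proof
    fix p assume "p \<in> mat_H D m F"
    then have p: "p \<in> D" "mat_analytic_at m F p" by (auto simp: mat_H_def)
    obtain r where r: "0 < r" "ball p r \<subseteq> D" "(ball p r - {p}) \<inter> Z = {}" by (rule sparse_in_setE[OF Z p(1)])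
    have "mat_removable_at m G p"
      by (rule mat_removable_cong[OF mat_analytic_removable[OF p(2)] r(1)]) (use r eq in blast)
    then show "p \<in> mat_H D m G" using G p(1) by (simp add: mat_meromorphic_on_def mat_H_def)
  qed
  have H: "mat_H D m F = mat_H D m G"
    by (intro equalityI sub F G) (use eq in auto)
  have "F p = G p" if p: "p \<in> mat_H D m F" for p
  proof (rule eq_matI)
    note FH = mat_H_holo[OF F] and GH = mat_H_holo[OF G]
    have c: "F p \<in> carrier_mat m m" "G p \<in> carrier_mat m m" using mholoD(1)[OF FH(2)] mholoD(1)[OF GH(2)] p H by auto
    then show "dim_row (F p) = dim_row (G p)" "dim_col (F p) = dim_col (G p)" by auto
    fix i j assume "i < dim_row (G p)" "j < dim_col (G p)"
    then have ij: "i < m" "j < m" using c by auto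
    have "sparse_in_set (mat_H D m F) Z"
    proof (rule sparse_in_setI)
      fix q assume q: "q \<in> mat_H D m F"
      then obtain r where r: "0 < r" "ball q r \<subseteq> D" "(ball q r - {q}) \<inter> Z = {}"
        using sparse_in_setE[OF Z, of q] by (auto simp: mat_H_def)
      obtain s where s: "0 < s" "ball q s \<subseteq> mat_H D m F" using FH(1) q by (rule openE)
      have "ball q (min r s) \<subseteq> ball q r" "ball q (min r s) \<subseteq> ball q s" by auto
      then show "\<exists>r>0. ball q r \<subseteq> mat_H D m F \<and> (ball q r - {q}) \<inter> Z = {}"
        using r s by (intro exI[of _ "min r s"] conjI) (simp, blast, blast)
    qed
    then show "F p $$ (i, j) = G p $$ (i, j)"
    proof (rule sparse_eq[where f="\<lambda>z. F z $$ (i, j)" and g="\<lambda>z. G z $$ (i, j)", OF _ _ _ _ p])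
      show "continuous_on (mat_H D m F) (\<lambda>z. F z $$ (i, j))" "continuous_on (mat_H D m F) (\<lambda>z. G z $$ (i, j))"
        using mholoD(2)[OF FH(2) ij] mholoD(2)[OF GH(2) ij] H by (auto intro: holomorphic_on_imp_continuous_on)
      show "F z $$ (i, j) = G z $$ (i, j)" if "z \<in> mat_H D m F - Z" for z
        using eq[of z] that by (simp add: mat_H_def)
    qed
  qed
  then show ?thesis using H by (simp add: mero_eq_def)
qed

lemma mero_eq_interp:
  assumes G: "P_J0_interp m J A n G" and eq: "mero_eq unit_disc m F G"
  shows "P_J0_interp m J A n F"
proof -
  have H: "mat_H unit_disc m F = mat_H unit_disc m G" "\<And>z. z \<in> mat_H unit_disc m G \<Longrightarrow> F z = G z"
    using eq by (auto simp: mero_eq_def)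
  have P: "P_J0 m J G" using G by (simp add: P_J0_interp_def)
  then have mG: "mat_meromorphic_on unit_disc m G" and 0: "0 \<in> mat_H unit_disc m G" by (auto simp: P_J0_def)
  have "P_J0 m J F"
    using P mat_meromorphic_mero_eq[OF mG eq] H by (simp add: P_J0_def)
  moreover have "(deriv ^^ j) (\<lambda>z. F z $$ (a, b)) 0 = (deriv ^^ j) (\<lambda>z. G z $$ (a, b)) 0" for j a b
    by (rule higher_deriv_cong_ev[OF eventually_mono[OF eventually_nhds_in_open[OF mat_H_holo(1)[OF mG] 0]] refl])
      (simp add: H(2))
  ultimately show ?thesis using G by (simp add: P_J0_interp_def)
qed

lemma interp_mtc: "P_J0_interp m J A n f \<longleftrightarrow> P_J0 m J f \<and> (\<forall>j\<le>n. mtc m f j = A j)"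
  by (simp add: P_J0_interp_def mtc_def tc_def)

text \<open>Exponent 0 covers the points where f does not vanish, so poles and regular points of the
  quotient can be handled alike.\<close>

lemma holomorphic_factor_zero:
  assumes f: "f holomorphic_on S" and S: "open S" "connected S" and p: "p \<in> S" and a: "a \<in> S" "f a \<noteq> 0"
  shows "\<exists>g r n. 0 < r \<and> ball p r \<subseteq> S \<and> g holomorphic_on ball p r \<and> (\<forall>w\<in>ball p r. f w = (w - p) ^ n * g w) \<and> (\<forall>w\<in>ball p r. g w \<noteq> 0)"
proof (cases "f p = 0")
  case True
  have "\<not> f constant_on S" using True p a unfolding constant_on_def by metis
  then show ?thesis using holomorphic_factor_zero_nonconstant[OF f S p True] by metis
next
  case False
  obtain r where r: "0 < r" "ball p r \<subseteq> S" "(ball p r - {p}) \<inter> {z. f z = 0} = {}"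
    by (rule sparse_in_setE[OF sparse_in_set_zeros[OF f S a] p])
  have "f w \<noteq> 0" if "w \<in> ball p r" for w using r(3) that False by (cases "w = p") auto
  then show ?thesis
    using r f by (intro exI[of _ f] exI[of _ r] exI[of _ 0]) (auto intro: holomorphic_on_subset)
qed

lemma op_eqI:
  assumes "X \<in> carrier_mat m m" "Y \<in> carrier_mat m m" "\<And>p. trunc m p \<Longrightarrow> op X p = op Y p"
  shows "X = Y"
proof (rule eq_matI)
  show "dim_row X = dim_row Y" "dim_col X = dim_col Y" using assms(1,2) by auto
  fix i j assume "i < dim_row Y" "j < dim_col Y"
  then have ij: "i < m" "j < m" using assms(2) by auto
  have "trunc m (monom 1 j)" using ij by (auto simp: trunc_def)
  then show "X $$ (i, j) = Y $$ (i, j)"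
    using assms(3) coeff_op_monom[OF assms(1) ij] coeff_op_monom[OF assms(2) ij] by metis
qed

section \<open>The functions given by a Schur parameter\<close>

context potapov_data
begin

lemma mholo_poly [intro]: "mholo m U (rho_poly m J A n)" "mholo m U (pi_poly m J A n)"
  "mholo m U (sigma_poly m J A n)" "mholo m U (tau_poly m J A n)"
  by (rule mtc_poly(1)[OF poly_carriers(1) poly_index(1)], assumption+)
    (rule mtc_poly(1)[OF poly_carriers(2) poly_index(2)], assumption+,
     rule mtc_poly(1)[OF poly_carriers(3) poly_index(3)], assumption+,
     rule mtc_poly(1)[OF poly_carriers(4) poly_index(4)], assumption+)

lemma mholo_tilde: "mholo m U (mat_tilde m n b)"
  unfolding mholo_def mat_tilde_def by (auto intro!: holomorphic_intros)

lemma mtc_polys: assumes "k \<le> n" shows "mtc m (rho_poly m J A n) k = Vc k" "mtc m (tau_poly m J A n) k = Tc k"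
  by (rule mtc_poly(2)[OF poly_carriers(1) poly_index(1) assms Vc], assumption+)
    (rule mtc_poly(2)[OF poly_carriers(4) poly_index(4) assms Tc], assumption+)

lemma mholo_DN:
  assumes K: "mholo m U K"
  shows "mholo m U (\<lambda>w. D1 (K w) w)" "mholo m U (\<lambda>w. N1 (K w) w)"
  unfolding D1_def N1_def
  by (intro mholo_add mholo_smult mholo_mult mholo_poly mholo_tilde mholo_const K Jc sqrtL(2) sqrtR(1) holomorphic_intros)+

lemma rho_poly_0: "rho_poly m J A n 0 = 1\<^sub>m m"
proof (rule eq_matI)
  show "dim_row (rho_poly m J A n 0) = dim_row (1\<^sub>m m)" "dim_col (rho_poly m J A n 0) = dim_col (1\<^sub>m m)"
    using poly_carriers(1)[of 0] by auto
  fix i j assume "i < dim_row (1\<^sub>m m :: complex mat)" "j < dim_col (1\<^sub>m m :: complex mat)"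
  then have ij: "i < m" "j < m" by auto
  have "rho_poly m J A n 0 $$ (i, j) = (\<Sum>k\<le>n. if k = 0 then Vc 0 $$ (i, j) else 0)"
    unfolding poly_index(1)[OF ij] by (intro sum.cong) auto
  then show "rho_poly m J A n 0 $$ (i, j) = 1\<^sub>m m $$ (i, j)" by (simp add: Vc_def)
qed

text \<open>At 0 the factor w removes the parameter and rho is the identity. Therefore the
  determinant does not vanish identically and its zeros are isolated.\<close>

lemma det_D1_0: assumes K: "K \<in> carrier_mat m m" shows "Determinant.det (D1 K 0) \<noteq> 0"
proof -
  have "D1 K 0 = 1\<^sub>m m"
    unfolding D1_def rho_poly_0
    by (rule eq_matI) (use K Jc(1) sqrtL(2) sqrtR(1) tilde_carrier[of "sigma_poly m J A n" 0] in auto)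
  then show ?thesis by simp
qed

context
  fixes S :: "complex \<Rightarrow> complex mat"
  assumes S: "mholo m (ball 0 1) S" and contr: "\<And>z p. z \<in> ball 0 1 \<Longrightarrow> nrm (op (S z) p) \<le> nrm p"
begin

definition "fS = f_S m J A n S"
definition "Z = {w. Determinant.det (D1 (S w) w) = 0}"

lemma S_carrier: "z \<in> ball 0 1 \<Longrightarrow> S z \<in> carrier_mat m m"
  by (rule mholoD(1)[OF S])

lemma det_holo: "(\<lambda>w. Determinant.det (D1 (S w) w)) holomorphic_on ball 0 1"
  by (rule mholo_det[OF mholo_DN(1)[OF S]])

lemma det_0: "Determinant.det (D1 (S 0) 0) \<noteq> 0"
  by (rule det_D1_0) (simp add: S_carrier)

lemma Z_sparse: "sparse_in_set (ball 0 1) Z"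
  unfolding Z_def by (rule sparse_in_set_zeros[OF det_holo open_ball _ _ det_0]) auto

lemma fS_eq: "z \<notin> Z \<Longrightarrow> fS z = N1 (S z) z * minv (D1 (S z) z)"
  by (simp add: fS_def f_S_def den_num Z_def)

lemma fS_D1:
  assumes z: "z \<in> ball 0 1" "z \<notin> Z"
  shows "fS z \<in> carrier_mat m m" "fS z * D1 (S z) z = N1 (S z) z"
proof -
  note c = DN_carrier[OF S_carrier[OF z(1)], of z]
  have det: "Determinant.det (D1 (S z) z) \<noteq> 0" using z(2) by (simp add: Z_def)
  note mi = minv_det[OF c(1) det]
  show "fS z \<in> carrier_mat m m" using c mi by (simp add: fS_eq[OF z(2)])
  have "fS z * D1 (S z) z = N1 (S z) z * (minv (D1 (S z) z) * D1 (S z) z)"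
    unfolding fS_eq[OF z(2)] by (rule assoc_mult_mat[OF c(2) mi(2) c(1)])
  then show "fS z * D1 (S z) z = N1 (S z) z" using c(2) by (simp add: mi(4))
qed

lemma fS_mholo: "mholo m (ball 0 1 - Z) fS"
proof -
  have s: "mholo m (ball 0 1 - Z) S" by (rule mholo_subset[OF S]) auto
  have "mholo m (ball 0 1 - Z) (\<lambda>z. N1 (S z) z * minv (D1 (S z) z))"
    by (intro mholo_mult mholo_minv mholo_DN s) (simp add: Z_def)
  then show ?thesis by (subst mholo_cong[OF fS_eq]) auto
qed

text \<open>If f_S had a holomorphic continuation G across a zero p of the determinant, N1 = G D1
  would extend to p by continuity. Then a kernel vector of D1 at p would also be one of N1, against
  \<open>DN1_injective\<close>.\<close>

lemma fS_removable_det: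
  assumes p: "p \<in> ball 0 1" and rem: "mat_removable_at m fS p"
  shows "p \<notin> Z"
proof
  assume pZ: "p \<in> Z"
  obtain r where r: "0 < r" "ball p r \<subseteq> ball 0 1" "(ball p r - {p}) \<inter> Z = {}"
    by (rule sparse_in_setE[OF Z_sparse p])
  obtain s G where s: "0 < s" "s \<le> r" and G: "mholo m (ball p s) G" "\<forall>z\<in>ball p s - {p}. \<forall>i<m. \<forall>j<m. fS z $$ (i, j) = G z $$ (i, j)"
    using mat_removable_ball[OF rem r(1)] by blast
  have sr: "ball p s \<subseteq> ball p r" by (rule subset_ball[OF s(2)])
  have sB: "ball p s \<subseteq> ball 0 1" using sr r(2) by blast
  have ps: "p \<in> ball p s" using s(1) by simp
  note DNs = mholo_DN[OF mholo_subset[OF S sB]]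
  have "N1 (S z) z = G z * D1 (S z) z" if z: "z \<in> ball p s" "z \<noteq> p" for z
  proof -
    have zB: "z \<in> ball 0 1" "z \<notin> Z" using z sB sr r(3) by blast+
    have "fS z = G z"
      using G(2) z fS_D1(1)[OF zB] mholoD(1)[OF G(1) z(1)] by (intro eq_matI) auto
    then show ?thesis using fS_D1(2)[OF zB] by simp
  qed
  note eq = this
  have "N1 (S p) p = G p * D1 (S p) p"
  proof (rule eq_matI)
    note c = mholoD(1)[OF DNs(2) ps] mholoD(1)[OF mholo_mult[OF G(1) DNs(1)] ps]
    show "dim_row (N1 (S p) p) = dim_row (G p * D1 (S p) p)" "dim_col (N1 (S p) p) = dim_col (G p * D1 (S p) p)"
      using c by auto
    fix i j assume "i < dim_row (G p * D1 (S p) p)" "j < dim_col (G p * D1 (S p) p)"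
    then have ij: "i < m" "j < m" using c by auto
    show "N1 (S p) p $$ (i, j) = (G p * D1 (S p) p) $$ (i, j)"
    proof (rule sparse_eq[where f="\<lambda>z. N1 (S z) z $$ (i, j)" and g="\<lambda>z. (G z * D1 (S z) z) $$ (i, j)", OF _ _ _ _ ps])
      show "sparse_in_set (ball p s) {p}" by (rule sparse_in_set_singleton) simp
      show "continuous_on (ball p s) (\<lambda>z. N1 (S z) z $$ (i, j))" "continuous_on (ball p s) (\<lambda>z. (G z * D1 (S z) z) $$ (i, j))"
        by (intro holomorphic_on_imp_continuous_on mholoD(2)[OF DNs(2) ij] mholoD(2)[OF mholo_mult[OF G(1) DNs(1)] ij])+
    qed (simp add: eq)
  qed
  note N1p = this
  note c = DN_carrier[OF S_carrier[OF p], of p]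
  obtain v where v: "trunc m v" "op (D1 (S p) p) v = 0" "v \<noteq> 0"
    using pZ det_nonzero_iff[OF c(1)] by (auto simp: Z_def)
  have "op (N1 (S p) p) v = op (G p) (op (D1 (S p) p) v)"
    unfolding N1p by (rule op_mult[OF mholoD(1)[OF G(1) ps] c(1)])
  then have "op (N1 (S p) p) v = 0" by (simp add: v(2) cip.lin_zero[OF lin_op])
  then have "v = 0" using DN1_injective[OF S_carrier[OF p], of p v] v p by simp
  then show False using v(3) by simp
qed

lemma fS_analytic: "p \<in> ball 0 1 \<Longrightarrow> p \<notin> Z \<Longrightarrow> mat_analytic_at m fS p"
  by (rule mat_analytic_atI[OF fS_mholo sparse_open_complement[OF Z_sparse]]) simp

lemma fS_H': "mat_H (ball 0 1) m fS = ball 0 1 - Z"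
proof (intro equalityI subsetI)
  show "p \<in> ball 0 1 - Z" if "p \<in> mat_H (ball 0 1) m fS" for p
    using that fS_removable_det[OF _ mat_analytic_removable] by (simp add: mat_H_def)
  show "p \<in> mat_H (ball 0 1) m fS" if "p \<in> ball 0 1 - Z" for p
    using that fS_analytic by (simp add: mat_H_def)
qed

lemma fS_H: "mat_H (ball 0 1) m fS = {w \<in> ball 0 1. Determinant.det (D1 (S w) w) \<noteq> 0}"
  unfolding fS_H' Z_def by blast

lemma fS_meromorphic: "mat_meromorphic_on (ball 0 1) m fS"
  unfolding mat_meromorphic_on_def
proof (intro conjI ballI impI open_ball)
  show "fS w \<in> carrier_mat m m" if "w \<in> mat_H (ball 0 1) m fS" for w
    using that fS_D1(1) unfolding fS_H' by blast
  fix p :: complex assume p: "p \<in> ball 0 1"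
  show "mat_analytic_at m fS p" if "mat_removable_at m fS p"
    by (rule fS_analytic[OF p fS_removable_det[OF p that]])
  \<comment> \<open>By the adjugate formula f_S is a holomorphic matrix divided by the determinant,
    so the order k of the zero bounds the order of the pole.\<close>
  obtain u r k where r: "0 < r" "ball p r \<subseteq> ball 0 1" and u: "u holomorphic_on ball p r"
    "\<forall>w\<in>ball p r. Determinant.det (D1 (S w) w) = (w - p) ^ k * u w" "\<forall>w\<in>ball p r. u w \<noteq> 0"
    using holomorphic_factor_zero[OF det_holo open_ball _ p _ det_0] by auto
  have "\<exists>g. g holomorphic_on ball p r \<and> (\<forall>z\<in>ball p r - {p}. fS z $$ (i, j) = g z / (z - p) ^ k)" if ij: "i < m" "j < m" for i j
  proof (intro exI conjI ballI)
    let ?M = "\<lambda>z. N1 (S z) z * adj_mat (D1 (S z) z)"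
    have S': "mholo m (ball p r) S" by (rule mholo_subset[OF S r(2)])
    have M: "mholo m (ball p r) ?M" by (intro mholo_mult mholo_adj_mat mholo_DN S')
    show "(\<lambda>z. ?M z $$ (i, j) / u z) holomorphic_on ball p r"
      using u by (intro holomorphic_intros mholoD(2)[OF M ij]) auto
    fix z assume z: "z \<in> ball p r - {p}"
    then have zB: "z \<in> ball 0 1" using r(2) by blast
    note c = DN_carrier[OF S_carrier[OF zB], of z]
    have d: "Determinant.det (D1 (S z) z) = (z - p) ^ k * u z" "u z \<noteq> 0" "z \<noteq> p" using u z by auto
    then have det: "Determinant.det (D1 (S z) z) \<noteq> 0" by simp
    have idx: "(x \<cdot>\<^sub>m ?M z) $$ (i, j) = x * ?M z $$ (i, j)" for x
      using c adj_mat(1)[OF c(1)] ij by (intro index_smult_mat(1)) auto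
    have "fS z = (1 / Determinant.det (D1 (S z) z)) \<cdot>\<^sub>m ?M z"
      using c det by (simp add: fS_eq Z_def minv_det(1)[OF c(1) det] mult_smult_distrib[OF c(2) adj_mat(1)[OF c(1)]])
    then show "fS z $$ (i, j) = (?M z $$ (i, j) / u z) / (z - p) ^ k"
      using d by (simp add: idx)
  qed
  then show "\<exists>r>0. ball p r \<subseteq> ball 0 1 \<and> (\<forall>i<m. \<forall>j<m. \<exists>k::nat. \<exists>g. g holomorphic_on ball p r \<and>
      (\<forall>z\<in>ball p r - {p}. fS z $$ (i, j) = g z / (z - p) ^ k))"
    using r by blast
qed

lemma fS_second:
  assumes z: "z \<in> ball 0 1" "z \<notin> Z"
  shows "Determinant.det (D2 (S z) z) \<noteq> 0" "D2 (S z) z * fS z = N2 (S z) z" "fS z = minv (D2 (S z) z) * N2 (S z) z"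
proof -
  note K = S_carrier[OF z(1)]
  note c = DN_carrier[OF K, of z]
  have d1: "Determinant.det (D1 (S z) z) \<noteq> 0" using z(2) by (simp add: Z_def)
  show d2: "Determinant.det (D2 (S z) z) \<noteq> 0" using det_D1_iff_D2[OF K, of z] d1 z(1) by simp
  note mi = minv_det[OF c(1) d1] and mi2 = minv_det[OF c(3) d2] and f = fS_D1[OF z]
  have "D2 (S z) z * N1 (S z) z = N2 (S z) z * D1 (S z) z"
    by (rule op_eqI[of _ m]) (use c in \<open>simp_all add: op_mult[of _ m m _ m] D2_N1[OF K]\<close>)
  then have "N2 (S z) z * (D1 (S z) z * minv (D1 (S z) z)) = D2 (S z) z * (N1 (S z) z * minv (D1 (S z) z))"
    using c mi by (simp add: assoc_mult_mat[of _ m m _ m _ m, symmetric])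
  then show e: "D2 (S z) z * fS z = N2 (S z) z" using c by (simp add: fS_eq[OF z(2)] mi(3))
  have "minv (D2 (S z) z) * N2 (S z) z = (minv (D2 (S z) z) * D2 (S z) z) * fS z"
    unfolding e[symmetric] by (rule assoc_mult_mat[OF mi2(2) c(3) f(1), symmetric])
  then show "fS z = minv (D2 (S z) z) * N2 (S z) z" using f(1) by (simp add: mi2(4))
qed

lemma fS_contractive:
  assumes z: "z \<in> ball 0 1" "z \<notin> Z" shows "J_contractive m J (fS z)"
  unfolding fS_eq[OF z(2)]
proof (rule J_contractive_quotient[OF sig])
  note K = S_carrier[OF z(1)]
  show "D1 (S z) z \<in> carrier_mat m m" "N1 (S z) z \<in> carrier_mat m m" by (rule DN_carrier[OF K])+
  show "Determinant.det (D1 (S z) z) \<noteq> 0" using z(2) by (simp add: Z_def)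
  have "cmod z < 1" using z(1) by simp
  then show "0 \<le> Re (pip (op J (op (D1 (S z) z) p)) (op (D1 (S z) z) p) - pip (op J (op (N1 (S z) z) p)) (op (N1 (S z) z) p))"
    if "trunc m p" for p
    using DN1_gap[OF K _ contr[OF z(1)] that] by blast
qed

text \<open>Coefficient k of tau f_S - sigma is the sum over j of T_(k-j) applied to the difference
  of coefficient j of f_S and A_j. It vanishes for k <= n, the terms with j < k vanish by induction,
  and T_0 is the identity.\<close>

lemma fS_taylor: "k \<le> n \<Longrightarrow> mtc m fS k = A k"
proof (induction k rule: less_induct)
  case (less k)
  have 0: "0 \<in> ball 0 1 - Z" using det_0 by (simp add: Z_def)
  have o: "open (ball 0 1 - Z)" by (rule sparse_open_complement[OF Z_sparse])
  have S': "mholo m (ball 0 1 - Z) S" by (rule mholo_subset[OF S]) auto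
  \<comment> \<open>L s as a function of v = D1 u: with s = pL S sR u the remainder in the second
    relation is w^(n+1) E v, and E is holomorphic near 0.\<close>
  define E where "E w = L * pL * S w * sR * minv (D1 (S w) w)" for w
  have "mholo m (ball 0 1 - Z) E"
    unfolding E_def
    by (intro mholo_mult mholo_const S' mholo_minv mholo_DN L_carrier sqrtL(2) sqrtR(1)) (simp add: Z_def)
  then have E: "mana m E" by (rule mana_mholo[OF _ o 0])
  have F: "mana m fS" by (rule mana_mholo[OF fS_mholo o 0])
  have sg: "mana m (sigma_poly m J A n)" and ta: "mana m (tau_poly m J A n)"
    by (rule mana_mholo[of m UNIV]; auto)+
  show ?case
  proof (rule op_eqI[of _ m])
    show "mtc m fS k \<in> carrier_mat m m" "A k \<in> carrier_mat m m" using less.prems Ac by auto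
    fix v assume v: "trunc m v"
    have main: "op (tau_poly m J A n w) (op (fS w) v) = op (sigma_poly m J A n w) v + Polynomial.smult (w ^ Suc n) (op (E w) v)"
      if w: "w \<in> ball 0 1 - Z" for w
    proof -
      have wB: "w \<in> ball 0 1" "w \<notin> Z" using w by auto
      note K = S_carrier[OF wB(1)]
      note c = DN_carrier[OF K, of w]
      have d1: "Determinant.det (D1 (S w) w) \<noteq> 0" using wB(2) by (simp add: Z_def)
      note mi = minv_det[OF c(1) d1]
      define u where "u = op (minv (D1 (S w) w)) v"
      define s where "s = op pL (op (S w) (op sR u))"
      have u: "trunc m u" unfolding u_def by (rule trunc_op[OF mi(2)])
      have s: "trunc m s" unfolding s_def by (rule trunc_op[OF sqrtL(2)])
      have Du: "op (D1 (S w) w) u = v"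
        unfolding u_def op_mult[OF c(1) mi(2), symmetric] mi(3) by (rule trunc_op_one[OF v])
      have Nu: "op (N1 (S w) w) u = op (fS w) v"
        unfolding fS_eq[OF wB(2)] u_def by (rule op_mult[OF c(2) mi(2), symmetric])
      have "pot.tau w (op (fS w) v) - pot.sigma w v = Polynomial.smult (w ^ Suc n) (op L s)"
        using pot.lft_relations(2)[of w s u] unfolding opE_trunc[OF s]
        unfolding op_D1[OF K u, of w, folded s_def, symmetric] Du Nu .
      moreover have "op L s = op (E w) v"
        unfolding E_def s_def u_def using L_carrier sqrtL(2) sqrtR(1) K mi(2) by (simp add: op_mult[of _ m m _ m])
      moreover have "trunc m (op (fS w) v)" by (rule trunc_op[OF fS_D1(1)[OF wB]])
      ultimately show ?thesis by (simp add: op_polys v algebra_simps)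
    qed
    define x where "x j = op (mtc m fS j) v" for j
    have "vtc m (\<lambda>w. op (tau_poly m J A n w) (op (fS w) v)) k =
        vtc m (\<lambda>w. op (sigma_poly m J A n w) v + Polynomial.smult (w ^ Suc n) (op (E w) v)) k"
      by (rule vtc_cong) (rule eventually_mono[OF eventually_nhds_in_open[OF o 0] main])
    also have "\<dots> = vtc m (\<lambda>w. op (sigma_poly m J A n w) v) k"
    proof -
      have v1: "vana (\<lambda>w. op (sigma_poly m J A n w) v)" "vana (\<lambda>w. op (E w) v)"
        by (rule vana_op[OF sg vana_const] vana_op[OF E vana_const])+
      have v2: "vana (\<lambda>w. Polynomial.smult (w ^ Suc n) (op (E w) v))"
        using v1(2) unfolding vana_def coeff_smult by (auto intro!: analytic_intros)
      show ?thesis using less.prems by (simp only: vtc_add[OF v1(1) v2] vtc_monom[OF v1(2)]) simp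
    qed
    also have "vtc m (\<lambda>w. op (tau_poly m J A n w) (op (fS w) v)) k = (\<Sum>j\<le>k. To (k - j) (x j))"
    proof -
      have "vtc m (\<lambda>w. op (tau_poly m J A n w) (op (fS w) v)) k = (\<Sum>j\<le>k. op (mtc m (tau_poly m J A n) (k - j)) (x j))"
        unfolding vtc_op[OF ta vana_op[OF F vana_const]] cv_def vtc_op_const[OF F] x_def ..
      also have "\<dots> = (\<Sum>j\<le>k. To (k - j) (x j))"
        using less.prems by (intro sum.cong refl) (simp add: mtc_polys op_Vc x_def trunc_op[of _ m m])
      finally show ?thesis .
    qed
    also have "vtc m (\<lambda>w. op (sigma_poly m J A n w) v) k = (\<Sum>j\<le>k. To (k - j) (Ao j v))"
    proof -
      have "vtc m (\<lambda>w. op (sigma_poly m J A n w) v) k = op (1\<^sub>m m) (op (Sc k) v)"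
        unfolding op_poly by (rule vtc_poly[OF less.prems])
      also have "\<dots> = (\<Sum>j\<le>k. To j (Ao (k - j) v))"
        using op_Sc[OF less.prems, of v] op_one_op[of "Sc k" m m v] by simp
      also have "\<dots> = (\<Sum>j\<le>k. To (k - j) (Ao j v))"
        by (rule sum.reindex_bij_witness[where i="\<lambda>j. k - j" and j="\<lambda>j. k - j"]) auto
      finally show ?thesis .
    qed
    finally have "(\<Sum>j\<le>k. To (k - j) (x j)) = (\<Sum>j\<le>k. To (k - j) (Ao j v))" .
    moreover have "(\<Sum>j<k. To (k - j) (x j)) = (\<Sum>j<k. To (k - j) (Ao j v))"
      using less by (intro sum.cong refl) (simp add: x_def Ao_def)
    ultimately show "op (mtc m fS k) v = op (A k) v"
      by (simp add: lessThan_Suc_atMost[symmetric] x_def To_def Ao_def)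
  qed
qed

theorem fS_interp: "P_J0_interp m J A n fS"
  unfolding interp_mtc P_J0_def fS_H'
  using fS_meromorphic fS_contractive fS_taylor det_0 by (auto simp: Z_def)

end

end

section \<open>Every interpolant has a Schur parameter\<close>

text \<open>Contractivity bounds every entry by 1, so the entries extend one by one; contractivity
  of the extension is recovered by continuity.\<close>

lemma mat_bounded_extension:
  assumes Z: "sparse_in_set D Z" and F: "mholo m (D - Z) F"
    and contr: "\<And>z p. z \<in> D - Z \<Longrightarrow> nrm (op (F z) p) \<le> nrm p"
  shows "\<exists>G. mholo m D G \<and> (\<forall>z\<in>D - Z. G z = F z) \<and> (\<forall>z\<in>D. \<forall>p. nrm (op (G z) p) \<le> nrm p)"
proof -
  have bound: "cmod (F z $$ (i, j)) \<le> 1" if z: "z \<in> D - Z" and ij: "i < m" "j < m" for z i j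
  proof -
    have c: "F z \<in> carrier_mat m m" by (rule mholoD(1)[OF F z])
    have "nrm (op (F z) (monom 1 j)) = (\<Sum>l<m. (cmod (F z $$ (l, j)))\<^sup>2)"
      using c coeff_op_monom[OF c _ ij(2)]
      by (subst pip_eq[of m]) (auto simp: coeff_op Re_sum complex_norm_square[symmetric] simp del: of_real_power intro!: sum.cong)
    moreover have "(cmod (F z $$ (i, j)))\<^sup>2 \<le> (\<Sum>l<m. (cmod (F z $$ (l, j)))\<^sup>2)"
      by (rule member_le_sum) (use ij in auto)
    moreover have "nrm (monom 1 j) = 1"
      by (subst pip_eq[of "Suc j"]) (auto simp: if_distrib cong: if_cong)
    ultimately have "(cmod (F z $$ (i, j)))\<^sup>2 \<le> 1" using contr[OF z, of "monom 1 j"] by simp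
    then show ?thesis by (simp add: abs_square_le_1)
  qed
  have "\<exists>g. g holomorphic_on D \<and> (\<forall>z\<in>D - Z. g z = F z $$ (i, j))" if "i < m" "j < m" for i j
    by (rule bounded_extension[OF Z mholoD(2)[OF F that] bound[OF _ that]])
  then obtain g where g: "\<And>i j. i < m \<Longrightarrow> j < m \<Longrightarrow> g i j holomorphic_on D \<and> (\<forall>z\<in>D - Z. g i j z = F z $$ (i, j))"
    by metis
  define G where "G z = mat m m (\<lambda>(i,j). g i j z)" for z
  have G: "mholo m D G" using g by (auto simp: mholo_def G_def)
  have eq: "G z = F z" if "z \<in> D - Z" for z
    using g that mholoD(1)[OF F that] by (intro eq_matI) (auto simp: G_def)
  have "nrm (op (G z) p) \<le> nrm p" if z: "z \<in> D" for z p
  proof -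
    have n: "nrm (op (G z) p) = Re (\<Sum>i<m. (\<Sum>j<m. g i j z * coeff p j) * cnj (\<Sum>j<m. g i j z * coeff p j))" for z
      by (subst pip_eq[of m]) (auto simp: coeff_op G_def)
    have "continuous_on D (\<lambda>z. nrm p - nrm (op (G z) p))"
      unfolding n using g by (intro continuous_intros holomorphic_on_imp_continuous_on) auto
    then have "0 \<le> nrm p - nrm (op (G z) p)"
      by (rule sparse_closure[OF Z _ _ z]) (simp add: eq contr)
    then show ?thesis by simp
  qed
  then show ?thesis using G eq by blast
qed

lemma mat_factor_power:
  assumes F: "mholo m D F" and D: "open D" "0 \<in> D" and z: "\<And>k. k < N \<Longrightarrow> mtc m F k = 0\<^sub>m m m"
  shows "\<exists>G. mholo m D G \<and> (\<forall>z\<in>D. F z = z ^ N \<cdot>\<^sub>m G z) \<and> G 0 = mtc m F N"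
proof -
  have "tc (\<lambda>z. F z $$ (i, j)) k = 0" if "k < N" "i < m" "j < m" for i j k
  proof -
    have "mtc m F k $$ (i, j) = 0" using z[OF that(1)] that(2,3) by simp
    then show ?thesis using that by (simp add: mtc_def)
  qed
  then have "\<exists>g. g holomorphic_on D \<and> (\<forall>z\<in>D. F z $$ (i, j) = z ^ N * g z) \<and> g 0 = tc (\<lambda>z. F z $$ (i, j)) N" if "i < m" "j < m" for i j
    by (intro holomorphic_factor_power[OF mholoD(2)[OF F that] D]) (use that in auto)
  then obtain g where g: "\<And>i j. i < m \<Longrightarrow> j < m \<Longrightarrow> g i j holomorphic_on D \<and> (\<forall>z\<in>D. F z $$ (i, j) = z ^ N * g i j z) \<and> g i j 0 = tc (\<lambda>z. F z $$ (i, j)) N"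
    by metis
  define G where "G z = mat m m (\<lambda>(i,j). g i j z)" for z
  have "mholo m D G" using g by (auto simp: mholo_def G_def)
  moreover have "F z = z ^ N \<cdot>\<^sub>m G z" if "z \<in> D" for z
    using g that mholoD(1)[OF F that] by (intro eq_matI) (auto simp: G_def)
  moreover have "G 0 = mtc m F N" using g by (auto simp: G_def mtc_def intro!: eq_matI)
  ultimately show ?thesis by blast
qed

lemma vtc_const_op:
  assumes C: "C \<in> carrier_mat m m" and \<phi>: "vana \<phi>"
  shows "vtc m (\<lambda>z. op C (\<phi> z)) k = op C (vtc m \<phi> k)"
proof (rule poly_eqI)
  fix i
  have "tc (\<lambda>z. \<Sum>j<m. C $$ (i, j) * coeff (\<phi> z) j) k = (\<Sum>j<m. C $$ (i, j) * tc (\<lambda>z. coeff (\<phi> z) j) k)"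
    using \<phi> by (subst tc_sum) (auto simp: vana_def tc_const_mult intro!: analytic_intros)
  then show "coeff (vtc m (\<lambda>z. op C (\<phi> z)) k) i = coeff (op C (vtc m \<phi> k)) i"
    using C by (auto simp: coeff_vtc coeff_op)
qed

lemma vana_const_op: "C \<in> carrier_mat m m \<Longrightarrow> vana \<phi> \<Longrightarrow> vana (\<lambda>z. op C (\<phi> z))"
  by (rule vana_op[of m]) (auto simp: mana_def mholo_const intro!: exI[of _ 1])

lemma mholo_pg:
  assumes sig: "sig_mat m J" and X: "mholo m U X"
  shows "mholo m U (\<lambda>z. pg_den m J (X z))" "mholo m U (\<lambda>z. pg_num m J (X z))"
  unfolding pg_den_def pg_num_def
  by (intro mholo_add mholo_mult mholo_const X J_plus_carrier[OF sig] J_minus_carrier[OF sig])+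

lemma one_mult_commute:
  fixes X Y :: "complex mat"
  assumes "X \<in> carrier_mat m m" "Y \<in> carrier_mat m m" "X * Y = 1\<^sub>m m" shows "Y * X = 1\<^sub>m m"
  by (rule mat_mult_left_right_inverse[OF assms])

context potapov_data
begin

text \<open>The difference is the squared norm of the coefficients from m on, where the extended J
  is the identity.\<close>

lemma J_pot_form:
  shows "Re (pip (op J u) u) \<le> Re (pip (Jo u) u)"
proof -
  have "pip (Jo u) u = pip (op J u) u + pip (u - op (1\<^sub>m m) u) u"
    by (simp add: Jo_def opE_def cip.ip_add_left)
  also have "pip (u - op (1\<^sub>m m) u) u = pip (u - op (1\<^sub>m m) u) (u - op (1\<^sub>m m) u)"
    by (subst pip_split[of _ _ m]) (simp add: cip.lin_diff[OF lin_op] op_op_one[of _ m m])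
  finally show ?thesis using nrm_nonneg[of "u - op (1\<^sub>m m) u"] by simp
qed

section \<open>An interpolant and its Potapov-Ginzburg transform\<close>

context
  fixes f :: "complex \<Rightarrow> complex mat"
  assumes f: "P_J0_interp m J A n f"
begin

definition "Hf = mat_H (ball 0 1) m f"

lemma f_mero: "mat_meromorphic_on (ball 0 1) m f" and f_0: "0 \<in> Hf"
  and f_contr: "z \<in> Hf \<Longrightarrow> psd m (J - mat_adjoint (f z) * J * f z)" and f_mtc: "k \<le> n \<Longrightarrow> mtc m f k = A k"
  using f unfolding interp_mtc P_J0_def Hf_def J_contractive_def by auto

lemma Hf_open: "open Hf" and f_mholo: "mholo m Hf f"
  unfolding Hf_def by (rule mat_H_holo[OF f_mero])+

lemma Hf_sparse: "sparse_in_set (ball 0 1) (ball 0 1 - Hf)" and Hf_sub: "Hf \<subseteq> ball 0 1"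
  unfolding Hf_def by (rule mat_meromorphic_sparse[OF f_mero]) (auto simp: mat_H_def)

lemma f_carrier: "z \<in> Hf \<Longrightarrow> f z \<in> carrier_mat m m"
  by (rule mholoD(1)[OF f_mholo])

lemma f_mana: "mana m f"
  by (rule mana_mholo[OF f_mholo Hf_open f_0])

text \<open>The transform is contractive wherever f is holomorphic, so it is bounded near the poles
  of f and these become removable.\<close>

lemma pg_extension:
  "\<exists>X. mholo m (ball 0 1) X \<and> (\<forall>z\<in>Hf. X z = pg m J (f z)) \<and> (\<forall>z\<in>ball 0 1. \<forall>p. nrm (op (X z) p) \<le> nrm p)"
proof -
  have e: "ball 0 1 - (ball 0 1 - Hf) = Hf" using Hf_sub by auto
  have "mholo m Hf (\<lambda>z. pg_num m J (f z) * minv (pg_den m J (f z)))"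
    by (intro mholo_mult mholo_minv mholo_pg sig f_mholo pg_den_det f_carrier f_contr)
  then have "mholo m Hf (\<lambda>z. pg m J (f z))"
    by (subst mholo_cong[OF pg_def[OF sig f_carrier f_contr]])
  then show ?thesis
    using mat_bounded_extension[OF Hf_sparse, of m "\<lambda>z. pg m J (f z)"] pg_facts(5)[OF sig f_carrier f_contr]
    unfolding e by blast
qed

definition "X = (SOME X. mholo m (ball 0 1) X \<and> (\<forall>z\<in>Hf. X z = pg m J (f z)) \<and> (\<forall>z\<in>ball 0 1. \<forall>p. nrm (op (X z) p) \<le> nrm p))"

lemma X_mholo: "mholo m (ball 0 1) X" and X_eq: "z \<in> Hf \<Longrightarrow> X z = pg m J (f z)"
  and X_contr: "z \<in> ball 0 1 \<Longrightarrow> nrm (op (X z) p) \<le> nrm p"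
  using someI_ex[OF pg_extension, folded X_def] by auto

text \<open>Numerator and denominator of the inverse transform, so that f = c d^(-1). Unlike f they
  are holomorphic in the whole disc, which makes all further functions holomorphic there.\<close>

definition "d z = pg_den m J (X z)"
definition "c z = pg_num m J (X z)"

lemma dc_mholo: "mholo m (ball 0 1) d" "mholo m (ball 0 1) c"
  unfolding d_def c_def by (rule mholo_pg[OF sig X_mholo])+

lemma f_d:
  assumes z: "z \<in> Hf"
  shows "f z * d z = c z" "Determinant.det (d z) \<noteq> 0" "X z * pg_den m J (f z) = pg_num m J (f z)"
proof -
  note F = f_carrier[OF z]
  note pf = pg_facts[OF sig F f_contr[OF z], folded X_eq[OF z], folded d_def c_def]
  have zB: "z \<in> ball 0 1" using z Hf_sub by blast
  note dz = mholoD(1)[OF dc_mholo(1) zB] and cz = mholoD(1)[OF dc_mholo(2) zB]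
  have D: "pg_den m J (f z) \<in> carrier_mat m m" by (rule pg_carrier(1)[OF sig F])
  have "pg_den m J (f z) * d z = 1\<^sub>m m" by (rule one_mult_commute[OF dz D pf(3)])
  then show "f z * d z = c z" using assoc_mult_mat[OF cz D dz] cz by (simp add: pf(4))
  have "Determinant.det (d z) * Determinant.det (pg_den m J (f z)) = 1"
    using det_mult[OF dz D] pf(3) by simp
  then show "Determinant.det (d z) \<noteq> 0" by auto
  show "X z * pg_den m J (f z) = pg_num m J (f z)" by (rule pf(2))
qed

text \<open>Comparison of coefficients in X (P + Q f) xp = (Q + P f) xp, where xp is the polynomial
  with coefficients x and P, Q are the spectral projections of J. Up to degree n the coefficients of
  f are the A_j, so both sides are expressed by the data.\<close>

lemma X_taylor:
  assumes i: "i \<le> n"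
  defines "\<xi> \<equiv> \<lambda>x i. op (J_plus m J) (x i) + op (J_minus m J) (cv Ao x i)"
  shows "cv (\<lambda>i. op (mtc m X i)) (\<xi> x) i = op (J_minus m J) (x i) + op (J_plus m J) (cv Ao x i)"
proof -
  define xp where "xp z = (\<Sum>l\<le>n. Polynomial.smult (z ^ l) (x l))" for z
  define \<phi> where "\<phi> z = op (f z) (xp z)" for z
  have vx: "vana xp" unfolding xp_def by (rule vana_poly)
  have vphi: "vana \<phi>" unfolding \<phi>_def by (rule vana_op[OF f_mana vx])
  have tx: "vtc m xp k = op (1\<^sub>m m) (x k)" if "k \<le> n" for k
    unfolding xp_def by (rule vtc_poly[OF that])
  have tphi: "vtc m \<phi> k = cv Ao x k" if k: "k \<le> n" for k
    unfolding \<phi>_def vtc_op[OF f_mana vx] cv_def Ao_def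
    using k Ac by (intro sum.cong refl) (auto simp: f_mtc tx op_op_one[of _ m m])
  note PQ = J_plus_carrier[OF sig] J_minus_carrier[OF sig]
  define \<psi> where "\<psi> z = op (J_plus m J) (xp z) + op (J_minus m J) (\<phi> z)" for z
  have vps: "vana (\<lambda>z. op (J_plus m J) (xp z))" "vana (\<lambda>z. op (J_minus m J) (\<phi> z))"
    "vana (\<lambda>z. op (J_minus m J) (xp z))" "vana (\<lambda>z. op (J_plus m J) (\<phi> z))"
    by (intro vana_const_op[OF PQ(1)] vana_const_op[OF PQ(2)] vx vphi)+
  have vpsi: "vana \<psi>" using vps unfolding \<psi>_def vana_def coeff_add by (auto intro!: analytic_intros)
  have tpsi: "vtc m \<psi> k = \<xi> x k" if "k \<le> n" for k
    unfolding \<psi>_def vtc_add[OF vps(1,2)] vtc_const_op[OF PQ(1) vx] vtc_const_op[OF PQ(2) vphi]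
    using PQ by (simp add: \<xi>_def tx tphi that op_op_one)
  have Xm: "mana m X" by (rule mana_mholo[OF X_mholo]) auto
  have main: "op (X z) (\<psi> z) = op (J_minus m J) (xp z) + op (J_plus m J) (\<phi> z)" if z: "z \<in> Hf" for z
  proof -
    note F = f_carrier[OF z]
    have Xz: "X z \<in> carrier_mat m m" using mholoD(1)[OF X_mholo] z Hf_sub by blast
    have "\<psi> z = op (pg_den m J (f z)) (xp z)"
      unfolding \<psi>_def \<phi>_def op_pg[OF sig F] by (simp add: add.commute)
    then have "op (X z) (\<psi> z) = op (pg_num m J (f z)) (xp z)"
      using op_mult[OF Xz pg_carrier(1)[OF sig F], of "xp z"] f_d(3)[OF z] by simp
    then show ?thesis unfolding op_pg[OF sig F] \<phi>_def by (simp add: add.commute)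
  qed
  have "cv (\<lambda>i. op (mtc m X i)) (\<xi> x) i = cv (\<lambda>i. op (mtc m X i)) (vtc m \<psi>) i"
    unfolding cv_def using i tpsi by (intro sum.cong refl) simp
  also have "\<dots> = vtc m (\<lambda>z. op (X z) (\<psi> z)) i" by (rule vtc_op[OF Xm vpsi, symmetric])
  also have "\<dots> = vtc m (\<lambda>z. op (J_minus m J) (xp z) + op (J_plus m J) (\<phi> z)) i"
    by (rule vtc_cong) (rule eventually_mono[OF eventually_nhds_in_open[OF Hf_open f_0] main])
  also have "\<dots> = op (J_minus m J) (x i) + op (J_plus m J) (cv Ao x i)"
    unfolding vtc_add[OF vps(3,4)] vtc_const_op[OF PQ(2) vx] vtc_const_op[OF PQ(1) vphi]
    using PQ i by (simp add: tx tphi op_op_one)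
  finally show ?thesis .
qed

text \<open>The contractive inequality for X is read back through the transform: P h + Q g = h' and
  P g + Q h = X(w) h', and the blocks with x recombine in the same way. Then each difference of
  squared norms is replaced by a J-form.\<close>

lemma fmi_f:
  assumes w: "cmod w < 1" and h': "trunc m h'"
  defines "h \<equiv> op (d w) h'" and "g \<equiv> op (c w) h'"
  shows "0 \<le> Re (\<Sum>i\<le>n. pip (Jo (x i + Polynomial.smult (w ^ (n - i)) h)) (x i + Polynomial.smult (w ^ (n - i)) h)
        - pip (Jo (cv Ao x i + Polynomial.smult (w ^ (n - i)) g)) (cv Ao x i + Polynomial.smult (w ^ (n - i)) g))
      + (cmod w)\<^sup>2 ^ Suc n / (1 - (cmod w)\<^sup>2) * Re (pip (Jo h) h - pip (Jo g) g)"
proof -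
  let ?P = "op (J_plus m J)" and ?Q = "op (J_minus m J)"
  define \<kappa> where "\<kappa> = (cmod w)\<^sup>2 ^ Suc n / (1 - (cmod w)\<^sup>2)"
  have wB: "w \<in> ball 0 1" using w by simp
  note Xw = mholoD(1)[OF X_mholo wB]
  have t: "trunc m h" "trunc m g"
    unfolding h_def g_def by (rule trunc_op[OF mholoD(1)[OF dc_mholo(1) wB]] trunc_op[OF mholoD(1)[OF dc_mholo(2) wB]])+
  have h: "h = ?Q (op (X w) h') + ?P h'" and g: "g = ?P (op (X w) h') + ?Q h'"
    unfolding h_def g_def d_def c_def op_pg[OF sig Xw] by simp_all
  note pm = J_pm_mult[OF sig]
  note lin = cip.lin_add[OF lin_op] cip.lin_scale[OF lin_op]
  have 1: "?P h + ?Q g = h'" "?P g + ?Q h = op (X w) h'"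
  proof -
    have "?P h + ?Q g = ?P h' + ?Q h'" "?P g + ?Q h = ?P (op (X w) h') + ?Q (op (X w) h')"
      by (simp_all add: h g lin pm)
    then show "?P h + ?Q g = h'" "?P g + ?Q h = op (X w) h'"
      by (simp_all add: J_pm_sum(1)[OF sig] trunc_op_one[OF h'] op_one_op[OF Xw])
  qed
  define u where "u i = x i + Polynomial.smult (w ^ (n - i)) h" for i
  define v where "v i = cv Ao x i + Polynomial.smult (w ^ (n - i)) g" for i
  define \<xi> where "\<xi> i = ?P (x i) + ?Q (cv Ao x i)" for i
  have xi: "\<xi> i + Polynomial.smult (w ^ (n - i)) h' = ?P (u i) + ?Q (v i)" for i
    unfolding \<xi>_def u_def v_def 1(1)[symmetric] lin smult_add_right by (simp add: algebra_simps)
  have Xxi: "cv (\<lambda>i. op (mtc m X i)) \<xi> i + Polynomial.smult (w ^ (n - i)) (op (X w) h') = ?P (v i) + ?Q (u i)" if "i \<le> n" for i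
    unfolding \<xi>_def X_taylor[OF that] u_def v_def 1(2)[symmetric] lin smult_add_right by (simp add: algebra_simps)
  \<comment> \<open>An inequality only, because u may have coefficients from m on: they count in the
    form of \<open>Jo\<close> and are invisible to the projections.\<close>
  have gap: "nrm (?P u + ?Q v) - nrm (?P v + ?Q u) \<le> Re (pip (Jo u) u - pip (Jo v) v)" if "trunc m v" for u v
    using J_pot_form[of u] that by (simp add: J_gap[OF sig] op_J)
  have tv: "trunc m (v i)" if "i \<le> n" for i
    unfolding v_def by (intro trunc_closed(1,3) trunc_cv that t)
  have "(\<Sum>i\<le>n. nrm (cv (\<lambda>i. op (mtc m X i)) \<xi> i + Polynomial.smult (w ^ (n - i)) (op (X w) h'))) + \<kappa> * nrm (op (X w) h')
    \<le> (\<Sum>i\<le>n. nrm (\<xi> i + Polynomial.smult (w ^ (n - i)) h')) + \<kappa> * nrm h'"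
    unfolding \<kappa>_def by (rule schur_extension[OF X_mholo X_contr w])
  then have "0 \<le> (\<Sum>i\<le>n. nrm (?P (u i) + ?Q (v i)) - nrm (?P (v i) + ?Q (u i))) + \<kappa> * (nrm (?P h + ?Q g) - nrm (?P g + ?Q h))"
    unfolding 1 by (simp add: xi Xxi sum_subtractf algebra_simps)
  also have "\<dots> \<le> (\<Sum>i\<le>n. Re (pip (Jo (u i)) (u i) - pip (Jo (v i)) (v i))) + \<kappa> * Re (pip (Jo h) h - pip (Jo g) g)"
    by (intro add_mono sum_mono mult_left_mono gap tv t)
      (use w in \<open>auto simp: \<kappa>_def abs_square_le_1 intro!: divide_nonneg_nonneg mult_nonneg_nonneg\<close>)
  finally show ?thesis by (simp add: u_def v_def \<kappa>_def)
qed

section \<open>The Schur parameter of an interpolant\<close>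

definition "\<alpha> w = mat_tilde m n (rho_poly m J A n) w * J * d w - mat_tilde m n (pi_poly m J A n) w * J * c w"
text \<open>In terms of \<alpha> and \<beta> the equation D2 c = N2 d for an unknown parameter S
  reads w sL S pR \<alpha> = \<beta>. Finding S thus means dividing \<beta> by \<alpha>.\<close>

definition "\<beta> w = tau_poly m J A n w * c w - sigma_poly m J A n w * d w"

lemma alpha_beta_mholo: "mholo m (ball 0 1) \<alpha>" "mholo m (ball 0 1) \<beta>"
  unfolding \<alpha>_def \<beta>_def
  by (intro mholo_minus mholo_mult mholo_tilde mholo_poly mholo_const Jc(1) dc_mholo)+

lemma op_alpha_beta:
  assumes w: "w \<in> ball 0 1"
  shows "op (\<alpha> w) v = pot.rhot w (Jo (op (d w) v)) - pot.pit w (Jo (op (c w) v))"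
    "op (\<beta> w) v = pot.tau w (op (c w) v) - pot.sigma w (op (d w) v)"
proof -
  note cc = mholoD(1)[OF dc_mholo(1) w] mholoD(1)[OF dc_mholo(2) w] Jc(1) poly_carriers(3,4)
  have t: "trunc m (op (d w) v)" "trunc m (op (c w) v)" by (rule trunc_op[OF cc(1)] trunc_op[OF cc(2)])+
  have "op (\<alpha> w) v = op (mat_tilde m n (rho_poly m J A n) w * J * d w) v - op (mat_tilde m n (pi_poly m J A n) w * J * c w) v"
    unfolding \<alpha>_def by (rule op_minus[of _ m m]) (use cc in auto)
  then show "op (\<alpha> w) v = pot.rhot w (Jo (op (d w) v)) - pot.pit w (Jo (op (c w) v))"
    using cc by (simp add: op_mult[of _ m m _ m] op_J t op_polys Jo_trunc)
  have "op (\<beta> w) v = op (tau_poly m J A n w * c w) v - op (sigma_poly m J A n w * d w) v"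
    unfolding \<beta>_def by (rule op_minus[of _ m m]) (use cc in auto)
  then show "op (\<beta> w) v = pot.tau w (op (c w) v) - pot.sigma w (op (d w) v)"
    using cc by (simp add: op_mult[of _ m m _ m] t op_polys)
qed

text \<open>The fundamental inequality yields \<alpha> v = R a and \<beta> v = L b. So the values
  lie in the ranges of R and L, where root and pseudoinverse cancel, and the inequality for a and b
  becomes one for pR \<alpha> v and pL \<beta> v.\<close>

lemma alpha_beta:
  assumes w: "w \<in> ball 0 1"
  shows "op sR (op pR (op (\<alpha> w) v)) = op (\<alpha> w) v" "op sL (op pL (op (\<beta> w) v)) = op (\<beta> w) v"
    "nrm (op pL (op (\<beta> w) v)) \<le> (cmod w)\<^sup>2 * nrm (op pR (op (\<alpha> w) v))"
proof -
  have w1: "cmod w < 1" using w by simp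
  define h' where "h' = op (1\<^sub>m m) v"
  have th: "trunc m h'" unfolding h'_def by (rule trunc_op[of _ m m]) simp
  note dw = mholoD(1)[OF dc_mholo(1) w] and cw = mholoD(1)[OF dc_mholo(2) w]
  have e: "op (d w) h' = op (d w) v" "op (c w) h' = op (c w) v"
    unfolding h'_def by (rule op_op_one[OF dw] op_op_one[OF cw])+
  obtain a b where ab: "op (\<alpha> w) v = op R a" "op (\<beta> w) v = op L b" "nrm (op sL b) \<le> (cmod w)\<^sup>2 * nrm (op sR a)"
    using fundamental_inequality[OF w1 trunc_op[OF dw] trunc_op[OF cw] fmi_f[OF w1 th]]
    unfolding e op_alpha_beta[OF w, symmetric] by blast
  have 1: "op pR (op R a) = op sR a" "op pL (op L b) = op sL b"
    unfolding sqrtR(3)[symmetric] sqrtL(3)[symmetric]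
    by (simp only: sqrtR(8)[of "op sR a", symmetric] sqrtR(6)) (simp only: sqrtL(8)[of "op sL b", symmetric] sqrtL(6))
  show "op sR (op pR (op (\<alpha> w) v)) = op (\<alpha> w) v" "op sL (op pL (op (\<beta> w) v)) = op (\<beta> w) v"
    unfolding ab 1 by (rule sqrtR(3) sqrtL(3))+
  show "nrm (op pL (op (\<beta> w) v)) \<le> (cmod w)\<^sup>2 * nrm (op pR (op (\<alpha> w) v))"
    unfolding ab(1,2) 1 by (rule ab(3))
qed

text \<open>Near 0 put d v = rho u and c v = pi u + E u with E = f rho - pi. The pair (rho u, pi u)
  contributes w^n R u by the first relation with s = 0, and E vanishes to order n+1, because up to
  degree n the coefficients of pi are the convolution of the A_j with those of rho. The value R d(0)
  left after division by w^n is what starts the construction of S.\<close>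

lemma alpha_factor:
  "\<exists>\<alpha>'. mholo m (ball 0 1) \<alpha>' \<and> (\<forall>w\<in>ball 0 1. \<alpha> w = w ^ n \<cdot>\<^sub>m \<alpha>' w) \<and> \<alpha>' 0 = R * d 0"
proof -
  \<comment> \<open>A neighbourhood of 0 that avoids the poles of f and the zeros of det rho. Only
    Taylor coefficients at 0 are extracted from it; the factorisation itself then holds on the whole
    disc.\<close>
  define U where "U = Hf \<inter> (ball 0 1 - {w. Determinant.det (rho_poly m J A n w) = 0})"
  have sp: "sparse_in_set (ball 0 1) {w. Determinant.det (rho_poly m J A n w) = 0}"
    by (rule sparse_in_set_zeros[OF mholo_det[OF mholo_poly(1)], of _ 0]) (auto simp: rho_poly_0)
  have oU: "open U" unfolding U_def by (intro open_Int Hf_open sparse_open_complement sp)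
  have 0: "0 \<in> U" using f_0 by (auto simp: U_def rho_poly_0)
  have subU: "U \<subseteq> Hf" "U \<subseteq> ball 0 1" by (auto simp: U_def)
  have rU: "Determinant.det (rho_poly m J A n w) \<noteq> 0" if "w \<in> U" for w using that by (auto simp: U_def)
  define M where "M w = minv (rho_poly m J A n w) * d w" for w
  define E where "E w = f w * rho_poly m J A n w - pi_poly m J A n w" for w
  define G where "G w = mat_tilde m n (pi_poly m J A n) w * J" for w
  have Mh: "mholo m U M" unfolding M_def
    by (intro mholo_mult mholo_minv mholo_poly mholo_subset[OF dc_mholo(1)] subU rU)
  have Eh: "mholo m U E" unfolding E_def
    by (intro mholo_mult mholo_minus mholo_poly mholo_subset[OF f_mholo] subU)
  have Gh: "mholo m U G" unfolding G_def by (intro mholo_mult mholo_tilde mholo_const Jc(1))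
  have RMh: "mholo m U (\<lambda>w. R * M w)" by (intro mholo_mult mholo_const Mh R_carrier)
  have an: "mana m M" "mana m E" "mana m G" "mana m (\<lambda>w. R * M w)" "mana m \<alpha>"
    by (rule mana_mholo[OF Mh oU 0] mana_mholo[OF Eh oU 0] mana_mholo[OF Gh oU 0] mana_mholo[OF RMh oU 0])+
      (rule mana_mholo[OF alpha_beta_mholo(1)]; simp)
  have rp: "mana m (rho_poly m J A n)" "mana m (pi_poly m J A n)"
    by (rule mana_mholo[OF mholo_poly(1) open_UNIV UNIV_I] mana_mholo[OF mholo_poly(2) open_UNIV UNIV_I])+
  have E0: "mtc m E k = 0\<^sub>m m m" if k: "k \<le> n" for k
  proof (rule op_eqI[of _ m])
    fix v assume v: "trunc m v"
    have "op (mtc m E k) v = vtc m (\<lambda>w. op (E w) v) k" by (rule vtc_op_const[OF an(2), symmetric])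
    also have "\<dots> = vtc m (\<lambda>w. op (f w) (op (rho_poly m J A n w) v) - op (pi_poly m J A n w) v) k"
    proof (rule vtc_cong, rule eventually_mono[OF eventually_nhds_in_open[OF oU 0]])
      fix w assume "w \<in> U"
      then have F: "f w \<in> carrier_mat m m" using f_carrier subU by blast
      show "op (E w) v = op (f w) (op (rho_poly m J A n w) v) - op (pi_poly m J A n w) v"
        unfolding E_def by (subst op_minus[of _ m m]) (use F poly_carriers in \<open>auto simp: op_mult[of _ m m _ m]\<close>)
    qed
    also have "\<dots> = 0"
    proof -
      have a: "vana (\<lambda>w. op (f w) (op (rho_poly m J A n w) v))" "vana (\<lambda>w. op (pi_poly m J A n w) v)"
        by (rule vana_op[OF f_mana vana_op[OF rp(1) vana_const]] vana_op[OF rp(2) vana_const])+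
      have "vtc m (\<lambda>w. op (f w) (op (rho_poly m J A n w) v) - op (pi_poly m J A n w) v) k =
          vtc m (\<lambda>w. op (f w) (op (rho_poly m J A n w) v)) k - vtc m (\<lambda>w. op (pi_poly m J A n w) v) k"
        using vtc_add[OF _ a(2), of "\<lambda>w. op (f w) (op (rho_poly m J A n w) v) - op (pi_poly m J A n w) v" m k] a
        by (simp add: vana_def analytic_on_diff)
      moreover have "vtc m (\<lambda>w. op (f w) (op (rho_poly m J A n w) v)) k = cv Ao (\<lambda>j. Vo j v) k"
        unfolding vtc_op[OF f_mana vana_op[OF rp(1) vana_const]] cv_def vtc_op_const[OF rp(1)] Ao_def
        using k by (intro sum.cong refl) (auto simp: f_mtc mtc_polys op_Vc v)
      moreover have "vtc m (\<lambda>w. op (pi_poly m J A n w) v) k = op (1\<^sub>m m) (op (Pc k) v)"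
        unfolding op_poly by (rule vtc_poly[OF k])
      ultimately show ?thesis using op_Pc[OF k, of v] op_one_op[of "Pc k" m m v] by simp
    qed
    also have "0 = op (0\<^sub>m m m) v" by (simp add: poly_eq_iff coeff_op)
    finally show "op (mtc m E k) v = op (0\<^sub>m m m) v" .
  qed auto
  have main: "op (\<alpha> w) v = Polynomial.smult (w ^ n) (op (R * M w) v) - op (G w) (op (E w) (op (M w) v))"
    if w: "w \<in> U" for w v
  proof -
    have wB: "w \<in> ball 0 1" "w \<in> Hf" using w subU by auto
    note dw = mholoD(1)[OF dc_mholo(1) wB(1)] and F = f_carrier[OF wB(2)]
    note r = poly_carriers(1)[of w]
    note mi = minv_det[OF r rU[OF w]]
    note Mw = mholoD(1)[OF Mh w] and Ew = mholoD(1)[OF Eh w]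
    define u where "u = op (M w) v"
    have u: "trunc m u" unfolding u_def by (rule trunc_op[OF Mw])
    have ru: "op (rho_poly m J A n w) u = op (d w) v"
      unfolding u_def M_def op_mult[OF mi(2) dw] op_mult[OF r mi(2), symmetric] mi(3) by (rule op_one_op[OF dw])
    have cu: "op (c w) v = op (f w) (op (rho_poly m J A n w) u)"
      unfolding ru f_d(1)[OF wB(2), symmetric] by (rule op_mult[OF F dw])
    have Eu: "op (E w) u = op (c w) v - op (pi_poly m J A n w) u"
      unfolding E_def cu by (subst op_minus[of _ m m]) (use F r poly_carriers in \<open>auto simp: op_mult[of _ m m _ m]\<close>)
    have z: "pot.sigmat w 0 = 0" "pot.taut w 0 = 0"
      by (simp_all add: pot.sigmat_def pot.taut_def cv_def Tos_def Aos_def cip.lin_zero[OF lin_op])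
    have J0: "Jo 0 = 0" by (rule toep.linJ(3))
    have t: "trunc m (op (E w) u)" "trunc m (op (c w) v)" by (rule trunc_op[OF Ew] trunc_op[OF mholoD(1)[OF dc_mholo(2) wB(1)]])+
    have "pot.rhot w (Jo (pot.rho w u)) - pot.pit w (Jo (pot.ppi w u)) = Polynomial.smult (w ^ n) (op R u)"
      using pot.lft_relations(1)[of w 0 u] by (simp add: z J0 opE_trunc[OF u])
    moreover have "pot.rho w u = op (d w) v" "pot.ppi w u = op (c w) v - op (E w) u"
      using op_polys(1,2)[OF u, of w] ru by (simp_all add: Eu)
    moreover have "pot.pit w (Jo (op (c w) v - op (E w) u)) = pot.pit w (Jo (op (c w) v)) - pot.pit w (Jo (op (E w) u))"
      unfolding toep.linJ
      by (simp only: op_polys(6)[symmetric] trunc_closed(2) Jo_trunc t cip.lin_diff[OF lin_op])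
    moreover have "pot.pit w (Jo (op (E w) u)) = op (G w) (op (E w) u)"
      unfolding G_def by (simp add: op_mult[OF tilde_carrier Jc(1)] op_J t op_polys Jo_trunc)
    ultimately show ?thesis
      unfolding op_alpha_beta(1)[OF wB(1)] op_mult[OF R_carrier Mw] u_def[symmetric] by (simp add: algebra_simps)
  qed
  have al: "op (mtc m \<alpha> k) v = (if k < n then 0 else op (R * d 0) v)" if k: "k \<le> n" for k v
  proof -
    have v1: "vana (\<lambda>w. op (R * M w) v)" "vana (\<lambda>w. op (M w) v)" by (rule vana_op[OF an(4) vana_const] vana_op[OF an(1) vana_const])+
    have v2: "vana (\<lambda>w. op (E w) (op (M w) v))" by (rule vana_op[OF an(2) v1(2)])
    have v3: "vana (\<lambda>w. op (G w) (op (E w) (op (M w) v)))" by (rule vana_op[OF an(3) v2])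
    have v4: "vana (\<lambda>w. Polynomial.smult (w ^ n) (op (R * M w) v))"
      using v1(1) unfolding vana_def coeff_smult by (auto intro!: analytic_intros)
    have v5: "vana (\<lambda>w. op (\<alpha> w) v)" by (rule vana_op[OF an(5) vana_const])
    have EM: "vtc m (\<lambda>w. op (E w) (op (M w) v)) j = 0" if "j \<le> n" for j
    proof -
      have "op (0\<^sub>m m m) y = 0" for y by (simp add: poly_eq_iff coeff_op)
      then show ?thesis
        unfolding vtc_op[OF an(2) v1(2)] cv_def using that by (intro sum.neutral) (auto simp: E0)
    qed
    have "vtc m (\<lambda>w. op (G w) (op (E w) (op (M w) v))) k = 0"
      unfolding vtc_op[OF an(3) v2] cv_def using k by (intro sum.neutral) (auto simp: EM cip.lin_zero[OF lin_op])
    moreover have "vtc m (\<lambda>w. op (\<alpha> w) v + op (G w) (op (E w) (op (M w) v))) k = vtc m (\<lambda>w. Polynomial.smult (w ^ n) (op (R * M w) v)) k"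
      by (rule vtc_cong, rule eventually_mono[OF eventually_nhds_in_open[OF oU 0]]) (simp add: main)
    ultimately have "vtc m (\<lambda>w. op (\<alpha> w) v) k = (if k < n then 0 else vtc m (\<lambda>w. op (R * M w) v) (k - n))"
      by (simp add: vtc_add[OF v5 v3] vtc_monom[OF v1(1)])
    moreover have "vtc m (\<lambda>w. op (R * M w) v) 0 = op (R * M 0) v"
      by (rule vtc_0) (rule trunc_op[OF mholoD(1)[OF RMh 0]])
    moreover have "M 0 = d 0"
    proof -
      have d0: "d 0 \<in> carrier_mat m m" by (rule mholoD(1)[OF dc_mholo(1)]) simp
      have "minv (1\<^sub>m m) = (1\<^sub>m m :: complex mat)"
        using minv_det(2,4)[of "1\<^sub>m m :: complex mat" m] by simp
      then show ?thesis using d0 by (simp add: M_def rho_poly_0)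
    qed
    ultimately show ?thesis using k unfolding vtc_op_const[OF an(5), symmetric] by auto
  qed
  have d0: "d 0 \<in> carrier_mat m m" by (rule mholoD(1)[OF dc_mholo(1)]) simp
  have Rd: "mtc m \<alpha> n = R * d 0"
    by (rule op_eqI[of _ m]) (use al R_carrier d0 in auto)
  have z: "mtc m \<alpha> k = 0\<^sub>m m m" if "k < n" for k
    by (rule op_eqI[of _ m]) (use al that in \<open>auto simp: poly_eq_iff coeff_op\<close>)
  show ?thesis
    using mat_factor_power[where N=n, OF alpha_beta_mholo(1) open_ball _ z] unfolding Rd by simp
qed

text \<open>After division by powers of w and normalisation by d(0)^(-1), S has to map a to b. At 0
  the function a pR is the projection sR pR onto the range of R, and on the complement nothing is
  prescribed. Adding the complementary projection gives M with M(0) = I, so b pR M^(-1) is defined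
  off the zeros of det M, is 0 on what is added, and is contractive.\<close>

lemma schur_parameter:
  "\<exists>S Z'. mholo m (ball 0 1) S \<and> (\<forall>z\<in>ball 0 1. \<forall>p. nrm (op (S z) p) \<le> nrm p) \<and> sparse_in_set (ball 0 1) Z' \<and>
    (\<forall>w\<in>ball 0 1 - Z'. \<forall>v. Polynomial.smult w (op sL (op (S w) (op pR (op (\<alpha> w) v)))) = op (\<beta> w) v)"
proof -
  obtain \<alpha>' where \<alpha>': "mholo m (ball 0 1) \<alpha>'" "\<And>w. w \<in> ball 0 1 \<Longrightarrow> \<alpha> w = w ^ n \<cdot>\<^sub>m \<alpha>' w" "\<alpha>' 0 = R * d 0"
    using alpha_factor by blast
  have B0: "(0::complex) \<in> ball 0 1" by simp
  note d0 = mholoD(1)[OF dc_mholo(1) B0]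
  note mi = minv_det[OF d0 f_d(2)[OF f_0]]
  define dI where "dI = minv (d 0)"
  have dI: "dI \<in> carrier_mat m m" "d 0 * dI = 1\<^sub>m m" "dI * d 0 = 1\<^sub>m m" using mi by (auto simp: dI_def)
  note sc = sqrtR(1,2) sqrtL(1,2)
  define a where "a w = pR * \<alpha>' w * dI" for w
  define b where "b w = (1 / w ^ Suc n) \<cdot>\<^sub>m (pL * \<beta> w * dI)" for w
  define M where "M w = a w * pR + (1\<^sub>m m - sR * pR)" for w
  have ah: "mholo m (ball 0 1) a" unfolding a_def by (intro mholo_mult mholo_const sc \<alpha>' dI)
  have bh: "mholo m (ball 0 1 - {0}) b"
    unfolding b_def
    by (intro mholo_mult mholo_smult mholo_const sc dI mholo_subset[OF alpha_beta_mholo(2)] holomorphic_intros) auto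
  have Pi: "1\<^sub>m m - sR * pR \<in> carrier_mat m m" using sc by (intro minus_carrier_mat) auto
  have Mh: "mholo m (ball 0 1) M" unfolding M_def by (intro mholo_add mholo_mult mholo_const ah sc Pi)
  have opPi: "op (1\<^sub>m m - sR * pR) v = op (1\<^sub>m m) v - op sR (op pR v)" for v
    using sc by (subst op_minus[of _ m m]) (auto simp: op_mult[of _ m m _ m])
  have opM: "op (M w) v = op (a w) (op pR v) + (op (1\<^sub>m m) v - op sR (op pR v))" if w: "w \<in> ball 0 1" for w v
    unfolding M_def using mholoD(1)[OF ah w] sc Pi by (subst op_add[of _ m m]) (auto simp: op_mult[of _ m m _ m] opPi)
  have opa: "op (a w) v = op pR (op (\<alpha>' w) (op dI v))" if w: "w \<in> ball 0 1" for w v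
    unfolding a_def using mholoD(1)[OF \<alpha>'(1) w] sc dI by (simp add: op_mult[of _ m m _ m])
  have aPi: "op sR (op pR (op (a w) v)) = op (a w) v" if w: "w \<in> ball 0 1" for w v
    unfolding opa[OF w] by (simp only: sqrtR(8)[of "op pR _"] sqrtR(7))
  have wa: "Polynomial.smult (w ^ n) (op (a w) v) = op pR (op (\<alpha> w) (op dI v))" if w: "w \<in> ball 0 1" for w v
    unfolding opa[OF w] \<alpha>'(2)[OF w] op_smult cip.lin_scale[OF lin_op] ..
  have wb: "Polynomial.smult (w ^ Suc n) (op (b w) v) = op pL (op (\<beta> w) (op dI v))" if w: "w \<in> ball 0 1" "w \<noteq> 0" for w v
    unfolding b_def op_smult using mholoD(1)[OF alpha_beta_mholo(2) w(1)] sc dI w(2) by (simp add: op_mult[of _ m m _ m])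
  have ns: "nrm (Polynomial.smult x v) = (cmod x)\<^sup>2 * nrm v" for x v
  proof -
    have "pip (Polynomial.smult x v) (Polynomial.smult x v) = (x * cnj x) * pip v v"
      by (simp add: cip.ip_scale_left cip.ip_scale_right mult_ac)
    also have "x * cnj x = of_real ((cmod x)\<^sup>2)" by (simp add: complex_norm_square[symmetric] del: of_real_power)
    finally have "pip (Polynomial.smult x v) (Polynomial.smult x v) = of_real ((cmod x)\<^sup>2) * pip v v" .
    moreover have "Re (of_real r * z) = r * Re z" for r z by simp
    ultimately show ?thesis by presburger
  qed
  have ba: "nrm (op (b w) v) \<le> nrm (op (a w) v)" if w: "w \<in> ball 0 1" "w \<noteq> 0" for w v
  proof -
    have "(cmod (w ^ Suc n))\<^sup>2 * nrm (op (b w) v) = nrm (op pL (op (\<beta> w) (op dI v)))"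
      unfolding ns[symmetric] wb[OF w] ..
    also have "\<dots> \<le> (cmod w)\<^sup>2 * nrm (op pR (op (\<alpha> w) (op dI v)))" by (rule alpha_beta(3)[OF w(1)])
    also have "\<dots> = (cmod (w ^ Suc n))\<^sup>2 * nrm (op (a w) v)"
      unfolding wa[OF w(1), symmetric] ns by (simp add: norm_mult norm_power power_mult_distrib)
    finally show ?thesis using w(2) by simp
  qed
  have pRs: "pip (op pR u) v = pip u (op pR v)" "pip (op sR u) v = pip u (op sR v)" for u v by (rule sqrtR)+
  have prp: "op pR (op sR (op pR v)) = op pR v" for v by (rule sqrtR(7))
  \<comment> \<open>The second summand is annihilated by pR, hence orthogonal to its range, which
    contains the values of a. So |a pR v| <= |M v|, and dividing by M does not spoil
    contractivity.\<close>
  have orth: "nrm (op pR y) \<le> nrm (op pR y + (op (1\<^sub>m m) v - op sR (op pR v)))" for y v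
  proof -
    let ?q = "op (1\<^sub>m m) v - op sR (op pR v)"
    have q0: "op pR ?q = 0" by (simp add: cip.lin_diff[OF lin_op] op_op_one[OF sc(2)] prp)
    have "pip (op pR y) ?q = 0" unfolding pRs q0 by simp
    moreover have "pip ?q (op pR y) = 0" unfolding pRs(1)[symmetric] q0 by simp
    ultimately have "nrm (op pR y + ?q) = nrm (op pR y) + nrm ?q"
      by (simp only: cip.ip_add_left cip.ip_add_right plus_complex.sel) simp
    then show ?thesis using nrm_nonneg[of ?q] by simp
  qed
  \<comment> \<open>The factor d(0)^(-1) cancels d(0), so a(0) pR = pR R pR = sR pR, and the
    complementary projection completes it to the identity.\<close>
  have M0: "M 0 = 1\<^sub>m m"
  proof (rule op_eqI[of _ m])
    show "M 0 \<in> carrier_mat m m" by (rule mholoD(1)[OF Mh B0])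
    fix v
    have "op (a 0) (op pR v) = op pR (op R (op (d 0) (op dI (op pR v))))"
      unfolding opa[OF B0] \<alpha>'(3) op_mult[OF R_carrier d0] ..
    also have "\<dots> = op pR (op R (op pR v))"
      unfolding op_mult[OF d0 dI(1), symmetric] dI(2) by (simp only: op_one_op[OF sc(2)])
    also have "\<dots> = op sR (op pR v)"
      unfolding sqrtR(3)[symmetric] by (simp only: sqrtR(8)[of "op sR (op pR v)", symmetric] prp)
    finally show "op (M 0) v = op (1\<^sub>m m) v" unfolding opM[OF B0] by simp
  qed simp
  define Z1 where "Z1 = {w. Determinant.det (M w) = 0}"
  have Z1: "sparse_in_set (ball 0 1) Z1"
    unfolding Z1_def by (rule sparse_in_set_zeros[OF mholo_det[OF Mh], of 0]) (auto simp: M0)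
  define Z' where "Z' = Z1 \<union> {0}"
  have Z': "sparse_in_set (ball 0 1) Z'"
    unfolding Z'_def by (intro sparse_in_set_Un Z1 sparse_in_set_singleton) simp
  define S0 where "S0 w = b w * pR * minv (M w)" for w
  have detM: "Determinant.det (M w) \<noteq> 0" "w \<in> ball 0 1" "w \<noteq> 0" if "w \<in> ball 0 1 - Z'" for w
    using that by (auto simp: Z'_def Z1_def)
  have S0h: "mholo m (ball 0 1 - Z') S0"
    unfolding S0_def
    by (intro mholo_mult mholo_minv mholo_const sc mholo_subset[OF bh] mholo_subset[OF Mh] detM) (auto simp: Z'_def)
  have inv: "op (S0 w) p = op (b w) (op pR (op (minv (M w)) p))" "op (M w) (op (minv (M w)) p) = op (1\<^sub>m m) p"
    if w: "w \<in> ball 0 1 - Z'" for w p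
  proof -
    note wf = detM[OF w]
    note Mw = mholoD(1)[OF Mh wf(2)]
    note mi = minv_det[OF Mw wf(1)]
    have bw: "b w \<in> carrier_mat m m" by (rule mholoD(1)[OF bh]) (use wf in simp)
    show "op (S0 w) p = op (b w) (op pR (op (minv (M w)) p))"
      unfolding S0_def using bw sc mi by (simp add: op_mult[of _ m m _ m])
    show "op (M w) (op (minv (M w)) p) = op (1\<^sub>m m) p"
      unfolding op_mult[OF Mw mi(2), symmetric] mi(3) ..
  qed
  have S0c: "nrm (op (S0 w) p) \<le> nrm p" if w: "w \<in> ball 0 1 - Z'" for w p
  proof -
    note wf = detM[OF w]
    let ?v = "op (minv (M w)) p"
    have "nrm (op (S0 w) p) \<le> nrm (op (a w) (op pR ?v))" unfolding inv(1)[OF w] by (rule ba[OF wf(2,3)])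
    also have "\<dots> \<le> nrm (op (M w) ?v)" unfolding opM[OF wf(2)] opa[OF wf(2)] by (rule orth)
    also have "\<dots> = nrm (op (1\<^sub>m m) p)" unfolding inv(2)[OF w] ..
    also have "\<dots> \<le> nrm p"
      using nrm_nonneg[of "p - op (1\<^sub>m m) p"] by (simp add: pip_split[of p p m])
    finally show ?thesis .
  qed
  obtain S where S: "mholo m (ball 0 1) S" "\<And>z. z \<in> ball 0 1 - Z' \<Longrightarrow> S z = S0 z" "\<forall>z\<in>ball 0 1. \<forall>p. nrm (op (S z) p) \<le> nrm p"
    using mat_bounded_extension[OF Z' S0h S0c] by blast
  \<comment> \<open>The definition of S0 only yields S a pR x = b pR x. For M x = a v the vectors a
    v and a pR x coincide, and since b is dominated by a in norm, b v and b pR x coincide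
    too.\<close>
  have Sa: "op (S w) (op (a w) v) = op (b w) v" if w: "w \<in> ball 0 1 - Z'" for w v
  proof -
    note wf = detM[OF w]
    note aw = mholoD(1)[OF ah wf(2)]
    define y where "y = op (a w) v"
    define x where "x = op (minv (M w)) y"
    have Mx: "op (a w) (op pR x) + (op (1\<^sub>m m) x - op sR (op pR x)) = y"
      using inv(2)[OF w, of y] unfolding opM[OF wf(2)] x_def[symmetric] by (simp add: y_def op_one_op[OF aw])
    let ?q = "op (1\<^sub>m m) x - op sR (op pR x)"
    have pq: "op pR ?q = 0" by (simp add: cip.lin_diff[OF lin_op] op_op_one[OF sc(2)] prp)
    have "op sR (op pR y) = op sR (op pR (op (a w) (op pR x) + ?q))" by (simp only: Mx)
    also have "\<dots> = op (a w) (op pR x)"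
      by (simp only: cip.lin_add[OF lin_op] pq cip.lin_zero[OF lin_op] aPi[OF wf(2)] add_0_right)
    finally have ay: "op (a w) (op pR x) = op (a w) v" using aPi[OF wf(2), of v] by (simp add: y_def)
    have "nrm (op (b w) (v - op pR x)) \<le> nrm (op (a w) (v - op pR x))" by (rule ba[OF wf(2,3)])
    also have "\<dots> = 0" by (simp add: cip.lin_diff[OF lin_op] ay)
    finally have "op (b w) (v - op pR x) = 0" using nrm_nonneg[of "op (b w) (v - op pR x)"] by (intro nrm_eq_0) simp
    then have "op (b w) v = op (b w) (op pR x)" by (simp add: cip.lin_diff[OF lin_op])
    then show ?thesis unfolding S(2)[OF w] inv(1)[OF w] by (simp add: x_def y_def)
  qed
  have "Polynomial.smult w (op sL (op (S w) (op pR (op (\<alpha> w) v)))) = op (\<beta> w) v" if w: "w \<in> ball 0 1 - Z'" for w v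
  proof -
    note wf = detM[OF w]
    define u where "u = op (d 0) v"
    have dv: "op dI u = op (1\<^sub>m m) v" unfolding u_def op_mult[OF dI(1) d0, symmetric] dI(3) ..
    have aw: "\<alpha> w \<in> carrier_mat m m" "\<beta> w \<in> carrier_mat m m"
      by (rule mholoD(1)[OF alpha_beta_mholo(1) wf(2)] mholoD(1)[OF alpha_beta_mholo(2) wf(2)])+
    have "op pR (op (\<alpha> w) v) = Polynomial.smult (w ^ n) (op (a w) u)"
      unfolding wa[OF wf(2)] dv op_op_one[OF aw(1)] ..
    then have "Polynomial.smult w (op sL (op (S w) (op pR (op (\<alpha> w) v)))) = op sL (Polynomial.smult (w ^ Suc n) (op (b w) u))"
      by (simp add: cip.lin_scale[OF lin_op] Sa[OF w])
    also have "\<dots> = op (\<beta> w) v"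
      unfolding wb[OF wf(2,3)] dv op_op_one[OF aw(2)] by (rule alpha_beta(2)[OF wf(2)])
    finally show ?thesis .
  qed
  then show ?thesis using S(1,3) Z' by blast
qed

text \<open>Off the exceptional set the property of S says D2 c = N2 d. Cancelling d gives D2 f =
  N2, the second representation of f_S, and \<open>mero_eqI\<close> extends the equality to all
  points of holomorphy.\<close>

theorem interp_fS: "\<exists>S. schur_class m S \<and> mero_eq (ball 0 1) m f (f_S m J A n S)"
proof -
  obtain S Z' where S: "mholo m (ball 0 1) S" "\<forall>z\<in>ball 0 1. \<forall>p. nrm (op (S z) p) \<le> nrm p" and Z': "sparse_in_set (ball 0 1) Z'"
    and main: "\<And>w v. w \<in> ball 0 1 - Z' \<Longrightarrow> Polynomial.smult w (op sL (op (S w) (op pR (op (\<alpha> w) v)))) = op (\<beta> w) v"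
    using schur_parameter by blast
  have contr: "nrm (op (S z) p) \<le> nrm p" if "z \<in> ball 0 1" for z p using S(2) that by blast
  have "mero_eq (ball 0 1) m f (fS S)"
  proof (rule mero_eqI[OF f_mero fS_meromorphic[OF S(1) contr]])
    show "sparse_in_set (ball 0 1) (Z' \<union> (ball 0 1 - Hf) \<union> Z S)"
      by (intro sparse_in_set_Un Z' Hf_sparse Z_sparse[OF S(1) contr])
    fix w assume w: "w \<in> ball 0 1 - (Z' \<union> (ball 0 1 - Hf) \<union> Z S)"
    then have wB: "w \<in> ball 0 1" "w \<in> Hf" "w \<in> ball 0 1 - Z'" "w \<notin> Z S" by auto
    note K = mholoD(1)[OF S(1) wB(1)]
    note dn = DN_carrier[OF K, of w]
    note dw = mholoD(1)[OF dc_mholo(1) wB(1)] and cw = mholoD(1)[OF dc_mholo(2) wB(1)] and F = f_carrier[OF wB(2)]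
    have fs: "Determinant.det (D2 (S w) w) \<noteq> 0" "fS S w = minv (D2 (S w) w) * N2 (S w) w"
      by (rule fS_second(1,3)[OF S(1) contr wB(1,4)]; assumption)+
    note mi = minv_det[OF dn(3) fs(1)] and mid = minv_det[OF dw f_d(2)[OF wB(2)]]
    \<comment> \<open>The difference of the two sides, applied to v, is \<beta> v minus w sL S pR
      \<alpha> v.\<close>
    have "D2 (S w) w * c w = N2 (S w) w * d w"
    proof (rule op_eqI[of _ m])
      fix v
      have t: "trunc m (op (c w) v)" "trunc m (op (d w) v)" by (rule trunc_op[OF cw] trunc_op[OF dw])+
      have "op (N2 (S w) w) (op (d w) v) - op (D2 (S w) w) (op (c w) v) =
          Polynomial.smult w (op sL (op (S w) (op pR (op (\<alpha> w) v)))) - op (\<beta> w) v"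
        unfolding op_D2(1)[OF K t(1)] op_D2(2)[OF K t(2)] op_alpha_beta[OF wB(1)]
        by (simp add: cip.lin_diff[OF lin_op] smult_diff_right algebra_simps)
      then show "op (D2 (S w) w * c w) v = op (N2 (S w) w * d w) v"
        unfolding main[OF wB(3)] by (simp add: op_mult[OF dn(3) cw] op_mult[OF dn(4) dw])
    qed (use dn cw dw in auto)
    then have "D2 (S w) w * (f w * d w) = N2 (S w) w * d w" unfolding f_d(1)[OF wB(2)] .
    then have "(D2 (S w) w * f w) * d w = N2 (S w) w * d w" using assoc_mult_mat[OF dn(3) F dw] by simp
    then have "(D2 (S w) w * f w) * (d w * minv (d w)) = N2 (S w) w * (d w * minv (d w))"
      using assoc_mult_mat[OF mult_carrier_mat[OF dn(3) F] dw mid(2)] assoc_mult_mat[OF dn(4) dw mid(2)] by simp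
    then have e: "D2 (S w) w * f w = N2 (S w) w" using dn F by (simp add: mid(3))
    have "f w = (minv (D2 (S w) w) * D2 (S w) w) * f w" using F by (simp add: mi(4))
    also have "\<dots> = minv (D2 (S w) w) * N2 (S w) w"
      unfolding e[symmetric] by (rule assoc_mult_mat[OF mi(2) dn(3) F])
    finally show "f w = fS S w" unfolding fs(2) .
  qed
  moreover have "schur_class m S" unfolding schur_class_iff using S by blast
  moreover have "fS S = f_S m J A n S" by (rule fS_def[OF S(1) contr])
  ultimately show ?thesis by metis
qed

end

end

text \<open>A meromorphic function is represented by a total one whose values at poles are
  arbitrary. Membership in the set of all f_S is therefore expressed through \<open>mero_eq\<close>
  and not through equality.\<close>

theorem theorem1p4:
  fixes m n :: nat and J :: "complex mat" and A :: "nat \<Rightarrow> complex mat"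
  assumes "0 < m"
    and "sig_mat m J"
    and "\<forall>j\<le>n. A j \<in> carrier_mat m m"
    and "J_Potapov m J A n"
  shows "(\<forall>S. schur_class m S \<longrightarrow>
            mat_meromorphic_on unit_disc m (f_S m J A n S)
          \<and> mat_H unit_disc m (f_S m J A n S) = {w \<in> unit_disc. Determinant.det (den1 m J A n S w) \<noteq> 0}
          \<and> mat_H unit_disc m (f_S m J A n S) = {w \<in> unit_disc. Determinant.det (den2 m J A n S w) \<noteq> 0}
          \<and> (\<forall>w \<in> mat_H unit_disc m (f_S m J A n S).
               f_S m J A n S w = minv (den2 m J A n S w) * num2 m J A n S w))
       \<and> (\<forall>f. P_J0_interp m J A n f \<longleftrightarrow>
               (\<exists>S. schur_class m S \<and> mero_eq unit_disc m f (f_S m J A n S)))"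
proof -
  interpret potapov_data m n J A by unfold_locales (rule assms)+
  have schur: "mholo m (ball 0 1) S" "\<And>z p. z \<in> ball 0 1 \<Longrightarrow> nrm (op (S z) p) \<le> nrm p" if "schur_class m S" for S
    using that unfolding schur_class_iff by blast+
  have fS: "fS S = f_S m J A n S" if "schur_class m S" for S by (rule fS_def[OF schur[OF that]])
  show ?thesis
  proof (intro conjI allI impI ballI iffI)
    fix S assume S: "schur_class m S"
    note fs = fS_meromorphic[OF schur[OF S]] fS_H[OF schur[OF S]] fS_H'[OF schur[OF S]]
    show "mat_meromorphic_on unit_disc m (f_S m J A n S)" using fs(1) unfolding fS[OF S] .
    show 1: "mat_H unit_disc m (f_S m J A n S) = {w \<in> unit_disc. Determinant.det (den1 m J A n S w) \<noteq> 0}"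
      using fs(2) unfolding fS[OF S] den_num .
    have "Determinant.det (D1 (S w) w) \<noteq> 0 \<longleftrightarrow> Determinant.det (D2 (S w) w) \<noteq> 0" if "w \<in> unit_disc" for w
      by (rule det_D1_iff_D2[OF mholoD(1)[OF schur(1)[OF S] that]]) (use that in simp)
    then show "mat_H unit_disc m (f_S m J A n S) = {w \<in> unit_disc. Determinant.det (den2 m J A n S w) \<noteq> 0}"
      unfolding 1 den_num by blast
    fix w assume "w \<in> mat_H unit_disc m (f_S m J A n S)"
    then have w: "w \<in> ball 0 1" "w \<notin> Z S" using fs(3) unfolding fS[OF S] by auto
    show "f_S m J A n S w = minv (den2 m J A n S w) * num2 m J A n S w"
      using fS_second(3)[OF schur[OF S] w] unfolding fS[OF S] den_num .
  next
    fix f assume "P_J0_interp m J A n f"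
    then show "\<exists>S. schur_class m S \<and> mero_eq unit_disc m f (f_S m J A n S)" by (rule interp_fS)
  next
    fix f assume "\<exists>S. schur_class m S \<and> mero_eq unit_disc m f (f_S m J A n S)"
    then obtain S where S: "schur_class m S" "mero_eq unit_disc m f (f_S m J A n S)" by blast
    show "P_J0_interp m J A n f"
      using fS_interp[OF schur[OF S(1)]] S(2) unfolding fS[OF S(1)] by (rule mero_eq_interp)
  qed
qed

end
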